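(* Let $(W,\lambda)$ be a Liouville domain. For any $H\in\mathcal H(W,\lambda)$, $$\Big(\min_{S^1\times W}\tau_{\lambda,H}\Big)\,h_{\rm top}\big(\varphi^1_{\hat\lambda|_{\partial W_H}}\big)\le h_{\rm top}(\varphi^1_H)\le\Big(\max_{S^1\times W}\tau_{\lambda,H}\Big)\,h_{\rm top}\big(\varphi^1_{\hat\lambda|_{\partial W_H}}\big).$$
   Context: A Liouville domain $(W,\lambda)$ is a compact exact symplectic manifold with boundary (symplectic form $d\lambda$) whose Liouville vector field $Y_\lambda$, defined by $\iota_{Y_\lambda}d\lambda=\lambda$, is outward transverse to $\partial W$. Let $S^1=\mathbb R/\mathbb Z$. For smooth $H:S^1\times W\to\mathbb R$ put $H_t=H(t,\cdot)$, define $X_{H_t}$ by $\iota_{X_{H_t}}d\lambda=dH_t$, and $\tau_{\lambda,H}(t,w)=\lambda(X_{H_t}(w))+H(t,w)$. $\mathcal H(W,\lambda)$ is the set of smooth $H:S^1\times W\to\mathbb R$ which are autonomous (independent of $t$) in a neighborhood of $\partial W$, vanish on $\partial W$, and satisfy $\tau_{\lambda,H}>0$ everywhere. $\varphi_H^1:W\to W$ is the time-1 map of the Hamiltonian flow of $H$ (generated by $X_{H_t}$). For $H\in\mathcal H(W,\lambda)$ the tube is $W_H=\{(w,z)\in W\times\mathbb C\mid z=re^{2\pi i t},\ \pi|z|^2\le H(t,w)\}$ with $\hat\lambda=\lambda+\pi r^2dt$; $(W_H,\hat\lambda)$ is a Liouville domain and $\hat\lambda|_{\partial W_H}$ is a contact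 form on $\partial W_H$. For a contact form $\alpha$, $\varphi^1_\alpha$ denotes the time-1 map of its Reeb flow. $h_{\rm top}$ is topological entropy (of a continuous map of a compact metric space). *)

theory Defs
  imports "HOL-Analysis.Analysis"
begin

section \<open>Smooth maps on subsets of Euclidean spaces\<close>

text \<open>\<open>ck_on k S f\<close> is meant for open \<open>S\<close> (the derivatives are taken at points, not within \<open>S\<close>).\<close>

primrec ck_on ::
  "nat \<Rightarrow> 'a::euclidean_space set \<Rightarrow> ('a \<Rightarrow> 'b::real_normed_vector) \<Rightarrow> bool" where
  "ck_on 0 S f \<longleftrightarrow> continuous_on S f"
| "ck_on (Suc k) S f \<longleftrightarrow> (\<forall>x\<in>S. f differentiable (at x)) \<and>
     (\<forall>v. ck_on k S (\<lambda>x. frechet_derivative f (at x) v))"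

text \<open>On a set that need not be open, smooth means: locally the restriction of a smooth map
  defined on an open subset of the Euclidean space.\<close>

definition smooth_on ::
  "'a::euclidean_space set \<Rightarrow> ('a \<Rightarrow> 'b::real_normed_vector) \<Rightarrow> bool" where
  "smooth_on S f \<longleftrightarrow> (\<forall>x\<in>S. \<exists>U g. open U \<and> x \<in> U \<and> (\<forall>k. ck_on k U g) \<and> (\<forall>y\<in>S \<inter> U. g y = f y))"


section \<open>Smooth manifolds with boundary\<close>

definition conormal :: "'e::euclidean_space" where
  "conormal = (SOME b. b \<in> Basis)"

definition half_space :: "'e::euclidean_space set" where
  "half_space = {x. 0 \<le> x \<bullet> conormal}"

text \<open>A chart is its domain together with its coordinate map; the values of the coordinate map
  outside the domain are irrelevant.\<close>

type_synonym ('a, 'e) chart = "'a set \<times> ('a \<Rightarrow> 'e)"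

definition chart_img :: "('a, 'e) chart \<Rightarrow> 'e set" where
  "chart_img c = snd c ` fst c"

definition chart_inv :: "('a, 'e) chart \<Rightarrow> 'e \<Rightarrow> 'a" where
  "chart_inv c = inv_into (fst c) (snd c)"

definition is_chart :: "'a::topological_space set \<Rightarrow> ('a, 'e::euclidean_space) chart \<Rightarrow> bool" where
  "is_chart M c \<longleftrightarrow> openin (top_of_set M) (fst c) \<and> openin (top_of_set half_space) (chart_img c) \<and>
     homeomorphism (fst c) (chart_img c) (snd c) (chart_inv c)"

definition transition_dom :: "('a, 'e) chart \<Rightarrow> ('a, 'f) chart \<Rightarrow> 'e set" where
  "transition_dom c d = snd c ` (fst c \<inter> fst d)"

definition transition :: "('a, 'e) chart \<Rightarrow> ('a, 'f) chart \<Rightarrow> 'e \<Rightarrow> 'f" where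
  "transition c d = snd d \<circ> chart_inv c"

text \<open>The derivative of a change of coordinates at a point of the manifold.\<close>

definition dtransition :: "('a, 'e::euclidean_space) chart \<Rightarrow> ('a, 'f::euclidean_space) chart \<Rightarrow>
    'a \<Rightarrow> 'e \<Rightarrow> 'f" where
  "dtransition c d p =
     frechet_derivative (transition c d) (at (snd c p) within transition_dom c d)"

definition smooth_manifold ::
  "'a::topological_space set \<Rightarrow> ('a, 'e::euclidean_space) chart set \<Rightarrow> bool" where
  "smooth_manifold M A \<longleftrightarrow> (\<forall>c\<in>A. is_chart M c) \<and> \<Union>(fst ` A) = M \<and>
     (\<forall>c\<in>A. \<forall>d\<in>A. smooth_on (transition_dom c d) (transition c d))"

definition mfd_boundary :: "('a, 'e::euclidean_space) chart set \<Rightarrow> 'a set" where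
  "mfd_boundary A = {p. \<exists>c\<in>A. p \<in> fst c \<and> snd c p \<bullet> conormal = 0}"

definition chart_at :: "('a, 'e) chart set \<Rightarrow> 'a \<Rightarrow> ('a, 'e) chart" where
  "chart_at A p = (SOME c. c \<in> A \<and> p \<in> fst c)"


section \<open>One-forms and vector fields in charts\<close>

text \<open>A one-form is given by its representatives: \<open>lam c p v\<close> is its value at the point \<open>p\<close> on the
  tangent vector whose coordinates in the chart \<open>c\<close> are \<open>v\<close>. Likewise \<open>X c p\<close> is the coordinate
  vector, in the chart \<open>c\<close>, of a vector field at \<open>p\<close>.\<close>

type_synonym ('a, 'e) one_form = "('a, 'e) chart \<Rightarrow> 'a \<Rightarrow> 'e \<Rightarrow> real"
type_synonym ('a, 'e) vector_field = "('a, 'e) chart \<Rightarrow> 'a \<Rightarrow> 'e"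

definition smooth_one_form ::
  "('a, 'e::euclidean_space) chart set \<Rightarrow> ('a, 'e) one_form \<Rightarrow> bool" where
  "smooth_one_form A lam \<longleftrightarrow>
     (\<forall>c\<in>A. (\<forall>p\<in>fst c. linear (lam c p)) \<and>
            (\<forall>v. smooth_on (chart_img c) (\<lambda>x. lam c (chart_inv c x) v))) \<and>
     (\<forall>c\<in>A. \<forall>d\<in>A. \<forall>p\<in>fst c \<inter> fst d. \<forall>v. lam c p v = lam d p (dtransition c d p v))"

definition ext_deriv ::
  "('a, 'e::euclidean_space) one_form \<Rightarrow> ('a, 'e) chart \<Rightarrow> 'a \<Rightarrow> 'e \<Rightarrow> 'e \<Rightarrow> real" where
  "ext_deriv lam c p u v =
     frechet_derivative (\<lambda>x. lam c (chart_inv c x) v) (at (snd c p) within chart_img c) u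
   - frechet_derivative (\<lambda>x. lam c (chart_inv c x) u) (at (snd c p) within chart_img c) v"

text \<open>Integral curves on the time interval \<open>[0,1]\<close> of a time-dependent vector field, lying in a
  subset \<open>S\<close> of the manifold with atlas \<open>A\<close>.\<close>

definition integral_curve :: "'a::topological_space set \<Rightarrow> ('a, 'e::euclidean_space) chart set \<Rightarrow>
    (real \<Rightarrow> ('a, 'e) vector_field) \<Rightarrow> (real \<Rightarrow> 'a) \<Rightarrow> bool" where
  "integral_curve S A X \<gamma> \<longleftrightarrow> \<gamma> ` {0..1} \<subseteq> S \<and> continuous_on {0..1} \<gamma> \<and>
     (\<forall>s\<in>{0..1}. \<forall>c\<in>A. \<gamma> s \<in> fst c \<longrightarrow>
        ((snd c \<circ> \<gamma>) has_vector_derivative X s c (\<gamma> s)) (at s within {0..1}))"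

definition time_one_map :: "'a::topological_space set \<Rightarrow> ('a, 'e::euclidean_space) chart set \<Rightarrow>
    (real \<Rightarrow> ('a, 'e) vector_field) \<Rightarrow> 'a \<Rightarrow> 'a" where
  "time_one_map S A X p = (THE q. \<exists>\<gamma>. integral_curve S A X \<gamma> \<and> \<gamma> 0 = p \<and> \<gamma> 1 = q)"


section \<open>Liouville domains, Hamiltonian flows and Reeb flows\<close>

definition liouville_vf :: "('a, 'e::euclidean_space) one_form \<Rightarrow> ('a, 'e) vector_field" where
  "liouville_vf lam c p = (THE y. \<forall>v. ext_deriv lam c p y v = lam c p v)"

text \<open>In a boundary chart the manifold is locally the half space on which the inner product with
  \<^const>\<open>conormal\<close> is nonnegative, so a negative inner product means pointing strictly outward.\<close>

definition liouville_domain ::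
  "'a::t2_space set \<Rightarrow> ('a, 'e::euclidean_space) chart set \<Rightarrow> ('a, 'e) one_form \<Rightarrow> bool" where
  "liouville_domain W A lam \<longleftrightarrow>
     W \<noteq> {} \<and> compact W \<and> smooth_manifold W A \<and> smooth_one_form A lam \<and>
     (\<forall>c\<in>A. \<forall>p\<in>fst c. \<forall>u. u \<noteq> 0 \<longrightarrow> (\<exists>v. ext_deriv lam c p u v \<noteq> 0)) \<and>
     (\<forall>c\<in>A. \<forall>p\<in>fst c \<inter> mfd_boundary A. liouville_vf lam c p \<bullet> conormal < 0)"

definition ham_vf ::
  "('a, 'e::euclidean_space) one_form \<Rightarrow> ('a \<Rightarrow> real) \<Rightarrow> ('a, 'e) vector_field" where
  "ham_vf lam h c p = (THE x. \<forall>v. ext_deriv lam c p x v =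
     frechet_derivative (h \<circ> chart_inv c) (at (snd c p) within chart_img c) v)"

definition ham_time_one :: "'a::topological_space set \<Rightarrow> ('a, 'e::euclidean_space) chart set \<Rightarrow>
    ('a, 'e) one_form \<Rightarrow> (real \<Rightarrow> 'a \<Rightarrow> real) \<Rightarrow> 'a \<Rightarrow> 'a" where
  "ham_time_one W A lam H = time_one_map W A (\<lambda>t. ham_vf lam (H t))"

definition tau :: "('a, 'e::euclidean_space) chart set \<Rightarrow> ('a, 'e) one_form \<Rightarrow>
    (real \<Rightarrow> 'a \<Rightarrow> real) \<Rightarrow> real \<Rightarrow> 'a \<Rightarrow> real" where
  "tau A lam H t w = (let c = chart_at A w in lam c w (ham_vf lam (H t) c w)) + H t w"

text \<open>Functions on \<open>S\<^sup>1 \<times> W\<close> with \<open>S\<^sup>1 = \<real>/\<int>\<close> are functions on \<open>\<real> \<times> W\<close> that are 1-periodic in the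
  first variable.\<close>

definition admissible_hamiltonians :: "'a::topological_space set \<Rightarrow>
    ('a, 'e::euclidean_space) chart set \<Rightarrow> ('a, 'e) one_form \<Rightarrow> (real \<Rightarrow> 'a \<Rightarrow> real) set" where
  "admissible_hamiltonians W A lam = {H.
     (\<forall>t. \<forall>w\<in>W. H (t + 1) w = H t w) \<and>
     (\<forall>c\<in>A. smooth_on (UNIV \<times> chart_img c) (\<lambda>(t, x). H t (chart_inv c x))) \<and>
     (\<exists>N. openin (top_of_set W) N \<and> mfd_boundary A \<subseteq> N \<and> (\<forall>w\<in>N. \<forall>s t. H s w = H t w)) \<and>
     (\<forall>t. \<forall>w\<in>mfd_boundary A. H t w = 0) \<and>
     (\<forall>t. \<forall>w\<in>W. tau A lam H t w > 0)}"

text \<open>For a one-form \<open>\<alpha>\<close> on a manifold with boundary, the Reeb vector field of the restriction of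
  \<open>\<alpha>\<close> to the boundary. In a chart, the tangent space of the boundary at a boundary point is the
  orthogonal complement of \<^const>\<open>conormal\<close>.\<close>

definition reeb_vf :: "('a, 'e::euclidean_space) one_form \<Rightarrow> ('a, 'e) vector_field" where
  "reeb_vf \<alpha> c p = (THE r. r \<bullet> conormal = 0 \<and> \<alpha> c p r = 1 \<and>
     (\<forall>v. v \<bullet> conormal = 0 \<longrightarrow> ext_deriv \<alpha> c p r v = 0))"

definition boundary_reeb_time_one :: "('a::topological_space, 'e::euclidean_space) chart set \<Rightarrow>
    ('a, 'e) one_form \<Rightarrow> 'a \<Rightarrow> 'a" where
  "boundary_reeb_time_one A \<alpha> = time_one_map (mfd_boundary A) A (\<lambda>t. reeb_vf \<alpha>)"


section \<open>The tube\<close>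

definition tube :: "'a set \<Rightarrow> (real \<Rightarrow> 'a \<Rightarrow> real) \<Rightarrow> ('a \<times> complex) set" where
  "tube W H = {(w, z). w \<in> W \<and>
     (\<exists>r t. 0 \<le> r \<and> z = complex_of_real r * cis (2 * pi * t) \<and> pi * (cmod z)\<^sup>2 \<le> H t w)}"

definition prod_chart ::
  "('a, 'e) chart \<Rightarrow> ('a \<times> complex, 'e \<times> complex) chart" where
  "prod_chart c = (fst c \<times> UNIV, \<lambda>(w, z). (snd c w, z))"

text \<open>The smooth structure that a full-dimensional subset \<open>S\<close> inherits from an ambient manifold with
  charts \<open>B\<close>: all half-space charts of \<open>S\<close> that are diffeomorphisms with respect to the ambient
  coordinates. The manifold boundary of \<open>S\<close> is then computed with these charts. It includes the
  points of \<open>S\<close> at which \<open>S\<close> touches the boundary of the ambient manifold. The charts in \<open>B\<close> enter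
  only through smoothness, so it does not matter which half space they are modelled on.\<close>

definition induced_atlas :: "'a::topological_space set \<Rightarrow> ('a, 'e::euclidean_space) chart set \<Rightarrow>
    ('a, 'e) chart set" where
  "induced_atlas S B = {d. is_chart S d \<and>
     (\<forall>c\<in>B. smooth_on (transition_dom d c) (transition d c) \<and>
            smooth_on (transition_dom c d) (transition c d))}"

definition tube_atlas :: "'a::topological_space set \<Rightarrow> ('a, 'e::euclidean_space) chart set \<Rightarrow>
    (real \<Rightarrow> 'a \<Rightarrow> real) \<Rightarrow> ('a \<times> complex, 'e \<times> complex) chart set" where
  "tube_atlas W A H = induced_atlas (tube W H) (prod_chart ` A)"

text \<open>The form \<open>\<lambda> + \<pi> r\<^sup>2 dt\<close> on the tube. With \<open>z = x + iy = r e\<^sup>2\<^sup>\<pi>\<^sup>i\<^sup>t\<close> one has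
  \<open>\<pi> r\<^sup>2 dt = (x dy - y dx) / 2\<close>, which is smooth also at \<open>z = 0\<close>. The vector \<open>v\<close>, given in the chart
  \<open>d\<close> of the tube, is first rewritten in the coordinates of a product chart.\<close>

definition tube_form :: "('a, 'e::euclidean_space) chart set \<Rightarrow> ('a, 'e) one_form \<Rightarrow>
    ('a \<times> complex, 'e \<times> complex) one_form" where
  "tube_form A lam d p v =
     (let c = chart_at A (fst p); u = dtransition d (prod_chart c) p v
      in lam c (fst p) (fst u) + (Re (snd p) * Im (snd u) - Im (snd p) * Re (snd u)) / 2)"


section \<open>Topological entropy\<close>

text \<open>The definition by open covers (Adler, Konheim and McAndrew), for a continuous self-map of a
  compact space \<open>S\<close>; on a compact metrizable space it needs no choice of a metric. The limit
  superior is a limit by subadditivity.\<close>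

definition open_covers :: "'a::topological_space set \<Rightarrow> 'a set set set" where
  "open_covers S = {\<U>. (\<forall>U\<in>\<U>. openin (top_of_set S) U) \<and> \<Union>\<U> = S}"

definition cover_number :: "'a set \<Rightarrow> 'a set set \<Rightarrow> nat" where
  "cover_number S \<U> = (LEAST n. \<exists>\<V>\<subseteq>\<U>. finite \<V> \<and> card \<V> = n \<and> S \<subseteq> \<Union>\<V>)"

definition iterated_join :: "'a set \<Rightarrow> ('a \<Rightarrow> 'a) \<Rightarrow> 'a set set \<Rightarrow> nat \<Rightarrow> 'a set set" where
  "iterated_join S f \<U> n = {{x \<in> S. \<forall>i<n. (f ^^ i) x \<in> g i} | g. \<forall>i<n. g i \<in> \<U>}"

definition cover_entropy :: "'a set \<Rightarrow> ('a \<Rightarrow> 'a) \<Rightarrow> 'a set set \<Rightarrow> ereal" where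
  "cover_entropy S f \<U> =
     limsup (\<lambda>n. ereal (ln (real (cover_number S (iterated_join S f \<U> n))) / real n))"

definition top_entropy :: "'a::topological_space set \<Rightarrow> ('a \<Rightarrow> 'a) \<Rightarrow> ereal" where
  "top_entropy S f = (SUP \<U>\<in>open_covers S. cover_entropy S f \<U>)"

end

(* Write f_u for the Hamiltonian flow from time 0, P_t(w) = (w, sqrt(H_t(w)/pi) e^(2 pi i t)), and
   sigma_w(u) for the integral of tau(v, f_v w) over 0 <= v <= u. The boundary of the tube is the set of
   all P_t(w), and at P_t(w) the Reeb field is (X_t, (dH_t/dt / (2 H_t) + 2 pi i) z) / tau. Hence the Reeb
   orbit through P_t(f_t w) is P_u(f_u w) run at the times sigma_w(u) - sigma_w(t): the Reeb flow is the
   suspension of f_1, collapsed over the boundary of W, and run with speed between 1/max tau and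
   1/min tau. Both inequalities follow from one estimate for the entropy under a time change, applied
   once with f_1 and once with the Reeb flow as the base. *)
theory Submission
  imports Defs
begin

text \<open>Neither flow is given: both fields are definite descriptions, so existence and
  uniqueness of integral curves must be established before the time-one maps mean anything. For the
  Hamiltonian field this rests on its tangency to the boundary; Reeb orbits are instead written down
  from Hamiltonian ones and shown unique by recovering the Hamiltonian time. The condition \<tau> >
  0 supplies the nondegeneracy: at an interior minimum of H_t the field vanishes, so H = \<tau> > 0
  there, and on the boundary of W it forbids dH = 0. The delicate set is z = 0 over the boundary of
  W. There the angle is lost, the square root of H is not smooth, and the tube touches the boundary
  of W \<times> C. Since H is autonomous near the boundary, \<tau> and X do not depend on the lost
  angle, and Hadamard's lemma supplies boundary charts of the tube. In the entropy estimate, nearby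
  base orbits reach the same value of the time change at times that may drift steadily apart, so
  closeness of base orbits alone does not give closeness of orbits of the other map; the drift has
  to be coded as well.\<close>

abbreviation "FD \<equiv> frechet_derivative"

abbreviation polar :: "real \<Rightarrow> real \<Rightarrow> complex" where
  "polar r t \<equiv> complex_of_real r * cis (2 * pi * t)"

section \<open>Entropy under a time change\<close>

lemma continuous_on_pair:
  assumes "continuous_on (S \<times> T) (\<lambda>(a, b). f a b)" "continuous_on K u" "continuous_on K v"
    "\<And>z. z \<in> K ==> u z \<in> S" "\<And>z. z \<in> K ==> v z \<in> T"
  shows "continuous_on K (\<lambda>z. f (u z) (v z))"
  using continuous_on_compose2[OF assms(1) continuous_on_Pair[OF assms(2,3)]] assms(4,5) by auto

lemma Hausdorff_space_euclidean_t2: "Hausdorff_space (euclidean :: 'a::t2_space topology)"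
  unfolding Hausdorff_space_def disjnt_def using hausdorff by (metis open_openin)

text \<open>No metric is chosen on the compact Hausdorff space. Finitely many Urysohn functions,
  each positive only inside one cover element and such that the sets where they exceed 1/2 cover
  \<open>S\<close>, give the pseudometric \<open>d\<close> as the sum of |f p x - f p y|; for it 1/2
  is a Lebesgue number of the cover.\<close>

lemma open_cover_separation:
  fixes S :: "'a::t2_space set"
  assumes S: "compact S" and \<U>: "\<U> \<in> open_covers S"
  obtains d :: "'a \<Rightarrow> 'a \<Rightarrow> real" where
    "continuous_on (S \<times> S) (\<lambda>(x, y). d x y)" "\<And>x. d x x = 0"
    "\<And>x. x \<in> S ==> \<exists>U\<in>\<U>. \<forall>y\<in>S. d x y < 1/2 \<longrightarrow> y \<in> U"
proof -
  have cr: "completely_regular_space (top_of_set S)"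
    using S by (intro normal_imp_completely_regular_space compact_Hausdorff_or_regular_imp_normal_space)
      (simp_all add: compact_space_subtopology Hausdorff_space_subtopology Hausdorff_space_euclidean_t2)
  have "\<exists>f U. U \<in> \<U> \<and> continuous_on S f \<and> f p = (1::real) \<and> (\<forall>y\<in>S. f y > 0 \<longrightarrow> y \<in> U)" if p: "p \<in> S" for p
  proof -
    obtain U where U: "U \<in> \<U>" "p \<in> U" using \<U> p unfolding open_covers_def by blast
    have "openin (top_of_set S) U" using \<U> U unfolding open_covers_def by blast
    hence "closedin (top_of_set S) (S - U)" by (simp add: closedin_diff)
    moreover have "p \<in> topspace (top_of_set S) - (S - U)" using p U by simp
    ultimately obtain f where f: "continuous_map (top_of_set S) (top_of_set {0..1::real}) f" "f p = 0" "f ` (S - U) \<subseteq> {1}"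
      using cr[unfolded completely_regular_space_def, rule_format, of "S - U" p] by blast
    have fc: "continuous_on S f" using f(1) by (simp add: continuous_map_in_subtopology)
    have "y \<in> U" if "y \<in> S" "1 - f y > 0" for y
      using f(3) that by force
    moreover have "continuous_on S (\<lambda>y. 1 - f y)" using fc by (intro continuous_intros)
    ultimately show ?thesis
      using U f(2) by (intro exI[of _ "\<lambda>y. 1 - f y"] exI[of _ U]) simp
  qed
  hence "\<forall>p\<in>S. \<exists>f U. U \<in> \<U> \<and> continuous_on S f \<and> f p = (1::real) \<and> (\<forall>y\<in>S. f y > 0 \<longrightarrow> y \<in> U)"
    by blast
  from bchoice[OF this] obtain f where "\<forall>p\<in>S. \<exists>U. U \<in> \<U> \<and> continuous_on S (f p) \<and> f p p = (1::real) \<and> (\<forall>y\<in>S. f p y > 0 \<longrightarrow> y \<in> U)"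
    by blast
  from bchoice[OF this] obtain U where fU: "\<And>p. p \<in> S ==> U p \<in> \<U> \<and> continuous_on S (f p) \<and> f p p = (1::real) \<and> (\<forall>y\<in>S. f p y > 0 \<longrightarrow> y \<in> U p)"
    by blast
  have "openin (top_of_set S) {y\<in>S. f p y > 1/2}" if "p \<in> S" for p
    using fU[OF that] continuous_openin_preimage_gen[of S "f p" "{1/2<..}"]
    by (auto simp: vimage_def Int_def)
  hence "\<exists>O'. open O' \<and> {y\<in>S. f p y > 1/2} = S \<inter> O'" if "p \<in> S" for p
    using that unfolding openin_open by blast
  then obtain O' where O': "\<And>p. p \<in> S ==> open (O' p) \<and> {y\<in>S. f p y > 1/2} = S \<inter> O' p" by metis
  have "\<exists>D\<subseteq>S. finite D \<and> S \<subseteq> (\<Union>p\<in>D. O' p)"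
  proof (rule compactE_image[OF S])
    show "open (O' p)" if "p \<in> S" for p using O' that by blast
    show "S \<subseteq> (\<Union>p\<in>S. O' p)"
    proof
      fix p assume p: "p \<in> S"
      hence "p \<in> {y\<in>S. f p y > 1/2}" using fU[OF p] by simp
      thus "p \<in> (\<Union>p\<in>S. O' p)" using O'[OF p] p by blast
    qed
  qed blast
  then obtain D where D: "D \<subseteq> S" "finite D" "S \<subseteq> (\<Union>p\<in>D. O' p)" by blast
  define d where "d = (\<lambda>x y. \<Sum>p\<in>D. \<bar>f p x - f p y\<bar>)"
  show ?thesis
  proof (rule that[of d])
    have "continuous_on (S \<times> S) (\<lambda>z. \<Sum>p\<in>D. \<bar>f p (fst z) - f p (snd z)\<bar>)"
    proof (intro continuous_on_sum continuous_on_rabs continuous_on_diff)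
      fix p assume "p \<in> D"
      hence "continuous_on S (f p)" using fU D(1) by blast
      thus "continuous_on (S \<times> S) (\<lambda>z. f p (fst z))" "continuous_on (S \<times> S) (\<lambda>z. f p (snd z))"
        by (auto intro!: continuous_on_compose2[of S "f p"] continuous_intros)
    qed
    thus "continuous_on (S \<times> S) (\<lambda>(x, y). d x y)" by (simp add: d_def case_prod_unfold)
    show "d x x = 0" for x by (simp add: d_def)
    fix x assume x: "x \<in> S"
    then obtain p where p: "p \<in> D" "x \<in> O' p" using D by blast
    hence fx: "f p x > 1/2" using O' D x by blast
    show "\<exists>U\<in>\<U>. \<forall>y\<in>S. d x y < 1/2 \<longrightarrow> y \<in> U"
    proof (intro bexI ballI impI)
      fix y assume y: "y \<in> S" "d x y < 1/2"
      have "\<bar>f p x - f p y\<bar> \<le> d x y" unfolding d_def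
        using D p by (intro member_le_sum) auto
      hence "f p y > 0" using y fx by linarith
      thus "y \<in> U p" using fU p D y by blast
    qed (use fU p D in blast)
  qed
qed

text \<open>A tube-lemma argument: the condition is open and holds over all of \<open>K\<close> at
  the point (x, x), so finitely many boxes over the compact \<open>K\<close> leave an open
  intersection \<open>V\<close> that works for all \<open>k\<close> at once. It replaces
  equicontinuity where no metric is at hand.\<close>

lemma diagonal_tube:
  fixes g :: "'k::topological_space \<Rightarrow> 'x::topological_space \<Rightarrow> 'x \<Rightarrow> real"
  assumes K: "compact K" and g: "continuous_on (K \<times> X \<times> X) (\<lambda>(k, y, z). g k y z)"
    and diag: "\<And>k x. k \<in> K ==> x \<in> X ==> g k x x < \<epsilon>" and x: "x \<in> X"
  obtains V where "open V" "x \<in> V" "\<And>k y z. k \<in> K ==> y \<in> V \<inter> X ==> z \<in> V \<inter> X ==> g k y z < \<epsilon>"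
proof -
  have "openin (top_of_set (K \<times> X \<times> X)) ((K \<times> X \<times> X) \<inter> (\<lambda>(k, y, z). g k y z) -` {..<\<epsilon>})"
    using g by (intro continuous_openin_preimage_gen) auto
  then obtain O' where O': "open O'" "(K \<times> X \<times> X) \<inter> (\<lambda>(k, y, z). g k y z) -` {..<\<epsilon>} = (K \<times> X \<times> X) \<inter> O'"
    unfolding openin_open by blast
  have "\<exists>A V. open A \<and> k \<in> A \<and> open V \<and> x \<in> V \<and> A \<times> V \<times> V \<subseteq> O'" if k: "k \<in> K" for k
  proof -
    have "(k, x, x) \<in> (K \<times> X \<times> X) \<inter> (\<lambda>(k, y, z). g k y z) -` {..<\<epsilon>}" using k x diag by auto
    hence "(k, x, x) \<in> O'" using O' by blast
    then obtain A B where AB: "open A" "open B" "k \<in> A" "(x, x) \<in> B" "A \<times> B \<subseteq> O'"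
      using open_prod_elim[OF O'(1)] by (metis mem_Sigma_iff)
    obtain C D where CD: "open C" "open D" "x \<in> C" "x \<in> D" "C \<times> D \<subseteq> B"
      using open_prod_elim[OF AB(2,4)] by (metis mem_Sigma_iff)
    show ?thesis by (rule exI[of _ A], rule exI[of _ "C \<inter> D"]) (use AB CD in auto)
  qed
  then obtain A V where AV: "\<And>k. k \<in> K ==> open (A k) \<and> k \<in> A k \<and> open (V k) \<and> x \<in> V k \<and> A k \<times> V k \<times> V k \<subseteq> O'"
    by metis
  have "\<exists>D\<subseteq>K. finite D \<and> K \<subseteq> (\<Union>k\<in>D. A k)"
    by (rule compactE_image[OF K, of K A]) (use AV in blast)+
  then obtain D where D: "D \<subseteq> K" "finite D" "K \<subseteq> (\<Union>k\<in>D. A k)" by blast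
  show ?thesis
  proof (rule that[of "\<Inter>k\<in>D. V k"])
    show "open (\<Inter>k\<in>D. V k)" using AV D by (intro open_INT) auto
    show "x \<in> (\<Inter>k\<in>D. V k)" using AV D by auto
    fix k y z assume k: "k \<in> K" and y: "y \<in> (\<Inter>k\<in>D. V k) \<inter> X" and z: "z \<in> (\<Inter>k\<in>D. V k) \<inter> X"
    obtain k' where "k' \<in> D" "k \<in> A k'" using D(3) k by blast
    have "y \<in> V k'" "z \<in> V k'" using \<open>k' \<in> D\<close> y z by auto
    hence "(k, y, z) \<in> A k' \<times> V k' \<times> V k'" using \<open>k \<in> A k'\<close> by simp
    hence "(k, y, z) \<in> O'" using AV[of k'] D \<open>k' \<in> D\<close> by blast
    moreover have "(k, y, z) \<in> K \<times> X \<times> X" using k y z by auto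
    ultimately have "(k, y, z) \<in> (K \<times> X \<times> X) \<inter> (\<lambda>(k, y, z). g k y z) -` {..<\<epsilon>}"
      unfolding O'(2) by (rule IntI[rotated])
    thus "g k y z < \<epsilon>" by simp
  qed
qed

text \<open>Triples on which \<open>d\<close> is at least 1/2 form a compact set that misses a = a'.
  Hence |a - a'| has a positive minimum on it, and half that minimum will do. Times up to 2 are
  enough: later the smaller of two times is reduced to [0,1), and the other is within 1 of
  it.\<close>

lemma uniform_time_continuity:
  fixes G :: "real \<Rightarrow> 'b::t2_space \<Rightarrow> 'q::t2_space" and d :: "'q \<Rightarrow> 'q \<Rightarrow> real"
  assumes B: "compact B" and d: "continuous_on (Q \<times> Q) (\<lambda>(x, y). d x y)" "\<And>x. d x x = 0"
    and G: "continuous_on ({0..2} \<times> B) (\<lambda>(a, b). G a b)" "\<And>a b. 0 \<le> a ==> b \<in> B ==> G a b \<in> Q"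
  obtains k where "k > 0" "\<And>a a' b. a \<in> {0..2} ==> a' \<in> {0..2} ==> \<bar>a - a'\<bar> \<le> k ==> b \<in> B ==> d (G a b) (G a' b) < 1/2"
proof -
  define K where "K = {0..2::real} \<times> {0..2::real} \<times> B"
  have cK: "compact K" unfolding K_def using B by (intro compact_Times) auto
  have g: "continuous_on K (\<lambda>z. d (G (fst z) (snd (snd z))) (G (fst (snd z)) (snd (snd z))))"
  proof -
    have 1: "continuous_on K (\<lambda>z. G (fst z) (snd (snd z)))"
      by (rule continuous_on_pair[OF G(1)]) (auto simp: K_def intro!: continuous_intros)
    have 2: "continuous_on K (\<lambda>z. G (fst (snd z)) (snd (snd z)))"
      by (rule continuous_on_pair[OF G(1)]) (auto simp: K_def intro!: continuous_intros)
    show ?thesis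
      by (rule continuous_on_pair[OF d(1) 1 2]) (use G(2) in \<open>auto simp: K_def\<close>)
  qed
  define Z where "Z = K \<inter> (\<lambda>z. d (G (fst z) (snd (snd z))) (G (fst (snd z)) (snd (snd z)))) -` {1/2..}"
  have "closedin (top_of_set K) Z" unfolding Z_def using g by (intro continuous_closedin_preimage) auto
  hence cZ: "compact Z" using cK closedin_compact by blast
  show ?thesis
  proof (cases "Z = {}")
    case True
    show ?thesis
    proof (rule that[of 1])
      fix a a' :: real and b assume "a \<in> {0..2}" "a' \<in> {0..2}" "b \<in> B"
      hence "(a, a', b) \<in> K" by (simp add: K_def)
      thus "d (G a b) (G a' b) < 1/2" using True unfolding Z_def by force
    qed simp
  next
    case False
    have "continuous_on Z (\<lambda>z. \<bar>fst z - fst (snd z)\<bar>)" by (intro continuous_intros)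
    then obtain z0 where z0: "z0 \<in> Z" "\<And>z. z \<in> Z ==> \<bar>fst z0 - fst (snd z0)\<bar> \<le> \<bar>fst z - fst (snd z)\<bar>"
      using continuous_attains_inf[OF cZ False] by blast
    have "fst z0 \<noteq> fst (snd z0)" using z0(1) d(2) unfolding Z_def by auto
    show ?thesis
    proof (rule that[of "\<bar>fst z0 - fst (snd z0)\<bar> / 2"])
      show "0 < \<bar>fst z0 - fst (snd z0)\<bar> / 2" using \<open>fst z0 \<noteq> _\<close> by simp
      fix a a' :: real and b assume *: "a \<in> {0..2}" "a' \<in> {0..2}" "\<bar>a - a'\<bar> \<le> \<bar>fst z0 - fst (snd z0)\<bar> / 2" "b \<in> B"
      hence "(a, a', b) \<in> K" by (simp add: K_def)
      moreover have "\<bar>fst z0 - fst (snd z0)\<bar> > 0" using \<open>fst z0 \<noteq> _\<close> by simp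
      hence "(a, a', b) \<notin> Z" using z0(2)[of "(a, a', b)"] *(3) by (auto simp del: zero_less_abs_iff)
      ultimately show "d (G a b) (G a' b) < 1/2" unfolding Z_def by auto
    qed
  qed
qed

text \<open>Although \<open>u i q\<close> may wander far, its increments agree up to h for all q in
  X. With the increments of a reference point as guide, the rounded value at step i determines the
  one at step i + 1 up to four possibilities; this is the factor \<open>4 ^ J\<close>. The first
  entry ranges over the integers of a fixed interval.\<close>

lemma card_floor_sequences:
  fixes u :: "nat \<Rightarrow> 'q \<Rightarrow> real"
  assumes h: "h > 0" and u0: "\<And>q. q \<in> X ==> - c \<le> u 0 q \<and> u 0 q \<le> 0"
    and inc: "\<And>i q q'. i < J ==> q \<in> X ==> q' \<in> X ==> \<bar>(u (Suc i) q - u i q) - (u (Suc i) q' - u i q')\<bar> \<le> h"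
  shows "finite ((\<lambda>q. map (\<lambda>i. \<lfloor>u i q / h\<rfloor>) [0..<Suc J]) ` X) \<and>
    card ((\<lambda>q. map (\<lambda>i. \<lfloor>u i q / h\<rfloor>) [0..<Suc J]) ` X) \<le> card {\<lfloor>- c / h\<rfloor>..0} * 4 ^ J"
  using inc
proof (induction J)
  case 0
  have "(\<lambda>q. map (\<lambda>i. \<lfloor>u i q / h\<rfloor>) [0..<Suc 0]) ` X \<subseteq> (\<lambda>k. [k]) ` {\<lfloor>- c / h\<rfloor>..0}"
  proof
    fix l assume "l \<in> (\<lambda>q. map (\<lambda>i. \<lfloor>u i q / h\<rfloor>) [0..<Suc 0]) ` X"
    then obtain q where q: "q \<in> X" "l = [\<lfloor>u 0 q / h\<rfloor>]" by auto
    have "\<lfloor>- c / h\<rfloor> \<le> \<lfloor>u 0 q / h\<rfloor>" using u0[OF q(1)] h by (intro floor_mono divide_right_mono) auto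
    moreover have "\<lfloor>u 0 q / h\<rfloor> \<le> 0" using u0[OF q(1)] h
      by (metis divide_nonpos_pos floor_mono floor_zero)
    ultimately show "l \<in> (\<lambda>k. [k]) ` {\<lfloor>- c / h\<rfloor>..0}" using q by auto
  qed
  moreover have "finite ((\<lambda>k. [k]) ` {\<lfloor>- c / h\<rfloor>..0})" by simp
  moreover have "card ((\<lambda>k. [k]) ` {\<lfloor>- c / h\<rfloor>..0}) \<le> card {\<lfloor>- c / h\<rfloor>..0}"
    by (rule card_image_le) simp
  ultimately show ?case
    by (simp only: power_0 mult_1_right) (meson finite_subset card_mono le_trans)
next
  case (Suc J)
  let ?m = "\<lambda>J q. map (\<lambda>i. \<lfloor>u i q / h\<rfloor>) [0..<Suc J]"
  have IH: "finite (?m J ` X)" "card (?m J ` X) \<le> card {\<lfloor>- c / h\<rfloor>..0} * 4 ^ J"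
    using Suc.IH Suc.prems by auto
  show ?case
  proof (cases "X = {}")
    case False
    then obtain q0 where q0: "q0 \<in> X" by blast
    define e where "e = \<lfloor>(u (Suc J) q0 - u J q0) / h\<rfloor>"
    \<comment> \<open>In units of h, let x be the previous value, \<delta> the increment of
      \<open>q0\<close> and |\<theta>| \<le> 1. The floor of x + \<delta> + \<theta> exceeds floor x
      + floor \<delta> by -1, 0, 1 or 2, since the two fractional parts add up to less than 2; the
      offsets -1 + k with k in 0..3 list these.\<close>
    have "?m (Suc J) ` X \<subseteq> (\<lambda>(l, k). l @ [last l + e - 1 + k]) ` (?m J ` X \<times> {0..3})"
    proof
      fix l assume "l \<in> ?m (Suc J) ` X"
      then obtain q where q: "q \<in> X" "l = ?m (Suc J) q" by auto
      have l: "l = ?m J q @ [\<lfloor>u (Suc J) q / h\<rfloor>]" using q by simp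
      have la: "last (?m J q) = \<lfloor>u J q / h\<rfloor>" by simp
      have "\<bar>(u (Suc J) q - u J q) - (u (Suc J) q0 - u J q0)\<bar> \<le> h" using Suc.prems q q0 by auto
      hence "\<bar>(u (Suc J) q - u J q) - (u (Suc J) q0 - u J q0)\<bar> / h \<le> 1" using h by (simp add: divide_simps)
      hence "\<bar>((u (Suc J) q - u J q) - (u (Suc J) q0 - u J q0)) / h\<bar> \<le> 1"
        using h by simp
      hence "\<bar>(u (Suc J) q / h - u J q / h) - (u (Suc J) q0 - u J q0) / h\<bar> \<le> 1"
        by (simp add: diff_divide_distrib)
      hence "\<lfloor>u (Suc J) q / h\<rfloor> - (\<lfloor>u J q / h\<rfloor> + e - 1) \<in> {0..3}"
        unfolding e_def by (simp; linarith)
      thus "l \<in> (\<lambda>(l, k). l @ [last l + e - 1 + k]) ` (?m J ` X \<times> {0..3})"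
        unfolding l using q(1) la
        by (intro image_eqI[of _ _ "(?m J q, \<lfloor>u (Suc J) q / h\<rfloor> - (\<lfloor>u J q / h\<rfloor> + e - 1))"]) auto
    qed
    moreover have fin: "finite ((\<lambda>(l, k). l @ [last l + e - 1 + k]) ` (?m J ` X \<times> {0..3}))" using IH by auto
    moreover have "card ((\<lambda>(l, k). l @ [last l + e - 1 + k]) ` (?m J ` X \<times> {0..3})) \<le> card (?m J ` X) * 4"
      using card_image_le[of "?m J ` X \<times> {0..3::int}"] IH by (simp add: card_cartesian_product)
    ultimately have "finite (?m (Suc J) ` X)" "card (?m (Suc J) ` X) \<le> card (?m J ` X) * 4"
      by (meson finite_subset card_mono le_trans)+
    thus ?thesis using IH(2) by auto
  qed simp
qed

lemma cover_number_le:
  assumes fin: "finite (c ` S)" and cl: "\<And>x. x \<in> S ==> \<exists>U\<in>\<U>. \<forall>y\<in>S. c y = c x \<longrightarrow> y \<in> U"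
  shows "cover_number S \<U> \<le> card (c ` S)"
proof -
  obtain U where U: "\<And>x. x \<in> S ==> U x \<in> \<U> \<and> (\<forall>y\<in>S. c y = c x \<longrightarrow> y \<in> U x)" using cl by metis
  define V where "V = (\<lambda>k. U (SOME x. x \<in> S \<and> c x = k)) ` c ` S"
  have some: "(SOME x. x \<in> S \<and> c x = c y) \<in> S \<and> c (SOME x. x \<in> S \<and> c x = c y) = c y" if "y \<in> S" for y
    using someI[of "\<lambda>x. x \<in> S \<and> c x = c y" y] that by auto
  have "V \<subseteq> \<U>" unfolding V_def using U some by auto
  moreover have "S \<subseteq> \<Union>V"
  proof
    fix y assume y: "y \<in> S"
    hence "y \<in> U (SOME x. x \<in> S \<and> c x = c y)" using U some[OF y] by metis
    thus "y \<in> \<Union>V" unfolding V_def using y by blast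
  qed
  moreover have "finite V" unfolding V_def using fin by simp
  ultimately have "cover_number S \<U> \<le> card V" unfolding cover_number_def by (intro Least_le) blast
  also have "\<dots> \<le> card (c ` S)" unfolding V_def using fin by (rule card_image_le)
  finally show ?thesis .
qed

lemma cover_number_attained:
  assumes "finite \<W>" "S \<subseteq> \<Union>\<W>" "\<W> \<subseteq> \<U>"
  obtains \<V> where "\<V> \<subseteq> \<U>" "finite \<V>" "card \<V> = cover_number S \<U>" "S \<subseteq> \<Union>\<V>"
proof -
  have "\<exists>n. \<exists>\<V>\<subseteq>\<U>. finite \<V> \<and> card \<V> = n \<and> S \<subseteq> \<Union>\<V>" using assms by blast
  hence "\<exists>\<V>\<subseteq>\<U>. finite \<V> \<and> card \<V> = cover_number S \<U> \<and> S \<subseteq> \<Union>\<V>"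
    unfolding cover_number_def by (rule LeastI_ex)
  thus ?thesis using that by blast
qed

text \<open>\<open>cover_number\<close> is a \<open>LEAST\<close>, which says something only if a
  finite subcover exists. As \<open>\<V>\<close> is finite and F preserves B, the join is a finite
  cover of B and the minimum is attained.\<close>

lemma iterated_join_subcover:
  assumes F: "\<And>b. b \<in> B ==> F b \<in> B" and \<V>: "finite \<V>" "B \<subseteq> \<Union>\<V>"
  obtains \<W> where "\<W> \<subseteq> iterated_join B F \<V> n" "finite \<W>"
    "card \<W> = cover_number B (iterated_join B F \<V> n)" "B \<subseteq> \<Union>\<W>"
proof -
  have "iterated_join B F \<V> n \<subseteq> (\<lambda>g. {x \<in> B. \<forall>i<n. (F ^^ i) x \<in> g i}) ` ({..<n} \<rightarrow>\<^sub>E \<V>)"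
  proof
    fix A assume "A \<in> iterated_join B F \<V> n"
    then obtain g where g: "A = {x \<in> B. \<forall>i<n. (F ^^ i) x \<in> g i}" "\<forall>i<n. g i \<in> \<V>"
      unfolding iterated_join_def by auto
    show "A \<in> (\<lambda>g. {x \<in> B. \<forall>i<n. (F ^^ i) x \<in> g i}) ` ({..<n} \<rightarrow>\<^sub>E \<V>)"
      by (rule image_eqI[of _ _ "restrict g {..<n}"]) (use g in auto)
  qed
  moreover have "finite ({..<n} \<rightarrow>\<^sub>E \<V>)" using \<V> by (intro finite_PiE) auto
  ultimately have fin: "finite (iterated_join B F \<V> n)" by (meson finite_imageI finite_subset)
  have FB: "(F ^^ i) b \<in> B" if "b \<in> B" for b i using that F by (induction i) auto
  have "B \<subseteq> \<Union>(iterated_join B F \<V> n)"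
  proof
    fix b assume b: "b \<in> B"
    hence "\<forall>i. \<exists>V\<in>\<V>. (F ^^ i) b \<in> V" using FB \<V> by blast
    then obtain g where "\<And>i. g i \<in> \<V> \<and> (F ^^ i) b \<in> g i" by metis
    thus "b \<in> \<Union>(iterated_join B F \<V> n)" unfolding iterated_join_def using b by blast
  qed
  thus ?thesis using fin that cover_number_attained[OF fin _ subset_refl] by metis
qed

lemma iterate_cover_closeness:
  assumes "W \<in> iterated_join B F \<V> n" "b \<in> W" "b' \<in> W" "i < n"
  obtains V where "V \<in> \<V>" "(F ^^ i) b \<in> V" "(F ^^ i) b' \<in> V"
  using assms unfolding iterated_join_def by blast

lemma drift_step:
  fixes x x' e :: real
  assumes "\<bar>x - x'\<bar> < e" "s = x + t" "s' = x' + t'" "\<bar>(t - b) - (t' - b')\<bar> \<le> k"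
  shows "\<bar>(s - b) - (s' - b')\<bar> \<le> k + e"
  using assms by linarith

text \<open>Code a point of \<open>Q\<close> by an element of a subcover for \<open>F\<close> around its base point \<open>b\<close>, together with
  the values of \<open>s\<close> at every \<open>L\<close>-th integer, rounded. Between two such times the drift of \<open>s\<close> inside
  one element is small, so each rounded value allows at most \<open>4\<close> successors, which costs \<open>ln 4 / L\<close> in
  entropy; then let \<open>L\<close> tend to infinity.\<close>

theorem entropy_time_change:
  fixes Q :: "'q::t2_space set" and B :: "'b::t2_space set"
    and G :: "real \<Rightarrow> 'b \<Rightarrow> 'q" and s :: "real \<Rightarrow> 'b \<Rightarrow> real"
  assumes Q: "compact Q" and B: "compact B" "B \<noteq> {}" and F: "\<And>b. b \<in> B ==> F b \<in> B"
    and G: "continuous_on ({0..2} \<times> B) (\<lambda>(a, b). G a b)" "\<And>a b. 0 \<le> a ==> b \<in> B ==> G a b \<in> Q"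
      "\<And>a b. 0 \<le> a ==> b \<in> B ==> G (a + 1) b = G a (F b)"
    and s: "continuous_on ({0..2} \<times> B) (\<lambda>(a, b). s a b)"
      "\<And>a b. 0 \<le> a ==> b \<in> B ==> s (a + 1) b = s a (F b) + s 1 b"
      "\<And>b. b \<in> B ==> s 0 b = 0"
      "\<And>a a' b. 0 \<le> a ==> a \<le> a' ==> b \<in> B ==> \<rho> * (a' - a) \<le> s a' b - s a b"
    and \<rho>: "\<rho> > 0"
    and orbits: "\<And>q. q \<in> Q ==> \<exists>b\<in>B. \<exists>r\<in>{0..1}. \<forall>k::nat. \<exists>a\<ge>r. s a b = s r b + real k \<and> (g ^^ k) q = G a b"
  shows "ereal \<rho> * top_entropy Q g \<le> top_entropy B F"
proof -
  have FB: "(F ^^ i) b \<in> B" if "b \<in> B" for b i using that F by (induction i) auto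
  have Gn: "G (a + real j) b = G a ((F ^^ j) b)" if "0 \<le> a" "b \<in> B" for a j b
    using that
  proof (induction j arbitrary: b)
    case (Suc j)
    have "G (a + real (Suc j)) b = G (a + real j) (F b)"
      using G(3)[of "a + real j" b] Suc.prems by (simp add: add_ac)
    also have "\<dots> = G a ((F ^^ Suc j) b)" using Suc.IH[of "F b"] Suc.prems F by (simp add: funpow_swap1)
    finally show ?case .
  qed simp
  have sn: "s (a + real j) b = s a ((F ^^ j) b) + s (real j) b" if "0 \<le> a" "b \<in> B" for a j b
    using that
  proof (induction j arbitrary: b)
    case 0 thus ?case using s(3) by simp
  next
    case (Suc j)
    have "s (a + real (Suc j)) b = s (a + real j) (F b) + s 1 b"
      using s(2)[of "a + real j" b] Suc.prems by (simp add: add_ac)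
    also have "\<dots> = s a ((F ^^ j) (F b)) + (s (real j) (F b) + s 1 b)" using Suc.IH[of "F b"] Suc.prems F by simp
    also have "s (real j) (F b) + s 1 b = s (real (Suc j)) b"
      using s(2)[of "real j" b] Suc.prems by (simp add: add_ac)
    finally show ?case by (simp add: funpow_swap1)
  qed
  \<comment> \<open>Each q is described by a base point \<open>\<beta> q\<close> and a starting
    phase \<open>r q\<close>; \<open>\<theta> q k\<close>, obtained next, is the base time at which
    its orbit reaches the k-th iterate.\<close>
  obtain r \<beta> where rb: "\<And>q. q \<in> Q ==> \<beta> q \<in> B \<and> r q \<in> {0..1} \<and>
      (\<forall>k::nat. \<exists>a\<ge>r q. s a (\<beta> q) = s (r q) (\<beta> q) + real k \<and> (g ^^ k) q = G a (\<beta> q))"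
    using orbits by metis
  then obtain \<theta> where \<theta>: "\<And>q k. q \<in> Q ==> \<theta> q k \<ge> r q \<and> s (\<theta> q k) (\<beta> q) = s (r q) (\<beta> q) + real k \<and> (g ^^ k) q = G (\<theta> q k) (\<beta> q)"
    by metis
  \<comment> \<open>This confines the first rounded value below: \<open>u 0 q\<close> will be - s (r
    q) (\<beta> q), which lies between -S and 0.\<close>
  have bnd: "\<exists>S. \<forall>b\<in>B. \<forall>a\<in>{0..1}. s a b \<le> S"
  proof -
    have "compact ((\<lambda>(a, b). s a b) ` ({0..2} \<times> B))" using s(1) B by (intro compact_continuous_image compact_Times) auto
    hence "bounded ((\<lambda>(a, b). s a b) ` ({0..2} \<times> B))" by (rule compact_imp_bounded)
    then obtain S where S: "\<And>x. x \<in> (\<lambda>(a, b). s a b) ` ({0..2} \<times> B) ==> norm x \<le> S"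
      unfolding bounded_iff by blast
    have "s a b \<le> S" if "b \<in> B" "a \<in> {0..1}" for a b using S[of "s a b"] that by force
    thus ?thesis by blast
  qed
  then obtain S where S: "\<And>a b. b \<in> B ==> a \<in> {0..1} ==> s a b \<le> S" by blast
  have main: "ereal \<rho> * cover_entropy Q g \<U> \<le> top_entropy B F + ereal (ln 4 / real L)"
    if \<U>: "\<U> \<in> open_covers Q" and L: "L > 0" for \<U> and L :: nat
  proof -
    obtain d :: "'q \<Rightarrow> 'q \<Rightarrow> real" where d: "continuous_on (Q \<times> Q) (\<lambda>(x, y). d x y)" "\<And>x. d x x = 0"
      "\<And>x. x \<in> Q ==> \<exists>U\<in>\<U>. \<forall>y\<in>Q. d x y < 1/2 \<longrightarrow> y \<in> U"
      using open_cover_separation[OF Q \<U>] by metis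
    obtain \<kappa> where \<kappa>: "\<kappa> > 0" "\<And>a a' b. a \<in> {0..2} ==> a' \<in> {0..2} ==> \<bar>a - a'\<bar> \<le> \<kappa> ==> b \<in> B ==> d (G a b) (G a' b) < 1/2"
      using uniform_time_continuity[OF B(1) d(1,2) G(1,2)] by metis
    \<comment> \<open>Two points with the same code will have values of s within 2h of each other at
      equal times; by the growth rate \<rho> their hitting times then differ by at most
      \<open>2 * h / \<rho>\<close>. This choice makes that at most \<kappa>, and at most 1 so that
      both shifted times stay in [0,2].\<close>
    define h where "h = min 1 \<kappa> * \<rho> / 2"
    have h: "h > 0" "2 * h / \<rho> \<le> \<kappa>" "2 * h / \<rho> \<le> 1" using \<kappa> \<rho> by (auto simp: h_def)
    define K where "K = {z \<in> {0..2::real} \<times> {0..2::real}. \<bar>fst z - snd z\<bar> \<le> \<kappa>}"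
    have cK: "compact K"
    proof -
      have "K = ({0..2} \<times> {0..2}) \<inter> {z. \<bar>fst z - snd z\<bar> \<le> \<kappa>}" unfolding K_def by auto
      moreover have "closed {z::real \<times> real. \<bar>fst z - snd z\<bar> \<le> \<kappa>}" by (intro closed_Collect_le continuous_intros)
      ultimately show ?thesis by (simp add: compact_Int_closed compact_Times)
    qed
    \<comment> \<open>The tolerance h / L for one unit of time adds up to h over a block of L
      units.\<close>
    have close: "\<exists>V. open V \<and> b \<in> V \<and> (\<forall>k\<in>K. \<forall>y\<in>V \<inter> B. \<forall>z\<in>V \<inter> B. d (G (fst k) y) (G (snd k) z) < 1/2) \<and>
        (\<forall>a\<in>{0..2}. \<forall>y\<in>V \<inter> B. \<forall>z\<in>V \<inter> B. \<bar>s a y - s a z\<bar> < h / real L)" if b: "b \<in> B" for b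
    proof -
      have 1: "continuous_on (K \<times> B \<times> B) (\<lambda>z. G (fst (fst z)) (fst (snd z)))"
        by (rule continuous_on_pair[OF G(1)]) (auto simp: K_def intro!: continuous_intros)
      have 2: "continuous_on (K \<times> B \<times> B) (\<lambda>z. G (snd (fst z)) (snd (snd z)))"
        by (rule continuous_on_pair[OF G(1)]) (auto simp: K_def intro!: continuous_intros)
      have 3: "continuous_on (K \<times> B \<times> B) (\<lambda>(k, y, z). d (G (fst k) y) (G (snd k) z))"
        using continuous_on_pair[OF d(1) 1 2] G(2) by (auto simp: K_def case_prod_unfold)
      obtain V1 where V1: "open V1" "b \<in> V1" "\<And>k y z. k \<in> K ==> y \<in> V1 \<inter> B ==> z \<in> V1 \<inter> B ==> d (G (fst k) y) (G (snd k) z) < 1/2"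
        by (rule diagonal_tube[where \<epsilon> = "1/2", OF cK 3 _ b]) (use \<kappa>(2) in \<open>auto simp: K_def\<close>)
      have 4: "continuous_on ({0..2} \<times> B \<times> B) (\<lambda>z. s (fst z) (fst (snd z)))"
        by (rule continuous_on_pair[OF s(1)]) (auto intro!: continuous_intros)
      have 5: "continuous_on ({0..2} \<times> B \<times> B) (\<lambda>z. s (fst z) (snd (snd z)))"
        by (rule continuous_on_pair[OF s(1)]) (auto intro!: continuous_intros)
      have 6: "continuous_on ({0..2} \<times> B \<times> B) (\<lambda>(a, y, z). \<bar>s a y - s a z\<bar>)"
        using continuous_on_rabs[OF continuous_on_diff[OF 4 5]] by (simp add: case_prod_unfold)
      obtain V2 where V2: "open V2" "b \<in> V2" "\<And>a y z. a \<in> {0..2} ==> y \<in> V2 \<inter> B ==> z \<in> V2 \<inter> B ==> \<bar>s a y - s a z\<bar> < h / real L"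
        by (rule diagonal_tube[where \<epsilon> = "h / real L", OF compact_Icc 6 _ b]) (use h L in auto)
      show ?thesis by (rule exI[of _ "V1 \<inter> V2"]) (use V1 V2 in auto)
    qed
    then obtain V where V: "\<And>b. b \<in> B ==> open (V b) \<and> b \<in> V b \<and>
        (\<forall>k\<in>K. \<forall>y\<in>V b \<inter> B. \<forall>z\<in>V b \<inter> B. d (G (fst k) y) (G (snd k) z) < 1/2) \<and>
        (\<forall>a\<in>{0..2}. \<forall>y\<in>V b \<inter> B. \<forall>z\<in>V b \<inter> B. \<bar>s a y - s a z\<bar> < h / real L)" by metis
    have "\<exists>D\<subseteq>B. finite D \<and> B \<subseteq> (\<Union>b\<in>D. V b)"
      by (rule compactE_image[OF B(1), of B V]) (use V in blast)+
    then obtain D where D: "D \<subseteq> B" "finite D" "B \<subseteq> (\<Union>b\<in>D. V b)" by blast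
    define \<V> where "\<V> = (\<lambda>b. V b \<inter> B) ` D"
    have \<V>c: "\<V> \<in> open_covers B"
      unfolding open_covers_def \<V>_def using D V by (auto intro!: openin_open_Int simp: Int_commute)
    have \<V>fin: "finite \<V>" "B \<subseteq> \<Union>\<V>" using D unfolding \<V>_def by auto
    have \<V>1: "d (G a y) (G a' z) < 1/2" if "v \<in> \<V>" "y \<in> v" "z \<in> v" "a \<in> {0..2}" "a' \<in> {0..2}" "\<bar>a - a'\<bar> \<le> \<kappa>" for v y z a a'
    proof -
      obtain b where "b \<in> D" "v = V b \<inter> B" using \<open>v \<in> \<V>\<close> unfolding \<V>_def by blast
      moreover have "(a, a') \<in> K" using that by (simp add: K_def)
      ultimately show ?thesis using V[of b] D that(2,3) by force
    qed
    have \<V>2: "\<bar>s a y - s a z\<bar> < h / real L" if "v \<in> \<V>" "y \<in> v" "z \<in> v" "a \<in> {0..2}" for v y z a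
    proof -
      obtain b where "b \<in> D" "v = V b \<inter> B" using \<open>v \<in> \<V>\<close> unfolding \<V>_def by blast
      thus ?thesis using V[of b] D that(2,3,4) by blast
    qed
    define C where "C = card {\<lfloor>- S / h\<rfloor>..0}"
    \<comment> \<open>The first n iterates occur before base time n / \<rho> + 1, because s grows at
      rate at least \<rho> and the phase is at most 1. \<open>J n\<close> blocks of length L cover
      this stretch.\<close>
    define J where "J = (\<lambda>n::nat. nat \<lceil>(real n / \<rho> + 1) / real L\<rceil>)"
    have count: "cover_number Q (iterated_join Q g \<U> n) \<le> cover_number B (iterated_join B F \<V> (J n * L + L)) * (C * 4 ^ J n)" for n
    proof -
      let ?m = "J n * L + L"
      obtain \<W> where \<W>: "\<W> \<subseteq> iterated_join B F \<V> ?m" "finite \<W>" "card \<W> = cover_number B (iterated_join B F \<V> ?m)" "B \<subseteq> \<Union>\<W>"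
        by (rule iterated_join_subcover[OF F \<V>fin])
      define wf where "wf = (\<lambda>q. SOME w. w \<in> \<W> \<and> \<beta> q \<in> w)"
      have wf: "wf q \<in> \<W> \<and> \<beta> q \<in> wf q" if "q \<in> Q" for q
        unfolding wf_def by (rule someI_ex) (use rb[OF that] \<W>(4) in blast)
      define u where "u = (\<lambda>i q. s (real (i * L)) (\<beta> q) - s (r q) (\<beta> q))"
      define fl where "fl = (\<lambda>q. map (\<lambda>i. \<lfloor>u i q / h\<rfloor>) [0..<Suc (J n)])"
      define c where "c = (\<lambda>q. (wf q, fl q))"
      have close1: "\<exists>v\<in>\<V>. (F ^^ i) (\<beta> q) \<in> v \<and> (F ^^ i) (\<beta> q') \<in> v"
        if "q \<in> Q" "q' \<in> Q" "wf q = wf q'" "i < ?m" for q q' i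
      proof -
        have "wf q \<in> iterated_join B F \<V> ?m" "\<beta> q \<in> wf q" "\<beta> q' \<in> wf q" using wf[OF that(1)] wf[OF that(2)] that(3) \<W>(1) by auto
        thus ?thesis using iterate_cover_closeness \<open>i < ?m\<close> by metis
      qed
      \<comment> \<open>Base points in one element of the subcover have iterates in common elements
        of \<open>\<V>\<close>. So each of the l unit steps, and the last piece of length a, adds at
        most h / L.\<close>
      have drift: "\<bar>(s (real (i + l) + a) (\<beta> q) - s (real i) (\<beta> q)) - (s (real (i + l) + a) (\<beta> q') - s (real i) (\<beta> q'))\<bar> \<le> real (Suc l) * (h / real L)"
        if q: "q \<in> Q" "q' \<in> Q" "wf q = wf q'" and i: "i + l < ?m" and a: "a \<in> {0..2}" for q q' i l a
        using i a
      proof (induction l arbitrary: a)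
        case 0
        obtain v where v: "v \<in> \<V>" "(F ^^ i) (\<beta> q) \<in> v" "(F ^^ i) (\<beta> q') \<in> v" using close1[OF q, of i] 0 by auto
        have "\<bar>s a ((F ^^ i) (\<beta> q)) - s a ((F ^^ i) (\<beta> q'))\<bar> < h / real L" using \<V>2[OF v] 0 by blast
        moreover have "s (a + real i) (\<beta> q) = s a ((F ^^ i) (\<beta> q)) + s (real i) (\<beta> q)"
          "s (a + real i) (\<beta> q') = s a ((F ^^ i) (\<beta> q')) + s (real i) (\<beta> q')"
          using sn 0 rb q by auto
        ultimately show ?case by (simp add: add.commute)
      next
        case (Suc l)
        obtain v where v: "v \<in> \<V>" "(F ^^ (i + Suc l)) (\<beta> q) \<in> v" "(F ^^ (i + Suc l)) (\<beta> q') \<in> v" using close1[OF q, of "i + Suc l"] Suc.prems by auto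
        have "\<bar>s a ((F ^^ (i + Suc l)) (\<beta> q)) - s a ((F ^^ (i + Suc l)) (\<beta> q'))\<bar> < h / real L" using \<V>2[OF v] Suc.prems by blast
        moreover have st: "s (real (i + Suc l) + a) (\<beta> p) = s a ((F ^^ (i + Suc l)) (\<beta> p)) + s (real (i + Suc l)) (\<beta> p)"
          if "p \<in> Q" for p
        proof -
          have "0 \<le> a" "\<beta> p \<in> B" using Suc.prems rb[OF that] by auto
          from sn[OF this, of "i + Suc l"] show ?thesis by (simp only: add.commute[of a])
        qed
        moreover have "\<bar>(s (real (i + l) + 1) (\<beta> q) - s (real i) (\<beta> q)) - (s (real (i + l) + 1) (\<beta> q') - s (real i) (\<beta> q'))\<bar> \<le> real (Suc l) * (h / real L)"
          using Suc.prems by (intro Suc.IH) auto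
        hence "\<bar>(s (real (i + Suc l)) (\<beta> q) - s (real i) (\<beta> q)) - (s (real (i + Suc l)) (\<beta> q') - s (real i) (\<beta> q'))\<bar> \<le> real (Suc l) * (h / real L)"
          by (simp add: add_ac)
        ultimately have "\<bar>(s (real (i + Suc l) + a) (\<beta> q) - s (real i) (\<beta> q)) - (s (real (i + Suc l) + a) (\<beta> q') - s (real i) (\<beta> q'))\<bar> \<le> real (Suc l) * (h / real L) + h / real L"
          using q by (intro drift_step)
        moreover have "real (Suc (Suc l)) * (h / real L) = real (Suc l) * (h / real L) + h / real L"
          by (simp only: of_nat_Suc distrib_right mult_1_left add_ac)
        ultimately show ?case by (simp only:)
      qed
      \<comment> \<open>Counted separately for each element w of the subcover: only for base points
        in a common element is the drift over a block bounded by h.\<close>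
      have card_fl: "finite (fl ` {q\<in>Q. wf q = w}) \<and> card (fl ` {q\<in>Q. wf q = w}) \<le> C * 4 ^ J n" for w
        unfolding fl_def C_def
      proof (rule card_floor_sequences[OF h(1)])
        fix q assume "q \<in> {q\<in>Q. wf q = w}"
        hence q: "q \<in> Q" by simp
        have "0 \<le> s (r q) (\<beta> q)" using s(4)[of 0 "r q" "\<beta> q"] rb[OF q] s(3)[of "\<beta> q"] \<rho>
          by (smt (verit) atLeastAtMost_iff mult_nonneg_nonneg)
        thus "- S \<le> u 0 q \<and> u 0 q \<le> 0" unfolding u_def using rb[OF q] s(3) S by auto
      next
        fix i q q' assume i: "i < J n" and "q \<in> {q\<in>Q. wf q = w}" "q' \<in> {q\<in>Q. wf q = w}"
        hence q: "q \<in> Q" "q' \<in> Q" "wf q = wf q'" by auto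
        have "i * L + L \<le> J n * L" using i by (metis Suc_leI add.commute mult_Suc mult_le_mono1)
        hence "i * L + (L - 1) < ?m" using L by linarith
        from drift[OF q this, of 1]
        have "\<bar>(s (real (i * L + (L - 1)) + 1) (\<beta> q) - s (real (i * L)) (\<beta> q)) - (s (real (i * L + (L - 1)) + 1) (\<beta> q') - s (real (i * L)) (\<beta> q'))\<bar> \<le> real (Suc (L - 1)) * (h / real L)" by simp
        moreover have "real (i * L + (L - 1)) + 1 = real (Suc i * L)" using L by (simp add: of_nat_diff)
        moreover have "real (Suc (L - 1)) * (h / real L) = h" using L by simp
        ultimately show "\<bar>(u (Suc i) q - u i q) - (u (Suc i) q' - u i q')\<bar> \<le> h"
          unfolding u_def by (simp only:)
      qed
      have cQ: "c ` Q \<subseteq> (\<Union>w\<in>\<W>. {w} \<times> fl ` {q\<in>Q. wf q = w})"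
        unfolding c_def using wf by auto
      have fin: "finite (\<Union>w\<in>\<W>. {w} \<times> fl ` {q\<in>Q. wf q = w})" using \<W>(2) card_fl by auto
      have "card (c ` Q) \<le> card (\<Union>w\<in>\<W>. {w} \<times> fl ` {q\<in>Q. wf q = w})" using cQ fin by (rule card_mono[rotated])
      also have "\<dots> \<le> (\<Sum>w\<in>\<W>. card ({w} \<times> fl ` {q\<in>Q. wf q = w}))" using \<W>(2) by (rule card_UN_le)
      also have "\<dots> \<le> (\<Sum>w\<in>\<W>. C * 4 ^ J n)" using card_fl by (intro sum_mono) (simp add: card_cartesian_product)
      also have "\<dots> = cover_number B (iterated_join B F \<V> ?m) * (C * 4 ^ J n)" using \<W>(3) by simp
      finally have card_c: "card (c ` Q) \<le> cover_number B (iterated_join B F \<V> ?m) * (C * 4 ^ J n)" .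
      have gclose: "d ((g ^^ k) q) ((g ^^ k) q') < 1/2" if q: "q \<in> Q" "q' \<in> Q" "c q = c q'" and k: "k < n" for q q' k
      proof -
        have weq: "wf q = wf q'" using q by (simp add: c_def)
        let ?t = "\<theta> q k" and ?t' = "\<theta> q' k"
        have J: "real (J n) * real L \<ge> real n / \<rho> + 1"
        proof -
          have "(real n / \<rho> + 1) / real L \<le> real (J n)" unfolding J_def by linarith
          thus ?thesis using L by (simp add: divide_simps)
        qed
        have tb: "0 \<le> \<theta> p k \<and> \<theta> p k < real (J n * L)" if p: "p \<in> Q" for p
        proof -
          have "\<rho> * (\<theta> p k - r p) \<le> real k" using s(4)[of "r p" "\<theta> p k" "\<beta> p"] \<theta>[OF p, of k] rb[OF p] by auto
          hence "\<theta> p k - r p \<le> real k / \<rho>" using \<rho> by (simp add: field_simps)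
          moreover have "real k / \<rho> < real n / \<rho>" using k \<rho> by (simp add: divide_strict_right_mono)
          ultimately show ?thesis using \<theta>[OF p, of k] rb[OF p] J by auto
        qed
        \<comment> \<open>One h comes from the rounding at the start of the block containing t, the
          other from the drift inside that block.\<close>
        have ublock: "\<bar>(s t (\<beta> q) - s (r q) (\<beta> q)) - (s t (\<beta> q') - s (r q') (\<beta> q'))\<bar> \<le> 2 * h"
          if t: "0 \<le> t" "t < real (J n * L)" for t
        proof -
          define j where "j = nat \<lfloor>t\<rfloor>"
          have j: "real j \<le> t" "t < real j + 1" using t unfolding j_def by linarith+
          define i where "i = j div L"
          define l where "l = j mod L"
          have jil: "j = i * L + l" unfolding i_def l_def by simp
          have lL: "l < L" using L by (simp add: l_def)
          have jJ: "j < J n * L" using j t by (metis le_less_trans of_nat_less_iff)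
          have iJ: "i < J n" using jJ L unfolding i_def by (simp add: less_mult_imp_div_less)
          have "i * L + l < ?m" using jJ jil by simp
          from drift[OF q(1,2) weq this, of "t - real j"] j
          have dr: "\<bar>(s t (\<beta> q) - s (real (i * L)) (\<beta> q)) - (s t (\<beta> q') - s (real (i * L)) (\<beta> q'))\<bar> \<le> real (Suc l) * (h / real L)"
            by (simp add: jil)
          have "real (Suc l) * (h / real L) \<le> real L * (h / real L)" using lL h by (intro mult_right_mono) auto
          also have "\<dots> = h" using L by simp
          finally have dr2: "real (Suc l) * (h / real L) \<le> h" .
          have "fl q ! i = fl q' ! i" using q(3) by (simp add: c_def)
          hence "\<lfloor>u i q / h\<rfloor> = \<lfloor>u i q' / h\<rfloor>" unfolding fl_def using iJ by (simp del: upt_Suc)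
          hence "\<bar>u i q / h - u i q' / h\<bar> < 1" by linarith
          hence "\<bar>u i q - u i q'\<bar> / h < 1" using h by (simp add: diff_divide_distrib[symmetric])
          hence "\<bar>u i q - u i q'\<bar> < h" using h by simp
          thus ?thesis using dr dr2 unfolding u_def by linarith
        qed
        \<comment> \<open>At their own times both points have s advanced by the same k. A gap
          between these times would appear, at rate \<rho>, as a gap between the values of s at one
          common time.\<close>
        have tt: "\<bar>?t - ?t'\<bar> \<le> 2 * h / \<rho>"
        proof (cases "?t \<le> ?t'")
          case True
          have "\<rho> * (?t' - ?t) \<le> s ?t' (\<beta> q') - s ?t (\<beta> q')" using s(4) True tb q rb by blast
          also have "\<dots> \<le> 2 * h" using ublock[of ?t] tb[OF q(1)] \<theta>[OF q(1), of k] \<theta>[OF q(2), of k] by linarith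
          finally show ?thesis using True \<rho> by (simp add: field_simps)
        next
          case False
          hence "\<rho> * (?t - ?t') \<le> s ?t (\<beta> q) - s ?t' (\<beta> q)" using s(4)[of ?t' ?t "\<beta> q"] tb q rb by auto
          also have "\<dots> \<le> 2 * h" using ublock[of ?t'] tb[OF q(2)] \<theta>[OF q(1), of k] \<theta>[OF q(2), of k] by linarith
          finally show ?thesis using False \<rho> by (simp add: field_simps)
        qed
        \<comment> \<open>Subtracting the integer part of the smaller time puts it in [0,1) and the
          other in [0,2], and replaces the base points by their j-th iterates, which share an
          element of \<open>\<V>\<close>.\<close>
        define j where "j = nat \<lfloor>min ?t ?t'\<rfloor>"
        have j: "real j \<le> min ?t ?t'" "min ?t ?t' < real j + 1" using tb[OF q(1)] tb[OF q(2)] unfolding j_def by linarith+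
        have a: "?t - real j \<in> {0..2}" "?t' - real j \<in> {0..2}" "\<bar>(?t - real j) - (?t' - real j)\<bar> \<le> \<kappa>"
          using j tt h by auto
        have "j < J n * L" using j tb[OF q(1)] by (metis le_less_trans min.boundedE of_nat_less_iff)
        then obtain v where v: "v \<in> \<V>" "(F ^^ j) (\<beta> q) \<in> v" "(F ^^ j) (\<beta> q') \<in> v" using close1[OF q(1,2) weq, of j] by auto
        have "d (G (?t - real j) ((F ^^ j) (\<beta> q))) (G (?t' - real j) ((F ^^ j) (\<beta> q'))) < 1/2"
          using \<V>1[OF v a] .
        moreover have "G (?t - real j) ((F ^^ j) (\<beta> q)) = (g ^^ k) q"
          using Gn[of "?t - real j" "\<beta> q" j] a(1) rb[OF q(1)] \<theta>[OF q(1), of k] by simp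
        moreover have "G (?t' - real j) ((F ^^ j) (\<beta> q')) = (g ^^ k) q'"
          using Gn[of "?t' - real j" "\<beta> q'" j] a(2) rb[OF q(2)] \<theta>[OF q(2), of k] by simp
        ultimately show ?thesis by simp
      qed
      have gQ: "(g ^^ k) q \<in> Q" if "q \<in> Q" for q k
        using \<theta>[OF that, of k] rb[OF that] G(2)[of "\<theta> q k" "\<beta> q"] by auto
      have "cover_number Q (iterated_join Q g \<U> n) \<le> card (c ` Q)"
      proof (rule cover_number_le)
        show "finite (c ` Q)" using cQ fin finite_subset by blast
        fix q assume q: "q \<in> Q"
        have "\<forall>k. \<exists>U\<in>\<U>. \<forall>y\<in>Q. d ((g ^^ k) q) y < 1/2 \<longrightarrow> y \<in> U" using d(3) gQ[OF q] by blast
        then obtain U where U: "\<And>k. U k \<in> \<U> \<and> (\<forall>y\<in>Q. d ((g ^^ k) q) y < 1/2 \<longrightarrow> y \<in> U k)" by metis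
        show "\<exists>U\<in>iterated_join Q g \<U> n. \<forall>y\<in>Q. c y = c q \<longrightarrow> y \<in> U"
        proof (intro bexI ballI impI)
          show "{x \<in> Q. \<forall>i<n. (g ^^ i) x \<in> U i} \<in> iterated_join Q g \<U> n" unfolding iterated_join_def using U by blast
          fix y assume y: "y \<in> Q" "c y = c q"
          thus "y \<in> {x \<in> Q. \<forall>i<n. (g ^^ i) x \<in> U i}" using U gclose[OF q y(1) y(2)[symmetric]] gQ by blast
        qed
      qed
      thus ?thesis using card_c by linarith
    qed
    have Npos: "cover_number B (iterated_join B F \<V> n) > 0" for n
    proof -
      obtain \<W> where \<W>: "\<W> \<subseteq> iterated_join B F \<V> n" "finite \<W>" "card \<W> = cover_number B (iterated_join B F \<V> n)" "B \<subseteq> \<Union>\<W>"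
        by (rule iterated_join_subcover[OF F \<V>fin])
      have "\<W> \<noteq> {}" using \<W>(4) B(2) by auto
      thus ?thesis using \<W> by (metis card_gt_0_iff)
    qed
    have Cpos: "C > 0"
    proof -
      obtain b where b: "b \<in> B" using B(2) by blast
      hence "0 \<le> S" using S[of b 0] s(3)[of b] by auto
      hence "- S / h \<le> 0" using h by (simp add: field_simps)
      hence "\<lfloor>- S / h\<rfloor> \<le> 0" by linarith
      thus ?thesis unfolding C_def by (simp add: card_gt_0_iff)
    qed
    define N where "N = (\<lambda>m. cover_number B (iterated_join B F \<V> m))"
    define M where "M = (\<lambda>n. J n * L + L)"
    have lncount: "ln (real (cover_number Q (iterated_join Q g \<U> n))) \<le> ln (real (N (M n))) + ln (real C) + real (J n) * ln 4" for n
    proof -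
      let ?N = "cover_number Q (iterated_join Q g \<U> n)"
      have pos: "0 < N (M n) * (C * 4 ^ J n)" using Npos Cpos by (simp add: N_def)
      have eq: "ln (real (N (M n) * (C * 4 ^ J n))) = ln (real (N (M n))) + ln (real C) + real (J n) * ln 4"
        using Npos Cpos by (simp add: ln_mult ln_realpow N_def)
      show ?thesis
      proof (cases "?N = 0")
        \<comment> \<open>The cover number vanishes for empty Q; then the left side is
          \<open>ln 0 = 0\<close> by convention.\<close>
        case True
        have "0 \<le> ln (real (N (M n) * (C * 4 ^ J n)))" using pos by (metis ln_ge_zero of_nat_1 of_nat_le_iff Suc_leI One_nat_def)
        thus ?thesis using True eq by simp
      next
        case False
        hence "ln (real ?N) \<le> ln (real (N (M n) * (C * 4 ^ J n)))"
          using count[of n] pos unfolding N_def M_def by (subst ln_le_cancel_iff) (auto simp del: of_nat_mult)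
        thus ?thesis using eq by simp
      qed
    qed
    have Jlim: "(\<lambda>n. real (J n) / real n) \<longlonglongrightarrow> 1 / (\<rho> * real L)"
    proof (rule tendsto_sandwich)
      show "\<forall>\<^sub>F n in sequentially. ((real n / \<rho> + 1) / real L) / real n \<le> real (J n) / real n"
        by (intro always_eventually allI divide_right_mono) (simp_all add: J_def real_nat_ceiling_ge)
      have "real (J n) \<le> (real n / \<rho> + 1) / real L + 1" for n
      proof -
        have "0 \<le> (real n / \<rho> + 1) / real L" using \<rho> by simp
        hence "real (J n) = of_int \<lceil>(real n / \<rho> + 1) / real L\<rceil>" unfolding J_def by simp
        thus ?thesis by linarith
      qed
      thus "\<forall>\<^sub>F n in sequentially. real (J n) / real n \<le> ((real n / \<rho> + 1) / real L + 1) / real n"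
        by (intro always_eventually allI divide_right_mono) auto
      have inv: "(\<lambda>n. 1 / real n) \<longlonglongrightarrow> 0" by (rule lim_1_over_n)
      have "(\<lambda>n. 1 / (\<rho> * real L) + (1 / real L) * (1 / real n)) \<longlonglongrightarrow> 1 / (\<rho> * real L) + (1 / real L) * 0"
        by (intro tendsto_intros inv)
      moreover have "\<forall>\<^sub>F n in sequentially. 1 / (\<rho> * real L) + (1 / real L) * (1 / real n) = ((real n / \<rho> + 1) / real L) / real n"
        using eventually_gt_at_top[of 0] by eventually_elim (use L \<rho> in \<open>simp add: field_simps\<close>)
      ultimately show "(\<lambda>n. ((real n / \<rho> + 1) / real L) / real n) \<longlonglongrightarrow> 1 / (\<rho> * real L)"
        by (simp only: mult_zero_right add_0_right) (rule Lim_transform_eventually)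
      have "(\<lambda>n. 1 / (\<rho> * real L) + (1 / real L + 1) * (1 / real n)) \<longlonglongrightarrow> 1 / (\<rho> * real L) + (1 / real L + 1) * 0"
        by (intro tendsto_intros inv)
      moreover have "\<forall>\<^sub>F n in sequentially. 1 / (\<rho> * real L) + (1 / real L + 1) * (1 / real n) = ((real n / \<rho> + 1) / real L + 1) / real n"
        using eventually_gt_at_top[of 0] by eventually_elim (use L \<rho> in \<open>simp add: field_simps\<close>)
      ultimately show "(\<lambda>n. ((real n / \<rho> + 1) / real L + 1) / real n) \<longlonglongrightarrow> 1 / (\<rho> * real L)"
        by (simp only: mult_zero_right add_0_right) (rule Lim_transform_eventually)
    qed
    \<comment> \<open>The origin of the factor \<rho>: n iterates of g are controlled by about n /
      \<rho> iterates of F.\<close>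
    have Mlim: "(\<lambda>n. real (M n) / real n) \<longlonglongrightarrow> 1 / \<rho>"
    proof -
      have "(\<lambda>n. (real (J n) / real n) * real L + real L * (1 / real n)) \<longlonglongrightarrow> 1 / (\<rho> * real L) * real L + real L * 0"
        by (intro tendsto_intros Jlim lim_1_over_n)
      moreover have "(\<lambda>n. (real (J n) / real n) * real L + real L * (1 / real n)) = (\<lambda>n. real (M n) / real n)"
        by (auto simp: M_def add_divide_distrib fun_eq_iff)
      ultimately show ?thesis using L by simp
    qed
    have Mtop: "filterlim M at_top sequentially"
    proof -
      have "n \<le> nat \<lceil>\<rho>\<rceil> * M n" for n
      proof -
        have "real n / \<rho> \<le> (real n / \<rho> + 1) / real L * real L" using L by simp
        also have "\<dots> \<le> real (J n) * real L" by (intro mult_right_mono) (simp_all add: J_def real_nat_ceiling_ge)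
        also have "\<dots> \<le> real (M n)" by (simp add: M_def)
        finally have "real n \<le> \<rho> * real (M n)" using \<rho> by (simp add: field_simps)
        also have "\<dots> \<le> real (nat \<lceil>\<rho>\<rceil>) * real (M n)" by (intro mult_right_mono) (simp_all add: real_nat_ceiling_ge)
        finally show ?thesis by (metis of_nat_le_iff of_nat_mult)
      qed
      hence "\<And>n Z. n \<ge> nat \<lceil>\<rho>\<rceil> * Z ==> M n \<ge> Z"
        using \<rho> by (metis (no_types) le_trans mult_le_cancel1 zero_less_nat_eq zero_less_ceiling)
      thus ?thesis unfolding filterlim_at_top eventually_sequentially by blast
    qed
    \<comment> \<open>A real x above the entropy of the base cover bounds the counts eventually, so
      the limit superior along \<open>M n\<close> reduces to ordinary limits of real
      sequences.\<close>
    have bound: "ereal \<rho> * cover_entropy Q g \<U> \<le> ereal x + ereal (ln 4 / real L)" if x: "cover_entropy B F \<V> < ereal x" for x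
    proof -
      have "\<forall>\<^sub>F m in sequentially. ereal (ln (real (N m)) / real m) < ereal x"
        using x unfolding cover_entropy_def N_def by (rule Limsup_lessD)
      hence "\<forall>\<^sub>F n in sequentially. ereal (ln (real (N (M n))) / real (M n)) < ereal x"
        using Mtop by (rule eventually_compose_filterlim)
      hence "\<forall>\<^sub>F n in sequentially. ereal (ln (real (cover_number Q (iterated_join Q g \<U> n))) / real n)
          \<le> ereal (x * (real (M n) / real n) + ln (real C) * (1 / real n) + ln 4 * (real (J n) / real n))"
        using eventually_gt_at_top[of 0]
      proof eventually_elim
        case (elim n)
        have Mn: "M n > 0" using L by (simp add: M_def)
        have "ln (real (N (M n))) \<le> x * real (M n)" using elim Mn by (simp add: divide_simps)
        hence "ln (real (cover_number Q (iterated_join Q g \<U> n))) \<le> x * real (M n) + ln (real C) + real (J n) * ln 4"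
          using lncount[of n] by linarith
        hence "ln (real (cover_number Q (iterated_join Q g \<U> n))) / real n \<le> (x * real (M n) + ln (real C) + real (J n) * ln 4) / real n"
          by (intro divide_right_mono) auto
        thus ?case by (simp add: add_divide_distrib mult.commute)
      qed
      hence "cover_entropy Q g \<U> \<le> limsup (\<lambda>n. ereal (x * (real (M n) / real n) + ln (real C) * (1 / real n) + ln 4 * (real (J n) / real n)))"
        unfolding cover_entropy_def by (rule Limsup_mono)
      also have "\<dots> = ereal (x * (1 / \<rho>) + ln (real C) * 0 + ln 4 * (1 / (\<rho> * real L)))"
        by (intro lim_imp_Limsup tendsto_ereal tendsto_intros Mlim Jlim lim_1_over_n) simp
      finally have "cover_entropy Q g \<U> \<le> ereal (x / \<rho> + ln 4 / (\<rho> * real L))" by simp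
      hence "ereal \<rho> * cover_entropy Q g \<U> \<le> ereal \<rho> * ereal (x / \<rho> + ln 4 / (\<rho> * real L))"
        using \<rho> by (intro ereal_mult_left_mono) auto
      also have "\<dots> = ereal (x + ln 4 / real L)" using \<rho> by (simp add: distrib_left)
      finally show ?thesis by simp
    qed
    have "ereal \<rho> * cover_entropy Q g \<U> \<le> cover_entropy B F \<V> + ereal (ln 4 / real L)"
    proof -
      have "ereal \<rho> * cover_entropy Q g \<U> - ereal (ln 4 / real L) \<le> cover_entropy B F \<V>"
      proof (rule ereal_le_real)
        fix z assume "cover_entropy B F \<V> \<le> ereal z"
        show "ereal \<rho> * cover_entropy Q g \<U> - ereal (ln 4 / real L) \<le> ereal z"
        proof (rule ereal_le_epsilon2)
          fix e :: real assume "0 < e"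
          hence "cover_entropy B F \<V> < ereal (z + e)" using \<open>_ \<le> ereal z\<close>
            by (metis ereal_less(2) le_less_trans less_add_same_cancel1 less_ereal.simps(1))
          from bound[OF this] show "ereal \<rho> * cover_entropy Q g \<U> - ereal (ln 4 / real L) \<le> ereal z + ereal e"
            by (simp add: ereal_minus_le)
        qed
      qed
      thus ?thesis by (simp add: ereal_minus_le)
    qed
    also have "\<dots> \<le> top_entropy B F + ereal (ln 4 / real L)"
      unfolding top_entropy_def using \<V>c by (intro add_right_mono SUP_upper)
    finally show ?thesis .
  qed
  have "ereal \<rho> * cover_entropy Q g \<U> \<le> top_entropy B F" if \<U>: "\<U> \<in> open_covers Q" for \<U>
  proof (rule ereal_le_epsilon2)
    fix e :: real assume e: "0 < e"
    obtain L :: nat where L: "ln 4 / e < real L" using reals_Archimedean2 by blast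
    have "0 < ln 4 / e" using e by simp
    hence Lp: "L > 0" using L by (metis of_nat_0_less_iff less_trans)
    have "ln 4 / real L \<le> e" using L e Lp by (simp add: field_simps)
    thus "ereal \<rho> * cover_entropy Q g \<U> \<le> top_entropy B F + ereal e"
      using main[OF \<U> Lp] by (meson add_left_mono ereal_less_eq(3) order_trans)
  qed
  hence "cover_entropy Q g \<U> \<le> top_entropy B F / ereal \<rho>" if "\<U> \<in> open_covers Q" for \<U>
    using that \<rho> by (simp add: ereal_le_divide_pos)
  hence "top_entropy Q g \<le> top_entropy B F / ereal \<rho>"
    unfolding top_entropy_def[of Q] by (rule SUP_least)
  thus ?thesis using \<rho> by (simp add: ereal_le_divide_pos)
qed

section \<open>Smooth maps\<close>

lemma ck_on_subset: "ck_on k S f ==> T \<subseteq> S ==> ck_on k T f"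
proof (induction k arbitrary: f)
  case 0
  thus ?case using continuous_on_subset by (simp only: ck_on.simps(1)) blast
next
  case (Suc k)
  hence "ck_on k T (\<lambda>x. FD f (at x) v)" for v by (simp only: ck_on.simps(2))
  thus ?case using Suc.prems by (simp only: ck_on.simps(2)) blast
qed

lemma ck_on_SucD: "ck_on (Suc k) S f ==> ck_on k S f"
proof (induction k arbitrary: f)
  case 0
  hence "f differentiable (at x)" if "x \<in> S" for x using that by (simp only: ck_on.simps)
  hence "f differentiable_on S"
    unfolding differentiable_on_def using differentiable_at_withinI by blast
  thus ?case by (simp add: differentiable_imp_continuous_on)
next
  case (Suc k)
  note * = iffD1[OF ck_on.simps(2) Suc.prems]
  have "ck_on k S (\<lambda>x. FD f (at x) v)" for v
    by (rule Suc.IH[OF spec[OF conjunct2[OF *]]])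
  with conjunct1[OF *] show ?case unfolding ck_on.simps(2) by (intro conjI allI)
qed

lemma ck_on_has_derivative:
  "ck_on (Suc k) S f ==> x \<in> S ==> (f has_derivative FD f (at x)) (at x)"
  by (simp add: frechet_derivative_works[symmetric])

lemma ck_on_cong:
  assumes "open S" "\<And>x. x \<in> S ==> f x = g x" "ck_on k S f"
  shows "ck_on k S g"
  using assms(2,3)
proof (induction k arbitrary: f g)
  case 0
  thus ?case by (simp cong: continuous_on_cong)
next
  case (Suc k)
  have d: "(g has_derivative FD f (at x)) (at x)" if "x \<in> S" for x
    by (rule has_derivative_transform_within_open[OF ck_on_has_derivative[OF Suc.prems(2) that] assms(1) that Suc.prems(1)])
  hence eq: "FD g (at x) = FD f (at x)" if "x \<in> S" for x
    using that by (metis frechet_derivative_at)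
  have "ck_on k S (\<lambda>x. FD g (at x) v)" for v
    by (rule Suc.IH[of "\<lambda>x. FD f (at x) v"]) (use Suc.prems eq in auto)
  thus ?case using d by (auto simp: differentiable_def)
qed

lemma ck_on_SucI:
  assumes "open S" "\<And>x. x \<in> S ==> (f has_derivative f' x) (at x)" "\<And>v. ck_on k S (\<lambda>x. f' x v)"
  shows "ck_on (Suc k) S f"
proof -
  have eq: "FD f (at x) = f' x" if "x \<in> S" for x
    using assms(2)[OF that] by (metis frechet_derivative_at)
  have "ck_on k S (\<lambda>x. FD f (at x) v)" for v
    by (rule ck_on_cong[OF assms(1) _ assms(3)[of v]]) (simp add: eq)
  thus ?thesis using assms(2) by (auto simp: differentiable_def)
qed

lemma ck_on_const: "open S ==> ck_on k S (\<lambda>x. c)"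
proof (induction k arbitrary: c)
  case (Suc k)
  thus ?case by (intro ck_on_SucI[where f' = "\<lambda>x v. 0"]) auto
qed simp

lemma ck_on_linear:
  assumes "bounded_linear L" "open S"
  shows "ck_on k S L"
proof (cases k)
  case 0
  thus ?thesis using assms(1) by (simp add: linear_continuous_on)
next
  case (Suc k)
  have "ck_on (Suc k) S L" for k
    using assms by (intro ck_on_SucI[where f' = "\<lambda>x. L"] ck_on_const bounded_linear_imp_has_derivative)
  thus ?thesis using Suc by (simp only:)
qed

lemma ck_on_add:
  assumes "open S" "ck_on k S f" "ck_on k S g"
  shows "ck_on k S (\<lambda>x. f x + g x)"
  using assms(2,3)
proof (induction k arbitrary: f g)
  case (Suc k)
  thus ?case
    by (intro ck_on_SucI[where f' = "\<lambda>x v. FD f (at x) v + FD g (at x) v"]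
        assms(1) has_derivative_add ck_on_has_derivative[OF Suc.prems(1)] ck_on_has_derivative[OF Suc.prems(2)] Suc.IH)
      auto
qed (simp add: continuous_on_add)

lemma ck_on_linear_compose:
  assumes "bounded_linear L" "open S" "ck_on k S f"
  shows "ck_on k S (\<lambda>x. L (f x))"
  using assms(3)
proof (induction k arbitrary: f)
  case 0
  thus ?case using assms(1) by (auto intro: bounded_linear.continuous_on)
next
  case (Suc k)
  thus ?case
    by (intro ck_on_SucI[where f' = "\<lambda>x v. L (FD f (at x) v)"]
        assms(2) bounded_linear.has_derivative[OF assms(1)] ck_on_has_derivative[OF Suc.prems] Suc.IH) auto
qed

lemma ck_on_bilinear:
  assumes "bounded_bilinear h" "open S" "ck_on k S f" "ck_on k S g"
  shows "ck_on k S (\<lambda>x. h (f x) (g x))"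
  using assms(3,4)
proof (induction k arbitrary: f g)
  case 0
  thus ?case using assms(1) by (auto intro: bounded_bilinear.continuous_on)
next
  case (Suc k)
  show ?case
  proof (rule ck_on_SucI[OF assms(2)])
    show "((\<lambda>x. h (f x) (g x)) has_derivative
        (\<lambda>v. h (f x) (FD g (at x) v) + h (FD f (at x) v) (g x))) (at x)" if "x \<in> S" for x
      by (rule bounded_bilinear.FDERIV[OF assms(1) ck_on_has_derivative[OF Suc.prems(1) that] ck_on_has_derivative[OF Suc.prems(2) that]])
    show "ck_on k S (\<lambda>x. h (f x) (FD g (at x) v) + h (FD f (at x) v) (g x))" for v
      by (intro ck_on_add assms(2) Suc.IH ck_on_SucD[OF Suc.prems(1)] ck_on_SucD[OF Suc.prems(2)]) (use Suc.prems in auto)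
  qed
qed

lemma ck_on_sum:
  "finite I ==> open S ==> (\<And>i. i \<in> I ==> ck_on k S (f i)) ==> ck_on k S (\<lambda>x. \<Sum>i\<in>I. f i x)"
proof (induction I rule: finite_induct)
  case empty
  thus ?case by (simp add: ck_on_const)
next
  case (insert i I)
  thus ?case by (simp add: ck_on_add)
qed

lemma linear_Basis_sum:
  fixes L :: "'a::euclidean_space \<Rightarrow> 'b::real_vector"
  assumes "linear L"
  shows "L w = (\<Sum>b\<in>Basis. (w \<bullet> b) *\<^sub>R L b)"
proof -
  have "L w = L (\<Sum>b\<in>Basis. (w \<bullet> b) *\<^sub>R b)" by (simp add: euclidean_representation)
  also have "\<dots> = (\<Sum>b\<in>Basis. (w \<bullet> b) *\<^sub>R L b)"
    using assms by (simp add: linear_sum linear_scale)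
  finally show ?thesis .
qed

text \<open>In \<open>FD g (at (f x)) (FD f (at x) v)\<close> the direction varies with x, so this
  is not a composition with f. Expanding the direction in the basis gives a sum of products of
  \<open>FD f (at x) v \<bullet> b\<close> with compositions of the partial derivatives of g, to
  which the induction hypothesis applies.\<close>

lemma ck_on_compose:
  fixes f :: "'a::euclidean_space \<Rightarrow> 'b::euclidean_space"
  assumes "open S" "open T" "f ` S \<subseteq> T" "ck_on k S f" "ck_on k T g"
  shows "ck_on k S (\<lambda>x. g (f x))"
  using assms(4,5)
proof (induction k arbitrary: g)
  case 0
  thus ?case using assms(3) by (auto intro: continuous_on_compose2)
next
  case (Suc k)
  show ?case
  proof (rule ck_on_SucI[OF assms(1)])
    fix x assume x: "x \<in> S"
    have g: "(g has_derivative FD g (at (f x))) (at (f x))"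
      using ck_on_has_derivative[OF Suc.prems(2)] x assms(3) by blast
    have "((\<lambda>x. g (f x)) has_derivative (\<lambda>v. FD g (at (f x)) (FD f (at x) v))) (at x)"
      by (rule has_derivative_compose[OF ck_on_has_derivative[OF Suc.prems(1) x] g])
    thus "((\<lambda>x. g (f x)) has_derivative
        (\<lambda>v. \<Sum>b\<in>Basis. (FD f (at x) v \<bullet> b) *\<^sub>R FD g (at (f x)) b)) (at x)"
      by (simp only: linear_Basis_sum[OF has_derivative_linear[OF g], of "FD f (at x) _"])
  next
    fix v
    show "ck_on k S (\<lambda>x. \<Sum>b\<in>Basis. (FD f (at x) v \<bullet> b) *\<^sub>R FD g (at (f x)) b)"
    proof (intro ck_on_sum ck_on_bilinear[OF bounded_bilinear_scaleR] assms(1))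
      fix b :: 'b
      show "ck_on k S (\<lambda>x. FD f (at x) v \<bullet> b)"
        by (rule ck_on_linear_compose[OF bounded_linear_inner_left assms(1)]) (use Suc.prems in simp)
      show "ck_on k S (\<lambda>x. FD g (at (f x)) b)"
        by (rule Suc.IH) (use Suc.prems ck_on_SucD[OF Suc.prems(1)] in auto)
    qed simp
  qed
qed

lemma ck_on_Pair:
  assumes "open S" "ck_on k S f" "ck_on k S g"
  shows "ck_on k S (\<lambda>x. (f x, g x))"
proof -
  have "ck_on k S (\<lambda>x. (f x, 0) + (0, g x))"
    by (intro ck_on_add assms ck_on_linear_compose[of "\<lambda>y. (y, 0)"] ck_on_linear_compose[of "\<lambda>y. (0, y)"]
        bounded_linear_Pair bounded_linear_ident bounded_linear_zero)
  thus ?thesis by simp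
qed

text \<open>Real and complex functions are treated at once: the derivative is multiplication by f',
  hence linear in the direction. The inductions for \<open>inverse\<close>, \<open>exp\<close> and
  \<open>sqrt\<close> close because each derivative is built from the function itself and
  \<open>inverse\<close>.\<close>

lemma ck_on_field_SucI:
  fixes f :: "'a::{real_normed_field,euclidean_space} \<Rightarrow> 'a"
  assumes "open S" "\<And>x. x \<in> S ==> (f has_field_derivative f' x) (at x)" "ck_on k S f'"
  shows "ck_on (Suc k) S f"
proof (rule ck_on_SucI[OF assms(1)])
  show "(f has_derivative (\<lambda>v. f' x * v)) (at x)" if "x \<in> S" for x
    using assms(2)[OF that] by (simp add: has_field_derivative_def)
  show "ck_on k S (\<lambda>x. f' x * v)" for v
    by (rule ck_on_linear_compose[OF bounded_linear_mult_left assms(1,3)])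
qed

lemma ck_on_inverse: "ck_on k (- {0 :: 'a::{real_normed_field,euclidean_space}}) inverse"
proof (induction k)
  case 0 show ?case by (auto intro!: continuous_intros)
next
  case (Suc k)
  show ?case
  proof (rule ck_on_field_SucI)
    show "(inverse has_field_derivative (- 1) * (inverse x * inverse x)) (at x)" if "x \<in> - {0}" for x :: 'a
      using DERIV_inverse[of x UNIV] that by (simp add: power2_eq_square numeral_2_eq_2)
    show "ck_on k (- {0}) (\<lambda>x::'a. (- 1) * (inverse x * inverse x))"
      by (intro ck_on_bilinear[OF bounded_bilinear_mult] ck_on_const Suc) auto
  qed auto
qed

lemma ck_on_exp: "ck_on k UNIV (exp :: complex \<Rightarrow> complex)"
proof (induction k)
  case 0 show ?case by (auto intro!: continuous_intros)
next
  case (Suc k)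
  thus ?case by (intro ck_on_field_SucI[where f' = exp]) (auto intro!: derivative_eq_intros)
qed

lemma ck_on_Ln: "ck_on k (- \<real>\<^sub>\<le>\<^sub>0) Ln"
proof (cases k)
  case 0 thus ?thesis by (auto intro!: continuous_intros)
next
  case (Suc k)
  have "ck_on (Suc k) (- \<real>\<^sub>\<le>\<^sub>0) Ln"
  proof (rule ck_on_field_SucI)
    show "(Ln has_field_derivative inverse x) (at x)" if "x \<in> - \<real>\<^sub>\<le>\<^sub>0" for x
      using that by (intro has_field_derivative_Ln) auto
    show "ck_on k (- \<real>\<^sub>\<le>\<^sub>0) (inverse :: complex \<Rightarrow> complex)" by (rule ck_on_subset[OF ck_on_inverse]) auto
  qed (simp add: open_Compl)
  thus ?thesis using Suc by simp
qed

lemma ck_on_sqrt: "ck_on k {0<..} sqrt"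
proof (induction k)
  case 0 show ?case by (auto intro!: continuous_intros)
next
  case (Suc k)
  show ?case
  proof (rule ck_on_field_SucI)
    show "(sqrt has_field_derivative inverse (sqrt x) * (1/2)) (at x)" if "x \<in> {0<..}" for x
      using DERIV_real_sqrt[of x] that by simp
    show "ck_on k {0<..} (\<lambda>x. inverse (sqrt x) * (1/2))"
      by (intro ck_on_bilinear[OF bounded_bilinear_mult] ck_on_const ck_on_compose[OF _ _ _ Suc ck_on_inverse]) auto
  qed auto
qed

lemma smooth_on_ckI: "open S ==> (\<And>k. ck_on k S f) ==> smooth_on S f"
  unfolding smooth_on_def by blast

lemma smooth_onE:
  assumes "smooth_on S f" "x \<in> S"
  obtains U g where "open U" "x \<in> U" "\<And>k. ck_on k U g" "\<And>y. y \<in> S \<inter> U ==> g y = f y"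
proof -
  have "\<exists>U g. open U \<and> x \<in> U \<and> (\<forall>k. ck_on k U g) \<and> (\<forall>y\<in>S \<inter> U. g y = f y)"
    using assms unfolding smooth_on_def by (rule bspec)
  then obtain U g where *: "open U \<and> x \<in> U \<and> (\<forall>k. ck_on k U g) \<and> (\<forall>y\<in>S \<inter> U. g y = f y)"
    by (elim exE)
  show ?thesis by (rule that[of U g]) (use * in simp_all)
qed

lemma smooth_onI:
  assumes "\<And>x. x \<in> S ==> \<exists>U g. open U \<and> x \<in> U \<and> (\<forall>k. ck_on k U g) \<and> (\<forall>y\<in>S \<inter> U. g y = f y)"
  shows "smooth_on S f"
  unfolding smooth_on_def using assms by (rule ballI)

lemma smooth_on_subset:
  assumes "smooth_on S f" "T \<subseteq> S"
  shows "smooth_on T f"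
proof (rule smooth_onI)
  fix x assume "x \<in> T"
  then obtain U g where "open U" "x \<in> U" "\<And>k. ck_on k U g" "\<And>y. y \<in> S \<inter> U ==> g y = f y"
    using smooth_onE[OF assms(1), of x] assms(2) by auto
  thus "\<exists>U g. open U \<and> x \<in> U \<and> (\<forall>k. ck_on k U g) \<and> (\<forall>y\<in>T \<inter> U. g y = f y)"
    using assms(2) by (intro exI[of _ U] exI[of _ g]) auto
qed

lemma smooth_on_cong:
  assumes "smooth_on S f" "\<And>x. x \<in> S ==> f x = g x"
  shows "smooth_on S g"
proof (rule smooth_onI)
  fix x assume "x \<in> S"
  then obtain U h where "open U" "x \<in> U" "\<And>k. ck_on k U h" "\<And>y. y \<in> S \<inter> U ==> h y = f y"
    using smooth_onE[OF assms(1), of x] by auto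
  thus "\<exists>U h. open U \<and> x \<in> U \<and> (\<forall>k. ck_on k U h) \<and> (\<forall>y\<in>S \<inter> U. h y = g y)"
    using assms(2) by (intro exI[of _ U] exI[of _ h]) auto
qed

lemma smooth_on_compose:
  fixes f :: "'a::euclidean_space \<Rightarrow> 'b::euclidean_space"
  assumes "smooth_on S f" "smooth_on T g" "\<And>x. x \<in> S ==> f x \<in> T"
  shows "smooth_on S (\<lambda>x. g (f x))"
proof (rule smooth_onI)
  fix x assume x: "x \<in> S"
  obtain U f' where U: "open U" "x \<in> U" "\<And>k. ck_on k U f'" "\<And>y. y \<in> S \<inter> U ==> f' y = f y"
    using smooth_onE[OF assms(1) x] by metis
  obtain V g' where V: "open V" "f x \<in> V" "\<And>k. ck_on k V g'" "\<And>y. y \<in> T \<inter> V ==> g' y = g y"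
    using smooth_onE[OF assms(2) assms(3)[OF x]] by metis
  have "continuous_on U f'" using U(3)[of 0] by simp
  hence op: "open (U \<inter> f' -` V)" using U V by (simp add: continuous_open_preimage)
  have "ck_on k (U \<inter> f' -` V) (\<lambda>x. g' (f' x))" for k
    by (rule ck_on_compose[OF op V(1) _ _ V(3)]) (use ck_on_subset[OF U(3), of "U \<inter> f' -` V"] in auto)
  moreover have "x \<in> U \<inter> f' -` V" using U V x by auto
  moreover have "\<forall>y\<in>S \<inter> (U \<inter> f' -` V). g' (f' y) = g (f y)"
    using U(4) V(4) assms(3) by (metis Int_iff vimageD)
  ultimately show "\<exists>U h. open U \<and> x \<in> U \<and> (\<forall>k. ck_on k U h) \<and> (\<forall>y\<in>S \<inter> U. h y = g (f y))"
    using op by (intro exI[of _ "U \<inter> f' -` V"] exI[of _ "\<lambda>x. g' (f' x)"]) blast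
qed

lemma smooth_on_Pair:
  assumes "smooth_on S f" "smooth_on S g"
  shows "smooth_on S (\<lambda>x. (f x, g x))"
proof (rule smooth_onI)
  fix x assume x: "x \<in> S"
  obtain U f' where U: "open U" "x \<in> U" "\<And>k. ck_on k U f'" "\<And>y. y \<in> S \<inter> U ==> f' y = f y"
    using smooth_onE[OF assms(1) x] by metis
  obtain V g' where V: "open V" "x \<in> V" "\<And>k. ck_on k V g'" "\<And>y. y \<in> S \<inter> V ==> g' y = g y"
    using smooth_onE[OF assms(2) x] by metis
  have "ck_on k (U \<inter> V) (\<lambda>x. (f' x, g' x))" for k
    by (intro ck_on_Pair ck_on_subset[OF U(3)] ck_on_subset[OF V(3)]) (use U V in auto)
  thus "\<exists>U h. open U \<and> x \<in> U \<and> (\<forall>k. ck_on k U h) \<and> (\<forall>y\<in>S \<inter> U. h y = (f y, g y))"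
    using U V by (intro exI[of _ "U \<inter> V"] exI[of _ "\<lambda>x. (f' x, g' x)"]) auto
qed

lemma smooth_on_linear: "bounded_linear L ==> smooth_on S L"
  by (rule smooth_on_subset[OF smooth_on_ckI[OF open_UNIV ck_on_linear]]) auto

lemma smooth_on_const: "smooth_on S (\<lambda>x. c)"
  by (rule smooth_on_subset[OF smooth_on_ckI[OF open_UNIV ck_on_const]]) auto

lemma smooth_on_ident: "smooth_on S (\<lambda>x. x)"
  by (intro smooth_on_linear bounded_linear_ident)

lemma smooth_on_linear_compose:
  fixes f :: "'a::euclidean_space \<Rightarrow> 'b::euclidean_space"
  shows "bounded_linear L ==> smooth_on S f ==> smooth_on S (\<lambda>x. L (f x))"
  by (rule smooth_on_compose[OF _ smooth_on_linear[of L UNIV]]) auto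

lemma smooth_on_bilinear:
  fixes f :: "'a::euclidean_space \<Rightarrow> 'b::euclidean_space" and g :: "'a \<Rightarrow> 'c::euclidean_space"
  assumes "bounded_bilinear h" "smooth_on S f" "smooth_on S g"
  shows "smooth_on S (\<lambda>x. h (f x) (g x))"
proof -
  have "smooth_on UNIV (\<lambda>z :: 'b \<times> 'c. h (fst z) (snd z))"
    by (intro smooth_on_ckI ck_on_bilinear[OF assms(1)] ck_on_linear bounded_linear_fst bounded_linear_snd) auto
  from smooth_on_compose[OF smooth_on_Pair[OF assms(2,3)] this] show ?thesis by simp
qed

lemma smooth_on_add:
  fixes f g :: "'a::euclidean_space \<Rightarrow> 'b::euclidean_space"
  assumes "smooth_on S f" "smooth_on S g"
  shows "smooth_on S (\<lambda>x. f x + g x)"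
proof -
  have "smooth_on UNIV (\<lambda>z :: 'b \<times> 'b. fst z + snd z)"
    by (intro smooth_on_linear bounded_linear_add bounded_linear_fst bounded_linear_snd)
  from smooth_on_compose[OF smooth_on_Pair[OF assms] this] show ?thesis by simp
qed

lemma smooth_on_diff:
  fixes f g :: "'a::euclidean_space \<Rightarrow> 'b::euclidean_space"
  assumes "smooth_on S f" "smooth_on S g"
  shows "smooth_on S (\<lambda>x. f x - g x)"
proof -
  have "smooth_on S (\<lambda>x. - g x)"
    by (intro smooth_on_linear_compose[OF _ assms(2)] bounded_linear_minus bounded_linear_ident)
  from smooth_on_add[OF assms(1) this] show ?thesis by simp
qed

lemma smooth_on_sqrt: "smooth_on S f ==> (\<And>x. x \<in> S ==> f x > 0) ==> smooth_on S (\<lambda>x. sqrt (f x))"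
  using smooth_on_compose[OF _ smooth_on_ckI[OF open_greaterThan ck_on_sqrt], of S f] by simp

lemma smooth_on_inverse:
  fixes f :: "'b::euclidean_space \<Rightarrow> 'a::{real_normed_field,euclidean_space}"
  shows "smooth_on S f ==> (\<And>x. x \<in> S ==> f x \<noteq> 0) ==> smooth_on S (\<lambda>x. inverse (f x))"
  using smooth_on_compose[OF _ smooth_on_ckI[OF _ ck_on_inverse], of S f] by (simp add: open_Compl)

lemma smooth_on_Ln: "smooth_on S f ==> (\<And>x. x \<in> S ==> f x \<notin> \<real>\<^sub>\<le>\<^sub>0) ==> smooth_on S (\<lambda>x. Ln (f x))"
  using smooth_on_compose[OF _ smooth_on_ckI[OF _ ck_on_Ln], of S f] by (simp add: open_Compl)

lemma smooth_on_cis: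
  assumes "smooth_on S f"
  shows "smooth_on S (\<lambda>x. cis (f x))"
proof -
  have "smooth_on S (\<lambda>x. \<i> * complex_of_real (f x))"
    by (intro smooth_on_linear_compose[OF _ assms] bounded_linear_compose[OF bounded_linear_mult_right] bounded_linear_of_real)
  hence "smooth_on S (\<lambda>x. exp (\<i> * complex_of_real (f x)))"
    by (rule smooth_on_compose[OF _ smooth_on_ckI[OF open_UNIV ck_on_exp]]) auto
  thus ?thesis by (simp add: cis_conv_exp)
qed

lemma smooth_on_continuous_on: "smooth_on S f ==> continuous_on S f"
  unfolding continuous_on_eq_continuous_within
proof
  fix x assume f: "smooth_on S f" and x: "x \<in> S"
  then obtain U g where U: "open U" "x \<in> U" "\<And>k. ck_on k U g" "\<And>y. y \<in> S \<inter> U ==> g y = f y"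
    using smooth_onE[of S f x] by metis
  have "continuous_on U g" using U(3)[of 0] by simp
  hence "continuous (at x within S) g" using U by (meson continuous_at_imp_continuous_at_within continuous_on_eq_continuous_at)
  moreover have "\<forall>\<^sub>F y in at x within S. g y = f y"
    unfolding eventually_at_topological using U(1,2,4) by (intro exI[of _ U]) simp
  moreover have "g x = f x" using U x by simp
  ultimately show "continuous (at x within S) f"
    unfolding continuous_within by (simp only:) (rule Lim_transform_eventually)
qed

section \<open>Derivatives on sets with enough directions\<close>

text \<open>The relevant domains are relatively open subsets of half spaces and their products with open
  sets. They are not all modelled on one half space, so we only record what makes derivatives
  unique.\<close>

definition fat :: "'a::euclidean_space set \<Rightarrow> bool" where
  "fat S \<longleftrightarrow> (\<forall>x\<in>S. \<forall>i\<in>Basis. \<forall>e>0. \<exists>d. 0 < \<bar>d\<bar> \<and> \<bar>d\<bar> < e \<and> x + d *\<^sub>R i \<in> S)"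

lemma fat_derivative_unique:
  assumes "fat S" "x \<in> S" "(f has_derivative f') (at x within S)" "(f has_derivative f'') (at x within S)"
  shows "f' = f''"
  using assms(1,2) by (intro frechet_derivative_unique_within[OF assms(3,4)]) (auto simp: fat_def)

lemma fat_frechet_derivative:
  assumes "fat S" "x \<in> S" "(f has_derivative f') (at x within S)"
  shows "FD f (at x within S) = f'"
  using fat_derivative_unique[OF assms] assms(3) frechet_derivative_works differentiable_def by metis

lemma fat_Int_open:
  assumes "fat S" "open U"
  shows "fat (S \<inter> U)"
  unfolding fat_def
proof (intro ballI allI impI)
  fix x i and e :: real assume x: "x \<in> S \<inter> U" and i: "i \<in> (Basis :: 'a set)" and e: "0 < e"
  obtain h where h: "h > 0" "ball x h \<subseteq> U" using assms(2) x open_contains_ball by blast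
  then obtain d where d: "0 < \<bar>d\<bar>" "\<bar>d\<bar> < min e h" "x + d *\<^sub>R i \<in> S"
    using assms(1) x i e unfolding fat_def by (metis IntD1 min_less_iff_conj)
  have "x + d *\<^sub>R i \<in> ball x h" using d i by (simp add: dist_norm)
  thus "\<exists>d. 0 < \<bar>d\<bar> \<and> \<bar>d\<bar> < e \<and> x + d *\<^sub>R i \<in> S \<inter> U" using d h by auto
qed

lemma conormal_Basis: "conormal \<in> Basis"
  unfolding conormal_def by (metis SOME_Basis)

lemma fat_half_space: "fat (half_space :: 'a::euclidean_space set)"
  unfolding fat_def
proof (intro ballI allI impI)
  fix x :: 'a and i and e :: real assume "x \<in> half_space" "i \<in> (Basis :: 'a set)" "0 < e"
  thus "\<exists>d. 0 < \<bar>d\<bar> \<and> \<bar>d\<bar> < e \<and> x + d *\<^sub>R i \<in> half_space"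
    \<comment> \<open>A positive step stays in the half space, since every basis vector has
      nonnegative product with \<open>conormal\<close>.\<close>
    by (intro exI[of _ "e/2"]) (auto simp: half_space_def inner_simps inner_Basis conormal_Basis)
qed

lemma fat_openin_half_space: "openin (top_of_set half_space) S ==> fat S"
  unfolding openin_open using fat_Int_open[OF fat_half_space] by auto

lemma fat_UNIV: "fat UNIV"
  unfolding fat_def
proof (intro ballI allI impI)
  fix x i :: 'a and e :: real assume "0 < e"
  thus "\<exists>d. 0 < \<bar>d\<bar> \<and> \<bar>d\<bar> < e \<and> x + d *\<^sub>R i \<in> UNIV"
    by (intro exI[of _ "e/2"]) auto
qed

lemma fat_Times:
  assumes "fat S" "fat T"
  shows "fat (S \<times> T)"
  unfolding fat_def
proof (intro ballI allI impI)
  fix x :: "'a \<times> 'b" and i and e :: real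
  assume x: "x \<in> S \<times> T" and i: "i \<in> (Basis :: ('a \<times> 'b) set)" and e: "0 < e"
  consider b where "b \<in> Basis" "i = (b, 0)" | b where "b \<in> Basis" "i = (0, b)"
    using i unfolding Basis_prod_def by auto
  thus "\<exists>d. 0 < \<bar>d\<bar> \<and> \<bar>d\<bar> < e \<and> x + d *\<^sub>R i \<in> S \<times> T"
  proof cases
    case 1
    then obtain d where "0 < \<bar>d\<bar>" "\<bar>d\<bar> < e" "fst x + d *\<^sub>R b \<in> S" using assms(1) x e unfolding fat_def by (metis mem_Times_iff)
    thus ?thesis using 1 x by (intro exI[of _ d]) (auto simp: mem_Times_iff)
  next
    case 2
    then obtain d where "0 < \<bar>d\<bar>" "\<bar>d\<bar> < e" "snd x + d *\<^sub>R b \<in> T" using assms(2) x e unfolding fat_def by (metis mem_Times_iff)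
    thus ?thesis using 2 x by (intro exI[of _ d]) (auto simp: mem_Times_iff)
  qed
qed

lemma at_within_Int_nhd: "open U ==> x \<in> U ==> at x within (S \<inter> U) = at x within S"
  by (rule at_within_nhd[where S = U]) auto

lemma has_derivative_local:
  assumes "(f has_derivative f') (at x within S)" "open U" "x \<in> U" "x \<in> S" "\<And>y. y \<in> S \<inter> U ==> g y = f y"
  shows "(g has_derivative f') (at x within S)"
proof -
  have "(f has_derivative f') (at x within (S \<inter> U))" using assms by (simp add: at_within_Int_nhd)
  hence "(g has_derivative f') (at x within (S \<inter> U))"
    by (rule has_derivative_transform[rotated 2]) (use assms in auto)
  thus ?thesis using assms by (simp add: at_within_Int_nhd)
qed

text \<open>On a \<open>fat\<close> set derivatives within the set are unique, so near x they
  coincide with the full derivatives of a local smooth extension. In this way the within-derivatives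
  that occur in \<open>ext_deriv\<close> and \<open>ham_vf\<close> inherit the regularity of maps on
  open sets.\<close>

lemma smooth_on_extension:
  assumes "fat S" "smooth_on S f" "x \<in> S"
  obtains U g where "open U" "x \<in> U" "\<forall>k. ck_on k U g" "\<forall>y\<in>S \<inter> U. g y = f y"
    "\<forall>y\<in>S \<inter> U. FD f (at y within S) = FD g (at y)"
    "\<forall>y\<in>S \<inter> U. (f has_derivative FD g (at y)) (at y within S)"
proof -
  obtain U g where U: "open U" "x \<in> U" "\<And>k. ck_on k U g" "\<And>y. y \<in> S \<inter> U ==> g y = f y"
    using smooth_onE[OF assms(2,3)] by metis
  have ck: "ck_on (Suc 0) U g" by (rule U(3))
  have d: "(f has_derivative FD g (at y)) (at y within S)" if y: "y \<in> S" "y \<in> U" for y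
  proof (rule has_derivative_local)
    show "(g has_derivative FD g (at y)) (at y within S)"
      by (rule has_derivative_at_withinI[OF ck_on_has_derivative[OF ck y(2)]])
    show "open U" "y \<in> U" "y \<in> S" by (fact U(1) y)+
    show "f z = g z" if "z \<in> S \<inter> U" for z using U(4)[OF that] by (rule sym)
  qed
  have "FD f (at y within S) = FD g (at y)" if "y \<in> S" "y \<in> U" for y
    by (rule fat_frechet_derivative[OF assms(1) that(1) d[OF that]])
  with that U d show ?thesis by (metis IntD1 IntD2)
qed

lemma smooth_on_has_derivative:
  assumes "fat S" "smooth_on S f" "x \<in> S"
  shows "(f has_derivative FD f (at x within S)) (at x within S)"
proof -
  obtain U g where "x \<in> U" and d: "\<forall>y\<in>S \<inter> U. FD f (at y within S) = FD g (at y)"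
    "\<forall>y\<in>S \<inter> U. (f has_derivative FD g (at y)) (at y within S)"
    by (rule smooth_on_extension[OF assms])
  hence "x \<in> S \<inter> U" using assms(3) by simp
  thus ?thesis using d by simp
qed

lemma has_real_derivative_along_line:
  fixes f :: "'a::real_normed_vector \<Rightarrow> real"
  assumes "(f has_derivative f') (at (p + s *\<^sub>R u))"
  shows "((\<lambda>s. f (p + s *\<^sub>R u)) has_real_derivative f' u) (at s)"
proof -
  have "((\<lambda>s. p + s *\<^sub>R u) has_derivative (\<lambda>h. h *\<^sub>R u)) (at s)" by (auto intro!: derivative_eq_intros)
  from has_derivative_compose[OF this assms]
  have "((\<lambda>s. f (p + s *\<^sub>R u)) has_derivative (\<lambda>h. f' (h *\<^sub>R u))) (at s)" .
  moreover have "f' (h *\<^sub>R u) = f' u * h" for h using has_derivative_linear[OF assms] by (simp add: linear_cmul mult.commute)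
  ultimately show ?thesis by (simp add: has_field_derivative_def)
qed

text \<open>The left side is symmetric in u and v. The mean value theorem is applied to the
  difference in direction v as it is moved along u, and once more to the resulting derivative along
  v; this yields a mixed derivative at a nearby point.\<close>

lemma second_difference:
  fixes f :: "'a::euclidean_space \<Rightarrow> real"
  assumes ck: "ck_on 2 (ball x d) f" and h: "0 < h" "h * (norm u + norm v) < d"
  obtains y where "y \<in> ball x d"
    "f (x + h *\<^sub>R u + h *\<^sub>R v) - f (x + h *\<^sub>R u) - f (x + h *\<^sub>R v) + f x
      = h * h * FD (\<lambda>y. FD f (at y) u) (at y) v"
proof -
  have inb: "x + s *\<^sub>R u + t *\<^sub>R v \<in> ball x d" if "0 \<le> s" "s \<le> h" "0 \<le> t" "t \<le> h" for s t
  proof -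
    have "norm (s *\<^sub>R u + t *\<^sub>R v) \<le> s * norm u + t * norm v" using that by (metis abs_of_nonneg norm_scaleR norm_triangle_ineq)
    also have "\<dots> \<le> h * norm u + h * norm v" using that by (intro add_mono mult_right_mono) auto
    finally have "norm (s *\<^sub>R u + t *\<^sub>R v) < d" using h(2) by (simp add: distrib_left)
    moreover have "dist x (x + s *\<^sub>R u + t *\<^sub>R v) = norm (s *\<^sub>R u + t *\<^sub>R v)"
      unfolding dist_norm by (subst norm_minus_commute) (simp add: algebra_simps)
    ultimately show ?thesis by simp
  qed
  have ck1: "ck_on (Suc 1) (ball x d) f" using ck by (simp add: numeral_2_eq_2)
  have fd: "(f has_derivative FD f (at y)) (at y)" if "y \<in> ball x d" for y
    using ck_on_has_derivative[OF ck1 that] .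
  have ck2: "ck_on (Suc 0) (ball x d) (\<lambda>y. FD f (at y) u)" using ck1 by simp
  have fdd: "((\<lambda>y. FD f (at y) u) has_derivative FD (\<lambda>y. FD f (at y) u) (at y)) (at y)" if "y \<in> ball x d" for y
    using ck_on_has_derivative[OF ck2 that] .
  have d1: "((\<lambda>s. f (x + s *\<^sub>R u + t *\<^sub>R v)) has_real_derivative FD f (at (x + s *\<^sub>R u + t *\<^sub>R v)) u) (at s)"
    if "0 \<le> s" "s \<le> h" "0 \<le> t" "t \<le> h" for s t
    using has_real_derivative_along_line[of f _ "x + t *\<^sub>R v" s u] fd[OF inb[OF that]]
    by (simp add: add.assoc add.commute[of "t *\<^sub>R v"])
  have "\<exists>g>0. g < h \<and> (f (x + h *\<^sub>R u + h *\<^sub>R v) - f (x + h *\<^sub>R u + 0 *\<^sub>R v)) - (f (x + 0 *\<^sub>R u + h *\<^sub>R v) - f (x + 0 *\<^sub>R u + 0 *\<^sub>R v))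
      = (h - 0) * (FD f (at (x + g *\<^sub>R u + h *\<^sub>R v)) u - FD f (at (x + g *\<^sub>R u + 0 *\<^sub>R v)) u)"
    by (rule MVT2[OF h(1)]) (intro DERIV_diff d1; use h in auto)
  then obtain g where g: "0 < g" "g < h" "(f (x + h *\<^sub>R u + h *\<^sub>R v) - f (x + h *\<^sub>R u + 0 *\<^sub>R v)) - (f (x + 0 *\<^sub>R u + h *\<^sub>R v) - f (x + 0 *\<^sub>R u + 0 *\<^sub>R v))
      = (h - 0) * (FD f (at (x + g *\<^sub>R u + h *\<^sub>R v)) u - FD f (at (x + g *\<^sub>R u + 0 *\<^sub>R v)) u)"
    by blast
  have "\<exists>t>0. t < h \<and> FD f (at (x + g *\<^sub>R u + h *\<^sub>R v)) u - FD f (at (x + g *\<^sub>R u + 0 *\<^sub>R v)) u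
      = (h - 0) * FD (\<lambda>y. FD f (at y) u) (at (x + g *\<^sub>R u + t *\<^sub>R v)) v"
    by (rule MVT2[OF h(1)]) (intro has_real_derivative_along_line fdd inb; use h g in auto)
  then obtain t where t: "0 < t" "t < h" "FD f (at (x + g *\<^sub>R u + h *\<^sub>R v)) u - FD f (at (x + g *\<^sub>R u + 0 *\<^sub>R v)) u
      = (h - 0) * FD (\<lambda>y. FD f (at y) u) (at (x + g *\<^sub>R u + t *\<^sub>R v)) v" by blast
  show ?thesis
    by (rule that[of "x + g *\<^sub>R u + t *\<^sub>R v"]) (use inb[of g t] g t in \<open>auto simp: algebra_simps\<close>)
qed

text \<open>Both mixed derivatives equal the same second difference divided by \<open>h * h\<close>,
  at points of a ball on which each of them varies by less than half their supposed gap.\<close>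

lemma symmetric_second_derivative_real:
  fixes f :: "'a::euclidean_space \<Rightarrow> real"
  assumes U: "open U" "x \<in> U" and ck: "ck_on 2 U f"
  shows "FD (\<lambda>y. FD f (at y) u) (at x) v = FD (\<lambda>y. FD f (at y) v) (at x) u"
proof (rule ccontr)
  let ?a = "\<lambda>u v y. FD (\<lambda>y. FD f (at y) u) (at y) v"
  assume "\<not> ?thesis"
  hence e: "\<bar>?a u v x - ?a v u x\<bar> / 2 > 0" (is "?e > 0") by simp
  have cont: "continuous_on U (?a u v)" for u v using ck by (simp add: numeral_2_eq_2)
  obtain d1 where d1: "d1 > 0" "\<And>y. y \<in> U ==> dist y x < d1 ==> dist (?a u v y) (?a u v x) < ?e"
    using cont[of u v] U(2) e unfolding continuous_on_iff by blast
  obtain d2 where d2: "d2 > 0" "\<And>y. y \<in> U ==> dist y x < d2 ==> dist (?a v u y) (?a v u x) < ?e"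
    using cont[of v u] U(2) e unfolding continuous_on_iff by blast
  obtain d3 where d3: "d3 > 0" "ball x d3 \<subseteq> U" using U open_contains_ball by blast
  define d where "d = min d1 (min d2 d3)"
  have d: "d > 0" "ball x d \<subseteq> U" using d1 d2 d3 by (auto simp: d_def)
  have ckb: "ck_on 2 (ball x d) f" by (rule ck_on_subset[OF ck d(2)])
  \<comment> \<open>The summand 1 keeps the denominator positive when u and v both vanish.\<close>
  define h where "h = d / (2 * (norm u + norm v + 1))"
  have np: "norm u + norm v + 1 > 0" using norm_ge_zero[of u] norm_ge_zero[of v] by linarith
  have h: "0 < h" "h * (norm u + norm v) < d"
  proof -
    show "0 < h" unfolding h_def using d np by simp
    have "h * (norm u + norm v) \<le> h * (norm u + norm v + 1)" using \<open>0 < h\<close> by simp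
    also have "\<dots> = d / 2" unfolding h_def using np by (simp add: field_simps)
    finally show "h * (norm u + norm v) < d" using d by simp
  qed
  obtain y where y: "y \<in> ball x d" "f (x + h *\<^sub>R u + h *\<^sub>R v) - f (x + h *\<^sub>R u) - f (x + h *\<^sub>R v) + f x = h * h * ?a u v y"
    using second_difference[OF ckb h] by blast
  have h': "h * (norm v + norm u) < d" using h by (simp add: add.commute)
  obtain z where z: "z \<in> ball x d" "f (x + h *\<^sub>R v + h *\<^sub>R u) - f (x + h *\<^sub>R v) - f (x + h *\<^sub>R u) + f x = h * h * ?a v u z"
    using second_difference[OF ckb h(1) h'] by blast
  have "h * h * ?a u v y = h * h * ?a v u z"
    using y(2)[symmetric] z(2)[symmetric] by (simp only: add.assoc add.commute[of "h *\<^sub>R v"])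
  hence eq: "?a u v y = ?a v u z" using h(1) by simp
  have "dist (?a u v y) (?a u v x) < ?e" using y(1) d by (intro d1(2)) (auto simp: d_def dist_commute)
  moreover have "dist (?a v u z) (?a v u x) < ?e" using z(1) d by (intro d2(2)) (auto simp: d_def dist_commute)
  ultimately have "dist (?a u v y) (?a u v x) < ?e" "dist (?a u v y) (?a v u x) < ?e" using eq by simp_all
  hence "dist (?a u v x) (?a v u x) < ?e + ?e"
    by (rule le_less_trans[OF dist_triangle3 add_strict_mono])
  thus False by (simp add: dist_real_def)
qed

lemma symmetric_second_derivative:
  fixes f :: "'a::euclidean_space \<Rightarrow> 'b::euclidean_space"
  assumes U: "open U" "x \<in> U" and ck: "ck_on 2 U f"
  shows "FD (\<lambda>y. FD f (at y) u) (at x) v = FD (\<lambda>y. FD f (at y) v) (at x) u"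
proof (rule euclidean_eqI)
  fix b :: 'b assume b: "b \<in> Basis"
  have ck1: "ck_on (Suc 1) U f" using ck by (simp add: numeral_2_eq_2)
  have fb: "FD (\<lambda>y. f y \<bullet> b) (at y) = (\<lambda>w. FD f (at y) w \<bullet> b)" if "y \<in> U" for y
    by (rule frechet_derivative_at[symmetric], rule bounded_linear.has_derivative[OF bounded_linear_inner_left])
      (rule ck_on_has_derivative[OF ck1 that])
  have dd: "FD (\<lambda>y. FD (\<lambda>y. f y \<bullet> b) (at y) u) (at x) v
      = FD (\<lambda>y. FD f (at y) u) (at x) v \<bullet> b" for u v
  proof -
    have "ck_on (Suc 0) U (\<lambda>y. FD f (at y) u)" using ck1 by simp
    from bounded_linear.has_derivative[OF bounded_linear_inner_left ck_on_has_derivative[OF this U(2)], of b]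
    have "((\<lambda>y. FD (\<lambda>y. f y \<bullet> b) (at y) u) has_derivative
      (\<lambda>v. FD (\<lambda>y. FD f (at y) u) (at x) v \<bullet> b)) (at x)"
      by (rule has_derivative_transform_within_open[OF _ U]) (simp add: fb)
    thus ?thesis by (metis frechet_derivative_at)
  qed
  have "ck_on 2 U (\<lambda>y. f y \<bullet> b)" by (rule ck_on_linear_compose[OF bounded_linear_inner_left U(1) ck])
  from symmetric_second_derivative_real[OF U this, of u v] show
    "FD (\<lambda>y. FD f (at y) u) (at x) v \<bullet> b = FD (\<lambda>y. FD f (at y) v) (at x) u \<bullet> b"
    by (simp add: dd)
qed

text \<open>The second derivatives of \<open>e\<close> cancel by symmetry.\<close>

lemma exterior_derivative_pullback:
  fixes e :: "'f::euclidean_space \<Rightarrow> 'e::euclidean_space" and a :: "'e \<Rightarrow> 'e \<Rightarrow> real" and h :: "'f \<Rightarrow> 'f \<Rightarrow> real"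
  assumes T: "fat T" and S: "fat S" and e: "smooth_on T e" "\<And>y. y \<in> T ==> e y \<in> S"
    and a: "\<And>v. smooth_on S (\<lambda>y. a y v)" "\<And>y. y \<in> S ==> linear (a y)"
    and h: "\<And>y v. y \<in> T ==> h y v = a (e y) (FD e (at y within T) v)"
    and x: "x \<in> T" and E: "E = FD e (at x within T)"
  shows "FD (\<lambda>y. h y v) (at x within T) u - FD (\<lambda>y. h y u) (at x within T) v
    = FD (\<lambda>y. a y (E v)) (at (e x) within S) (E u) - FD (\<lambda>y. a y (E u)) (at (e x) within S) (E v)"
proof -
  obtain U g where U: "open U" "x \<in> U" "\<forall>k. ck_on k U g" "\<forall>y\<in>T \<inter> U. g y = e y"
    "\<forall>y\<in>T \<inter> U. FD e (at y within T) = FD g (at y)"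
    by (rule smooth_on_extension[OF T e(1) x])
  have Eg: "E = FD g (at x)" using U x E by auto
  define A where "A = (\<lambda>b. FD (\<lambda>y. a y b) (at (e x) within S))"
  have A: "((\<lambda>y. a y b) has_derivative A b) (at (e x) within S)" for b
    unfolding A_def by (rule smooth_on_has_derivative[OF S a(1) e(2)[OF x]])
  have Ab: "((\<lambda>y. a (e y) b) has_derivative (\<lambda>w. A b (E w))) (at x within T)" for b
  proof -
    have "((\<lambda>y. a y b) has_derivative A b) (at (e x) within e ` T)"
      by (rule has_derivative_subset[OF A]) (use e(2) in auto)
    from has_derivative_in_compose[OF _ this] smooth_on_has_derivative[OF T e(1) x]
    show ?thesis unfolding E by blast
  qed
  have rep: "a y w = (\<Sum>b\<in>Basis. (w \<bullet> b) * a y b)" if "y \<in> S" for y w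
    using linear_Basis_sum[OF a(2)[OF that], of w] by simp
  define G where "G = (\<lambda>v u. FD (\<lambda>y. FD g (at y) v) (at x) u)"
  have G: "((\<lambda>y. FD g (at y) v) has_derivative G v) (at x within T)" for v
  proof -
    have "ck_on (Suc 0) U (\<lambda>y. FD g (at y) v)" using U(3)[rule_format, of "Suc (Suc 0)"] by simp
    from ck_on_has_derivative[OF this U(2)] show ?thesis unfolding G_def by (rule has_derivative_at_withinI)
  qed
  have lhs: "FD (\<lambda>y. h y v) (at x within T) u
      = (\<Sum>b\<in>Basis. (E v \<bullet> b) * A b (E u) + (G v u \<bullet> b) * a (e x) b)" for u v
  proof -
    have "((\<lambda>y. \<Sum>b\<in>Basis. (FD g (at y) v \<bullet> b) * a (e y) b) has_derivative
      (\<lambda>u. \<Sum>b\<in>Basis. (FD g (at x) v \<bullet> b) * A b (E u) + (G v u \<bullet> b) * a (e x) b)) (at x within T)"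
      by (intro has_derivative_sum has_derivative_mult Ab bounded_linear.has_derivative[OF bounded_linear_inner_left G])
    hence "((\<lambda>y. h y v) has_derivative
      (\<lambda>u. \<Sum>b\<in>Basis. (FD g (at x) v \<bullet> b) * A b (E u) + (G v u \<bullet> b) * a (e x) b)) (at x within T)"
    proof (rule has_derivative_local[OF _ U(1,2) x])
      fix y assume y: "y \<in> T \<inter> U"
      hence "h y v = a (e y) (FD g (at y) v)" using h U(5) by auto
      thus "h y v = (\<Sum>b\<in>Basis. (FD g (at y) v \<bullet> b) * a (e y) b)" using rep e(2) y by auto
    qed
    from fat_frechet_derivative[OF T x this] show ?thesis by (simp add: Eg)
  qed
  have rhs: "FD (\<lambda>y. a y w) (at (e x) within S) u = (\<Sum>b\<in>Basis. (w \<bullet> b) * A b u)" for u w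
  proof -
    have "((\<lambda>y. \<Sum>b\<in>Basis. (w \<bullet> b) * a y b) has_derivative (\<lambda>u. \<Sum>b\<in>Basis. (w \<bullet> b) * A b u)) (at (e x) within S)"
      by (intro has_derivative_sum has_derivative_mult_right A)
    hence "((\<lambda>y. a y w) has_derivative (\<lambda>u. \<Sum>b\<in>Basis. (w \<bullet> b) * A b u)) (at (e x) within S)"
      by (rule has_derivative_transform[rotated 2]) (use e(2)[OF x] rep in auto)
    from fat_frechet_derivative[OF S e(2)[OF x] this] show ?thesis by simp
  qed
  have sym: "G v u = G u v" unfolding G_def by (rule symmetric_second_derivative[OF U(1,2) spec[OF U(3)]])
  show ?thesis unfolding lhs rhs by (simp add: sum.distrib sym)
qed

section \<open>Flows on compact manifolds with boundary\<close>

text \<open>The weighted square exp (-2 L (s - a)) |q|^2 has nonpositive derivative by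
  Cauchy-Schwarz; squaring keeps it differentiable where q vanishes.\<close>

lemma gronwall:
  fixes q :: "real \<Rightarrow> 'e::euclidean_space"
  assumes d: "\<And>s. s \<in> {a..b} ==> (q has_vector_derivative q' s) (at s within {a..b})"
    and le: "\<And>s. s \<in> {a..b} ==> norm (q' s) \<le> L * norm (q s)"
    and t: "t \<in> {a..b}"
  shows "norm (q t) \<le> exp (L * (t - a)) * norm (q a)"
proof (cases "t = a")
  case False
  hence at: "a < t" using t by simp
  define f where "f = (\<lambda>s. exp (- (2 * L * (s - a))) * (q s \<bullet> q s))"
  define f' where "f' = (\<lambda>s. exp (- (2 * L * (s - a))) * (2 * (q s \<bullet> q' s) - 2 * L * (q s \<bullet> q s)))"
  have "(f has_derivative (\<lambda>h. h * f' s)) (at s within {a..t})" if s: "s \<in> {a..t}" for s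
  proof -
    have "(q has_vector_derivative q' s) (at s within {a..t})"
      by (rule has_vector_derivative_within_subset[OF d]) (use s t in auto)
    hence "(q has_derivative (\<lambda>h. h *\<^sub>R q' s)) (at s within {a..t})" by (simp add: has_vector_derivative_def)
    note [derivative_intros] = this
    show ?thesis unfolding f_def f'_def
      by (auto intro!: derivative_eq_intros simp: algebra_simps inner_commute)
  qed
  hence "\<exists>s\<in>{a<..<t}. f t - f a = (t - a) * f' s"
    using mvt_simple[OF at, of f "\<lambda>s h. h * f' s"] by auto
  then obtain s where s: "s \<in> {a<..<t}" "f t - f a = (t - a) * f' s" by blast
  have "q s \<bullet> q' s \<le> norm (q s) * norm (q' s)" by (rule norm_cauchy_schwarz)
  also have "\<dots> \<le> norm (q s) * (L * norm (q s))" using le s t by (intro mult_left_mono) auto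
  also have "\<dots> = L * (q s \<bullet> q s)" by (simp add: power2_norm_eq_inner[symmetric] power2_eq_square)
  finally have "f' s \<le> 0" unfolding f'_def by (simp add: mult_nonneg_nonpos)
  hence "f t \<le> f a" using s at by (smt (verit) mult_nonneg_nonpos)
  hence "exp (- (2 * L * (t - a))) * (norm (q t))\<^sup>2 \<le> (norm (q a))\<^sup>2"
    by (simp add: f_def power2_norm_eq_inner)
  hence "exp (2 * L * (t - a)) * (exp (- (2 * L * (t - a))) * (norm (q t))\<^sup>2) \<le> exp (2 * L * (t - a)) * (norm (q a))\<^sup>2"
    by (intro mult_left_mono) auto
  moreover have "exp (2 * L * (t - a)) * exp (- (2 * L * (t - a))) = 1" by (simp add: exp_minus)
  ultimately have "(norm (q t))\<^sup>2 \<le> exp (2 * L * (t - a)) * (norm (q a))\<^sup>2" by (simp add: mult.assoc[symmetric])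
  also have "\<dots> = (exp (L * (t - a)) * norm (q a))\<^sup>2" by (simp add: power_mult_distrib exp_double[symmetric] mult.assoc)
  finally show ?thesis by (rule power2_le_imp_le) simp
qed simp

text \<open>A zero propagates both ways: forward by \<open>gronwall\<close> on [s,b], backward by
  the same estimate for the curve run in reverse.\<close>

lemma gronwall_zero:
  fixes h :: "real \<Rightarrow> 'e::euclidean_space"
  assumes d: "\<And>s. s \<in> {a..b} ==> (h has_vector_derivative h' s) (at s within {a..b})"
    and le: "\<And>s. s \<in> {a..b} ==> norm (h' s) \<le> L * norm (h s)"
    and s: "s \<in> {a..b}" "h s = 0" and t: "t \<in> {a..b}"
  shows "h t = 0"
proof (cases "s \<le> t")
  case True
  have "norm (h t) \<le> exp (L * (t - s)) * norm (h s)"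
  proof (rule gronwall[of s b])
    show "(h has_vector_derivative h' u) (at u within {s..b})" if "u \<in> {s..b}" for u
      by (rule has_vector_derivative_within_subset[OF d]) (use that s in auto)
  qed (use s t True le in auto)
  thus ?thesis using s by simp
next
  case False
  have "norm ((\<lambda>u. h (- u)) (- t)) \<le> exp (L * (- t - (- s))) * norm ((\<lambda>u. h (- u)) (- s))"
  proof (rule gronwall[of "- s" "- a" _ "\<lambda>u. - h' (- u)"])
    show "((\<lambda>u. h (- u)) has_vector_derivative - h' (- u)) (at u within {- s..- a})" if u: "u \<in> {- s..- a}" for u
    proof -
      have "(h has_vector_derivative h' (- u)) (at (- u) within uminus ` {- s..- a})"
        by (rule has_vector_derivative_within_subset[OF d]) (use u s in auto)
      moreover have "(uminus has_vector_derivative - 1) (at u within {- s..- a})"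
        by (auto intro!: derivative_eq_intros simp: has_vector_derivative_def)
      ultimately have "(h \<circ> uminus has_vector_derivative (- 1) *\<^sub>R h' (- u)) (at u within {- s..- a})"
        by (intro vector_diff_chain_within)
      thus ?thesis by (simp add: o_def)
    qed
  qed (use s t False le in auto)
  thus ?thesis using s by simp
qed

lemma vector_derivative_bound:
  fixes f :: "real \<Rightarrow> 'e::real_normed_vector"
  assumes d: "\<And>s. s \<in> {a..b} ==> (f has_vector_derivative f' s) (at s within {a..b})"
    and le: "\<And>s. s \<in> {a..b} ==> norm (f' s) \<le> B" and st: "s \<in> {a..b}" "t \<in> {a..b}"
  shows "norm (f t - f s) \<le> B * \<bar>t - s\<bar>"
proof -
  have "norm (f t - f s) \<le> B * norm (t - s)"
  proof (rule differentiable_bound[of "{a..b}" f "\<lambda>s h. h *\<^sub>R f' s"])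
    show "(f has_derivative (\<lambda>h. h *\<^sub>R f' u)) (at u within {a..b})" if "u \<in> {a..b}" for u
      using d[OF that] by (simp add: has_vector_derivative_def)
    show "onorm (\<lambda>h. h *\<^sub>R f' u) \<le> B" if u: "u \<in> {a..b}" for u
    proof (rule onorm_le)
      fix h :: real
      have "\<bar>h\<bar> * norm (f' u) \<le> \<bar>h\<bar> * B" using le[OF u] by (rule mult_left_mono) simp
      thus "norm (h *\<^sub>R f' u) \<le> B * norm h" by (simp add: mult.commute)
    qed
  qed (use st in auto)
  thus ?thesis by simp
qed

text \<open>The integral operator is a contraction with factor L (b - a) on the complete space of
  bounded continuous functions on the line. Integrating up to the clamped time
  \<open>max a (min b t)\<close> keeps its values in that space. The Lipschitz bound is global in x,
  so the solution lives on the whole of [a,b].\<close>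

lemma picard_lindelof:
  fixes f :: "real \<Rightarrow> 'e::euclidean_space \<Rightarrow> 'e"
  assumes ab: "a \<le> b" and cont: "continuous_on ({a..b} \<times> UNIV) (\<lambda>(t, x). f t x)"
    and lip: "\<And>t x y. t \<in> {a..b} ==> norm (f t x - f t y) \<le> L * norm (x - y)"
    and L: "0 \<le> L" "L * (b - a) < 1"
  obtains g where "g a = x0" "\<And>t. t \<in> {a..b} ==> (g has_vector_derivative f t (g t)) (at t within {a..b})"
proof -
  have fc: "continuous_on {a..b} (\<lambda>u. f u (g u))" if "continuous_on {a..b} g" for g
    using continuous_on_compose2[OF cont continuous_on_Pair[OF continuous_on_id that]] by auto
  define G where "G = (\<lambda>g t. x0 + integral {a..max a (min b t)} (\<lambda>u. f u (g u)))"
  have phc: "continuous_on S (apply_bcontfun g)" for g :: "real \<Rightarrow>\<^sub>C 'e" and S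
    by (rule continuous_on_apply_bcontfun)
  have Gb: "G g \<in> bcontfun" if "continuous_on {a..b} g" for g
  proof -
    have int: "(\<lambda>u. f u (g u)) integrable_on {a..b}" by (rule integrable_continuous_real[OF fc[OF that]])
    hence c1: "continuous_on {a..b} (\<lambda>x. x0 + integral {a..x} (\<lambda>u. f u (g u)))"
      by (intro continuous_on_add continuous_on_const indefinite_integral_continuous_1)
    have c2: "continuous_on UNIV (\<lambda>t. max a (min b t))" by (intro continuous_intros)
    have "continuous_on UNIV (G g)" unfolding G_def
      by (rule continuous_on_compose2[OF c1 c2]) (use ab in auto)
    moreover have "range (G g) \<subseteq> (\<lambda>x. x0 + integral {a..x} (\<lambda>u. f u (g u))) ` {a..b}"
      unfolding G_def using ab by auto
    hence "bounded (range (G g))"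
      using compact_imp_bounded[OF compact_continuous_image[OF c1 compact_Icc]] bounded_subset by blast
    ultimately show ?thesis by (simp add: bcontfun_def)
  qed
  define T where "T = (\<lambda>g :: real \<Rightarrow>\<^sub>C 'e. Bcontfun (G (apply_bcontfun g)))"
  have T: "apply_bcontfun (T g) = G (apply_bcontfun g)" for g
    unfolding T_def by (rule Bcontfun_inverse[OF Gb[OF phc]])
  have "dist (T g) (T k) \<le> (L * (b - a)) * dist g k" for g k
  proof (rule dist_bound)
    fix t
    let ?m = "max a (min b t)"
    have m: "?m \<in> {a..b}" using ab by auto
    have i: "(\<lambda>u. f u (apply_bcontfun g u)) integrable_on {a..?m}" for g :: "real \<Rightarrow>\<^sub>C 'e"
      by (rule integrable_continuous_real, rule continuous_on_subset[OF fc[OF phc]]) (use m in auto)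
    have "dist (apply_bcontfun (T g) t) (apply_bcontfun (T k) t)
        = norm (integral {a..?m} (\<lambda>u. f u (apply_bcontfun g u)) - integral {a..?m} (\<lambda>u. f u (apply_bcontfun k u)))"
      by (simp add: T G_def dist_norm)
    also have "\<dots> = norm (integral {a..?m} (\<lambda>u. f u (apply_bcontfun g u) - f u (apply_bcontfun k u)))"
      by (simp only: integral_diff[OF i i])
    also have "\<dots> \<le> (L * dist g k) * (?m - a)"
    proof (rule integral_bound)
      show "a \<le> ?m" using m by simp
      show "continuous_on {a..?m} (\<lambda>u. f u (apply_bcontfun g u) - f u (apply_bcontfun k u))"
        by (intro continuous_on_diff continuous_on_subset[OF fc[OF phc]]) (use m in auto)
      fix u assume u: "u \<in> {a..?m}"
      have "norm (f u (apply_bcontfun g u) - f u (apply_bcontfun k u)) \<le> L * norm (apply_bcontfun g u - apply_bcontfun k u)"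
        by (rule lip) (use u m in auto)
      also have "\<dots> \<le> L * dist g k" using dist_bounded[of g u k] L by (intro mult_left_mono) (auto simp: dist_norm)
      finally show "norm (f u (apply_bcontfun g u) - f u (apply_bcontfun k u)) \<le> L * dist g k" .
    qed
    also have "\<dots> \<le> (L * dist g k) * (b - a)" using m L by (intro mult_left_mono) auto
    finally show "dist (apply_bcontfun (T g) t) (apply_bcontfun (T k) t) \<le> (L * (b - a)) * dist g k"
      by (simp add: mult_ac)
  qed
  hence "\<exists>!g. T g = g"
    by (intro banach_fix_type[of "L * (b - a)"]) (use L ab in auto)
  then obtain g where g: "T g = g" by blast
  hence eq: "apply_bcontfun g t = G (apply_bcontfun g) t" for t using T[of g] by simp
  show ?thesis
  proof (rule that[of "apply_bcontfun g"])
    show "apply_bcontfun g a = x0" by (subst eq) (simp add: G_def ab)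
    fix t assume t: "t \<in> {a..b}"
    have "((\<lambda>x. x0 + integral {a..x} (\<lambda>u. f u (apply_bcontfun g u))) has_vector_derivative f t (apply_bcontfun g t)) (at t within {a..b})"
      using integral_has_vector_derivative[OF fc[OF phc] t] by (auto intro!: derivative_eq_intros)
    thus "(apply_bcontfun g has_vector_derivative f t (apply_bcontfun g t)) (at t within {a..b})"
    proof (rule has_vector_derivative_transform[OF t, rotated])
      fix u assume u: "u \<in> {a..b}"
      hence "max a (min b u) = u" by auto
      thus "apply_bcontfun g u = x0 + integral {a..u} (\<lambda>u. f u (apply_bcontfun g u))" by (subst eq) (simp add: G_def)
    qed
  qed
qed

section \<open>Charts and integral curves\<close>

lemma chart_simps:
  assumes "is_chart M c"
  shows "p \<in> fst c ==> chart_inv c (snd c p) = p" "x \<in> chart_img c ==> snd c (chart_inv c x) = x"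
    "x \<in> chart_img c ==> chart_inv c x \<in> fst c" "p \<in> fst c ==> snd c p \<in> chart_img c"
    "fst c \<subseteq> M" "continuous_on (fst c) (snd c)" "continuous_on (chart_img c) (chart_inv c)"
    "openin (top_of_set M) (fst c)" "openin (top_of_set half_space) (chart_img c)" "chart_img c \<subseteq> half_space"
proof -
  have h: "homeomorphism (fst c) (chart_img c) (snd c) (chart_inv c)" and o: "openin (top_of_set M) (fst c)"
    "openin (top_of_set half_space) (chart_img c)" using assms by (auto simp: is_chart_def)
  show "p \<in> fst c ==> chart_inv c (snd c p) = p" "x \<in> chart_img c ==> snd c (chart_inv c x) = x"
    "x \<in> chart_img c ==> chart_inv c x \<in> fst c" "p \<in> fst c ==> snd c p \<in> chart_img c"
    "continuous_on (fst c) (snd c)" "continuous_on (chart_img c) (chart_inv c)"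
    using h unfolding homeomorphism_def by auto
  show "fst c \<subseteq> M" "chart_img c \<subseteq> half_space" using o openin_imp_subset by auto
qed (use assms in \<open>auto simp: is_chart_def\<close>)

text \<open>The chain rule for a curve read in two charts, at a time around which it lies in both
  domains. The charts may have different coordinate spaces, and of \<open>c\<close> only the inverse
  property is assumed; so product charts, whose images need not lie in the half space of the
  product, are covered too.\<close>

lemma chart_change_derivative:
  fixes d :: "('a, 'f::euclidean_space) chart" and c :: "('a, 'e::euclidean_space) chart"
  assumes D: "(transition c d has_derivative D) (at (snd c (g u)) within transition_dom c d)"
    and v: "((snd c \<circ> g) has_vector_derivative v) (at u within I)"
    and ev: "eventually (\<lambda>s. g s \<in> fst c \<inter> fst d) (at u within I)" and u: "g u \<in> fst c \<inter> fst d"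
    and uI: "u \<in> I" and inv: "\<And>p. p \<in> fst c ==> chart_inv c (snd c p) = p"
  shows "((snd d \<circ> g) has_vector_derivative D v) (at u within I)"
proof -
  obtain O' where O': "open O'" "u \<in> O'" "\<And>s. s \<in> O' ==> s \<noteq> u ==> s \<in> I ==> g s \<in> fst c \<inter> fst d"
    using ev unfolding eventually_at_topological by blast
  have eq: "at u within (I \<inter> O') = at u within I" by (rule at_within_nhd[where S = O']) (use O' in auto)
  have mem: "g s \<in> fst c \<inter> fst d" if "s \<in> I \<inter> O'" for s using O'(3)[of s] that u by (cases "s = u") auto
  have v': "((snd c \<circ> g) has_derivative (\<lambda>h. h *\<^sub>R v)) (at u within (I \<inter> O'))"
    using v unfolding eq has_vector_derivative_def .
  have "(transition c d has_derivative D) (at ((snd c \<circ> g) u) within (snd c \<circ> g) ` (I \<inter> O'))"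
    by (rule has_derivative_subset[OF D[folded o_apply[of "snd c" g]]]) (use mem in \<open>auto simp: transition_dom_def\<close>)
  from has_derivative_in_compose[OF v' this]
  have "((\<lambda>s. transition c d ((snd c \<circ> g) s)) has_derivative (\<lambda>h. D (h *\<^sub>R v))) (at u within (I \<inter> O'))" .
  moreover have "D (h *\<^sub>R v) = h *\<^sub>R D v" for h using has_derivative_linear[OF D] by (simp add: linear_scale)
  ultimately have "((\<lambda>s. transition c d ((snd c \<circ> g) s)) has_derivative (\<lambda>h. h *\<^sub>R D v)) (at u within I)"
    unfolding eq by simp
  thus ?thesis unfolding has_vector_derivative_def
  proof (rule has_derivative_transform_eventually)
    show "\<forall>\<^sub>F s in at u within I. transition c d ((snd c \<circ> g) s) = (snd d \<circ> g) s"
      using ev by eventually_elim (simp add: transition_def inv)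
    show "transition c d ((snd c \<circ> g) u) = (snd d \<circ> g) u" using u by (simp add: transition_def inv)
  qed (fact uI)
qed

text \<open>\<open>integral_curve\<close> on an arbitrary interval, so that curves can be
  restricted, shifted and joined. Derivatives at the two ends are one-sided.\<close>

definition curve_on :: "'a::topological_space set \<Rightarrow> ('a, 'e::euclidean_space) chart set \<Rightarrow>
    (real \<Rightarrow> ('a, 'e) vector_field) \<Rightarrow> real \<Rightarrow> real \<Rightarrow> (real \<Rightarrow> 'a) \<Rightarrow> bool" where
  "curve_on S A X a b g \<longleftrightarrow> g ` {a..b} \<subseteq> S \<and> continuous_on {a..b} g \<and>
     (\<forall>s\<in>{a..b}. \<forall>c\<in>A. g s \<in> fst c \<longrightarrow> ((snd c \<circ> g) has_vector_derivative X s c (g s)) (at s within {a..b}))"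

lemma curve_onD:
  "curve_on S A X a b g ==> s \<in> {a..b} ==> c \<in> A ==> g s \<in> fst c ==>
    ((snd c \<circ> g) has_vector_derivative X s c (g s)) (at s within {a..b})"
  unfolding curve_on_def by blast

lemma integral_curve_iff: "integral_curve S A X g \<longleftrightarrow> curve_on S A X 0 1 g"
  unfolding integral_curve_def curve_on_def ..

lemma curve_on_subinterval:
  assumes "curve_on S A X a b g" "a \<le> a'" "b' \<le> b"
  shows "curve_on S A X a' b' g"
proof -
  have sub: "{a'..b'} \<subseteq> {a..b}" using assms by auto
  thus ?thesis using assms(1) continuous_on_subset[OF _ sub] has_vector_derivative_within_subset[OF _ sub]
    unfolding curve_on_def by (meson image_mono order_trans subsetD)
qed

lemma curve_on_cong:
  assumes "curve_on S A X a b g" "\<And>s. s \<in> {a..b} ==> g' s = g s"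
  shows "curve_on S A X a b g'"
  unfolding curve_on_def
proof (intro conjI ballI impI)
  show "g' ` {a..b} \<subseteq> S" using assms by (auto simp: curve_on_def)
  show "continuous_on {a..b} g'"
    by (rule continuous_on_eq[of _ g]) (use assms in \<open>auto simp: curve_on_def\<close>)
  fix s c assume s: "s \<in> {a..b}" and c: "c \<in> A" "g' s \<in> fst c"
  have "((snd c \<circ> g) has_vector_derivative X s c (g s)) (at s within {a..b})"
    using assms s c by (simp add: curve_on_def)
  hence "((snd c \<circ> g') has_vector_derivative X s c (g s)) (at s within {a..b})"
    by (rule has_vector_derivative_transform[OF s, rotated]) (simp add: assms(2))
  thus "((snd c \<circ> g') has_vector_derivative X s c (g' s)) (at s within {a..b})"
    using assms(2) s by simp
qed

lemma curve_on_shift: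
  assumes "curve_on S A X (a + h) (b + h) g"
  shows "curve_on S A (\<lambda>s. X (s + h)) a b (\<lambda>s. g (s + h))"
  unfolding curve_on_def
proof (intro conjI ballI impI)
  show "(\<lambda>s. g (s + h)) ` {a..b} \<subseteq> S" using assms by (auto simp: curve_on_def)
  show "continuous_on {a..b} (\<lambda>s. g (s + h))"
    by (rule continuous_on_compose2[of "{a+h..b+h}" g]) (use assms in \<open>auto simp: curve_on_def intro!: continuous_intros\<close>)
  fix s c assume s: "s \<in> {a..b}" and c: "c \<in> A" "g (s + h) \<in> fst c"
  have "((snd c \<circ> g) has_vector_derivative X (s + h) c (g (s + h))) (at (s + h) within (\<lambda>s. s + h) ` {a..b})"
    using assms s c by (simp add: curve_on_def)
  moreover have "((\<lambda>s. s + h) has_vector_derivative 1) (at s within {a..b})" by (auto intro!: derivative_eq_intros)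
  ultimately have "((snd c \<circ> g) \<circ> (\<lambda>s. s + h) has_vector_derivative 1 *\<^sub>R X (s + h) c (g (s + h))) (at s within {a..b})"
    by (intro vector_diff_chain_within)
  thus "(snd c \<circ> (\<lambda>s. g (s + h)) has_vector_derivative X (s + h) c (g (s + h))) (at s within {a..b})"
    by (simp add: o_def)
qed

lemma has_vector_derivative_within_Un:
  assumes "(f has_vector_derivative v) (at x within S)" "(f has_vector_derivative v) (at x within T)"
  shows "(f has_vector_derivative v) (at x within (S \<union> T))"
  using assms unfolding has_vector_derivative_def has_derivative_within by (auto simp: Lim_within_Un)

text \<open>At the joint both one-sided derivatives are the value of the field at the common point,
  so they combine to a derivative within the union.\<close>

lemma curve_on_join:
  assumes 1: "curve_on S A X a m q1" and 2: "curve_on S A X m b q2" and eq: "q1 m = q2 m" and am: "a \<le> m" "m \<le> b"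
  shows "curve_on S A X a b (\<lambda>s. if s \<le> m then q1 s else q2 s)"
proof -
  let ?g = "\<lambda>s. if s \<le> m then q1 s else q2 s"
  have un: "{a..b} = {a..m} \<union> {m..b}" using am by auto
  have g1: "curve_on S A X a m ?g" by (rule curve_on_cong[OF 1]) auto
  have g2: "curve_on S A X m b ?g" by (rule curve_on_cong[OF 2]) (use eq in auto)
  show ?thesis unfolding curve_on_def
  proof (intro conjI ballI impI)
    show "?g ` {a..b} \<subseteq> S" using g1 g2 unfolding un curve_on_def by blast
    show "continuous_on {a..b} ?g" unfolding un
      by (rule continuous_on_closed_Un) (use g1 g2 in \<open>auto simp: curve_on_def\<close>)
    fix s c assume s: "s \<in> {a..b}" and c: "c \<in> A" "?g s \<in> fst c"
    have d1: "((snd c \<circ> ?g) has_vector_derivative X s c (?g s)) (at s within {a..m})" if "s \<le> m"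
      by (rule curve_onD[OF g1 _ c]) (use s that in simp)
    have d2: "((snd c \<circ> ?g) has_vector_derivative X s c (?g s)) (at s within {m..b})" if "m \<le> s"
      by (rule curve_onD[OF g2 _ c]) (use s that in simp)
    consider "s < m" | "s = m" | "m < s" by linarith
    thus "((snd c \<circ> ?g) has_vector_derivative X s c (?g s)) (at s within {a..b})"
    proof cases
      case 1
      have "at s within {a..b} = at s within {a..m}" by (rule at_within_nhd[where S = "{..<m}"]) (use 1 am in auto)
      thus ?thesis using d1 1 by simp
    next
      case 2
      thus ?thesis unfolding un using d1 d2 by (intro has_vector_derivative_within_Un) auto
    next
      case 3
      have "at s within {a..b} = at s within {m..b}" by (rule at_within_nhd[where S = "{m<..}"]) (use 3 am in auto)
      thus ?thesis using d2 3 by simp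
    qed
  qed
qed

text \<open>What existence and uniqueness of a flow ask of a time-dependent field on a compact
  manifold with boundary. The linear map in \<open>compatible\<close> is the same for all times, so
  that rescaling the field by a function of time or changing its time argument preserves the
  assumption.\<close>

locale flow_domain =
  fixes W :: "'a::t2_space set" and A :: "('a, 'e::euclidean_space) chart set"
    and X :: "real \<Rightarrow> ('a, 'e) vector_field"
  assumes compact_W: "compact W" and charts: "\<And>c. c \<in> A ==> is_chart W c" and cover: "\<Union>(fst ` A) = W"
    and local_lipschitz: "\<And>c t x. c \<in> A ==> x \<in> chart_img c ==> \<exists>r>0. \<exists>L\<ge>0. cball x r \<inter> half_space \<subseteq> chart_img c \<and>
      continuous_on ({t - r..t + r} \<times> (cball x r \<inter> half_space)) (\<lambda>(s, y). X s c (chart_inv c y)) \<and>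
      (\<forall>s\<in>{t - r..t + r}. \<forall>y\<in>cball x r \<inter> half_space. \<forall>z\<in>cball x r \<inter> half_space.
         norm (X s c (chart_inv c y) - X s c (chart_inv c z)) \<le> L * norm (y - z))"
    and tangent: "\<And>c s p. c \<in> A ==> p \<in> fst c ==> snd c p \<bullet> conormal = 0 ==> X s c p \<bullet> conormal = 0"
    and compatible: "\<And>c d p. c \<in> A ==> d \<in> A ==> p \<in> fst c \<inter> fst d ==>
      \<exists>D. (transition c d has_derivative D) (at (snd c p) within transition_dom c d) \<and> (\<forall>s. X s d p = D (X s c p))"
begin

text \<open>The set of agreement is closed because W is Hausdorff and open by Gronwall's inequality
  in a chart, hence it is the whole interval. The common point may sit at any time
  \<open>s0\<close>, so uniqueness also holds backward.\<close>

lemma curve_unique: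
  assumes 1: "curve_on W A X a b q1" and 2: "curve_on W A X a b q2"
    and s0: "s0 \<in> {a..b}" "q1 s0 = q2 s0" and s: "s \<in> {a..b}"
  shows "q1 s = q2 s"
proof -
  define E where "E = {s \<in> {a..b}. q1 s = q2 s}"
  have c1: "continuous_on {a..b} q1" "\<And>s. s \<in> {a..b} ==> q1 s \<in> W" using 1 by (auto simp: curve_on_def)
  have c2: "continuous_on {a..b} q2" "\<And>s. s \<in> {a..b} ==> q2 s \<in> W" using 2 by (auto simp: curve_on_def)
  have "closedin (top_of_set {a..b}) ({a..b} \<inter> (\<lambda>s. (q1 s, q2 s)) -` {y. \<exists>x. y = (x, x)})"
    by (intro continuous_closedin_preimage continuous_on_Pair c1 c2 closed_diagonal)
  moreover have "{a..b} \<inter> (\<lambda>s. (q1 s, q2 s)) -` {y. \<exists>x. y = (x, x)} = E" unfolding E_def by auto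
  ultimately have cl: "closedin (top_of_set {a..b}) E" by simp
  have nb: "\<exists>O'. open O' \<and> s \<in> O' \<and> {a..b} \<inter> O' \<subseteq> E" if sE: "s \<in> E" for s
  proof -
    have s: "s \<in> {a..b}" "q1 s = q2 s" using sE by (auto simp: E_def)
    obtain c where c: "c \<in> A" "q1 s \<in> fst c" using c1(2)[OF s(1)] cover by blast
    note ch = chart_simps[OF charts[OF c(1)]]
    define x where "x = snd c (q1 s)"
    have x: "x \<in> chart_img c" using ch c by (simp add: x_def)
    obtain r L where r: "r > 0" "cball x r \<inter> half_space \<subseteq> chart_img c"
      and L: "\<forall>u\<in>{s - r..s + r}. \<forall>y\<in>cball x r \<inter> half_space. \<forall>z\<in>cball x r \<inter> half_space.
         norm (X u c (chart_inv c y) - X u c (chart_inv c z)) \<le> L * norm (y - z)"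
      using local_lipschitz[OF c(1) x, of s] by blast
    \<comment> \<open>For times close to s a curve through this point stays in the domain of
      \<open>c\<close> and in the ball on which the Lipschitz bound holds.\<close>
    have near: "\<exists>O'. open O' \<and> s \<in> O' \<and> (\<forall>u\<in>{a..b} \<inter> O'. q u \<in> fst c \<and> snd c (q u) \<in> ball x r)"
      if g: "continuous_on {a..b} q" "\<And>s. s \<in> {a..b} ==> q s \<in> W" "q s = q1 s" for q
    proof -
      have "openin (top_of_set (fst c)) (fst c \<inter> snd c -` ball x r)"
        by (rule continuous_openin_preimage_gen[OF ch(6)]) simp
      hence "openin (top_of_set W) (fst c \<inter> snd c -` ball x r)" using ch(8) openin_trans by blast
      then obtain V where V: "open V" "fst c \<inter> snd c -` ball x r = W \<inter> V" unfolding openin_open by blast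
      obtain O' where O': "open O'" "{a..b} \<inter> q -` V = {a..b} \<inter> O'"
        using continuous_openin_preimage_gen[OF g(1) V(1)] unfolding openin_open by blast
      have "q s \<in> fst c \<inter> snd c -` ball x r" using g(3) c r by (simp add: x_def)
      hence "s \<in> O'" using V O' s by blast
      moreover have "q u \<in> fst c \<and> snd c (q u) \<in> ball x r" if "u \<in> {a..b} \<inter> O'" for u
      proof -
        have "q u \<in> W \<inter> V" using that O' g(2) by blast
        thus ?thesis using V by blast
      qed
      ultimately show ?thesis using O' by blast
    qed
    obtain O1 where O1: "open O1" "s \<in> O1" "\<And>u. u \<in> {a..b} \<inter> O1 ==> q1 u \<in> fst c \<and> snd c (q1 u) \<in> ball x r"
      using near[OF c1 refl] by blast
    obtain O2 where O2: "open O2" "s \<in> O2" "\<And>u. u \<in> {a..b} \<inter> O2 ==> q2 u \<in> fst c \<and> snd c (q2 u) \<in> ball x r"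
      using near[OF c2 s(2)[symmetric]] by blast
    obtain e where e: "e > 0" "cball s e \<subseteq> O1 \<inter> O2" using O1 O2 open_contains_cball[of "O1 \<inter> O2"] by blast
    define h where "h = min e r"
    have h: "h > 0" "h \<le> r" using e r by (auto simp: h_def)
    define a' where "a' = max a (s - h)"
    define b' where "b' = min b (s + h)"
    have sub: "{a'..b'} \<subseteq> {a..b} \<inter> O1 \<inter> O2"
    proof
      fix u assume u: "u \<in> {a'..b'}"
      hence "u \<in> cball s e" by (auto simp: a'_def b'_def h_def dist_real_def)
      thus "u \<in> {a..b} \<inter> O1 \<inter> O2" using e u by (auto simp: a'_def b'_def)
    qed
    have eq0: "snd c (q1 u) - snd c (q2 u) = 0" if u: "u \<in> {a'..b'}" for u
    proof (rule gronwall_zero[of a' b' "\<lambda>u. snd c (q1 u) - snd c (q2 u)" "\<lambda>u. X u c (q1 u) - X u c (q2 u)" L s])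
      fix u assume u: "u \<in> {a'..b'}"
      have "((snd c \<circ> q1) has_vector_derivative X u c (q1 u)) (at u within {a..b})"
        using 1 c(1) O1(3) u sub unfolding curve_on_def by blast
      moreover have "((snd c \<circ> q2) has_vector_derivative X u c (q2 u)) (at u within {a..b})"
        using 2 c(1) O2(3) u sub unfolding curve_on_def by blast
      ultimately have "((\<lambda>u. snd c (q1 u) - snd c (q2 u)) has_vector_derivative X u c (q1 u) - X u c (q2 u)) (at u within {a..b})"
        unfolding o_def by (rule has_vector_derivative_diff)
      thus "((\<lambda>u. snd c (q1 u) - snd c (q2 u)) has_vector_derivative X u c (q1 u) - X u c (q2 u)) (at u within {a'..b'})"
        by (rule has_vector_derivative_within_subset) (use sub in auto)
      have m1: "q1 u \<in> fst c" "snd c (q1 u) \<in> ball x r" using O1(3)[of u] u sub by auto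
      have m2: "q2 u \<in> fst c" "snd c (q2 u) \<in> ball x r" using O2(3)[of u] u sub by auto
      have "snd c (q1 u) \<in> cball x r \<inter> half_space" "snd c (q2 u) \<in> cball x r \<inter> half_space"
        using m1 m2 ch(4,10) by (auto simp: less_imp_le)
      moreover have "u \<in> {s - r..s + r}" using u h by (auto simp: a'_def b'_def)
      ultimately have "norm (X u c (chart_inv c (snd c (q1 u))) - X u c (chart_inv c (snd c (q2 u)))) \<le> L * norm (snd c (q1 u) - snd c (q2 u))"
        using L by blast
      thus "norm (X u c (q1 u) - X u c (q2 u)) \<le> L * norm (snd c (q1 u) - snd c (q2 u))"
        using ch(1) m1 m2 by simp
    next
      show "s \<in> {a'..b'}" using s h by (auto simp: a'_def b'_def)
      show "snd c (q1 s) - snd c (q2 s) = 0" using s by simp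
    qed (use u in simp)
    have "{a..b} \<inter> ball s h \<subseteq> E"
    proof
      fix u assume u: "u \<in> {a..b} \<inter> ball s h"
      hence u': "u \<in> {a'..b'}" by (auto simp: a'_def b'_def dist_real_def)
      have "snd c (q1 u) = snd c (q2 u)" using eq0[OF u'] by simp
      moreover have "q1 u \<in> fst c" "q2 u \<in> fst c" using O1(3)[of u] O2(3)[of u] u' sub by auto
      ultimately have "q1 u = q2 u" using ch(1) by metis
      thus "u \<in> E" using u by (simp add: E_def)
    qed
    thus ?thesis using h by (intro exI[of _ "ball s h"]) auto
  qed
  have op: "openin (top_of_set {a..b}) E"
  proof (subst openin_subopen, intro ballI)
    fix s assume "s \<in> E"
    moreover from this have "s \<in> {a..b}" by (simp add: E_def)
    moreover from nb[OF \<open>s \<in> E\<close>] obtain O' where "open O' \<and> s \<in> O' \<and> {a..b} \<inter> O' \<subseteq> E" ..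
    ultimately show "\<exists>T. openin (top_of_set {a..b}) T \<and> s \<in> T \<and> T \<subseteq> E"
      by (intro exI[of _ "{a..b} \<inter> O'"]) (auto simp: openin_open_Int)
  qed
  have "E = {} \<or> E = {a..b}" using connected_Icc[of a b] cl op unfolding connected_clopen by blast
  moreover have "s0 \<in> E" using s0 by (simp add: E_def)
  ultimately have "s \<in> E" using s by blast
  thus ?thesis by (simp add: E_def)
qed

text \<open>The nearest-point projection extends a field from the half space to the whole coordinate
  space with the same Lipschitz constant. Points outside are sent to the boundary hyperplane, where
  tangency of the field applies.\<close>

lemma half_space_clamp:
  fixes x :: 'e
  defines "\<pi> \<equiv> closest_point half_space"
  shows "\<pi> y \<in> half_space" "dist (\<pi> y) (\<pi> z) \<le> dist y z" "y \<in> half_space ==> \<pi> y = y"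
    "y \<bullet> conormal \<le> 0 ==> \<pi> y \<bullet> conormal = 0" "x \<in> half_space ==> dist x (\<pi> y) \<le> dist x y"
proof -
  have hs: "half_space = {x::'e. conormal \<bullet> x \<ge> 0}" by (auto simp: half_space_def inner_commute)
  have cl: "closed (half_space :: 'e set)" and cv: "convex (half_space :: 'e set)" and ne: "(half_space :: 'e set) \<noteq> {}"
    unfolding hs by (auto simp: closed_halfspace_ge convex_halfspace_ge intro!: exI[of _ 0])
  show *: "dist (\<pi> y) (\<pi> z) \<le> dist y z" for y z unfolding \<pi>_def by (rule closest_point_lipschitz[OF cv cl ne])
  show "\<pi> y \<in> half_space" unfolding \<pi>_def by (rule closest_point_in_set[OF cl ne])
  show **: "y \<in> half_space ==> \<pi> y = y" for y unfolding \<pi>_def by (rule closest_point_self)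
  show "x \<in> half_space ==> dist x (\<pi> y) \<le> dist x y" using *[of x y] **[of x] by simp
  show "\<pi> y \<bullet> conormal = 0" if y: "y \<bullet> conormal \<le> 0"
  proof -
    let ?n = "conormal :: 'e"
    have n: "?n \<bullet> ?n = 1" "norm ?n = 1" by (simp_all add: inner_Basis conormal_Basis norm_Basis)
    have "y - (y \<bullet> ?n) *\<^sub>R ?n = closest_point half_space y"
    proof (rule closest_point_unique[OF cv cl])
      show "y - (y \<bullet> ?n) *\<^sub>R ?n \<in> half_space" by (simp add: half_space_def inner_diff_left n)
      show "\<forall>z\<in>half_space. dist y (y - (y \<bullet> ?n) *\<^sub>R ?n) \<le> dist y z"
      proof
        fix z :: 'e assume "z \<in> half_space"
        hence "z \<bullet> ?n \<ge> 0" by (simp add: half_space_def)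
        hence "\<bar>y \<bullet> ?n\<bar> \<le> \<bar>(y - z) \<bullet> ?n\<bar>" using y by (simp add: inner_diff_left)
        also have "\<dots> \<le> norm (y - z)" using Cauchy_Schwarz_ineq2[of "y - z" ?n] n by simp
        finally show "dist y (y - (y \<bullet> ?n) *\<^sub>R ?n) \<le> dist y z" by (simp add: dist_norm n)
      qed
    qed
    thus ?thesis unfolding \<pi>_def by (metis inner_diff_left inner_scaleR_left n(1) mult.right_neutral diff_self)
  qed
qed

text \<open>\<open>picard_lindelof\<close> wants a field on the whole space, but charts are modelled
  on a half space. The field is extended by nearest-point projections. At points of the ball outside
  the half space the extension takes boundary values, which are tangent, so a solution starting in
  the half space cannot leave it. The step \<epsilon> is common to all starting times near
  \<open>t0\<close>, which the later compactness argument requires.\<close>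

lemma local_flow:
  assumes p0: "p0 \<in> W"
  shows "\<exists>\<epsilon>>0. \<exists>V. openin (top_of_set W) V \<and> p0 \<in> V \<and> (\<forall>t'. \<bar>t' - t0\<bar> \<le> \<epsilon> \<longrightarrow>
    (\<exists>l. continuous_on ({t'..t' + \<epsilon>} \<times> V) (\<lambda>(u, p). l u p) \<and>
      (\<forall>p\<in>V. l t' p = p \<and> curve_on W A X t' (t' + \<epsilon>) (\<lambda>u. l u p))))"
proof -
  let ?n = "conormal :: 'e" and ?H = "half_space :: 'e set"
  define \<pi> where "\<pi> = closest_point ?H"
  note \<pi> = half_space_clamp[folded \<pi>_def]
  obtain c where c: "c \<in> A" "p0 \<in> fst c" using p0 cover by blast
  note ch = chart_simps[OF charts[OF c(1)]]
  define x where "x = snd c p0"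
  have x: "x \<in> chart_img c" "x \<in> ?H" using ch c by (auto simp: x_def)
  obtain r L where r: "r > 0" "cball x r \<inter> ?H \<subseteq> chart_img c" and L0: "L \<ge> 0"
    and Xc: "continuous_on ({t0 - r..t0 + r} \<times> (cball x r \<inter> ?H)) (\<lambda>(s, y). X s c (chart_inv c y))"
    and L: "\<forall>u\<in>{t0 - r..t0 + r}. \<forall>y\<in>cball x r \<inter> ?H. \<forall>z\<in>cball x r \<inter> ?H.
         norm (X u c (chart_inv c y) - X u c (chart_inv c z)) \<le> L * norm (y - z)"
    using local_lipschitz[OF c(1) x(1), of t0] by blast
  define K where "K = cball x r \<inter> ?H"
  have hs: "?H = {x. conormal \<bullet> x \<ge> 0}" by (auto simp: half_space_def inner_commute)
  have K: "closed K" "convex K" "K \<noteq> {}" "compact K" "K \<subseteq> chart_img c"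
  proof -
    have "x \<in> K" using x r by (simp add: K_def)
    thus "K \<noteq> {}" by blast
    show "closed K" "convex K" "compact K" unfolding K_def hs
      by (auto simp: closed_halfspace_ge closed_Int convex_halfspace_ge convex_Int compact_Int_closed)
    show "K \<subseteq> chart_img c" using r by (simp add: K_def)
  qed
  have cpK: "closest_point K y \<in> K" for y by (rule closest_point_in_set[OF K(1,3)])
  \<comment> \<open>Projecting into the half space and on into the compact \<open>K\<close> makes
    the field bounded and globally Lipschitz without changing it on \<open>K\<close>.\<close>
  define f where "f = (\<lambda>s y. X s c (chart_inv c (closest_point K (\<pi> y))))"
  let ?I = "{t0 - r..t0 + r}"
  have fcont: "continuous_on (?I \<times> UNIV) (\<lambda>(s, y). f s y)"
  proof -
    have "continuous_on UNIV (\<lambda>y. closest_point K (\<pi> y))"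
      unfolding \<pi>_def
      using K by (intro continuous_on_compose2[OF continuous_on_closest_point[OF K(2,1,3)] continuous_on_closest_point])
        (auto simp: hs closed_halfspace_ge convex_halfspace_ge intro!: exI[of _ 0])
    hence cpc: "continuous_on (?I \<times> UNIV) (\<lambda>z. closest_point K (\<pi> (snd z)))"
      by (rule continuous_on_compose2[OF _ continuous_on_snd[OF continuous_on_id]]) auto
    show ?thesis unfolding f_def case_prod_unfold
      by (rule continuous_on_pair[OF Xc[folded K_def] continuous_on_fst[OF continuous_on_id] cpc]) (use cpK in auto)
  qed
  have flip: "norm (f s y - f s z) \<le> L * norm (y - z)" if s: "s \<in> ?I" for s y z
  proof -
    have "norm (f s y - f s z) \<le> L * norm (closest_point K (\<pi> y) - closest_point K (\<pi> z))"
      unfolding f_def using L s cpK by (auto simp: K_def)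
    also have "\<dots> \<le> L * norm (y - z)"
    proof (rule mult_left_mono[OF _ L0])
      have "dist (closest_point K (\<pi> y)) (closest_point K (\<pi> z)) \<le> dist (\<pi> y) (\<pi> z)" by (rule closest_point_lipschitz[OF K(2,1,3)])
      also have "\<dots> \<le> dist y z" by (rule \<pi>(2))
      finally show "norm (closest_point K (\<pi> y) - closest_point K (\<pi> z)) \<le> norm (y - z)" by (simp add: dist_norm)
    qed
    finally show ?thesis .
  qed
  have "compact ((\<lambda>(s, y). X s c (chart_inv c y)) ` (?I \<times> K))"
    by (intro compact_continuous_image compact_Times compact_Icc K) (use Xc in \<open>simp add: K_def\<close>)
  hence "bounded ((\<lambda>(s, y). X s c (chart_inv c y)) ` (?I \<times> K))" by (rule compact_imp_bounded)
  then obtain B0 where B0: "\<forall>z\<in>(\<lambda>(s, y). X s c (chart_inv c y)) ` (?I \<times> K). norm z \<le> B0"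
    unfolding bounded_iff ..
  define B where "B = max B0 1"
  have fB: "norm (f s y) \<le> B" if "s \<in> ?I" for s y
  proof -
    have "f s y \<in> (\<lambda>(s, y). X s c (chart_inv c y)) ` (?I \<times> K)" unfolding f_def using that cpK[of "\<pi> y"] by force
    thus ?thesis using bspec[OF B0] by (force simp: B_def)
  qed
  have B: "B > 0" by (simp add: B_def)
  \<comment> \<open>The three bounds keep the time interval in the window of radius r, keep
    solutions that start in the ball of radius r/2 inside the ball of radius r, and give L
    \<epsilon> < 1 for the contraction.\<close>
  define \<epsilon> where "\<epsilon> = min (r / 2) (min (r / (4 * B)) (1 / (2 * (L + 1))))"
  have \<epsilon>: "\<epsilon> > 0" "2 * \<epsilon> \<le> r" "B * \<epsilon> < r / 2" "L * \<epsilon> < 1"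
  proof -
    show "\<epsilon> > 0" using r B L0 by (simp add: \<epsilon>_def)
    show "2 * \<epsilon> \<le> r" by (simp add: \<epsilon>_def min_def)
    have "B * \<epsilon> \<le> B * (r / (4 * B))" using B by (intro mult_left_mono) (auto simp: \<epsilon>_def)
    also have "\<dots> = r / 4" using B by simp
    finally show "B * \<epsilon> < r / 2" using r by simp
    have "L * \<epsilon> \<le> L * (1 / (2 * (L + 1)))" using L0 by (intro mult_left_mono) (auto simp: \<epsilon>_def)
    also have "\<dots> < 1" using L0 by (simp add: divide_simps)
    finally show "L * \<epsilon> < 1" .
  qed
  define V where "V = fst c \<inter> snd c -` ball x (r / 2)"
  have "openin (top_of_set (fst c)) V" unfolding V_def by (rule continuous_openin_preimage_gen[OF ch(6)]) simp
  hence V: "openin (top_of_set W) V" using ch(8) openin_trans by blast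
  have p0V: "p0 \<in> V" using c r by (simp add: V_def x_def)
  show ?thesis
  proof (intro exI[of _ \<epsilon>] conjI exI[of _ V] allI impI)
    fix t' assume t': "\<bar>t' - t0\<bar> \<le> \<epsilon>"
    let ?J = "{t'..t' + \<epsilon>}"
    have JI: "?J \<subseteq> ?I" using t' \<epsilon> by auto
    have "\<exists>g. g t' = y \<and> (\<forall>t\<in>?J. (g has_vector_derivative f t (g t)) (at t within ?J))" for y
    proof (rule picard_lindelof[of t' "t' + \<epsilon>" f L y])
      show "continuous_on (?J \<times> UNIV) (\<lambda>(t, x). f t x)" by (rule continuous_on_subset[OF fcont]) (use JI in auto)
    qed (use \<epsilon> L0 JI flip in auto)
    then obtain Y where Y: "\<And>y. Y y t' = y" "\<And>y t. t \<in> ?J ==> (Y y has_vector_derivative f t (Y y t)) (at t within ?J)"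
      by metis
    have YB: "norm (Y y t - Y y s) \<le> B * \<bar>t - s\<bar>" if "s \<in> ?J" "t \<in> ?J" for y s t
      by (rule vector_derivative_bound[OF Y(2) _ that]) (use fB JI in auto)
    have YL: "norm (Y y t - Y z t) \<le> exp (L * \<epsilon>) * norm (y - z)" if t: "t \<in> ?J" for y z t
    proof -
      have "norm (Y y t - Y z t) \<le> exp (L * (t - t')) * norm (Y y t' - Y z t')"
      proof (rule gronwall[of t' "t' + \<epsilon>" "\<lambda>t. Y y t - Y z t" "\<lambda>t. f t (Y y t) - f t (Y z t)"])
        show "((\<lambda>t. Y y t - Y z t) has_vector_derivative f s (Y y s) - f s (Y z s)) (at s within ?J)" if "s \<in> ?J" for s
          by (rule has_vector_derivative_diff[OF Y(2)[OF that] Y(2)[OF that]])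
      qed (use flip JI t in auto)
      also have "\<dots> \<le> exp (L * \<epsilon>) * norm (y - z)" using t L0 by (auto simp: Y(1) intro!: mult_right_mono mult_left_mono)
      finally show ?thesis .
    qed
    have Yball: "Y y t \<in> ball x r" if y: "y \<in> ball x (r / 2)" and t: "t \<in> ?J" for y t
    proof -
      have "norm (Y y t - y) \<le> B * \<bar>t - t'\<bar>" using YB[of t' t y] t \<epsilon> Y(1) by auto
      also have "\<dots> \<le> B * \<epsilon>" using t B by (intro mult_left_mono) auto
      finally have "dist y (Y y t) < r / 2" using \<epsilon> by (simp add: dist_norm norm_minus_commute)
      thus ?thesis using y dist_triangle[of x "Y y t" y] by simp
    qed
    have cpi: "closest_point K (\<pi> y) = \<pi> y" if y: "y \<in> ball x r" for y
    proof (rule closest_point_self)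
      show "\<pi> y \<in> K" unfolding K_def using \<pi>(1) \<pi>(5)[OF x(2), of y] y by auto
    qed
    have Yhalf: "Y y s \<in> ?H" if y: "y \<in> ball x (r / 2)" "y \<in> ?H" and s: "s \<in> ?J" for y s
    proof (rule ccontr)
      define q where "q = (\<lambda>s. Y y s \<bullet> ?n)"
      assume "\<not> ?thesis"
      hence qs: "q s < 0" by (simp add: q_def half_space_def)
      have qd: "(q has_vector_derivative f u (Y y u) \<bullet> ?n) (at u within ?J)" if "u \<in> ?J" for u
        unfolding q_def using bounded_linear.has_vector_derivative[OF bounded_linear_inner_left Y(2)[OF that]] .
      have qc: "continuous_on ?J q"
        unfolding continuous_on_eq_continuous_within using has_vector_derivative_continuous[OF qd] by blast
      \<comment> \<open>Let \<open>s0\<close> be the last time up to s with nonnegative conormal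
        component. After it the extended field has conormal component 0, so that component is
        constant and cannot have become negative.\<close>
      define Z where "Z = {t'..s} \<inter> q -` {0..}"
      have sub: "{t'..s} \<subseteq> ?J" using s by auto
      have "closedin (top_of_set {t'..s}) Z" unfolding Z_def
        by (rule continuous_closedin_preimage[OF continuous_on_subset[OF qc sub]]) simp
      hence "compact Z" using closedin_compact by blast
      moreover have "t' \<in> Z" using y s by (auto simp: Z_def q_def Y(1) half_space_def)
      ultimately obtain s0 where s0: "s0 \<in> Z" "\<And>u. u \<in> Z ==> u \<le> s0" using compact_attains_sup[of Z] by auto
      have "s0 < s" using s0(1) qs by (auto simp: Z_def less_le)
      have neg: "q u < 0" if "s0 < u" "u \<le> s" for u
      proof (rule ccontr)
        assume "\<not> q u < 0"
        hence "u \<in> Z" using that s0(1) by (auto simp: Z_def)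
        thus False using s0(2)[of u] that by simp
      qed
      have "\<exists>u\<in>{s0<..<s}. q s - q s0 = (\<lambda>h. h * (f u (Y y u) \<bullet> ?n)) (s - s0)"
      proof (rule mvt_simple[OF \<open>s0 < s\<close>])
        fix u assume "s0 \<le> u" "u \<le> s"
        hence u: "u \<in> ?J" "{s0..s} \<subseteq> ?J" using s0(1) s by (auto simp: Z_def)
        show "(q has_derivative (\<lambda>h. h * (f u (Y y u) \<bullet> ?n))) (at u within {s0..s})"
          using has_vector_derivative_within_subset[OF qd[OF u(1)] u(2)] by (simp add: has_vector_derivative_def)
      qed
      then obtain u where u: "s0 < u" "u < s" "q s - q s0 = (s - s0) * (f u (Y y u) \<bullet> ?n)" by auto
      have uJ: "u \<in> ?J" using u s s0(1) by (auto simp: Z_def)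
      have neg': "Y y u \<bullet> ?n \<le> 0" using neg[of u] u by (simp add: q_def)
      have b: "Y y u \<in> ball x r" by (rule Yball[OF y(1) uJ])
      have pK: "\<pi> (Y y u) \<in> chart_img c" using cpi[OF b] cpK K(5) by (metis subsetD)
      have "X u c (chart_inv c (\<pi> (Y y u))) \<bullet> ?n = 0"
        by (rule tangent[OF c(1) ch(3)[OF pK]]) (simp add: ch(2)[OF pK] \<pi>(4)[OF neg'])
      hence "q s = q s0" using u(3) by (simp add: f_def cpi[OF b])
      thus False using qs s0(1) by (simp add: Z_def)
    qed
    have YK: "Y y t \<in> K" "f t (Y y t) = X t c (chart_inv c (Y y t))"
      if "y \<in> ball x (r / 2)" "y \<in> ?H" "t \<in> ?J" for y t
    proof -
      have b: "Y y t \<in> ball x r" "Y y t \<in> ?H" using Yball Yhalf that by auto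
      thus "Y y t \<in> K" by (auto simp: K_def)
      show "f t (Y y t) = X t c (chart_inv c (Y y t))" unfolding f_def using cpi[OF b(1)] \<pi>(3)[OF b(2)] by simp
    qed
    have Vx: "snd c p \<in> ball x (r / 2)" "snd c p \<in> ?H" "p \<in> fst c" if "p \<in> V" for p
      using that ch(4,10) by (auto simp: V_def)
    define l where "l = (\<lambda>u p. chart_inv c (Y (snd c p) u))"
    \<comment> \<open>Joint continuity holds because solutions are B-Lipschitz in time and depend on
      the initial point with Lipschitz constant exp (L \<epsilon>).\<close>
    have Ycont: "continuous_on (?J \<times> UNIV) (\<lambda>(u, y). Y y u)"
      unfolding continuous_on_iff
    proof (intro ballI allI impI)
      fix z0 and e :: real assume z0: "z0 \<in> ?J \<times> (UNIV :: 'e set)" and e: "0 < e"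
      define \<delta> where "\<delta> = min (e / (2 * exp (L * \<epsilon>))) (e / (2 * B))"
      have \<delta>: "\<delta> > 0" using e B by (simp add: \<delta>_def)
      show "\<exists>d>0. \<forall>z\<in>?J \<times> UNIV. dist z z0 < d \<longrightarrow> dist (case z of (u, y) \<Rightarrow> Y y u) (case z0 of (u, y) \<Rightarrow> Y y u) < e"
      proof (intro exI[of _ \<delta>] conjI \<delta> ballI impI)
        fix z assume z: "z \<in> ?J \<times> (UNIV :: 'e set)" "dist z z0 < \<delta>"
        have d1: "\<bar>fst z - fst z0\<bar> < \<delta>" using dist_fst_le[of z z0] z(2) by (simp add: dist_real_def)
        have d2: "norm (snd z - snd z0) < \<delta>" using dist_snd_le[of z z0] z(2) by (simp add: dist_norm)
        have "norm (Y (snd z) (fst z) - Y (snd z0) (fst z)) \<le> exp (L * \<epsilon>) * norm (snd z - snd z0)" using z by (intro YL) auto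
        also have "\<dots> < exp (L * \<epsilon>) * \<delta>" using d2 by simp
        also have "\<dots> \<le> exp (L * \<epsilon>) * (e / (2 * exp (L * \<epsilon>)))" by (intro mult_left_mono) (auto simp: \<delta>_def)
        finally have 1: "norm (Y (snd z) (fst z) - Y (snd z0) (fst z)) < e / 2" by simp
        have "norm (Y (snd z0) (fst z) - Y (snd z0) (fst z0)) \<le> B * \<bar>fst z - fst z0\<bar>" using z z0 by (intro YB) auto
        also have "\<dots> < B * \<delta>" using d1 B by simp
        also have "\<dots> \<le> B * (e / (2 * B))" using B by (intro mult_left_mono) (auto simp: \<delta>_def)
        finally have 2: "norm (Y (snd z0) (fst z) - Y (snd z0) (fst z0)) < e / 2" using B by simp
        have "dist (Y (snd z) (fst z)) (Y (snd z0) (fst z0)) < e"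
          using dist_triangle[of "Y (snd z) (fst z)" "Y (snd z0) (fst z0)" "Y (snd z0) (fst z)"] 1 2 by (simp add: dist_norm)
        thus "dist (case z of (u, y) \<Rightarrow> Y y u) (case z0 of (u, y) \<Rightarrow> Y y u) < e" by (simp add: case_prod_unfold)
      qed
    qed
    show "\<exists>l. continuous_on (?J \<times> V) (\<lambda>(u, p). l u p) \<and> (\<forall>p\<in>V. l t' p = p \<and> curve_on W A X t' (t' + \<epsilon>) (\<lambda>u. l u p))"
    proof (intro exI[of _ l] conjI ballI)
      have "continuous_on V (snd c)" by (rule continuous_on_subset[OF ch(6)]) (use Vx in auto)
      hence "continuous_on (?J \<times> V) (\<lambda>z. snd c (snd z))"
        by (rule continuous_on_compose2[OF _ continuous_on_snd[OF continuous_on_id]]) auto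
      hence "continuous_on (?J \<times> V) (\<lambda>z. Y (snd c (snd z)) (fst z))"
        by (rule continuous_on_pair[OF Ycont continuous_on_fst[OF continuous_on_id]]) auto
      hence "continuous_on (?J \<times> V) (\<lambda>z. chart_inv c (Y (snd c (snd z)) (fst z)))"
        by (rule continuous_on_compose2[OF continuous_on_subset[OF ch(7) K(5)]]) (use YK(1) Vx in auto)
      thus "continuous_on (?J \<times> V) (\<lambda>(u, p). l u p)" by (simp add: l_def case_prod_unfold)
    next
      fix p assume p: "p \<in> V"
      note px = Vx[OF p]
      show "l t' p = p" by (simp add: l_def Y(1) ch(1)[OF px(3)])
      let ?y = "snd c p"
      have img: "Y ?y u \<in> chart_img c" if "u \<in> ?J" for u using YK(1)[OF px(1,2) that] K(5) by blast
      have lf: "l u p \<in> fst c" if "u \<in> ?J" for u unfolding l_def by (rule ch(3)[OF img[OF that]])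
      have sl: "snd c (l u p) = Y ?y u" if "u \<in> ?J" for u unfolding l_def by (rule ch(2)[OF img[OF that]])
      have Yc: "continuous_on ?J (Y ?y)" unfolding continuous_on_eq_continuous_within using has_vector_derivative_continuous[OF Y(2)] by blast
      have lc: "continuous_on ?J (\<lambda>u. l u p)" unfolding l_def
        by (rule continuous_on_compose2[OF ch(7) Yc]) (use img in auto)
      show "curve_on W A X t' (t' + \<epsilon>) (\<lambda>u. l u p)"
        unfolding curve_on_def
      proof (intro conjI ballI impI)
        show "(\<lambda>u. l u p) ` ?J \<subseteq> W" using lf ch(5) by auto
        show "continuous_on ?J (\<lambda>u. l u p)" by (rule lc)
        fix u d assume u: "u \<in> ?J" and d: "d \<in> A" "l u p \<in> fst d"
        obtain D where D: "(transition c d has_derivative D) (at (snd c (l u p)) within transition_dom c d)" "\<And>s. X s d (l u p) = D (X s c (l u p))"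
          using compatible[OF c(1) d(1)] lf[OF u] d(2) by blast
        have cd: "((snd c \<circ> (\<lambda>u. l u p)) has_vector_derivative X u c (l u p)) (at u within ?J)"
        proof (rule has_vector_derivative_transform[OF u])
          show "(Y ?y has_vector_derivative X u c (l u p)) (at u within ?J)"
            using Y(2)[OF u, of ?y] YK(2)[OF px(1,2) u] by (simp add: l_def)
        qed (simp add: sl)
        obtain O1 where O1: "open O1" "fst d = W \<inter> O1" using chart_simps(8)[OF charts[OF d(1)]] unfolding openin_open by blast
        have "\<forall>\<^sub>F s in at u within ?J. l s p \<in> O1"
          using lc u d(2) O1 unfolding continuous_on_def by (metis IntD2 topological_tendstoD)
        moreover have "\<forall>\<^sub>F s in at u within ?J. s \<in> ?J" by (simp add: eventually_at_filter)
        ultimately have ev: "\<forall>\<^sub>F s in at u within ?J. l s p \<in> fst c \<inter> fst d"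
          by eventually_elim (use lf ch(5) O1 in blast)
        show "((snd d \<circ> (\<lambda>u. l u p)) has_vector_derivative X u d (l u p)) (at u within ?J)"
          unfolding D(2)
          by (rule chart_change_derivative[of c d D "\<lambda>u. l u p", OF D(1) cd ev _ u ch(1)]) (use lf u d in auto)
      qed
    qed
  qed (use \<epsilon> V p0V in auto)
qed

text \<open>Finitely many of the local neighbourhoods cover the compact [a,b] \<times> W, and the
  least of their step sizes serves everywhere. The local flows agree on overlaps by uniqueness and
  therefore patch to a continuous map on W.\<close>

lemma uniform_local_flow:
  obtains d where "d > 0" "\<And>t'. t' \<in> {a..b} ==> \<exists>l. continuous_on ({t'..t' + d} \<times> W) (\<lambda>(u, p). l u p) \<and>
    (\<forall>p\<in>W. l t' p = p \<and> curve_on W A X t' (t' + d) (\<lambda>u. l u p))"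
proof -
  have "\<exists>h V. 0 < h \<and> openin (top_of_set W) V \<and> snd z \<in> V \<and> (\<forall>t'. \<bar>t' - fst z\<bar> \<le> h \<longrightarrow>
    (\<exists>l. continuous_on ({t'..t' + h} \<times> V) (\<lambda>(u, p). l u p) \<and>
      (\<forall>p\<in>V. l t' p = p \<and> curve_on W A X t' (t' + h) (\<lambda>u. l u p))))" if "z \<in> {a..b} \<times> W" for z
    using local_flow[of "snd z" "fst z"] that by (simp add: mem_Times_iff)
  then obtain h V where eV: "\<And>z. z \<in> {a..b} \<times> W ==> 0 < h z \<and> openin (top_of_set W) (V z) \<and> snd z \<in> V z \<and> (\<forall>t'. \<bar>t' - fst z\<bar> \<le> h z \<longrightarrow>
    (\<exists>l. continuous_on ({t'..t' + h z} \<times> V z) (\<lambda>(u, p). l u p) \<and>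
      (\<forall>p\<in>V z. l t' p = p \<and> curve_on W A X t' (t' + h z) (\<lambda>u. l u p))))"
    by metis
  have "\<exists>O'. open O' \<and> V z = W \<inter> O'" if "z \<in> {a..b} \<times> W" for z using eV[OF that] unfolding openin_open by blast
  then obtain O' where O': "\<And>z. z \<in> {a..b} \<times> W ==> open (O' z) \<and> V z = W \<inter> O' z" by metis
  have "\<exists>D\<subseteq>{a..b} \<times> W. finite D \<and> {a..b} \<times> W \<subseteq> (\<Union>z\<in>D. ball (fst z) (h z) \<times> O' z)"
  proof (rule compactE_image[of "{a..b} \<times> W" "{a..b} \<times> W" "\<lambda>z. ball (fst z) (h z) \<times> O' z"])
    show "compact ({a..b} \<times> W)" by (intro compact_Times compact_Icc compact_W)
    show "open (ball (fst z) (h z) \<times> O' z)" if "z \<in> {a..b} \<times> W" for z using O'[OF that] by (intro open_Times) auto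
    show "{a..b} \<times> W \<subseteq> (\<Union>z\<in>{a..b} \<times> W. ball (fst z) (h z) \<times> O' z)"
    proof
      fix z assume z: "z \<in> {a..b} \<times> W"
      hence "z \<in> ball (fst z) (h z) \<times> O' z" using eV[OF z] O'[OF z] by (auto simp: mem_Times_iff)
      thus "z \<in> (\<Union>z\<in>{a..b} \<times> W. ball (fst z) (h z) \<times> O' z)" using z by blast
    qed
  qed blast
  then obtain D where D: "D \<subseteq> {a..b} \<times> W" "finite D" "{a..b} \<times> W \<subseteq> (\<Union>z\<in>D. ball (fst z) (h z) \<times> O' z)" by blast
  \<comment> \<open>The inserted 1 keeps \<open>Min\<close> meaningful when no neighbourhoods are
    needed, as for an empty interval.\<close>
  define d where "d = Min (insert 1 (h ` D))"
  have d: "d > 0" "\<And>z. z \<in> D ==> d \<le> h z"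
    unfolding d_def using D eV by (auto simp: Min_gr_iff)
  show ?thesis
  proof (rule that[OF d(1)])
    fix t' assume t': "t' \<in> {a..b}"
    have "\<exists>V l. openin (top_of_set W) V \<and> p \<in> V \<and> continuous_on ({t'..t' + d} \<times> V) (\<lambda>(u, p). l u p) \<and>
      (\<forall>p\<in>V. l t' p = p \<and> curve_on W A X t' (t' + d) (\<lambda>u. l u p))" if p: "p \<in> W" for p
    proof -
      have "(t', p) \<in> (\<Union>z\<in>D. ball (fst z) (h z) \<times> O' z)" using D(3) t' p by blast
      then obtain z where z: "z \<in> D" "t' \<in> ball (fst z) (h z)" "p \<in> O' z" by auto
      have zD: "z \<in> {a..b} \<times> W" using z D by blast
      have "\<bar>t' - fst z\<bar> \<le> h z" using z(2) by (simp add: dist_real_def)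
      then obtain l where l: "continuous_on ({t'..t' + h z} \<times> V z) (\<lambda>(u, p). l u p)"
        "\<And>p. p \<in> V z ==> l t' p = p \<and> curve_on W A X t' (t' + h z) (\<lambda>u. l u p)" using eV[OF zD] by blast
      have "continuous_on ({t'..t' + d} \<times> V z) (\<lambda>(u, p). l u p)"
        by (rule continuous_on_subset[OF l(1)]) (use d(2)[OF z(1)] in auto)
      moreover have "curve_on W A X t' (t' + d) (\<lambda>u. l u p)" if "p \<in> V z" for p
        by (rule curve_on_subinterval[of W A X t' "t' + h z"]) (use l(2)[OF that] d(2)[OF z(1)] in auto)
      ultimately show ?thesis
        using eV[OF zD] O'[OF zD] z(3) p l(2) by (intro exI[of _ "V z"] exI[of _ l]) auto
    qed
    then obtain V' l where Vl: "\<And>p. p \<in> W ==> openin (top_of_set W) (V' p) \<and> p \<in> V' p \<and> continuous_on ({t'..t' + d} \<times> V' p) (\<lambda>(u, q). l p u q) \<and>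
      (\<forall>q\<in>V' p. l p t' q = q \<and> curve_on W A X t' (t' + d) (\<lambda>u. l p u q))" by metis
    define m where "m = (\<lambda>u p. l p u p)"
    have meq: "m u q = l p u q" if "p \<in> W" "q \<in> V' p" "u \<in> {t'..t' + d}" for p q u
    proof -
      have q: "q \<in> W" using Vl[OF that(1)] that(2) openin_imp_subset by blast
      show ?thesis unfolding m_def
        by (rule curve_unique[of t' "t' + d" "\<lambda>u. l q u q" "\<lambda>u. l p u q" t'])
          (use Vl[OF q] Vl[OF that(1)] that d(1) in auto)
    qed
    have "continuous_on ({t'..t' + d} \<times> W) (\<lambda>(u, p). m u p)"
      unfolding continuous_on_eq_continuous_within
    proof
      fix z assume z: "z \<in> {t'..t' + d} \<times> W"
      hence p: "snd z \<in> W" by (simp add: mem_Times_iff)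
      obtain O1 where O1: "open O1" "V' (snd z) = W \<inter> O1" using Vl[OF p] unfolding openin_open by blast
      have eq: "at z within ({t'..t' + d} \<times> V' (snd z)) = at z within ({t'..t' + d} \<times> W)"
        by (rule at_within_nhd[where S = "UNIV \<times> O1"]) (use O1 Vl[OF p] in \<open>auto simp: mem_Times_iff open_Times\<close>)
      have "continuous_on ({t'..t' + d} \<times> V' (snd z)) (\<lambda>(u, q). m u q)"
        by (rule continuous_on_eq[of _ "\<lambda>(u, q). l (snd z) u q"]) (use Vl[OF p] meq[OF p] in auto)
      moreover have "z \<in> {t'..t' + d} \<times> V' (snd z)" using z Vl[OF p] by (auto simp: mem_Times_iff)
      ultimately have "continuous (at z within ({t'..t' + d} \<times> V' (snd z))) (\<lambda>(u, q). m u q)"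
        unfolding continuous_on_eq_continuous_within by (rule bspec)
      thus "continuous (at z within ({t'..t' + d} \<times> W)) (\<lambda>(u, p). m u p)" by (simp only: eq)
    qed
    moreover have "m t' p = p \<and> curve_on W A X t' (t' + d) (\<lambda>u. m u p)" if "p \<in> W" for p
      using Vl[OF that] by (simp add: m_def)
    ultimately show "\<exists>l. continuous_on ({t'..t' + d} \<times> W) (\<lambda>(u, p). l u p) \<and>
      (\<forall>p\<in>W. l t' p = p \<and> curve_on W A X t' (t' + d) (\<lambda>u. l u p))" by blast
  qed
qed

text \<open>The existence time d does not depend on the starting time or point, so finitely many
  restarts reach b.\<close>

lemma flow_exists:
  assumes ab: "a \<le> b"
  obtains f where "continuous_on ({a..b} \<times> W) (\<lambda>(u, p). f u p)"
    "\<And>p. p \<in> W ==> f a p = p" "\<And>p. p \<in> W ==> curve_on W A X a b (\<lambda>u. f u p)"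
proof -
  define P where "P = (\<lambda>T. \<exists>f. continuous_on ({a..T} \<times> W) (\<lambda>(u, p). f u p) \<and> (\<forall>p\<in>W. f a p = p \<and> curve_on W A X a T (\<lambda>u. f u p)))"
  obtain d where d: "d > 0" "\<And>t'. t' \<in> {a..b} ==> \<exists>l. continuous_on ({t'..t' + d} \<times> W) (\<lambda>(u, p). l u p) \<and>
    (\<forall>p\<in>W. l t' p = p \<and> curve_on W A X t' (t' + d) (\<lambda>u. l u p))" using uniform_local_flow[where a = a and b = b] by blast
  have step: "P (T + d)" if PT: "P T" and T: "a \<le> T" "T \<le> b" for T
  proof -
    obtain f where f: "continuous_on ({a..T} \<times> W) (\<lambda>(u, p). f u p)" "\<And>p. p \<in> W ==> f a p = p \<and> curve_on W A X a T (\<lambda>u. f u p)"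
      using PT unfolding P_def by blast
    obtain l where l: "continuous_on ({T..T + d} \<times> W) (\<lambda>(u, p). l u p)" "\<And>p. p \<in> W ==> l T p = p \<and> curve_on W A X T (T + d) (\<lambda>u. l u p)"
      using d(2)[of T] T by auto
    have fW: "f T p \<in> W" if "p \<in> W" for p using f(2)[OF that] T by (auto simp: curve_on_def)
    define g where "g = (\<lambda>u p. if u \<le> T then f u p else l u (f T p))"
    have "continuous_on ({a..T} \<times> W \<union> {T..T + d} \<times> W) (\<lambda>z. if fst z \<le> T then f (fst z) (snd z) else l (fst z) (f T (snd z)))"
    proof (rule continuous_on_If)
      show "closed ({a..T} \<times> W)" "closed ({T..T + d} \<times> W)" by (auto intro!: closed_Times compact_imp_closed[OF compact_W])
      show "continuous_on ({a..T} \<times> W) (\<lambda>z. f (fst z) (snd z))" using f(1) by (simp add: case_prod_unfold)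
      have "continuous_on W (f T)"
        by (rule continuous_on_pair[OF f(1) continuous_on_const continuous_on_id]) (use T in auto)
      hence "continuous_on ({T..T + d} \<times> W) (\<lambda>z. f T (snd z))"
        by (rule continuous_on_compose2[OF _ continuous_on_snd[OF continuous_on_id]]) auto
      thus "continuous_on ({T..T + d} \<times> W) (\<lambda>z. l (fst z) (f T (snd z)))"
        by (rule continuous_on_pair[OF l(1) continuous_on_fst[OF continuous_on_id]]) (use fW in auto)
    qed (use l(2) fW in auto)
    moreover have "{a..T} \<times> W \<union> {T..T + d} \<times> W = {a..T + d} \<times> W" using T d(1) by auto
    ultimately have "continuous_on ({a..T + d} \<times> W) (\<lambda>(u, p). g u p)" by (simp add: g_def case_prod_unfold)
    moreover have "g a p = p \<and> curve_on W A X a (T + d) (\<lambda>u. g u p)" if p: "p \<in> W" for p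
    proof
      show "g a p = p" using T f(2)[OF p] by (simp add: g_def)
      show "curve_on W A X a (T + d) (\<lambda>u. g u p)" unfolding g_def
        by (rule curve_on_join) (use f(2)[OF p] l(2)[OF fW[OF p]] T d(1) in auto)
    qed
    ultimately show ?thesis unfolding P_def by blast
  qed
  \<comment> \<open>On a one-point interval the derivative condition is vacuous.\<close>
  have base: "P a"
  proof -
    have "curve_on W A X a a (\<lambda>u. p)" if "p \<in> W" for p
      using that by (auto simp: curve_on_def has_vector_derivative_def has_derivative_within_singleton_iff bounded_linear_scaleR_left)
    moreover have "continuous_on ({a..a} \<times> W) (\<lambda>(u, p). p)" by (simp add: case_prod_unfold continuous_on_snd)
    ultimately show ?thesis unfolding P_def by (intro exI[of _ "\<lambda>u p. p"]) auto
  qed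
  have "\<exists>T. min b (a + real n * d) \<le> T \<and> a \<le> T \<and> P T" for n
  proof (induction n)
    case 0 thus ?case using base by (intro exI[of _ a]) auto
  next
    case (Suc n)
    then obtain T where T: "min b (a + real n * d) \<le> T" "a \<le> T" "P T" by blast
    show ?case
    proof (cases "b \<le> T")
      case True
      thus ?thesis using T by (intro exI[of _ T]) auto
    next
      case False
      hence "P (T + d)" using step T by simp
      thus ?thesis using T False d(1) by (intro exI[of _ "T + d"]) (auto simp: algebra_simps)
    qed
  qed
  moreover obtain n where n: "(b - a) / d < real n" using reals_Archimedean2 by blast
  ultimately obtain T where T: "min b (a + real n * d) \<le> T" "a \<le> T" "P T" by blast
  have "b - a \<le> real n * d" using n d(1) by (simp add: field_simps)
  hence "b \<le> T" using T by auto
  obtain f where f: "continuous_on ({a..T} \<times> W) (\<lambda>(u, p). f u p)" "\<And>p. p \<in> W ==> f a p = p \<and> curve_on W A X a T (\<lambda>u. f u p)"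
    using T(3) unfolding P_def by blast
  show ?thesis
  proof (rule that[of f])
    show "continuous_on ({a..b} \<times> W) (\<lambda>(u, p). f u p)" by (rule continuous_on_subset[OF f(1)]) (use \<open>b \<le> T\<close> in auto)
    show "curve_on W A X a b (\<lambda>u. f u p)" if "p \<in> W" for p
      by (rule curve_on_subinterval[of W A X a T]) (use f(2)[OF that] \<open>b \<le> T\<close> in auto)
  qed (use f(2) in auto)
qed

text \<open>It serves twice: with v = -1 and T s = t - s it produces the backward flow, and with
  speed 1/\<tau> it describes the projections of Reeb orbits to W.\<close>

lemma reparametrized:
  assumes v: "continuous_on UNIV v" and T: "continuous_on UNIV T"
  shows "flow_domain W A (\<lambda>s c p. v s *\<^sub>R X (T s) c p)"
proof (unfold_locales, goal_cases)
  case (4 c t x)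
  obtain r L where r: "r > 0" "cball x r \<inter> half_space \<subseteq> chart_img c" and L0: "L \<ge> 0"
    and Xc: "continuous_on ({T t - r..T t + r} \<times> (cball x r \<inter> half_space)) (\<lambda>(s, y). X s c (chart_inv c y))"
    and L: "\<forall>u\<in>{T t - r..T t + r}. \<forall>y\<in>cball x r \<inter> half_space. \<forall>z\<in>cball x r \<inter> half_space.
         norm (X u c (chart_inv c y) - X u c (chart_inv c z)) \<le> L * norm (y - z)"
    using local_lipschitz[OF 4, of "T t"] by blast
  have "isCont T t" using T by (simp add: continuous_on_eq_continuous_at)
  then obtain d where d: "d > 0" "\<And>s. dist s t < d ==> dist (T s) (T t) < r"
    using r unfolding continuous_at_eps_delta by (metis dist_commute)
  define r' where "r' = min r (d / 2)"
  have r': "r' > 0" "r' \<le> r" using r d by (auto simp: r'_def)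
  have TI: "T s \<in> {T t - r..T t + r}" if "s \<in> {t - r'..t + r'}" for s
  proof -
    have "dist s t < d" using that d by (auto simp: r'_def dist_real_def)
    from d(2)[OF this] show ?thesis by (auto simp: dist_real_def)
  qed
  have "bounded (v ` {t - r'..t + r'})"
    by (intro compact_imp_bounded compact_continuous_image continuous_on_subset[OF v]) auto
  then obtain R where R: "\<And>s. s \<in> {t - r'..t + r'} ==> \<bar>v s\<bar> \<le> R"
    unfolding bounded_iff using that by (metis imageI real_norm_def)
  have R0: "R \<ge> 0" using R[of t] r' by simp
  show ?case
  proof (rule exI[of _ r'], rule conjI[OF r'(1)], rule exI[of _ "R * L"], intro conjI)
    have "continuous_on ({t - r'..t + r'} \<times> (cball x r' \<inter> half_space)) (\<lambda>z. T (fst z))"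
      by (rule continuous_on_compose2[OF T continuous_on_fst[OF continuous_on_id]]) auto
    hence 1: "continuous_on ({t - r'..t + r'} \<times> (cball x r' \<inter> half_space)) (\<lambda>z. X (T (fst z)) c (chart_inv c (snd z)))"
      by (rule continuous_on_pair[OF Xc _ continuous_on_snd[OF continuous_on_id]]) (use TI r' in auto)
    have 2: "continuous_on ({t - r'..t + r'} \<times> (cball x r' \<inter> half_space)) (\<lambda>z. v (fst z))"
      by (intro continuous_on_compose2[OF v continuous_on_fst[OF continuous_on_id]]) auto
    show "continuous_on ({t - r'..t + r'} \<times> (cball x r' \<inter> half_space)) (\<lambda>(s, y). v s *\<^sub>R X (T s) c (chart_inv c y))"
      using continuous_on_scaleR[OF 2 1] by (simp add: case_prod_unfold)
    show "\<forall>s\<in>{t - r'..t + r'}. \<forall>y\<in>cball x r' \<inter> half_space. \<forall>z\<in>cball x r' \<inter> half_space.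
       norm (v s *\<^sub>R X (T s) c (chart_inv c y) - v s *\<^sub>R X (T s) c (chart_inv c z)) \<le> R * L * norm (y - z)"
    proof (intro ballI)
      fix s y z assume s: "s \<in> {t - r'..t + r'}" and yz: "y \<in> cball x r' \<inter> half_space" "z \<in> cball x r' \<inter> half_space"
      have "norm (v s *\<^sub>R X (T s) c (chart_inv c y) - v s *\<^sub>R X (T s) c (chart_inv c z))
         = \<bar>v s\<bar> * norm (X (T s) c (chart_inv c y) - X (T s) c (chart_inv c z))"
        by (simp add: scaleR_diff_right[symmetric])
      also have "\<dots> \<le> R * (L * norm (y - z))"
        by (rule mult_mono) (use R s R0 L TI[OF s] yz r' in auto)
      finally show "norm (v s *\<^sub>R X (T s) c (chart_inv c y) - v s *\<^sub>R X (T s) c (chart_inv c z)) \<le> R * L * norm (y - z)"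
        by (simp add: mult.assoc)
    qed
  qed (use r r' L0 R0 in auto)
next
  case (6 c d p)
  obtain D where D: "(transition c d has_derivative D) (at (snd c p) within transition_dom c d)" "\<And>s. X s d p = D (X s c p)"
    using compatible[OF 6] by blast
  show ?case using D(2) linear_scale[OF has_derivative_linear[OF D(1)]] by (intro exI[of _ D] conjI D(1)) simp
qed (use compact_W charts cover tangent in auto)

end

section \<open>Linear algebra and Lipschitz estimates for Hamiltonian vector fields\<close>

text \<open>Identifying a functional with its values on the basis turns u \<mapsto> w u into an
  injective linear map of the space to itself, which is surjective by finite dimension.\<close>

lemma nondegenerate_solve:
  fixes w :: "'e::euclidean_space \<Rightarrow> 'e \<Rightarrow> real"
  assumes w: "\<And>u. linear (w u)" "\<And>v. linear (\<lambda>u. w u v)" and nondeg: "\<And>u. u \<noteq> 0 ==> \<exists>v. w u v \<noteq> 0" and l: "linear l"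
  shows "\<exists>!x. \<forall>v. w x v = l v"
proof -
  define V where "V = (\<lambda>u. \<Sum>b\<in>Basis. w u b *\<^sub>R b)"
  have Vb: "V u \<bullet> b = w u b" if "b \<in> Basis" for u b
    unfolding V_def using that by (simp add: inner_sum_left_Basis)
  have ext: "w u v = (\<Sum>b\<in>Basis. (v \<bullet> b) * w u b)" for u v using linear_Basis_sum[OF w(1), of u v] by simp
  have lin: "linear V"
    unfolding V_def using w(2) by (intro linear_compose_sum ballI) (simp add: linear_iff scaleR_left_distrib)
  have "inj V"
    unfolding linear_injective_0[OF lin]
  proof (intro allI impI)
    fix u assume "V u = 0"
    hence "w u v = 0" for v using Vb[of _ u] ext[of u v] by simp
    thus "u = 0" using nondeg[of u] by metis
  qed
  hence "surj V" using lin linear_injective_imp_surjective by blast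
  then obtain x where x: "V x = (\<Sum>b\<in>Basis. l b *\<^sub>R b)" by (metis surjD)
  have "w x b = l b" if "b \<in> Basis" for b using Vb[OF that, of x] x that by (simp add: inner_sum_left_Basis)
  hence eq: "(\<Sum>b\<in>Basis. (v \<bullet> b) * w x b) = (\<Sum>b\<in>Basis. (v \<bullet> b) *\<^sub>R l b)" for v by simp
  have "w x v = l v" for v
    using ext[of x v] eq[of v] linear_Basis_sum[OF l, of v] by (metis (no_types))
  hence "\<forall>v. w x v = l v" by blast
  moreover have "y = x" if "\<forall>v. w y v = l v" for y
  proof (rule ccontr)
    assume "y \<noteq> x"
    then obtain v where "w (y - x) v \<noteq> 0" using nondeg[of "y - x"] by auto
    thus False using that \<open>\<forall>v. w x v = l v\<close> linear_diff[OF w(2)[of v], of y x] by simp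
  qed
  ultimately show ?thesis by blast
qed

text \<open>\<open>ext_deriv\<close> with the chart stripped off, so that bilinearity can be proved
  in Euclidean space.\<close>

definition form_d :: "('e::euclidean_space \<Rightarrow> 'e \<Rightarrow> real) \<Rightarrow> 'e set \<Rightarrow> 'e \<Rightarrow> 'e \<Rightarrow> 'e \<Rightarrow> real" where
  "form_d a S x u v = FD (\<lambda>y. a y v) (at x within S) u - FD (\<lambda>y. a y u) (at x within S) v"

lemma ext_deriv_form_d: "ext_deriv lam c p = form_d (\<lambda>y. lam c (chart_inv c y)) (chart_img c) (snd c p)"
  by (simp add: fun_eq_iff ext_deriv_def form_d_def)

lemma one_form_derivative:
  assumes S: "fat S" "x \<in> S" and a: "\<And>v. smooth_on S (\<lambda>y. a y v)" "\<And>y. y \<in> S ==> linear (a y)"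
  shows "linear (FD (\<lambda>y. a y v) (at x within S))"
    "FD (\<lambda>y. a y v) (at x within S) u = (\<Sum>b\<in>Basis. (v \<bullet> b) * FD (\<lambda>y. a y b) (at x within S) u)"
proof -
  have A: "((\<lambda>y. a y b) has_derivative FD (\<lambda>y. a y b) (at x within S)) (at x within S)" for b
    by (rule smooth_on_has_derivative[OF S(1) a(1) S(2)])
  show "linear (FD (\<lambda>y. a y v) (at x within S))" by (rule has_derivative_linear[OF A])
  have "((\<lambda>y. \<Sum>b\<in>Basis. (v \<bullet> b) * a y b) has_derivative (\<lambda>u. \<Sum>b\<in>Basis. (v \<bullet> b) * FD (\<lambda>y. a y b) (at x within S) u)) (at x within S)"
    by (intro has_derivative_sum has_derivative_mult_right A)
  hence "((\<lambda>y. a y v) has_derivative (\<lambda>u. \<Sum>b\<in>Basis. (v \<bullet> b) * FD (\<lambda>y. a y b) (at x within S) u)) (at x within S)"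
    by (rule has_derivative_transform[rotated 2]) (use S linear_Basis_sum[OF a(2)] in auto)
  from fat_frechet_derivative[OF S this]
  show "FD (\<lambda>y. a y v) (at x within S) u = (\<Sum>b\<in>Basis. (v \<bullet> b) * FD (\<lambda>y. a y b) (at x within S) u)" by simp
qed

lemma linear_sum_inner: "linear (\<lambda>v. \<Sum>b\<in>Basis. (v \<bullet> b) * k b :: real)"
  by (auto simp: linear_iff inner_add_left distrib_right sum.distrib sum_distrib_left mult.assoc)

lemma form_d_bilinear:
  assumes S: "fat S" "x \<in> S" and a: "\<And>v. smooth_on S (\<lambda>y. a y v)" "\<And>y. y \<in> S ==> linear (a y)"
  shows "linear (form_d a S x u)" "linear (\<lambda>u. form_d a S x u v)"
proof -
  note d = one_form_derivative[OF S a]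
  have "linear (\<lambda>v. FD (\<lambda>y. a y v) (at x within S) u)" for u
  proof -
    have "(\<lambda>v. FD (\<lambda>y. a y v) (at x within S) u)
        = (\<lambda>v. \<Sum>b\<in>Basis. (v \<bullet> b) * FD (\<lambda>y. a y b) (at x within S) u)"
      by (rule ext) (rule d(2))
    thus ?thesis by (simp only: linear_sum_inner)
  qed
  thus "linear (form_d a S x u)" "linear (\<lambda>u. form_d a S x u v)"
    unfolding form_d_def using d(1) by (auto intro!: linear_compose_sub)
qed

lemma C1_lipschitz:
  fixes f :: "'a::euclidean_space \<Rightarrow> 'b::real_normed_vector"
  assumes ck: "ck_on (Suc 0) U f" and K: "compact K" "convex K" "K \<subseteq> U"
  obtains L where "L \<ge> 0" "\<And>x y. x \<in> K ==> y \<in> K ==> norm (f x - f y) \<le> L * norm (x - y)"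
proof -
  have "\<exists>B. \<forall>x\<in>K. norm (FD f (at x) b) \<le> B" for b
  proof -
    have "continuous_on K (\<lambda>x. FD f (at x) b)"
      by (rule continuous_on_subset[OF _ K(3)]) (use ck in simp)
    hence "bounded ((\<lambda>x. FD f (at x) b) ` K)"
      by (intro compact_imp_bounded compact_continuous_image K)
    thus ?thesis by (auto simp: bounded_iff)
  qed
  then obtain B where B: "\<And>b x. x \<in> K ==> norm (FD f (at x) b) \<le> B b" by metis
  define L where "L = (\<Sum>b\<in>Basis. \<bar>B b\<bar>)"
  show ?thesis
  proof (rule that[of L])
    show "L \<ge> 0" unfolding L_def by (simp add: sum_nonneg)
    fix x y assume xy: "x \<in> K" "y \<in> K"
    show "norm (f x - f y) \<le> L * norm (x - y)"
    proof (rule differentiable_bound[OF K(2) _ _ xy])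
      fix z assume z: "z \<in> K"
      hence fd: "(f has_derivative FD f (at z)) (at z)" using ck_on_has_derivative[OF ck] K(3) by blast
      thus "(f has_derivative FD f (at z)) (at z within K)" by (rule has_derivative_at_withinI)
      show "onorm (FD f (at z)) \<le> L"
      proof (rule onorm_le)
        fix v
        have "norm (FD f (at z) v) = norm (\<Sum>b\<in>Basis. (v \<bullet> b) *\<^sub>R FD f (at z) b)"
          by (simp add: linear_Basis_sum[OF has_derivative_linear[OF fd], symmetric])
        also have "\<dots> \<le> (\<Sum>b\<in>Basis. norm ((v \<bullet> b) *\<^sub>R FD f (at z) b))" by (rule norm_sum)
        also have "\<dots> \<le> (\<Sum>b\<in>Basis. norm v * \<bar>B b\<bar>)"
          using B[OF z] Basis_le_norm[of _ v] by (auto intro!: sum_mono mult_mono order_trans[OF B[OF z]])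
        finally show "norm (FD f (at z) v) \<le> L * norm v" by (simp add: L_def sum_distrib_left mult.commute)
      qed
    qed
  qed
qed

text \<open>The solution of a linear system with Lipschitz coefficients is Lipschitz, without
  inverting a matrix: nondegeneracy on the compact product of \<open>K\<close> with the unit sphere
  gives a lower bound m |u| for the size of V z u, and V z (X z - X z') is controlled by differences
  of coefficients.\<close>

lemma solve_lipschitz:
  fixes w :: "'e::euclidean_space \<Rightarrow> 'e \<Rightarrow> 'z::real_normed_vector \<Rightarrow> real" and X :: "'z \<Rightarrow> 'e"
  assumes K: "compact K"
    and w: "\<And>a b z z'. a \<in> Basis ==> b \<in> Basis ==> z \<in> K ==> z' \<in> K ==> \<bar>w a b z - w a b z'\<bar> \<le> L * norm (z - z')"
    and h: "\<And>b z z'. b \<in> Basis ==> z \<in> K ==> z' \<in> K ==> \<bar>h b z - h b z'\<bar> \<le> L * norm (z - z')"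
    and nondeg: "\<And>u z. z \<in> K ==> u \<noteq> 0 ==> \<exists>b\<in>Basis. (\<Sum>a\<in>Basis. (u \<bullet> a) * w a b z) \<noteq> 0"
    and X: "\<And>b z. b \<in> Basis ==> z \<in> K ==> (\<Sum>a\<in>Basis. (X z \<bullet> a) * w a b z) = h b z"
    and L: "L \<ge> 0"
  obtains C where "C \<ge> 0" "\<And>z z'. z \<in> K ==> z' \<in> K ==> norm (X z - X z') \<le> C * norm (z - z')"
proof (cases "K = {}")
  case True
  thus ?thesis using that[of 0] by simp
next
  case False
  have lipc: "continuous_on K f" if "\<And>z z'. z \<in> K ==> z' \<in> K ==> \<bar>f z - f z'\<bar> \<le> L * norm (z - z')" for f :: "'z \<Rightarrow> real"
    by (rule lipschitz_on_continuous_on[of L], rule lipschitz_onI) (use that L in \<open>auto simp: dist_norm\<close>)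
  have wc: "continuous_on K (w a b)" if "a \<in> Basis" "b \<in> Basis" for a b using w[OF that] by (rule lipc)
  have hc: "continuous_on K (h b)" if "b \<in> Basis" for b using h[OF that] by (rule lipc)
  define V where "V = (\<lambda>z u b. \<Sum>a\<in>Basis. (u \<bullet> a) * w a b z)"
  define N where "N = (\<lambda>z u. \<Sum>b\<in>Basis. \<bar>V z u b\<bar>)"
  have Vs: "V z (k *\<^sub>R u) b = k * V z u b" "V z (u - v) b = V z u b - V z v b" for z k u v b
    by (simp_all add: V_def sum_distrib_left mult.assoc inner_diff_left left_diff_distrib sum_subtractf)
  have "continuous_on (K \<times> sphere (0::'e) 1) (\<lambda>zu. N (fst zu) (snd zu))"
    unfolding N_def V_def
    by (intro continuous_on_sum continuous_on_rabs continuous_on_mult continuous_on_inner continuous_on_snd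
        continuous_on_id continuous_on_const continuous_on_compose2[OF wc continuous_on_fst[OF continuous_on_id]]) auto
  note c1 = this
  have c2: "compact (K \<times> sphere (0::'e) 1)" by (intro compact_Times K compact_sphere)
  have c3: "K \<times> sphere (0::'e) 1 \<noteq> {}" using False by simp
  obtain zu0 where zu0: "zu0 \<in> K \<times> sphere 0 1" "\<And>zu. zu \<in> K \<times> sphere 0 1 ==> N (fst zu0) (snd zu0) \<le> N (fst zu) (snd zu)"
    using continuous_attains_inf[OF c2 c3 c1] by blast
  define m where "m = N (fst zu0) (snd zu0)"
  have m: "m > 0"
  proof -
    have "fst zu0 \<in> K" "snd zu0 \<noteq> 0" using zu0(1) by (auto simp: mem_Times_iff)
    then obtain b where b: "b \<in> Basis" "V (fst zu0) (snd zu0) b \<noteq> 0" using nondeg unfolding V_def by blast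
    have "\<bar>V (fst zu0) (snd zu0) b\<bar> \<le> m" unfolding m_def N_def using b(1) by (intro member_le_sum) auto
    thus ?thesis using b(2) by linarith
  qed
  have low: "m * norm u \<le> N z u" if z: "z \<in> K" for z u
  proof (cases "u = 0")
    case True thus ?thesis by (simp add: N_def sum_nonneg)
  next
    case False
    have "m \<le> N z ((1 / norm u) *\<^sub>R u)" unfolding m_def using zu0(2)[of "(z, (1 / norm u) *\<^sub>R u)"] z False by simp
    also have "\<dots> = (1 / norm u) * N z u" unfolding N_def Vs by (simp add: abs_mult sum_distrib_left)
    finally show ?thesis using False by (simp add: field_simps)
  qed
  have VX: "V z (X z) b = h b z" if "b \<in> Basis" "z \<in> K" for z b using X[OF that] by (simp add: V_def)
  have "\<exists>B. \<forall>z\<in>K. (\<Sum>b\<in>Basis. \<bar>h b z\<bar>) \<le> B"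
  proof -
    have "continuous_on K (\<lambda>z. \<Sum>b\<in>Basis. \<bar>h b z\<bar>)" by (intro continuous_on_sum continuous_on_rabs hc)
    from continuous_attains_sup[OF K False this] show ?thesis by blast
  qed
  then obtain B where B: "\<And>z. z \<in> K ==> (\<Sum>b\<in>Basis. \<bar>h b z\<bar>) \<le> B" by blast
  have XB: "norm (X z) \<le> \<bar>B\<bar> / m" if z: "z \<in> K" for z
  proof -
    have "m * norm (X z) \<le> N z (X z)" by (rule low[OF z])
    also have "\<dots> = (\<Sum>b\<in>Basis. \<bar>h b z\<bar>)" unfolding N_def using VX z by simp
    also have "\<dots> \<le> \<bar>B\<bar>" using B[OF z] by simp
    finally show ?thesis using m by (simp add: field_simps)
  qed
  define n where "n = real DIM('e)"
  \<comment> \<open>Each of the n components of V z (X z - X z') is at most L |z - z'| from the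
    right side, plus n terms from the matrix, where |X z'| \<le> |B| / m; the last division by m is
    the lower bound on V.\<close>
  define C where "C = n * (L + n * (\<bar>B\<bar> / m) * L) / m"
  show ?thesis
  proof (rule that[of C])
    show "C \<ge> 0" unfolding C_def n_def using m L by simp
    fix z z' assume z: "z \<in> K" "z' \<in> K"
    have each: "\<bar>V z (X z - X z') b\<bar> \<le> L * norm (z - z') + n * (\<bar>B\<bar> / m) * L * norm (z - z')" if b: "b \<in> Basis" for b
    proof -
      have "V z (X z - X z') b = (h b z - h b z') - (\<Sum>a\<in>Basis. (X z' \<bullet> a) * (w a b z - w a b z'))"
        unfolding Vs using VX[OF b z(1)] VX[OF b z(2)]
        by (simp add: V_def right_diff_distrib sum_subtractf)
      moreover have "\<bar>\<Sum>a\<in>Basis. (X z' \<bullet> a) * (w a b z - w a b z')\<bar> \<le> n * (\<bar>B\<bar> / m) * L * norm (z - z')"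
      proof -
        have "\<bar>\<Sum>a\<in>Basis. (X z' \<bullet> a) * (w a b z - w a b z')\<bar> \<le> (\<Sum>a\<in>Basis. \<bar>(X z' \<bullet> a) * (w a b z - w a b z')\<bar>)" by (rule sum_abs)
        also have "\<dots> \<le> (\<Sum>a\<in>(Basis::'e set). (\<bar>B\<bar> / m) * (L * norm (z - z')))"
        proof (rule sum_mono)
          fix a :: 'e assume a: "a \<in> Basis"
          have "\<bar>X z' \<bullet> a\<bar> \<le> \<bar>B\<bar> / m" using Basis_le_norm[OF a, of "X z'"] XB[OF z(2)] by linarith
          thus "\<bar>(X z' \<bullet> a) * (w a b z - w a b z')\<bar> \<le> (\<bar>B\<bar> / m) * (L * norm (z - z'))"
            unfolding abs_mult using w[OF a b z] m by (intro mult_mono) auto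
        qed
        finally show ?thesis by (simp add: n_def mult.assoc)
      qed
      ultimately show ?thesis using h[OF b z] by linarith
    qed
    have "m * norm (X z - X z') \<le> N z (X z - X z')" by (rule low[OF z(1)])
    also have "\<dots> \<le> (\<Sum>b\<in>(Basis::'e set). L * norm (z - z') + n * (\<bar>B\<bar> / m) * L * norm (z - z'))"
      unfolding N_def by (rule sum_mono) (rule each)
    also have "\<dots> = n * (L + n * (\<bar>B\<bar> / m) * L) * norm (z - z')" by (simp add: n_def algebra_simps)
    finally show "norm (X z - X z') \<le> C * norm (z - z')" unfolding C_def using m by (simp add: field_simps)
  qed
qed

text \<open>For v parallel to the boundary hyperplane the line x + s v stays in S for small s of
  both signs, and f is constant on it. Applied to H on the boundary of W and to the defining
  function of the boundary of the tube.\<close>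

lemma derivative_zero_along_boundary:
  fixes f :: "'e::euclidean_space \<Rightarrow> 'b::real_normed_vector"
  assumes f: "(f has_derivative f') (at x within S)" and S: "openin (top_of_set half_space) S" "x \<in> S" "x \<bullet> conormal = 0"
    and const: "\<And>y. y \<in> S ==> y \<bullet> conormal = 0 ==> f y = k" and v: "v \<bullet> conormal = 0"
  shows "f' v = 0"
proof -
  obtain U where U: "open U" "S = half_space \<inter> U" using S(1) unfolding openin_open by blast
  define J where "J = (\<lambda>s. x + s *\<^sub>R v) -` U"
  have "continuous_on UNIV (\<lambda>s. x + s *\<^sub>R v)" by (intro continuous_intros)
  hence J: "open J" "(0::real) \<in> J" unfolding J_def using U S(2) by (auto intro: open_vimage)
  have mem: "x + s *\<^sub>R v \<in> S \<and> (x + s *\<^sub>R v) \<bullet> conormal = 0" if "s \<in> J" for s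
    using that v S(3) unfolding J_def U by (auto simp: half_space_def inner_add_left)
  have p: "((\<lambda>s. x + s *\<^sub>R v) has_derivative (\<lambda>h. h *\<^sub>R v)) (at 0 within J)" by (auto intro!: derivative_eq_intros)
  have "(f has_derivative f') (at (x + 0 *\<^sub>R v) within (\<lambda>s. x + s *\<^sub>R v) ` J)"
    by (rule has_derivative_subset[of _ _ _ S]) (use f mem in auto)
  from has_derivative_in_compose[OF p this]
  have "((\<lambda>s. f (x + s *\<^sub>R v)) has_derivative (\<lambda>h. f' (h *\<^sub>R v))) (at 0 within J)" .
  moreover have "((\<lambda>s. f (x + s *\<^sub>R v)) has_derivative (\<lambda>h. 0)) (at 0 within J)"
    by (rule has_derivative_transform[OF J(2) _ has_derivative_const[of k]]) (use mem const in auto)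
  ultimately have "(\<lambda>h. f' (h *\<^sub>R v)) = (\<lambda>h. 0)" using has_derivative_unique J by (metis at_within_open)
  from fun_cong[OF this, of 1] show ?thesis by simp
qed

lemma continuous_on_locally:
  fixes f :: "'a::t2_space \<Rightarrow> 'b::topological_space"
  assumes "\<And>z. z \<in> S ==> \<exists>O'. open O' \<and> z \<in> O' \<and> continuous_on (S \<inter> O') f"
  shows "continuous_on S f"
  unfolding continuous_on_eq_continuous_within
proof
  fix z assume z: "z \<in> S"
  then obtain O' where O': "open O'" "z \<in> O'" "continuous_on (S \<inter> O') f" using assms by blast
  hence "continuous (at z within (S \<inter> O')) f" using z by (simp add: continuous_on_eq_continuous_within)
  moreover have "at z within (S \<inter> O') = at z within S" by (rule at_within_nhd[where S = O']) (use O' in auto)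
  ultimately show "continuous (at z within S) f" by simp
qed

section \<open>The Hamiltonian vector field\<close>

text \<open>The second chart enters only through its domain. The lemma is also applied to a pair
  made of a smaller open set and the coordinate map of \<open>c\<close> itself, in order to shrink a
  chart.\<close>

lemma openin_transition_dom:
  assumes c: "is_chart M c" and d: "openin (top_of_set M) (fst d)"
  obtains O' where "open O'" "transition_dom c d = chart_img c \<inter> O'"
proof -
  obtain V where V: "open V" "fst d = M \<inter> V" using d unfolding openin_open by blast
  note ch = chart_simps[OF c]
  obtain O' where O': "open O'" "chart_img c \<inter> chart_inv c -` V = chart_img c \<inter> O'"
    using continuous_openin_preimage_gen[OF ch(7) V(1)] unfolding openin_open by blast
  have "transition_dom c d = chart_img c \<inter> chart_inv c -` V"
  proof (intro set_eqI iffI)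
    fix x assume "x \<in> transition_dom c d"
    then obtain p where p: "p \<in> fst c" "p \<in> fst d" "x = snd c p" by (auto simp: transition_dom_def)
    thus "x \<in> chart_img c \<inter> chart_inv c -` V" using ch(1,4) V by auto
  next
    fix x assume x: "x \<in> chart_img c \<inter> chart_inv c -` V"
    hence "chart_inv c x \<in> fst c \<inter> fst d" using ch(3)[of x] ch(5) V by auto
    moreover have "snd c (chart_inv c x) = x" using ch(2) x by auto
    ultimately show "x \<in> transition_dom c d" unfolding transition_dom_def by (metis imageI)
  qed
  thus ?thesis using that O' by simp
qed

lemma linear_vanishing_on_hyperplane:
  assumes f: "linear (f :: 'e::euclidean_space \<Rightarrow> real)" and z: "\<And>v. v \<bullet> conormal = 0 ==> f v = 0"
  shows "f v = (v \<bullet> conormal) * f conormal"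
proof -
  have n: "(conormal :: 'e) \<bullet> conormal = 1" by (simp add: inner_Basis conormal_Basis)
  have "f (v - (v \<bullet> conormal) *\<^sub>R conormal) = 0" by (rule z) (simp add: inner_diff_left n)
  thus ?thesis using linear_diff[OF f, of v "(v \<bullet> conormal) *\<^sub>R conormal"] linear_scale[OF f, of "v \<bullet> conormal" conormal] by simp
qed

locale hamiltonian_domain =
  fixes W :: "'a::t2_space set" and A :: "('a, 'e::euclidean_space) chart set"
    and lam :: "('a, 'e) one_form" and H :: "real \<Rightarrow> 'a \<Rightarrow> real"
  assumes liouville: "liouville_domain W A lam" and adm: "H \<in> admissible_hamiltonians W A lam"
begin

abbreviation \<tau> :: "real \<Rightarrow> 'a \<Rightarrow> real" where "\<tau> \<equiv> tau A lam H"
abbreviation bd :: "'a set" where "bd \<equiv> mfd_boundary A"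
abbreviation TA :: "('a \<times> complex, 'e \<times> complex) chart set" where "TA \<equiv> tube_atlas W A H"
abbreviation RV :: "real \<Rightarrow> ('a \<times> complex, 'e \<times> complex) vector_field" where "RV \<equiv> \<lambda>t. reeb_vf (tube_form A lam)"
abbreviation RT :: "'a \<times> complex \<Rightarrow> 'a \<times> complex" where "RT \<equiv> boundary_reeb_time_one TA (tube_form A lam)"

lemma compact_W: "compact W" and W_nonempty: "W \<noteq> {}"
  and charts: "c \<in> A ==> is_chart W c" and cover: "\<Union>(fst ` A) = W"
  and smooth_transition: "c \<in> A ==> d \<in> A ==> smooth_on (transition_dom c d) (transition c d)"
  and linear_lam: "c \<in> A ==> p \<in> fst c ==> linear (lam c p)"
  and smooth_lam: "c \<in> A ==> smooth_on (chart_img c) (\<lambda>x. lam c (chart_inv c x) v)"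
  and lam_change: "c \<in> A ==> d \<in> A ==> p \<in> fst c \<inter> fst d ==> lam c p v = lam d p (dtransition c d p v)"
  and nondegenerate: "c \<in> A ==> p \<in> fst c ==> u \<noteq> 0 ==> \<exists>v. ext_deriv lam c p u v \<noteq> 0"
  using liouville unfolding liouville_domain_def smooth_manifold_def smooth_one_form_def by blast+

lemma periodic: "w \<in> W ==> H (t + 1) w = H t w"
  and smooth_H: "c \<in> A ==> smooth_on (UNIV \<times> chart_img c) (\<lambda>(t, x). H t (chart_inv c x))"
  and autonomous: "\<exists>N. openin (top_of_set W) N \<and> bd \<subseteq> N \<and> (\<forall>w\<in>N. \<forall>s t. H s w = H t w)"
  and H_boundary: "w \<in> bd ==> H t w = 0"
  and tau_pos: "w \<in> W ==> \<tau> t w > 0"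
  using adm unfolding admissible_hamiltonians_def by blast+

lemma chart_exists: assumes "w \<in> W" obtains c where "c \<in> A" "w \<in> fst c"
  using assms cover by blast

lemma chart_at_in: "w \<in> W ==> chart_at A w \<in> A \<and> w \<in> fst (chart_at A w)"
  unfolding chart_at_def by (rule someI_ex) (use chart_exists in blast)

lemma boundary_subset: "bd \<subseteq> W"
  using chart_simps(5)[OF charts] by (auto simp: mfd_boundary_def)

lemma fat_chart_img: "c \<in> A ==> fat (chart_img c)"
  using fat_openin_half_space chart_simps(9)[OF charts] by blast

lemma bilinear_ext_deriv:
  assumes c: "c \<in> A" "p \<in> fst c"
  shows "linear (ext_deriv lam c p u)" "linear (\<lambda>u. ext_deriv lam c p u v)"
proof -
  note ch = chart_simps[OF charts[OF c(1)]]
  have "linear (lam c (chart_inv c y))" if "y \<in> chart_img c" for y using linear_lam[OF c(1)] ch(3)[OF that] by blast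
  from form_d_bilinear[OF fat_chart_img[OF c(1)] ch(4)[OF c(2)] smooth_lam[OF c(1)] this]
  show "linear (ext_deriv lam c p u)" "linear (\<lambda>u. ext_deriv lam c p u v)"
    unfolding ext_deriv_form_d by blast+
qed

definition dH :: "real \<Rightarrow> ('a, 'e) chart \<Rightarrow> 'a \<Rightarrow> 'e \<Rightarrow> real" where
  "dH t c p = FD (H t \<circ> chart_inv c) (at (snd c p) within chart_img c)"

text \<open>The derivative in time and space together: \<open>dH\<close> is its value on (0, v), and
  its value on (1, 0) is the partial derivative of H in time.\<close>

definition DG :: "('a, 'e) chart \<Rightarrow> real \<times> 'e \<Rightarrow> real \<times> 'e \<Rightarrow> real" where
  "DG c z = FD (\<lambda>(t, x). H t (chart_inv c x)) (at z within UNIV \<times> chart_img c)"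

lemma DG_derivative:
  assumes "c \<in> A" "x \<in> chart_img c"
  shows "((\<lambda>(t, x). H t (chart_inv c x)) has_derivative DG c (t, x)) (at (t, x) within UNIV \<times> chart_img c)"
  unfolding DG_def
  by (rule smooth_on_has_derivative[OF fat_Times[OF fat_UNIV fat_chart_img[OF assms(1)]] smooth_H[OF assms(1)]]) (use assms in auto)

lemma dH_derivative_coord:
  assumes "c \<in> A" "x \<in> chart_img c"
  shows "((\<lambda>x. H t (chart_inv c x)) has_derivative (\<lambda>v. DG c (t, x) (0, v))) (at x within chart_img c)"
proof -
  have p: "((\<lambda>x. (t, x)) has_derivative (\<lambda>v. (0, v))) (at x within chart_img c)" by (auto intro!: derivative_eq_intros)
  have "((\<lambda>(t, x). H t (chart_inv c x)) has_derivative DG c (t, x)) (at (t, x) within (\<lambda>x. (t, x)) ` chart_img c)"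
    by (rule has_derivative_subset[OF DG_derivative[OF assms]]) auto
  from has_derivative_in_compose[OF p this] show ?thesis by simp
qed

lemma dH_eq:
  assumes c: "c \<in> A" "p \<in> fst c"
  shows "dH t c p v = DG c (t, snd c p) (0, v)"
proof -
  have x: "snd c p \<in> chart_img c" using chart_simps(4)[OF charts[OF c(1)]] c(2) .
  from fat_frechet_derivative[OF fat_chart_img[OF c(1)] x dH_derivative_coord[OF c(1) x, of t]]
  show ?thesis unfolding dH_def o_def by simp
qed

lemma dH_derivative:
  assumes c: "c \<in> A" "p \<in> fst c"
  shows "((H t \<circ> chart_inv c) has_derivative dH t c p) (at (snd c p) within chart_img c)"
proof -
  have x: "snd c p \<in> chart_img c" using chart_simps(4)[OF charts[OF c(1)]] c(2) .
  have "dH t c p = (\<lambda>v. DG c (t, snd c p) (0, v))" using dH_eq[OF c] by blast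
  thus ?thesis using dH_derivative_coord[OF c(1) x, of t] by (simp add: o_def)
qed

lemma linear_dH: "c \<in> A ==> p \<in> fst c ==> linear (dH t c p)"
  by (rule has_derivative_linear[OF dH_derivative])

abbreviation X :: "real \<Rightarrow> ('a, 'e) vector_field" where "X \<equiv> \<lambda>t. ham_vf lam (H t)"

lemma X_unique:
  assumes c: "c \<in> A" "p \<in> fst c"
  shows "\<exists>!x. \<forall>v. ext_deriv lam c p x v = dH t c p v"
  by (rule nondegenerate_solve[OF bilinear_ext_deriv[OF c] nondegenerate[OF c] linear_dH[OF c]])

lemma X_eq:
  assumes c: "c \<in> A" "p \<in> fst c"
  shows "ext_deriv lam c p (X t c p) v = dH t c p v"
  using theI'[OF X_unique[OF c, of t]] unfolding ham_vf_def dH_def by blast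

lemma X_eqI:
  assumes c: "c \<in> A" "p \<in> fst c" and x: "\<And>v. ext_deriv lam c p x v = dH t c p v"
  shows "X t c p = x"
  unfolding ham_vf_def dH_def[symmetric] by (rule the1_equality[OF X_unique[OF c]]) (use x in blast)

lemma dH_X: "c \<in> A ==> p \<in> fst c ==> dH t c p (X t c p) = 0"
  using X_eq[of c p t "X t c p"] by (simp add: ext_deriv_def)

text \<open>H_t vanishes on the boundary, so dH annihilates boundary vectors and is a multiple of
  the conormal component. From dH (X) = 0, either that multiple is nonzero and X is tangent, or dH =
  0 and X = 0.\<close>

lemma tangent:
  assumes c: "c \<in> A" "p \<in> fst c" and p: "snd c p \<bullet> conormal = 0"
  shows "X t c p \<bullet> conormal = 0"
proof -
  note ch = chart_simps[OF charts[OF c(1)]]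
  have "dH t c p v = 0" if "v \<bullet> conormal = 0" for v
  proof (rule derivative_zero_along_boundary[OF dH_derivative[OF c] ch(9) ch(4)[OF c(2)] p _ that])
    fix y assume y: "y \<in> chart_img c" "y \<bullet> conormal = 0"
    hence "chart_inv c y \<in> bd" unfolding mfd_boundary_def using c(1) ch(2,3) by force
    thus "(H t \<circ> chart_inv c) y = 0" by (simp add: H_boundary)
  qed
  hence *: "dH t c p v = (v \<bullet> conormal) * dH t c p conormal" for v
    by (rule linear_vanishing_on_hyperplane[OF linear_dH[OF c]])
  show ?thesis
  proof (cases "dH t c p conormal = 0")
    case True
    hence "dH t c p v = 0" for v using *[of v] by simp
    hence "X t c p = 0" using linear_0[OF bilinear_ext_deriv(2)[OF c]] by (intro X_eqI[OF c]) simp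
    thus ?thesis by simp
  next
    case False
    thus ?thesis using dH_X[OF c, of t] *[of "X t c p"] by simp
  qed
qed

text \<open>The field at a point depends only on H_t near the point. In particular it does not
  depend on time near the boundary of W.\<close>

lemma X_cong:
  assumes c: "c \<in> A" "p \<in> fst c" and V: "openin (top_of_set W) V" "p \<in> V" and eq: "\<And>w. w \<in> V ==> H s w = H t w"
  shows "X s c p = X t c p" "dH s c p = dH t c p"
proof -
  note ch = chart_simps[OF charts[OF c(1)]]
  have x: "snd c p \<in> chart_img c" using ch(4) c by blast
  obtain O1 where O1: "open O1" "V = W \<inter> O1" using V(1) unfolding openin_open by blast
  obtain O2 where O2: "open O2" "chart_img c \<inter> chart_inv c -` O1 = chart_img c \<inter> O2"
    using continuous_openin_preimage_gen[OF ch(7) O1(1)] unfolding openin_open by blast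
  have "snd c p \<in> chart_img c \<inter> chart_inv c -` O1" using x ch(1)[OF c(2)] V(2) O1 by auto
  hence xO: "snd c p \<in> O2" using O2 by blast
  have "((H t \<circ> chart_inv c) has_derivative dH s c p) (at (snd c p) within chart_img c)"
  proof (rule has_derivative_local[OF dH_derivative[OF c] O2(1) xO x])
    fix y assume "y \<in> chart_img c \<inter> O2"
    hence "y \<in> chart_img c \<inter> chart_inv c -` O1" using O2(2) by simp
    hence "chart_inv c y \<in> V" using O1(2) ch(3)[of y] ch(5) by auto
    thus "(H t \<circ> chart_inv c) y = (H s \<circ> chart_inv c) y" using eq by simp
  qed
  from fat_frechet_derivative[OF fat_chart_img[OF c(1)] x this]
  show d: "dH s c p = dH t c p" unfolding dH_def[of t] by (rule sym)
  show "X s c p = X t c p" by (rule X_eqI[OF c]) (simp add: X_eq[OF c] d)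
qed

lemma X_periodic: "c \<in> A ==> p \<in> fst c ==> X (t + 1) c p = X t c p"
  by (rule X_cong(1)[of c p W]) (use chart_simps(5)[OF charts[of c]] periodic in auto)

lemma dtransition_derivative:
  assumes c: "c \<in> A" and d: "d \<in> A" and p: "p \<in> fst c \<inter> fst d"
  shows "(transition c d has_derivative dtransition c d p) (at (snd c p) within transition_dom c d)"
proof -
  obtain O' where O': "open O'" "transition_dom c d = chart_img c \<inter> O'"
    using openin_transition_dom[OF charts[OF c] chart_simps(8)[OF charts[OF d]]] by blast
  have "snd c p \<in> transition_dom c d" using p by (auto simp: transition_dom_def)
  thus ?thesis unfolding dtransition_def
    by (intro smooth_on_has_derivative smooth_transition c d) (use fat_Int_open[OF fat_chart_img[OF c] O'(1)] O' in auto)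
qed

lemma dtransition_inverse:
  assumes c: "c \<in> A" and d: "d \<in> A" and p: "p \<in> fst c \<inter> fst d"
  shows "dtransition d c p (dtransition c d p v) = v"
proof -
  note chc = chart_simps[OF charts[OF c]]
  note chd = chart_simps[OF charts[OF d]]
  have e: "transition c d (snd c q) = snd d q" "transition d c (snd d q) = snd c q" if "q \<in> fst c \<inter> fst d" for q
    using that chc(1) chd(1) by (auto simp: transition_def)
  have D: "(transition c d has_derivative dtransition c d p) (at (snd c p) within transition_dom c d)" by (rule dtransition_derivative[OF c d p])
  have "(transition d c has_derivative dtransition d c p) (at (snd d p) within transition_dom d c)" by (rule dtransition_derivative[OF d c]) (use p in auto)
  hence D': "(transition d c has_derivative dtransition d c p) (at (transition c d (snd c p)) within transition c d ` transition_dom c d)"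
    unfolding e(1)[OF p] by (rule has_derivative_subset) (auto simp: transition_dom_def e)
  have "((\<lambda>x. transition d c (transition c d x)) has_derivative (\<lambda>v. dtransition d c p (dtransition c d p v))) (at (snd c p) within transition_dom c d)"
    by (rule has_derivative_in_compose[OF D D'])
  moreover have "((\<lambda>x. transition d c (transition c d x)) has_derivative (\<lambda>v. v)) (at (snd c p) within transition_dom c d)"
    by (rule has_derivative_transform[OF _ _ has_derivative_ident]) (use p in \<open>auto simp: transition_dom_def e\<close>)
  moreover obtain O' where O': "open O'" "transition_dom c d = chart_img c \<inter> O'"
    using openin_transition_dom[OF charts[OF c] chd(8)] by blast
  moreover have "snd c p \<in> transition_dom c d" using p by (auto simp: transition_dom_def)
  ultimately show ?thesis using fat_derivative_unique[OF fat_Int_open[OF fat_chart_img[OF c] O'(1)], of "snd c p"] by (metis (no_types, lifting))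
qed

text \<open>The defining equation is natural: a change of coordinates pulls the exterior derivative
  back to the exterior derivative and dH to dH. So the image of X solves the equation in the other
  chart, where the solution is unique.\<close>

lemma X_change:
  assumes c: "c \<in> A" and d: "d \<in> A" and p: "p \<in> fst c \<inter> fst d"
  shows "X t d p = dtransition c d p (X t c p)"
proof (rule X_eqI[OF d])
  note chc = chart_simps[OF charts[OF c]]
  note chd = chart_simps[OF charts[OF d]]
  let ?E = "dtransition c d p" and ?T = "transition_dom c d"
  show "p \<in> fst d" using p by simp
  obtain O' where O': "open O'" "?T = chart_img c \<inter> O'"
    using openin_transition_dom[OF charts[OF c] chd(8)] by blast
  have T: "fat ?T" "snd c p \<in> ?T" using fat_Int_open[OF fat_chart_img[OF c] O'(1)] O' p by (auto simp: transition_dom_def)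
  have xO: "snd c p \<in> O'" using T O' by blast
  have eq: "at (snd c p) within ?T = at (snd c p) within chart_img c"
    unfolding O'(2) by (rule at_within_Int_nhd[OF O'(1) xO])
  have e: "transition c d (snd c q) = snd d q" if "q \<in> fst c \<inter> fst d" for q
    using that chc(1) by (auto simp: transition_def)
  have ext: "ext_deriv lam c p u v = ext_deriv lam d p (?E u) (?E v)" for u v
  proof -
    have "FD (\<lambda>y. lam c (chart_inv c y) v) (at (snd c p) within ?T) u - FD (\<lambda>y. lam c (chart_inv c y) u) (at (snd c p) within ?T) v
      = FD (\<lambda>y. lam d (chart_inv d y) (?E v)) (at (transition c d (snd c p)) within chart_img d) (?E u)
      - FD (\<lambda>y. lam d (chart_inv d y) (?E u)) (at (transition c d (snd c p)) within chart_img d) (?E v)"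
    proof (rule exterior_derivative_pullback[OF T(1) fat_chart_img[OF d] smooth_transition[OF c d] _ smooth_lam[OF d] _ _ T(2)])
      show "transition c d y \<in> chart_img d" if "y \<in> ?T" for y
        using that e chd(4) by (auto simp: transition_dom_def)
      show "linear (lam d (chart_inv d y))" if "y \<in> chart_img d" for y using linear_lam[OF d chd(3)[OF that]] .
      show "lam c (chart_inv c y) v = lam d (chart_inv d (transition c d y)) (FD (transition c d) (at y within ?T) v)" if y: "y \<in> ?T" for y v
      proof -
        obtain q where q: "q \<in> fst c \<inter> fst d" "y = snd c q" using y by (auto simp: transition_dom_def)
        hence "chart_inv c y = q" "chart_inv d (transition c d y) = q" using chc(1) chd(1) e by auto
        thus ?thesis using lam_change[OF c d q(1), of v] q(2) by (simp add: dtransition_def)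
      qed
    qed (simp add: dtransition_def)
    thus ?thesis unfolding ext_deriv_def eq e[OF p] .
  qed
  have dHc: "dH t c p v = dH t d p (?E v)" for v
  proof -
    have D: "(transition c d has_derivative ?E) (at (snd c p) within ?T)" by (rule dtransition_derivative[OF c d p])
    have "((H t \<circ> chart_inv d) has_derivative dH t d p) (at (transition c d (snd c p)) within transition c d ` ?T)"
      by (rule has_derivative_subset[of _ _ _ "chart_img d"]) (use dH_derivative[OF d, of p t] p e chd(4) in \<open>auto simp: transition_dom_def\<close>)
    from has_derivative_in_compose[OF D this]
    have "((\<lambda>x. (H t \<circ> chart_inv d) (transition c d x)) has_derivative (\<lambda>v. dH t d p (?E v))) (at (snd c p) within ?T)" .
    hence "((H t \<circ> chart_inv c) has_derivative (\<lambda>v. dH t d p (?E v))) (at (snd c p) within ?T)"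
      by (rule has_derivative_transform[OF T(2), rotated]) (use e chc(1) chd(1) in \<open>auto simp: transition_dom_def\<close>)
    moreover have "((H t \<circ> chart_inv c) has_derivative dH t c p) (at (snd c p) within ?T)"
      unfolding eq using dH_derivative[OF c] p by auto
    ultimately show ?thesis using fat_derivative_unique[OF T] by metis
  qed
  fix v
  have v: "?E (dtransition d c p v) = v" by (rule dtransition_inverse[OF d c]) (use p in auto)
  have "ext_deriv lam d p (?E (X t c p)) (?E (dtransition d c p v)) = dH t d p (?E (dtransition d c p v))"
    unfolding ext[symmetric] dHc[symmetric] by (rule X_eq[OF c]) (use p in auto)
  thus "ext_deriv lam d p (?E (X t c p)) v = dH t d p v" unfolding v .
qed

lemma tau_eq:
  assumes c: "c \<in> A" "w \<in> fst c"
  shows "\<tau> t w = lam c w (X t c w) + H t w"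
proof -
  have w: "w \<in> W" using c chart_simps(5)[OF charts] by blast
  have d: "chart_at A w \<in> A" "w \<in> fst (chart_at A w)" using chart_at_in[OF w] by auto
  show ?thesis unfolding tau_def Let_def
    using lam_change[OF c(1) d(1), of w "X t c w"] X_change[OF c(1) d(1), of w t] c(2) d(2) by simp
qed

lemma tau_periodic: "w \<in> W ==> \<tau> (t + 1) w = \<tau> t w"
  using chart_at_in[of w] X_periodic[of "chart_at A w" w t] periodic[of w t] by (simp add: tau_def Let_def)

text \<open>In a chart X solves a linear system whose coefficients are derivatives of \<lambda> and
  H. Their smooth extensions to full balls are Lipschitz by the mean value inequality on a convex
  set, and \<open>solve_lipschitz\<close> passes this on to X over the half space. Time is treated
  as one more coordinate, so the same bound yields joint continuity.\<close>

lemma local_lipschitz: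
  assumes c: "c \<in> A" and x: "x \<in> chart_img c"
  shows "\<exists>r>0. \<exists>L\<ge>0. cball x r \<inter> half_space \<subseteq> chart_img c \<and>
      (\<forall>s\<in>{t - r..t + r}. \<forall>s'\<in>{t - r..t + r}. \<forall>y\<in>cball x r \<inter> half_space. \<forall>z\<in>cball x r \<inter> half_space.
         norm (X s c (chart_inv c y) - X s' c (chart_inv c z)) \<le> L * norm ((s, y) - (s', z)))"
proof -
  let ?S = "chart_img c" and ?a = "\<lambda>b y. lam c (chart_inv c y) b"
  note ch = chart_simps[OF charts[OF c]]
  note S = fat_chart_img[OF c]
  have RS: "fat ((UNIV::real set) \<times> ?S)" by (rule fat_Times[OF fat_UNIV S])
  obtain O1 where O1: "open O1" "?S = half_space \<inter> O1" using ch(9) unfolding openin_open by blast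
  obtain U g where U: "open U" "(t, x) \<in> U" "\<forall>k. ck_on k U g"
    and gd: "\<forall>y\<in>(UNIV \<times> ?S) \<inter> U. FD (\<lambda>(t, x). H t (chart_inv c x)) (at y within UNIV \<times> ?S) = FD g (at y)"
    by (rule smooth_on_extension[OF RS smooth_H[OF c], of "(t, x)"]) (use x in auto)
  have "\<exists>U g. open U \<and> x \<in> U \<and> (\<forall>k. ck_on k U g) \<and> (\<forall>y\<in>?S \<inter> U. FD (?a b) (at y within ?S) = FD g (at y))" for b
    by (rule smooth_on_extension[OF S smooth_lam[OF c] x]) blast
  then obtain V q where V: "\<And>b. open (V b) \<and> x \<in> V b \<and> (\<forall>k. ck_on k (V b) (q b)) \<and> (\<forall>y\<in>?S \<inter> V b. FD (?a b) (at y within ?S) = FD (q b) (at y))"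
    by metis
  obtain A1 B1 where AB: "open A1" "open B1" "t \<in> A1" "x \<in> B1" "A1 \<times> B1 \<subseteq> U"
    using open_prod_elim[OF U(1,2)] by (metis mem_Sigma_iff)
  define O2 where "O2 = O1 \<inter> B1 \<inter> (\<Inter>b\<in>Basis. V b)"
  have O2: "open O2" "x \<in> O2" unfolding O2_def using O1 AB V x by (auto intro!: open_Int open_INT)
  obtain r1 where r1: "r1 > 0" "cball x r1 \<subseteq> O2" using O2 open_contains_cball by blast
  obtain r2 where r2: "r2 > 0" "cball t r2 \<subseteq> A1" using AB open_contains_cball by blast
  define r where "r = min r1 r2"
  have r: "r > 0" "cball x r \<subseteq> O2" "{t - r..t + r} \<subseteq> A1"
  proof -
    have "{t - r..t + r} \<subseteq> cball t r2" by (auto simp: r_def dist_real_def)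
    thus "{t - r..t + r} \<subseteq> A1" using r2(2) by blast
    have "cball x r \<subseteq> cball x r1" by (auto simp: r_def)
    thus "cball x r \<subseteq> O2" using r1(2) by blast
    show "r > 0" using r1 r2 by (simp add: r_def)
  qed
  have KS: "cball x r \<inter> half_space \<subseteq> ?S" using r(2) O1 by (auto simp: O2_def)
  define K where "K = {t - r..t + r} \<times> cball x r"
  have K: "compact K" "convex K" "K \<subseteq> U" unfolding K_def using r AB
    by (auto intro!: compact_Times convex_Times simp: O2_def)
  define K' where "K' = {t - r..t + r} \<times> (cball x r \<inter> half_space)"
  have hs: "half_space = {x::'e. conormal \<bullet> x \<ge> 0}" by (auto simp: half_space_def inner_commute)
  have K': "compact K'" "K' \<subseteq> K" unfolding K'_def K_def hs
    by (auto intro!: compact_Times compact_Int_closed closed_halfspace_ge)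
  have "\<exists>L\<ge>0. \<forall>z\<in>K. \<forall>z'\<in>K. norm (FD g (at z) (0, b) - FD g (at z') (0, b)) \<le> L * norm (z - z')" for b
  proof -
    have "ck_on (Suc 0) U (\<lambda>z. FD g (at z) (0, b))" using U(3)[rule_format, of "Suc (Suc 0)"] by simp
    from C1_lipschitz[OF this K] show ?thesis by metis
  qed
  then obtain Lh where Lh: "\<And>b. Lh b \<ge> 0" "\<And>b z z'. z \<in> K ==> z' \<in> K ==> norm (FD g (at z) (0, b) - FD g (at z') (0, b)) \<le> Lh b * norm (z - z')"
    by metis
  \<comment> \<open>Restricted to basis vectors b, because the radius was chosen for these finitely
    many b to have the ball inside \<open>V b\<close>.\<close>
  have "\<exists>L. b \<in> Basis \<longrightarrow> L \<ge> 0 \<and> (\<forall>z\<in>cball x r. \<forall>z'\<in>cball x r. norm (FD (q b) (at z) a - FD (q b) (at z') a) \<le> L * norm (z - z'))" for a b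
  proof (cases "b \<in> Basis")
    case True
    have "ck_on (Suc 0) (V b) (\<lambda>z. FD (q b) (at z) a)" using V[of b] ck_on.simps(2) by blast
    moreover have "cball x r \<subseteq> V b" using r(2) True by (auto simp: O2_def)
    ultimately show ?thesis using C1_lipschitz[of "V b" "\<lambda>z. FD (q b) (at z) a" "cball x r"] by (metis compact_cball convex_cball)
  qed simp
  note Lex = this
  define Lq where "Lq = (\<lambda>a b. SOME L. b \<in> Basis \<longrightarrow> L \<ge> 0 \<and> (\<forall>z\<in>cball x r. \<forall>z'\<in>cball x r. norm (FD (q b) (at z) a - FD (q b) (at z') a) \<le> L * norm (z - z')))"
  have Lq': "b \<in> Basis \<longrightarrow> Lq a b \<ge> 0 \<and> (\<forall>z\<in>cball x r. \<forall>z'\<in>cball x r. norm (FD (q b) (at z) a - FD (q b) (at z') a) \<le> Lq a b * norm (z - z'))" for a b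
    unfolding Lq_def by (rule someI_ex[OF Lex])
  have Lq: "\<And>a b. b \<in> Basis ==> Lq a b \<ge> 0" "\<And>a b z z'. b \<in> Basis ==> z \<in> cball x r ==> z' \<in> cball x r ==> norm (FD (q b) (at z) a - FD (q b) (at z') a) \<le> Lq a b * norm (z - z')"
    using Lq' by blast+
  define L where "L = (\<Sum>b\<in>Basis. Lh b) + (\<Sum>a\<in>Basis. \<Sum>b\<in>Basis. Lq a b + Lq b a)"
  have L0: "L \<ge> 0" unfolding L_def using Lh(1) Lq(1) by (intro add_nonneg_nonneg sum_nonneg) auto
  have Lhb: "Lh b \<le> L" if "b \<in> Basis" for b
  proof -
    have "Lh b \<le> (\<Sum>b\<in>Basis. Lh b)" using that Lh(1) by (intro member_le_sum) auto
    moreover have "0 \<le> (\<Sum>a\<in>Basis. \<Sum>b\<in>Basis. Lq a b + Lq b a)" using Lq(1) by (intro sum_nonneg add_nonneg_nonneg) auto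
    ultimately show ?thesis by (simp add: L_def)
  qed
  have Lqb: "Lq a b + Lq b a \<le> L" if "a \<in> Basis" "b \<in> Basis" for a b
  proof -
    have "Lq a b + Lq b a \<le> (\<Sum>b\<in>Basis. Lq a b + Lq b a)" using that Lq(1) by (intro member_le_sum[of b _ "\<lambda>b. Lq a b + Lq b a"]) auto
    also have "\<dots> \<le> (\<Sum>a\<in>Basis. \<Sum>b\<in>Basis. Lq a b + Lq b a)"
      using that Lq(1) by (intro member_le_sum[of a _ "\<lambda>a. \<Sum>b\<in>Basis. Lq a b + Lq b a"]) (auto intro!: sum_nonneg)
    finally show ?thesis using Lh(1) sum_nonneg[of Basis Lh] by (simp add: L_def)
  qed
  \<comment> \<open>The matrix of the exterior derivative, read off from the extensions: defined
    around x on both sides of the hyperplane, and equal to \<open>ext_deriv\<close> on the half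
    space.\<close>
  define w where "w = (\<lambda>a b z. FD (q b) (at (snd (z :: real \<times> 'e))) a - FD (q a) (at (snd z)) b :: real)"
  define h where "h = (\<lambda>(b::'e) z. FD g (at (z :: real \<times> 'e)) (0, b))"
  have mem: "fst z \<in> {t - r..t + r}" "snd z \<in> cball x r" "snd z \<in> ?S" "z \<in> K" if "z \<in> K'" for z
    using that KS K' by (auto simp: K'_def)
  have wext: "ext_deriv lam c (chart_inv c (snd z)) a b = w a b z" if z: "z \<in> K'" and ab: "a \<in> Basis" "b \<in> Basis" for z a b
  proof -
    have "snd z \<in> ?S \<inter> V a" "snd z \<in> ?S \<inter> V b" using mem[OF z] r(2) ab by (auto simp: O2_def)
    thus ?thesis using V[of a] V[of b] ch(2)[OF mem(3)[OF z]] by (simp add: ext_deriv_def w_def)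
  qed
  have hd: "dH s c (chart_inv c y) b = h b (s, y)" if z: "(s, y) \<in> K'" for s y b
  proof -
    have "(s, y) \<in> (UNIV \<times> ?S) \<inter> U" using mem[OF z] K by auto
    moreover have "dH s c (chart_inv c y) b = DG c (s, y) (0, b)"
      using dH_eq[OF c ch(3)] ch(2) mem(3)[OF z] by simp
    ultimately show ?thesis using gd by (simp add: DG_def h_def)
  qed
  have bil: "ext_deriv lam c (chart_inv c (snd z)) u b = (\<Sum>a\<in>Basis. (u \<bullet> a) * w a b z)" if z: "z \<in> K'" "b \<in> Basis" for z u b
  proof -
    have "chart_inv c (snd z) \<in> fst c" using ch(3) mem(3)[OF z(1)] .
    from linear_Basis_sum[OF bilinear_ext_deriv(2)[OF c this, of b], of u]
    show ?thesis using wext[OF z(1) _ z(2)] by simp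
  qed
  obtain C where C: "C \<ge> 0" "\<And>z z'. z \<in> K' ==> z' \<in> K' ==>
    norm ((\<lambda>z. X (fst z) c (chart_inv c (snd z))) z - (\<lambda>z. X (fst z) c (chart_inv c (snd z))) z') \<le> C * norm (z - z')"
  proof (rule solve_lipschitz[OF K'(1), of w L h "\<lambda>z. X (fst z) c (chart_inv c (snd z))"])
    fix a b z z' assume ab: "a \<in> (Basis::'e set)" "b \<in> (Basis::'e set)" and z: "z \<in> K'" "z' \<in> K'"
    have "\<bar>w a b z - w a b z'\<bar> \<le> Lq a b * norm (snd z - snd z') + Lq b a * norm (snd z - snd z')"
      unfolding w_def using Lq(2)[OF ab(2) mem(2)[OF z(1)] mem(2)[OF z(2)], of a] Lq(2)[OF ab(1) mem(2)[OF z(1)] mem(2)[OF z(2)], of b]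
      by (simp only: real_norm_def)
    also have "\<dots> = (Lq a b + Lq b a) * norm (snd z - snd z')" by (simp add: distrib_right)
    also have "\<dots> \<le> L * norm (z - z')"
      using Lqb[OF ab] dist_snd_le[of z z'] L0 by (intro mult_mono) (auto simp: dist_norm)
    finally show "\<bar>w a b z - w a b z'\<bar> \<le> L * norm (z - z')" .
  next
    fix b z z' assume b: "b \<in> (Basis::'e set)" and z: "z \<in> K'" "z' \<in> K'"
    have "\<bar>h b z - h b z'\<bar> \<le> Lh b * norm (z - z')" unfolding h_def using Lh(2)[OF mem(4)[OF z(1)] mem(4)[OF z(2)], of b] by simp
    also have "\<dots> \<le> L * norm (z - z')" using Lhb[OF b] by (intro mult_right_mono) auto
    finally show "\<bar>h b z - h b z'\<bar> \<le> L * norm (z - z')" .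
  next
    fix u :: 'e and z assume z: "z \<in> K'" and u: "u \<noteq> 0"
    have p: "chart_inv c (snd z) \<in> fst c" using ch(3) mem(3)[OF z] .
    obtain v where v: "ext_deriv lam c (chart_inv c (snd z)) u v \<noteq> 0" using nondegenerate[OF c p u] by blast
    have "\<exists>b\<in>Basis. ext_deriv lam c (chart_inv c (snd z)) u b \<noteq> 0"
    proof (rule ccontr)
      assume "\<not> ?thesis"
      hence "(\<Sum>b\<in>Basis. (v \<bullet> b) *\<^sub>R ext_deriv lam c (chart_inv c (snd z)) u b) = 0" by (intro sum.neutral) auto
      thus False using v linear_Basis_sum[OF bilinear_ext_deriv(1)[OF c p], of u v] by metis
    qed
    thus "\<exists>b\<in>Basis. (\<Sum>a\<in>Basis. (u \<bullet> a) * w a b z) \<noteq> 0" using bil[OF z] by auto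
  next
    fix b z assume b: "b \<in> (Basis::'e set)" and z: "z \<in> K'"
    have p: "chart_inv c (snd z) \<in> fst c" using ch(3) mem(3)[OF z] .
    show "(\<Sum>a\<in>Basis. (X (fst z) c (chart_inv c (snd z)) \<bullet> a) * w a b z) = h b z"
      unfolding bil[OF z b, symmetric] X_eq[OF c p] using hd[of "fst z" "snd z" b] z by simp
  qed (use L0 that in auto)
  show ?thesis
  proof (rule exI[of _ r], rule conjI[OF r(1)], rule exI[of _ C], intro conjI ballI C(1) KS)
    fix s s' y z assume "s \<in> {t - r..t + r}" "s' \<in> {t - r..t + r}" "y \<in> cball x r \<inter> half_space" "z \<in> cball x r \<inter> half_space"
    thus "norm (X s c (chart_inv c y) - X s' c (chart_inv c z)) \<le> C * norm ((s, y) - (s', z))"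
      using C(2)[of "(s, y)" "(s', z)"] by (simp add: K'_def)
  qed
qed

lemma X_continuous_coord:
  assumes c: "c \<in> A"
  shows "continuous_on (UNIV \<times> chart_img c) (\<lambda>(t, x). X t c (chart_inv c x))"
proof (rule continuous_on_locally)
  fix z assume z: "z \<in> (UNIV :: real set) \<times> chart_img c"
  note ch = chart_simps[OF charts[OF c]]
  obtain r L where r: "r > 0" "L \<ge> 0" and L: "\<forall>s\<in>{fst z - r..fst z + r}. \<forall>s'\<in>{fst z - r..fst z + r}. \<forall>y\<in>cball (snd z) r \<inter> half_space. \<forall>y'\<in>cball (snd z) r \<inter> half_space.
         norm (X s c (chart_inv c y) - X s' c (chart_inv c y')) \<le> L * norm ((s, y) - (s', y'))"
    using local_lipschitz[OF c, of "snd z" "fst z"] z by (auto simp: mem_Times_iff)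
  define O' where "O' = ball (fst z) r \<times> ball (snd z) r"
  have "continuous_on ((UNIV \<times> chart_img c) \<inter> O') (\<lambda>(t, x). X t c (chart_inv c x))"
  proof (rule lipschitz_on_continuous_on[of L], rule lipschitz_onI)
    fix y y' assume yy: "y \<in> (UNIV \<times> chart_img c) \<inter> O'" "y' \<in> (UNIV \<times> chart_img c) \<inter> O'"
    hence "fst y \<in> {fst z - r..fst z + r}" "fst y' \<in> {fst z - r..fst z + r}"
      "snd y \<in> cball (snd z) r \<inter> half_space" "snd y' \<in> cball (snd z) r \<inter> half_space"
      using ch(10) by (auto simp: O'_def dist_real_def)
    hence "norm (X (fst y) c (chart_inv c (snd y)) - X (fst y') c (chart_inv c (snd y'))) \<le> L * norm ((fst y, snd y) - (fst y', snd y'))"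
      using L by blast
    thus "dist (case y of (t, x) \<Rightarrow> X t c (chart_inv c x)) (case y' of (t, x) \<Rightarrow> X t c (chart_inv c x)) \<le> L * dist y y'"
      by (simp add: case_prod_unfold dist_norm)
  qed (use r in auto)
  moreover have "open O'" "z \<in> O'" unfolding O'_def using r by (auto simp: open_Times mem_Times_iff)
  ultimately show "\<exists>O'. open O' \<and> z \<in> O' \<and> continuous_on ((UNIV \<times> chart_img c) \<inter> O') (\<lambda>(t, x). X t c (chart_inv c x))" by blast
qed

lemma continuous_on_chartwise:
  assumes "\<And>c. c \<in> A ==> continuous_on (S \<times> chart_img c) (\<lambda>(t, x). f t (chart_inv c x))"
  shows "continuous_on ((S :: 's::t2_space set) \<times> W) (\<lambda>(t, w). f t w)"
proof (rule continuous_on_locally)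
  fix z assume z: "z \<in> S \<times> W"
  then obtain c where c: "c \<in> A" "snd z \<in> fst c" using chart_exists[of "snd z"] by (auto simp: mem_Times_iff)
  note ch = chart_simps[OF charts[OF c(1)]]
  obtain O1 where O1: "open O1" "fst c = W \<inter> O1" using ch(8) unfolding openin_open by blast
  have "continuous_on (S \<times> fst c) (\<lambda>z. snd c (snd z))"
    by (rule continuous_on_compose2[OF ch(6) continuous_on_snd[OF continuous_on_id]]) auto
  hence "continuous_on (S \<times> fst c) (\<lambda>z. f (fst z) (chart_inv c (snd c (snd z))))"
    by (rule continuous_on_pair[OF assms[OF c(1)] continuous_on_fst[OF continuous_on_id]]) (use ch(4) in auto)
  hence "continuous_on (S \<times> fst c) (\<lambda>(t, w). f t w)"
    by (rule continuous_on_eq) (use ch(1) in auto)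
  moreover have "(S \<times> W) \<inter> (UNIV \<times> O1) = S \<times> fst c" using O1 by auto
  ultimately show "\<exists>O'. open O' \<and> z \<in> O' \<and> continuous_on ((S \<times> W) \<inter> O') (\<lambda>(t, w). f t w)"
    using O1 c z by (intro exI[of _ "UNIV \<times> O1"]) (auto simp: open_Times mem_Times_iff)
qed

lemma continuous_H: "continuous_on (UNIV \<times> W) (\<lambda>(t, w). H t w)"
  by (rule continuous_on_chartwise) (use smooth_on_continuous_on[OF smooth_H] in auto)

lemma continuous_tau: "continuous_on (UNIV \<times> W) (\<lambda>(t, w). \<tau> t w)"
proof (rule continuous_on_chartwise)
  fix c assume c: "c \<in> A"
  note ch = chart_simps[OF charts[OF c]]
  have X: "continuous_on (UNIV \<times> chart_img c) (\<lambda>z. X (fst z) c (chart_inv c (snd z)))"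
    using X_continuous_coord[OF c] by (simp add: case_prod_unfold)
  have G: "continuous_on (UNIV \<times> chart_img c) (\<lambda>z. H (fst z) (chart_inv c (snd z)))"
    using smooth_on_continuous_on[OF smooth_H[OF c]] by (simp add: case_prod_unfold)
  have l: "continuous_on ((UNIV :: real set) \<times> chart_img c) (\<lambda>z. lam c (chart_inv c (snd z)) b)" for b
    by (rule continuous_on_compose2[OF smooth_on_continuous_on[OF smooth_lam[OF c, of b]] continuous_on_snd[OF continuous_on_id]]) auto
  have "continuous_on (UNIV \<times> chart_img c) (\<lambda>z. (\<Sum>b\<in>Basis. (X (fst z) c (chart_inv c (snd z)) \<bullet> b) * lam c (chart_inv c (snd z)) b) + H (fst z) (chart_inv c (snd z)))"
    by (intro continuous_on_add continuous_on_sum continuous_on_mult continuous_on_inner X G l continuous_on_const)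
  thus "continuous_on (UNIV \<times> chart_img c) (\<lambda>(t, x). \<tau> t (chart_inv c x))"
  proof (rule continuous_on_eq)
    fix z assume z: "z \<in> (UNIV :: real set) \<times> chart_img c"
    hence p: "chart_inv c (snd z) \<in> fst c" using ch(3) by auto
    show "(\<Sum>b\<in>Basis. (X (fst z) c (chart_inv c (snd z)) \<bullet> b) * lam c (chart_inv c (snd z)) b) + H (fst z) (chart_inv c (snd z))
       = (case z of (t, x) \<Rightarrow> \<tau> t (chart_inv c x))"
      using linear_Basis_sum[OF linear_lam[OF c p], of "X (fst z) c (chart_inv c (snd z))"]
      unfolding case_prod_unfold tau_eq[OF c p] real_scaleR_def by (rule arg_cong[OF sym])
  qed
qed

text \<open>At an interior minimum of H_t one has dH = 0, so X = 0 and \<tau> = H; the value there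
  is positive. Hence the minimum over the compact W is either positive or attained on the boundary
  with value 0, and in the latter case a nonpositive value inside would be an interior minimum as
  well.\<close>

lemma H_pos_iff:
  assumes w: "w \<in> W"
  shows "H t w \<ge> 0" "H t w = 0 \<longleftrightarrow> w \<in> bd"
proof -
  have Ht: "continuous_on W (H t)"
    by (rule continuous_on_pair[OF continuous_H continuous_on_const continuous_on_id]) auto
  have interior: "H t p > 0" if p: "p \<in> W" "p \<notin> bd" and min: "\<And>q. q \<in> W ==> H t p \<le> H t q" for p
  proof -
    obtain c where c: "c \<in> A" "p \<in> fst c" using chart_exists[OF p(1)] .
    note ch = chart_simps[OF charts[OF c(1)]]
    let ?x = "snd c p"
    have x: "?x \<in> chart_img c" using ch(4) c by blast
    have "?x \<bullet> conormal \<noteq> 0" using p(2) c by (auto simp: mfd_boundary_def)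
    moreover have "?x \<bullet> conormal \<ge> 0" using ch(10) x by (auto simp: half_space_def)
    ultimately have xp: "?x \<bullet> conormal > 0" by simp
    obtain O1 where O1: "open O1" "chart_img c = half_space \<inter> O1" using ch(9) unfolding openin_open by blast
    define U where "U = O1 \<inter> {y. y \<bullet> conormal > 0}"
    have U: "open U" "?x \<in> U" "U \<subseteq> chart_img c"
    proof -
      show "open U" unfolding U_def using O1(1) open_halfspace_component_gt by (rule open_Int)
      have "?x \<in> O1" using O1(2) x by blast
      thus "?x \<in> U" using xp by (simp add: U_def)
      show "U \<subseteq> chart_img c" unfolding U_def O1(2) by (auto simp: half_space_def)
    qed
    have "((H t \<circ> chart_inv c) has_derivative dH t c p) (at ?x within U)"
      by (rule has_derivative_subset[OF dH_derivative[OF c] U(3)])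
    hence "((H t \<circ> chart_inv c) has_derivative dH t c p) (at ?x)" unfolding at_within_open[OF U(2,1)] .
    moreover have "\<forall>y\<in>U. (H t \<circ> chart_inv c) ?x \<le> (H t \<circ> chart_inv c) y"
      using min U(3) ch(1)[OF c(2)] ch(3,5) by auto
    ultimately have "dH t c p = (\<lambda>v. 0)" using differential_zero_maxmin[OF U(2,1)] by blast
    hence "X t c p = 0" using linear_0[OF bilinear_ext_deriv(2)[OF c]] by (intro X_eqI[OF c]) simp
    hence "\<tau> t p = H t p" using tau_eq[OF c, of t] linear_0[OF linear_lam[OF c]] by simp
    thus ?thesis using tau_pos[OF p(1), of t] by simp
  qed
  obtain w0 where w0: "w0 \<in> W" "\<And>q. q \<in> W ==> H t w0 \<le> H t q"
    using continuous_attains_inf[OF compact_W W_nonempty Ht] by blast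
  have pos: "H t w > 0" if nb: "w \<notin> bd"
  proof (rule ccontr)
    assume "\<not> H t w > 0"
    hence le: "H t w0 \<le> H t w" "H t w \<le> 0" using w0(2)[OF w] by auto
    show False
    proof (cases "w0 \<in> bd")
      case True
      hence "H t w0 = 0" by (rule H_boundary)
      hence "H t w = H t w0" using le by simp
      hence "H t w > 0" using interior[OF w nb] w0(2) by simp
      thus False using le by simp
    next
      case False
      thus False using interior[OF w0(1) False w0(2)] le by simp
    qed
  qed
  show "H t w \<ge> 0" "H t w = 0 \<longleftrightarrow> w \<in> bd" using pos H_boundary[of w t] by (cases "w \<in> bd"; force)+
qed

text \<open>By \<open>H_pos_iff\<close> the boundary is the zero set in W of the continuous function
  \<open>H 0\<close>.\<close>

lemma closed_boundary: "closed (bd)"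
proof -
  have Ht: "continuous_on W (H 0)"
    by (rule continuous_on_pair[OF continuous_H continuous_on_const continuous_on_id]) auto
  have "bd = W \<inter> H 0 -` {0}" using H_pos_iff(2)[of _ 0] boundary_subset by auto
  moreover have "closedin (top_of_set W) (W \<inter> H 0 -` {0})" by (rule continuous_closedin_preimage[OF Ht]) simp
  ultimately show ?thesis using closedin_closed_trans[OF _ compact_imp_closed[OF compact_W]] by simp
qed

text \<open>Periodicity reduces the range of \<tau> to that over the compact [0,1] \<times> W, so
  the infimum and supremum over the unbounded set of times are genuine bounds and the infimum is
  attained.\<close>

lemma tau_bounds:
  defines "m \<equiv> INF (t, w)\<in>UNIV \<times> W. \<tau> t w" and "M \<equiv> SUP (t, w)\<in>UNIV \<times> W. \<tau> t w"
  shows "m > 0" "\<And>t w. w \<in> W ==> m \<le> \<tau> t w" "\<And>t w. w \<in> W ==> \<tau> t w \<le> M"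
proof -
  let ?f = "\<lambda>(t, w). \<tau> t w"
  have per: "\<tau> (t + of_int n) w = \<tau> t w" if w: "w \<in> W" for t w n
  proof (induction n rule: int_induct[of _ 0])
    case (step1 i) thus ?case using tau_periodic[OF w, of "t + of_int i"] by (simp add: add_ac)
  next
    case (step2 i) thus ?case using tau_periodic[OF w, of "t + of_int (i - 1)"] by (simp add: add_ac)
  qed simp
  have img: "?f ` (UNIV \<times> W) = ?f ` ({0..1} \<times> W)"
  proof (intro equalityI subsetI)
    fix y assume "y \<in> ?f ` (UNIV \<times> W)"
    then obtain t w where tw: "w \<in> W" "y = \<tau> t w" by auto
    have "\<tau> (frac t + of_int \<lfloor>t\<rfloor>) w = \<tau> (frac t) w" by (rule per[OF tw(1)])
    hence "y = ?f (frac t, w)" using tw by (simp add: frac_def)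
    moreover have "(frac t, w) \<in> {0..1} \<times> W" using tw frac_ge_0[of t] frac_lt_1[of t] by (auto intro: less_imp_le)
    ultimately show "y \<in> ?f ` ({0..1} \<times> W)" by blast
  qed auto
  have cont: "continuous_on ({0..1} \<times> W) ?f" by (rule continuous_on_subset[OF continuous_tau]) auto
  have comp: "compact (?f ` (UNIV \<times> W))" unfolding img
    by (intro compact_continuous_image cont compact_Times compact_Icc compact_W)
  have ne: "?f ` (UNIV \<times> W) \<noteq> {}" using W_nonempty by auto
  obtain z where z: "z \<in> ?f ` (UNIV \<times> W)" "\<And>y. y \<in> ?f ` (UNIV \<times> W) ==> z \<le> y" using compact_attains_inf[OF comp ne] by blast
  have "m = z" unfolding m_def by (rule cInf_eq_minimum[OF z])
  thus "m > 0" using z(1) tau_pos by auto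
  have bd: "bdd_below (?f ` (UNIV \<times> W))" "bdd_above (?f ` (UNIV \<times> W))"
    using compact_imp_bounded[OF comp] by (auto simp: bounded_imp_bdd_below bounded_imp_bdd_above)
  fix t w assume w: "w \<in> W"
  hence "\<tau> t w \<in> ?f ` (UNIV \<times> W)" by force
  thus "m \<le> \<tau> t w" "\<tau> t w \<le> M" unfolding m_def M_def
    by (rule cInf_lower[OF _ bd(1)], rule cSup_upper[OF _ bd(2)])
qed

lemma flow: "flow_domain W A X"
proof (unfold_locales, goal_cases)
  case (4 c t x)
  obtain r L where r: "r > 0" "L \<ge> 0" "cball x r \<inter> half_space \<subseteq> chart_img c" and L: "\<forall>s\<in>{t - r..t + r}. \<forall>s'\<in>{t - r..t + r}. \<forall>y\<in>cball x r \<inter> half_space. \<forall>z\<in>cball x r \<inter> half_space.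
         norm (X s c (chart_inv c y) - X s' c (chart_inv c z)) \<le> L * norm ((s, y) - (s', z))"
    using local_lipschitz[OF 4, of t] by blast
  show ?case
  proof (rule exI[of _ r], rule conjI[OF r(1)], rule exI[of _ L], intro conjI ballI r(2,3))
    show "continuous_on ({t - r..t + r} \<times> (cball x r \<inter> half_space)) (\<lambda>(s, y). X s c (chart_inv c y))"
      by (rule continuous_on_subset[OF X_continuous_coord[OF 4(1)]]) (use r(3) in auto)
    fix s y z assume "s \<in> {t - r..t + r}" "y \<in> cball x r \<inter> half_space" "z \<in> cball x r \<inter> half_space"
    hence "norm (X s c (chart_inv c y) - X s c (chart_inv c z)) \<le> L * norm ((s, y) - (s, z))" using L by blast
    thus "norm (X s c (chart_inv c y) - X s c (chart_inv c z)) \<le> L * norm (y - z)" by (simp add: norm_Pair)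
  qed
next
  case (6 c d p)
  thus ?case using dtransition_derivative[OF 6] X_change[OF 6] by (intro exI[of _ "dtransition c d p"]) blast
qed (use compact_W charts cover tangent in auto)

end

section \<open>The Hamiltonian flow and the boundary of the tube\<close>

lemma curve_on_cong_vf:
  assumes "curve_on S A X a b g" "\<And>s c. s \<in> {a..b} ==> c \<in> A ==> g s \<in> fst c ==> X s c (g s) = Y s c (g s)"
  shows "curve_on S A Y a b g"
  using assms unfolding curve_on_def by (metis (no_types, lifting))

lemma curve_on_reverse:
  assumes g: "curve_on S A (\<lambda>s c p. (- 1) *\<^sub>R X (t - s) c p) 0 t g"
  shows "curve_on S A X 0 t (\<lambda>s. g (t - s))"
  unfolding curve_on_def
proof (intro conjI ballI impI)
  have img: "(\<lambda>s. t - s) ` {0..t} = {0..t}" by (auto simp: image_iff intro!: bexI[of _ "t - x" for x])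
  show "(\<lambda>s. g (t - s)) ` {0..t} \<subseteq> S" using g by (auto simp: curve_on_def)
  show "continuous_on {0..t} (\<lambda>s. g (t - s))"
    by (rule continuous_on_compose2[of "{0..t}" g]) (use g in \<open>auto simp: curve_on_def intro!: continuous_intros\<close>)
  fix s c assume s: "s \<in> {0..t}" and c: "c \<in> A" "g (t - s) \<in> fst c"
  have "((snd c \<circ> g) has_vector_derivative (- 1) *\<^sub>R X (t - (t - s)) c (g (t - s))) (at (t - s) within (\<lambda>s. t - s) ` {0..t})"
    unfolding img by (rule curve_onD[OF g _ c]) (use s in auto)
  moreover have "((\<lambda>s. t - s) has_vector_derivative - 1) (at s within {0..t})" by (auto intro!: derivative_eq_intros)
  ultimately have "((snd c \<circ> g) \<circ> (\<lambda>s. t - s) has_vector_derivative (- 1) *\<^sub>R ((- 1) *\<^sub>R X (t - (t - s)) c (g (t - s)))) (at s within {0..t})"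
    by (intro vector_diff_chain_within)
  thus "(snd c \<circ> (\<lambda>s. g (t - s)) has_vector_derivative X s c (g (t - s))) (at s within {0..t})"
    by (simp add: o_def)
qed

lemma cis_2pi_int: "cis (2 * pi * (t + of_int n)) = cis (2 * pi * t)"
proof -
  have "cis (2 * pi * (t + of_int n)) = cis (2 * pi * t) * cis (2 * pi * of_int n)"
    by (simp only: cis_mult distrib_left)
  also have "cis (2 * pi * of_int n) = 1" by (simp add: cis_multiple_2pi)
  finally show ?thesis by simp
qed

lemma cis_2pi_eq:
  assumes "cis (2 * pi * s) = cis (2 * pi * t)"
  obtains n :: int where "s = t + of_int n"
proof -
  have "exp (\<i> * complex_of_real (2 * pi * s)) = exp (\<i> * complex_of_real (2 * pi * t))" using assms by (simp add: cis_conv_exp)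
  then obtain n :: int where "\<i> * complex_of_real (2 * pi * s) = \<i> * complex_of_real (2 * pi * t) + (of_int (2 * n) * pi) * \<i>"
    unfolding exp_eq by blast
  hence "Im (\<i> * complex_of_real (2 * pi * s)) = Im (\<i> * complex_of_real (2 * pi * t) + (of_int (2 * n) * pi) * \<i>)" by (rule arg_cong)
  hence "2 * pi * s = 2 * pi * (t + of_int n)" by (simp add: algebra_simps)
  hence "s = t + of_int n" by simp
  thus ?thesis by (rule that)
qed

sublocale hamiltonian_domain \<subseteq> fd: flow_domain W A "\<lambda>t. ham_vf lam (H t)"
  by (rule flow)

context hamiltonian_domain
begin

text \<open>A curve is chosen anew for each u; by uniqueness the choices agree, and
  \<open>fl u w\<close> is the Hamiltonian flow from time 0 for u \<ge> 0.\<close>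

definition fl :: "real \<Rightarrow> 'a \<Rightarrow> 'a" where
  "fl u w = (SOME g. curve_on W A X 0 u g \<and> g 0 = w) u"

lemma fl_eq:
  assumes c: "curve_on W A X 0 T c" "c 0 = w" and u: "0 \<le> u" "u \<le> T"
  shows "fl u w = c u"
proof -
  have "curve_on W A X 0 u c" by (rule curve_on_subinterval[OF c(1)]) (use u in auto)
  hence g: "curve_on W A X 0 u c \<and> c 0 = w" using c(2) by simp
  let ?c = "SOME c. curve_on W A X 0 u c \<and> c 0 = w"
  have s: "curve_on W A X 0 u ?c \<and> ?c 0 = w" by (rule someI[where P = "\<lambda>c. curve_on W A X 0 u c \<and> c 0 = w" and x = c, OF g])
  have "?c u = c u" by (rule fd.curve_unique[of 0 u ?c c 0]) (use s g u in auto)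
  thus ?thesis by (simp add: fl_def)
qed

lemma fl_exists:
  assumes T: "0 \<le> T"
  shows "continuous_on ({0..T} \<times> W) (\<lambda>(u, w). fl u w)" "w \<in> W ==> fl 0 w = w"
    "w \<in> W ==> curve_on W A X 0 T (\<lambda>u. fl u w)"
proof -
  obtain f where f: "continuous_on ({0..T} \<times> W) (\<lambda>(u, p). f u p)" "\<And>p. p \<in> W ==> f 0 p = p"
    "\<And>p. p \<in> W ==> curve_on W A X 0 T (\<lambda>u. f u p)"
    using fd.flow_exists[OF T] by metis
  have eq: "fl u p = f u p" if "p \<in> W" "u \<in> {0..T}" for u p
    by (rule fl_eq[OF f(3)[OF that(1)] f(2)[OF that(1)]]) (use that in auto)
  show "continuous_on ({0..T} \<times> W) (\<lambda>(u, w). fl u w)"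
    by (rule continuous_on_eq[OF f(1)]) (use eq in auto)
  show "fl 0 w = w" if "w \<in> W" using eq[OF that, of 0] f(2)[OF that] T by simp
  show "curve_on W A X 0 T (\<lambda>u. fl u w)" if "w \<in> W"
    by (rule curve_on_cong[OF f(3)[OF that]]) (use eq that in auto)
qed

lemma fl_in: "0 \<le> u ==> w \<in> W ==> fl u w \<in> W"
  using fl_exists(3)[of u w] by (auto simp: curve_on_def)

lemma fl_0: "w \<in> W ==> fl 0 w = w"
  using fl_exists(2)[of 0] by simp

text \<open>Periodicity of X turns the part of the orbit after time 1 into an orbit from time
  0.\<close>

lemma fl_shift:
  assumes u: "0 \<le> u" and w: "w \<in> W"
  shows "fl (u + 1) w = fl u (fl 1 w)"
proof -
  have "curve_on W A X (0 + 1) (u + 1) (\<lambda>u. fl u w)"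
    by (rule curve_on_subinterval[OF fl_exists(3)[OF _ w, of "u + 1"]]) (use u in auto)
  from curve_on_shift[OF this] have "curve_on W A X 0 u (\<lambda>u. fl (u + 1) w)"
    by (rule curve_on_cong_vf) (rule X_periodic)
  from fl_eq[OF this refl, of u] show ?thesis using u by simp
qed

text \<open>A preimage is found by flowing back: follow -X, evaluated at time t - s, for time
  t.\<close>

lemma fl_surj:
  assumes t: "0 \<le> t" and y: "y \<in> W"
  obtains w where "w \<in> W" "fl t w = y"
proof -
  interpret r: flow_domain W A "\<lambda>s c p. (- 1) *\<^sub>R X (t - s) c p"
    by (rule fd.reparametrized) (intro continuous_intros)+
  obtain f where f: "\<And>p. p \<in> W ==> f 0 p = p" "\<And>p. p \<in> W ==> curve_on W A (\<lambda>s c p. (- 1) *\<^sub>R X (t - s) c p) 0 t (\<lambda>u. f u p)"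
    using r.flow_exists[OF t] by metis
  have c: "curve_on W A X 0 t (\<lambda>s. f (t - s) y)" by (rule curve_on_reverse[OF f(2)[OF y]])
  have w: "f t y \<in> W" using f(2)[OF y] t by (auto simp: curve_on_def)
  have "fl t (f t y) = f (t - t) y" by (rule fl_eq[OF c]) (use t in auto)
  thus ?thesis using that w f(1)[OF y] by simp
qed

lemma ham_time_one_eq:
  assumes w: "w \<in> W"
  shows "ham_time_one W A lam H w = fl 1 w"
  unfolding ham_time_one_def time_one_map_def integral_curve_iff
proof (rule the_equality)
  show "\<exists>g. curve_on W A X 0 1 g \<and> g 0 = w \<and> g 1 = fl 1 w"
    by (rule exI[of _ "\<lambda>u. fl u w"]) (use fl_exists(3)[OF _ w, of 1] fl_0[OF w] in simp)
  fix q assume "\<exists>g. curve_on W A X 0 1 g \<and> g 0 = w \<and> g 1 = q"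
  then obtain g where g: "curve_on W A X 0 1 g" "g 0 = w" "g 1 = q" by blast
  from fl_eq[OF g(1,2), of 1] g(3) show "q = fl 1 w" by simp
qed

text \<open>Near the boundary H is autonomous, so a curve moving along some multiple of some
  \<open>X T\<close> keeps \<open>H 0\<close> constant there, and the zero set of H is open and
  closed along it. Factor and time may vary freely because the lemma is also applied to projections
  of Reeb orbits, whose Hamiltonian time is not yet known.\<close>

lemma boundary_invariant:
  assumes g: "continuous_on {a..b} g" "\<And>s. s \<in> {a..b} ==> g s \<in> W"
    and d: "\<And>s c. s \<in> {a..b} ==> c \<in> A ==> g s \<in> fst c ==>
      \<exists>r T. ((snd c \<circ> g) has_vector_derivative r *\<^sub>R X T c (g s)) (at s within {a..b})"
    and s0: "s0 \<in> {a..b}" "g s0 \<in> bd" and s: "s \<in> {a..b}"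
  shows "g s \<in> bd"
proof -
  define E where "E = {a..b} \<inter> g -` bd"
  obtain N where N: "openin (top_of_set W) N" "bd \<subseteq> N" "\<And>w s t. w \<in> N ==> H s w = H t w"
    using autonomous by blast
  have cl: "closedin (top_of_set {a..b}) E" unfolding E_def
    by (rule continuous_closedin_preimage[OF g(1) closed_boundary])
  have nb: "\<exists>O'. open O' \<and> s \<in> O' \<and> {a..b} \<inter> O' \<subseteq> E" if sE: "s \<in> E" for s
  proof -
    have s: "s \<in> {a..b}" "g s \<in> bd" using sE by (auto simp: E_def)
    obtain c where c: "c \<in> A" "g s \<in> fst c" using chart_exists[OF g(2)[OF s(1)]] .
    note ch = chart_simps[OF charts[OF c(1)]]
    have "openin (top_of_set W) (fst c \<inter> N)" using ch(8) N(1) by (rule openin_Int)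
    then obtain V where V: "open V" "fst c \<inter> N = W \<inter> V" unfolding openin_open by blast
    obtain O' where O': "open O'" "{a..b} \<inter> g -` V = {a..b} \<inter> O'"
      using continuous_openin_preimage_gen[OF g(1) V(1)] unfolding openin_open by blast
    have "g s \<in> W \<inter> V" unfolding V(2)[symmetric] using c s N by blast
    hence "s \<in> O'" using O' s by blast
    then obtain e where e: "e > 0" "cball s e \<subseteq> O'" using O'(1) open_contains_cball by blast
    define a' where "a' = max a (s - e)"
    define b' where "b' = min b (s + e)"
    have sub: "{a'..b'} \<subseteq> {a..b} \<inter> O'" using e(2) by (auto simp: a'_def b'_def subset_iff dist_real_def)
    have mem: "g u \<in> fst c" "g u \<in> N" "u \<in> {a..b}" if "u \<in> {a'..b'}" for u
    proof -
      show "u \<in> {a..b}" using that sub by blast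
      have "g u \<in> W \<inter> V" using that sub O' g(2) by blast
      thus "g u \<in> fst c" "g u \<in> N" using V(2) by blast+
    qed
    have zero: "((\<lambda>u. H 0 (g u)) has_derivative (\<lambda>h. 0)) (at u within {a'..b'})" if u: "u \<in> {a'..b'}" for u
    proof -
      note m = mem[OF u]
      obtain r T where dd: "((snd c \<circ> g) has_vector_derivative r *\<^sub>R X T c (g u)) (at u within {a..b})"
        using d[OF m(3) c(1) m(1)] by blast
      have XT: "X T c (g u) = X 0 c (g u)" by (rule X_cong(1)[OF c(1) m(1) N(1) m(2) N(3)])
      have "((snd c \<circ> g) has_vector_derivative r *\<^sub>R X T c (g u)) (at u within {a'..b'})"
        by (rule has_vector_derivative_within_subset[OF dd]) (use sub in blast)
      hence 1: "((snd c \<circ> g) has_derivative (\<lambda>h. h *\<^sub>R (r *\<^sub>R X 0 c (g u)))) (at u within {a'..b'})"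
        unfolding has_vector_derivative_def XT .
      have 2: "((H 0 \<circ> chart_inv c) has_derivative dH 0 c (g u)) (at ((snd c \<circ> g) u) within (snd c \<circ> g) ` {a'..b'})"
        by (rule has_derivative_subset[of _ _ _ "chart_img c"]) (use dH_derivative[OF c(1) m(1), of 0] ch(4) mem(1) in auto)
      have "((\<lambda>u. (H 0 \<circ> chart_inv c) ((snd c \<circ> g) u)) has_derivative (\<lambda>h. dH 0 c (g u) (h *\<^sub>R (r *\<^sub>R X 0 c (g u))))) (at u within {a'..b'})"
        by (rule has_derivative_in_compose[OF 1 2])
      moreover have "dH 0 c (g u) (h *\<^sub>R (r *\<^sub>R X 0 c (g u))) = 0" for h
        using linear_scale[OF linear_dH[OF c(1) m(1)]] dH_X[OF c(1) m(1)] by simp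
      ultimately have "((\<lambda>u. (H 0 \<circ> chart_inv c) ((snd c \<circ> g) u)) has_derivative (\<lambda>h. 0)) (at u within {a'..b'})" by simp
      thus ?thesis by (rule has_derivative_transform[OF u, rotated]) (use ch(1) mem(1) in auto)
    qed
    have "\<exists>k. \<forall>u\<in>{a'..b'}. H 0 (g u) = k"
      by (rule has_derivative_zero_constant[OF _ zero]) auto
    moreover have sI: "s \<in> {a'..b'}" using s e by (auto simp: a'_def b'_def)
    ultimately have "H 0 (g u) = 0" if "u \<in> {a'..b'}" for u using that H_boundary[OF s(2), of 0] by metis
    hence "g u \<in> bd" if "u \<in> {a'..b'}" for u
      using that H_pos_iff(2)[OF g(2)[OF mem(3)[OF that]]] by blast
    moreover have "{a..b} \<inter> ball s e \<subseteq> {a'..b'}" by (auto simp: a'_def b'_def dist_real_def)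
    ultimately have "{a..b} \<inter> ball s e \<subseteq> E" by (auto simp: E_def)
    thus ?thesis using e by (intro exI[of _ "ball s e"]) auto
  qed
  have op: "openin (top_of_set {a..b}) E"
  proof (subst openin_subopen, intro ballI)
    fix s assume sE: "s \<in> E"
    from nb[OF this] obtain O' where O': "open O' \<and> s \<in> O' \<and> {a..b} \<inter> O' \<subseteq> E" ..
    moreover have "s \<in> {a..b}" using sE by (simp add: E_def)
    ultimately show "\<exists>T. openin (top_of_set {a..b}) T \<and> s \<in> T \<and> T \<subseteq> E"
      by (intro exI[of _ "{a..b} \<inter> O'"]) (auto simp: openin_open_Int)
  qed
  have "E = {} \<or> E = {a..b}" using connected_Icc[of a b] cl op unfolding connected_clopen by blast
  moreover have "s0 \<in> E" using s0 by (simp add: E_def)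
  ultimately have "s \<in> E" using s by blast
  thus ?thesis by (simp add: E_def)
qed

lemma H_int: "w \<in> W ==> H (t + of_int n) w = H t w"
proof (induction n rule: int_induct[of _ 0])
  case (step1 i) thus ?case using periodic[of w "t + of_int i"] by (simp add: add_ac)
next
  case (step2 i) thus ?case using periodic[of w "t + of_int (i - 1)"] by (simp add: add_ac)
qed simp

section \<open>Parametrizing the boundary of the tube\<close>

definition P :: "real \<Rightarrow> 'a \<Rightarrow> 'a \<times> complex" where
  "P t w = (w, complex_of_real (sqrt (H t w / pi)) * cis (2 * pi * t))"

definition M :: "('a \<times> complex) set" where
  "M = (\<lambda>(t, w). P t w) ` ({0..1} \<times> W)"

lemma fst_P [simp]: "fst (P t w) = w"
  by (simp add: P_def)

lemma norm_snd_P: "w \<in> W ==> pi * (cmod (snd (P t w)))\<^sup>2 = H t w"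
  using H_pos_iff(1)[of w t] by (simp add: P_def norm_mult)

lemma snd_P_polar: "w \<in> W ==> snd (P t w) = complex_of_real (cmod (snd (P t w))) * cis (2 * pi * t)"
  using H_pos_iff(1)[of w t] by (simp add: P_def norm_mult)

lemma P_int: "w \<in> W ==> P (t + of_int n) w = P t w"
  unfolding P_def using H_int[of w t n] cis_2pi_int[of t n] by simp

lemma P_in_M: assumes "w \<in> W" shows "P t w \<in> M"
proof -
  have "P (frac t + of_int \<lfloor>t\<rfloor>) w = P (frac t) w" by (rule P_int[OF assms])
  hence "P t w = P (frac t) w" by (simp add: frac_def)
  moreover have "(frac t, w) \<in> {0..1} \<times> W" using assms frac_ge_0[of t] frac_lt_1[of t] by (auto intro: less_imp_le)
  ultimately show ?thesis unfolding M_def by (metis (no_types, lifting) case_prod_conv image_eqI)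
qed

lemma continuous_P: "continuous_on (UNIV \<times> W) (\<lambda>(t, w). P t w)"
proof -
  have H: "continuous_on (UNIV \<times> W) (\<lambda>z. H (fst z) (snd z))" using continuous_H by (simp add: case_prod_unfold)
  have "continuous_on (UNIV \<times> W) (\<lambda>z. P (fst z) (snd z))" unfolding P_def
    by (intro continuous_on_Pair continuous_on_mult continuous_on_of_real continuous_on_real_sqrt continuous_on_divide H
        continuous_on_snd continuous_on_id continuous_on_const continuous_on_cis continuous_on_fst) auto
  thus ?thesis by (simp add: case_prod_unfold)
qed

lemma compact_M: "compact M"
  unfolding M_def by (intro compact_continuous_image continuous_on_subset[OF continuous_P] compact_Times compact_Icc compact_W) auto

text \<open>At \<open>z = 0\<close> both sides hold for every angle \<open>t\<close>, so the angle need not be determined by \<open>z\<close>.\<close>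

lemma polar_H_eq:
  assumes y: "y \<in> W" and z: "z \<noteq> 0 \<or> y \<in> bd"
    "z = complex_of_real r * cis (2 * pi * t)" "0 \<le> r" "z = complex_of_real r' * cis (2 * pi * t')" "0 \<le> r'"
  shows "\<exists>V. openin (top_of_set W) V \<and> y \<in> V \<and> (\<forall>w\<in>V. H t w = H t' w)"
proof (cases "z = 0")
  case True
  thus ?thesis using z(1) autonomous by blast
next
  case False
  have "cmod z = r" by (subst z(2)) (simp add: norm_mult z(3))
  moreover have "cmod z = r'" by (subst z(4)) (simp add: norm_mult z(5))
  ultimately have "cis (2 * pi * t) = cis (2 * pi * t')" using z False by auto
  then obtain n :: int where "t = t' + of_int n" by (rule cis_2pi_eq)
  thus ?thesis using H_int[of _ t' n] y by (intro exI[of _ W]) auto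
qed

text \<open>\<open>tube\<close> asks for some polar representation; here any angle t of z may be
  used. Angles of a nonzero z differ by integers, and H is periodic. For z = 0 the inequality always
  holds since H \<ge> 0, while equality forces y into the boundary of W, where H vanishes for every
  t.\<close>

lemma tube_iff:
  assumes y: "y \<in> W" and z: "z = polar (cmod z) t"
  shows "(y, z) \<in> tube W H \<longleftrightarrow> pi * (cmod z)\<^sup>2 \<le> H t y" "(y, z) \<in> M \<longleftrightarrow> pi * (cmod z)\<^sup>2 = H t y"
proof -
  have eq: "H t' y = H t y" if "z \<noteq> 0" "z = complex_of_real r * cis (2 * pi * t')" "0 \<le> r" for r t'
    using polar_H_eq[OF y _ that(2,3) z] that(1) by auto
  show "(y, z) \<in> tube W H \<longleftrightarrow> pi * (cmod z)\<^sup>2 \<le> H t y"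
  proof (cases "z = 0")
    case True
    have "\<exists>r. 0 \<le> r \<and> 0 = complex_of_real r * cis (2 * pi * t)" by (rule exI[of _ 0]) simp
    thus ?thesis using True y H_pos_iff(1)[OF y] unfolding tube_def by auto
  next
    case False
    show ?thesis
    proof
      assume "(y, z) \<in> tube W H"
      then obtain r t' where "0 \<le> r" "z = complex_of_real r * cis (2 * pi * t')" "pi * (cmod z)\<^sup>2 \<le> H t' y"
        unfolding tube_def by blast
      thus "pi * (cmod z)\<^sup>2 \<le> H t y" using eq[OF False] by metis
    next
      assume "pi * (cmod z)\<^sup>2 \<le> H t y"
      hence "0 \<le> cmod z \<and> z = polar (cmod z) t \<and> pi * (cmod z)\<^sup>2 \<le> H t y"
        using z by simp
      thus "(y, z) \<in> tube W H" unfolding tube_def using y by blast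
    qed
  qed
  show "(y, z) \<in> M \<longleftrightarrow> pi * (cmod z)\<^sup>2 = H t y"
  proof
    assume "(y, z) \<in> M"
    then obtain t' where t': "(y, z) = P t' y" unfolding M_def by (auto simp: P_def)
    hence 1: "pi * (cmod z)\<^sup>2 = H t' y" using norm_snd_P[OF y, of t'] by (metis snd_conv)
    show "pi * (cmod z)\<^sup>2 = H t y"
    proof (cases "z = 0")
      case True
      hence "y \<in> bd" using 1 H_pos_iff(2)[OF y] by simp
      thus ?thesis using True H_boundary by simp
    next
      case False
      have "z = polar (cmod z) t'" using snd_P_polar[OF y, of t'] t' by (metis snd_conv)
      thus ?thesis using 1 eq[OF False] by simp
    qed
  next
    assume *: "pi * (cmod z)\<^sup>2 = H t y"
    hence "sqrt (H t y / pi) = cmod z" by (metis nonzero_mult_div_cancel_left pi_neq_zero real_sqrt_abs abs_norm_cancel)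
    hence "(y, z) = P t y" unfolding P_def using z by simp
    thus "(y, z) \<in> M" using P_in_M[OF y] by simp
  qed
qed

text \<open>Parameters identified by P have functions H_t and H_t' that agree on a neighbourhood,
  not only at the point. This makes X and \<tau> well defined at points of the boundary of the tube
  even where the angle is lost.\<close>

lemma P_eq_same_H:
  assumes w: "w \<in> W" and eq: "P t w = P t' w'"
  shows "w' = w" "\<exists>V. openin (top_of_set W) V \<and> w \<in> V \<and> (\<forall>p\<in>V. H t p = H t' p)"
proof -
  show w': "w' = w" using arg_cong[OF eq, of fst] by simp
  show "\<exists>V. openin (top_of_set W) V \<and> w \<in> V \<and> (\<forall>p\<in>V. H t p = H t' p)"
  proof (rule polar_H_eq[OF w, of "snd (P t w)"])
    show "snd (P t w) \<noteq> 0 \<or> w \<in> bd" using norm_snd_P[OF w, of t] H_pos_iff(2)[OF w, of t] by auto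
    show "snd (P t w) = complex_of_real (cmod (snd (P t w))) * cis (2 * pi * t)" by (rule snd_P_polar[OF w])
    show "snd (P t w) = complex_of_real (cmod (snd (P t w))) * cis (2 * pi * t')" unfolding eq w' by (rule snd_P_polar[OF w])
  qed auto
qed

lemma P_eq_same_X:
  assumes w: "w \<in> W" and eq: "P t w = P t' w'"
  shows "c \<in> A ==> w \<in> fst c ==> X t c w = X t' c w" "\<tau> t w = \<tau> t' w" "H t w = H t' w"
proof -
  obtain V where V: "openin (top_of_set W) V" "w \<in> V" "\<And>p. p \<in> V ==> H t p = H t' p" using P_eq_same_H(2)[OF w eq] by blast
  show X: "X t c w = X t' c w" if "c \<in> A" "w \<in> fst c" for c using X_cong(1)[OF that V] .
  show HH: "H t w = H t' w" using V by blast
  obtain c where c: "c \<in> A" "w \<in> fst c" using chart_exists[OF w] .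
  show "\<tau> t w = \<tau> t' w" unfolding tau_eq[OF c] using X[OF c] HH by simp
qed

text \<open>No order between s and u is assumed: a Hamiltonian orbit lies in the boundary of W
  either always or never.\<close>

lemma fl_boundary:
  assumes w: "w \<in> W" and s: "0 \<le> s" "0 \<le> u" and b: "fl s w \<in> bd"
  shows "fl u w \<in> bd"
proof -
  let ?T = "max s u"
  have c: "curve_on W A X 0 ?T (\<lambda>u. fl u w)" using fl_exists(3)[OF _ w, of ?T] s by simp
  show ?thesis
  proof (rule boundary_invariant[of 0 ?T "\<lambda>u. fl u w" s u])
    show "continuous_on {0..?T} (\<lambda>u. fl u w)" "\<And>s. s \<in> {0..?T} ==> fl s w \<in> W" using c by (auto simp: curve_on_def)
    show "\<exists>r T. ((snd c \<circ> (\<lambda>u. fl u w)) has_vector_derivative r *\<^sub>R X T c (fl v w)) (at v within {0..?T})"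
      if "v \<in> {0..?T}" "c \<in> A" "fl v w \<in> fst c" for v c
      using curve_onD[OF \<open>curve_on W A X 0 ?T (\<lambda>u. fl u w)\<close> that] by (metis scaleR_one)
  qed (use s b in auto)
qed

end

section \<open>Boundary charts of the tube\<close>

text \<open>For a unit vector n, \<open>A u x\<close> runs from the orthogonal projection of x onto
  the hyperplane (u = 0) to x (u = 1). Differentiating under the integral yields integrals of the
  same kind, in part with the weight multiplied by 1 - u; an arbitrary weight w lets the induction
  close.\<close>

lemma ck_on_segment_integral:
  fixes g :: "'e::euclidean_space \<Rightarrow> real" and n :: 'e
  defines "A \<equiv> \<lambda>u x. x - ((1 - u) * (x \<bullet> n)) *\<^sub>R n"
  assumes U: "open U" "convex U" and AU: "\<And>x u. x \<in> U ==> u \<in> cbox 0 1 ==> A u x \<in> U"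
    and w: "continuous_on (cbox 0 1) w" and g: "\<And>j. ck_on j U g"
  shows "ck_on k U (\<lambda>x. integral (cbox 0 1) (\<lambda>u. w u * g (A u x)))"
  using w g
proof (induction k arbitrary: g w)
  case 0
  have gc: "continuous_on U g" using 0(2)[of 0] by simp
  have "continuous_on (U \<times> cbox 0 1) (\<lambda>z. w (snd z) * g (A (snd z) (fst z)))"
    using AU unfolding A_def
    by (intro continuous_on_mult continuous_on_compose2[OF 0(1) continuous_on_snd[OF continuous_on_id]] continuous_on_compose2[OF gc])
      (auto intro!: continuous_intros)
  hence "continuous_on (U \<times> cbox 0 1) (\<lambda>(x, u). w u * g (A u x))" by (simp add: case_prod_unfold)
  from integral_continuous_on_param[OF this] show ?case by simp
next
  case (Suc k)
  define D where "D = (\<lambda>y v. FD g (at y) v)"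
  have gD: "(g has_derivative D y) (at y)" if "y \<in> U" for y
    unfolding D_def using ck_on_has_derivative[OF Suc.prems(2)[of "Suc 0"] that] by simp
  have Dck: "ck_on j U (\<lambda>y. D y v)" for j v using Suc.prems(2)[of "Suc j"] by (simp add: D_def)
  have Dlin: "linear (D y)" if "y \<in> U" for y using has_derivative_linear[OF gD[OF that]] .
  define B where "B = (\<lambda>u v. v - ((1 - u) * (v \<bullet> n)) *\<^sub>R n)"
  have DB: "D y (B u v) = D y v - ((1 - u) * (v \<bullet> n)) * D y n" if "y \<in> U" for y u v
    unfolding B_def using linear_diff[OF Dlin[OF that]] linear_scale[OF Dlin[OF that]] by simp
  have Ad: "(A u has_derivative B u) (at x)" for u x
    unfolding A_def B_def by (auto intro!: derivative_eq_intros)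
  define fx where "fx = (\<lambda>x u. \<Sum>b\<in>Basis. (w u * D (A u x) (B u b)) *\<^sub>R blinfun_inner_left b)"
  have fxa: "blinfun_apply (fx x u) v = w u * D (A u x) (B u v)" if x: "x \<in> U" and u: "u \<in> cbox 0 1" for x u v
  proof -
    have y: "A u x \<in> U" using AU x u .
    have lin: "linear (\<lambda>v. D (A u x) (B u v))"
      unfolding DB[OF y] using Dlin[OF y] by (auto simp: linear_iff algebra_simps inner_add_left)
    have "D (A u x) (B u v) = (\<Sum>b\<in>Basis. (v \<bullet> b) *\<^sub>R D (A u x) (B u b))" by (rule linear_Basis_sum[OF lin])
    thus ?thesis unfolding fx_def
      by (simp add: blinfun.sum_left blinfun.scaleR_left sum_distrib_left mult_ac)
  qed
  have wc: "continuous_on (U \<times> cbox 0 1) (\<lambda>z. w (snd z))"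
    by (rule continuous_on_compose2[OF Suc.prems(1) continuous_on_snd[OF continuous_on_id]]) auto
  have Ac: "continuous_on (U \<times> cbox 0 1) (\<lambda>z. A (snd z) (fst z))" unfolding A_def by (intro continuous_intros)
  have Dc: "continuous_on (U \<times> cbox 0 1) (\<lambda>z. D (A (snd z) (fst z)) v)" for v
    by (rule continuous_on_compose2[of U "\<lambda>y. D y v", OF _ Ac]) (use Dck[of 0] AU in auto)
  have Dc': "continuous_on (cbox 0 1) (\<lambda>u. D (A u x) v)" if "x \<in> U" for x v
  proof -
    have "continuous_on (cbox (0::real) 1) (\<lambda>u. (x, u))" by (intro continuous_intros)
    from continuous_on_compose2[OF Dc this] that show ?thesis by (simp add: image_subset_iff)
  qed
  show ?case
  proof (rule ck_on_SucI[OF U(1)])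
    fix x assume x: "x \<in> U"
    have "((\<lambda>x. integral (cbox 0 1) (\<lambda>u. w u * g (A u x))) has_derivative blinfun_apply (integral (cbox 0 1) (fx x))) (at x within U)"
    proof (rule leibniz_rule[OF _ _ _ x U(2)])
      fix y u assume y: "y \<in> U" and u: "u \<in> cbox (0::real) 1"
      have "((\<lambda>x. w u * g (A u x)) has_derivative (\<lambda>v. w u * D (A u y) (B u v))) (at y)"
        by (rule has_derivative_mult_right[OF has_derivative_compose[OF Ad gD]]) (rule AU[OF y u])
      hence "((\<lambda>x. w u * g (A u x)) has_derivative blinfun_apply (fx y u)) (at y)"
      proof -
        assume d: "((\<lambda>x. w u * g (A u x)) has_derivative (\<lambda>v. w u * D (A u y) (B u v))) (at y)"
        have "blinfun_apply (fx y u) = (\<lambda>v. w u * D (A u y) (B u v))" using fxa[OF y u] by blast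
        with d show ?thesis by simp
      qed
      thus "((\<lambda>x. w u * g (A u x)) has_derivative blinfun_apply (fx y u)) (at y within U)" by (rule has_derivative_at_withinI)
    next
      fix y assume y: "y \<in> U"
      have gc: "continuous_on U g" using Suc.prems(2)[of 0] by simp
      have "continuous_on (cbox 0 1) (\<lambda>u. w u * g (A u y))"
        using AU y unfolding A_def
        by (intro continuous_on_mult Suc.prems(1) continuous_on_compose2[OF gc]) (auto intro!: continuous_intros)
      thus "(\<lambda>u. w u * g (A u y)) integrable_on cbox 0 1" by (rule integrable_continuous)
    next
      have "continuous_on (U \<times> cbox 0 1) (\<lambda>z. fx (fst z) (snd z))"
      proof (rule continuous_on_eq)
        show "continuous_on (U \<times> cbox 0 1) (\<lambda>z. \<Sum>b\<in>Basis. (w (snd z) * (D (A (snd z) (fst z)) b - ((1 - snd z) * (b \<bullet> n)) * D (A (snd z) (fst z)) n)) *\<^sub>R (blinfun_inner_left b :: 'e \<Rightarrow>\<^sub>L real))"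
          by (intro continuous_on_sum continuous_on_scaleR continuous_on_mult wc continuous_on_diff Dc continuous_on_const continuous_on_snd continuous_on_id)
      qed (use DB AU in \<open>auto simp: fx_def intro!: sum.cong\<close>)
      thus "continuous_on (U \<times> cbox 0 1) (\<lambda>(x, t). fx x t)" by (simp add: case_prod_unfold)
    qed
    hence d: "((\<lambda>x. integral (cbox 0 1) (\<lambda>u. w u * g (A u x))) has_derivative blinfun_apply (integral (cbox 0 1) (fx x))) (at x)"
      using at_within_open[OF x U(1)] by simp
    have fxc: "continuous_on (cbox 0 1) (fx x)"
    proof (rule continuous_on_eq)
      show "continuous_on (cbox 0 1) (\<lambda>u. \<Sum>b\<in>Basis. (w u * (D (A u x) b - ((1 - u) * (b \<bullet> n)) * D (A u x) n)) *\<^sub>R (blinfun_inner_left b :: 'e \<Rightarrow>\<^sub>L real))"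
        by (intro continuous_on_sum continuous_on_scaleR continuous_on_mult Suc.prems(1) continuous_on_diff Dc'[OF x] continuous_on_const continuous_on_id)
    qed (use DB AU[OF x] in \<open>auto simp: fx_def intro!: sum.cong\<close>)
    have i1: "(\<lambda>u. w u * D (A u x) v) integrable_on cbox 0 1" for v
      by (intro integrable_continuous continuous_on_mult Suc.prems(1) Dc'[OF x])
    have i2: "(\<lambda>u. (w u * (1 - u)) * D (A u x) n) integrable_on cbox 0 1"
      by (intro integrable_continuous continuous_on_mult Suc.prems(1) Dc'[OF x] continuous_intros)
    have "blinfun_apply (integral (cbox 0 1) (fx x)) v = integral (cbox 0 1) (\<lambda>u. w u * D (A u x) v) + (- (v \<bullet> n)) * integral (cbox 0 1) (\<lambda>u. (w u * (1 - u)) * D (A u x) n)" for v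
    proof -
      have "blinfun_apply (integral (cbox 0 1) (fx x)) v = integral (cbox 0 1) (\<lambda>u. blinfun_apply (fx x u) v)"
        by (rule blinfun_apply_integral[OF integrable_continuous[OF fxc]])
      also have "\<dots> = integral (cbox 0 1) (\<lambda>u. w u * D (A u x) v + (- (v \<bullet> n)) * ((w u * (1 - u)) * D (A u x) n))"
        by (rule integral_cong) (simp add: fxa[OF x] DB[OF AU[OF x]] algebra_simps)
      also have "\<dots> = integral (cbox 0 1) (\<lambda>u. w u * D (A u x) v) + integral (cbox 0 1) (\<lambda>u. (- (v \<bullet> n)) * ((w u * (1 - u)) * D (A u x) n))"
        by (rule integral_add[OF i1 integrable_on_mult_right[OF i2]])
      finally show ?thesis by simp
    qed
    thus "((\<lambda>x. integral (cbox 0 1) (\<lambda>u. w u * g (A u x))) has_derivative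
       (\<lambda>v. integral (cbox 0 1) (\<lambda>u. w u * D (A u x) v) + (- (v \<bullet> n)) * integral (cbox 0 1) (\<lambda>u. (w u * (1 - u)) * D (A u x) n))) (at x)"
    proof -
      assume e: "\<And>v. blinfun_apply (integral (cbox 0 1) (fx x)) v = integral (cbox 0 1) (\<lambda>u. w u * D (A u x) v) + (- (v \<bullet> n)) * integral (cbox 0 1) (\<lambda>u. (w u * (1 - u)) * D (A u x) n)"
      have "blinfun_apply (integral (cbox 0 1) (fx x)) = (\<lambda>v. integral (cbox 0 1) (\<lambda>u. w u * D (A u x) v) + (- (v \<bullet> n)) * integral (cbox 0 1) (\<lambda>u. (w u * (1 - u)) * D (A u x) n))"
        using e by blast
      with d show ?thesis by (simp only:)
    qed
  next
    fix v
    have w': "continuous_on (cbox 0 1) (\<lambda>u. w u * (1 - u))" by (intro continuous_on_mult Suc.prems(1) continuous_intros)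
    show "ck_on k U (\<lambda>x. integral (cbox 0 1) (\<lambda>u. w u * D (A u x) v) + (- (v \<bullet> n)) * integral (cbox 0 1) (\<lambda>u. (w u * (1 - u)) * D (A u x) n))"
      by (intro ck_on_add[OF U(1)] ck_on_linear_compose[OF bounded_linear_mult_right U(1)] Suc.IH Suc.prems(1) w' Dck)
  qed
qed

text \<open>As g vanishes on the hyperplane, g x is the integral over u of x \<bullet> n times the
  normal derivative of g at \<open>A u x\<close>. The quotient h is this integral without the factor
  x \<bullet> n; at x0 the segment shrinks to a point, which gives the value there.\<close>

lemma hadamard_division:
  fixes g :: "'e::euclidean_space \<Rightarrow> real" and n x0 :: 'e and r :: real
  defines "U \<equiv> ball x0 r"
  assumes r: "r > 0" and n: "norm n = 1" "x0 \<bullet> n = 0" and g: "\<And>j. ck_on j U g" "\<And>x. x \<in> U ==> x \<bullet> n = 0 ==> g x = 0"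
  obtains h where "\<And>k. ck_on k U h" "\<And>x. x \<in> U ==> g x = (x \<bullet> n) * h x" "h x0 = FD g (at x0) n"
proof -
  have nn: "n \<bullet> n = 1" using n(1) by (simp add: norm_eq_1)
  define A where "A = (\<lambda>u x. x - ((1 - u) * (x \<bullet> n)) *\<^sub>R n)"
  have U: "open U" "convex U" by (auto simp: U_def)
  \<comment> \<open>The hyperplane passes through x0, so projecting onto it does not increase the
    distance to x0; convexity of the ball covers the rest of the segment.\<close>
  have AU: "A u x \<in> U" if x: "x \<in> U" and u: "u \<in> cbox 0 1" for x u
  proof -
    define p where "p = x - (x \<bullet> n) *\<^sub>R n"
    define y where "y = x - x0"
    have py: "p - x0 = y - (y \<bullet> n) *\<^sub>R n" using n(2) by (simp add: p_def y_def inner_diff_left)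
    have "(y - (y \<bullet> n) *\<^sub>R n) \<bullet> (y - (y \<bullet> n) *\<^sub>R n) = y \<bullet> y - (y \<bullet> n)\<^sup>2"
      by (simp add: inner_diff_left inner_diff_right nn power2_eq_square inner_commute)
    hence "(norm (p - x0))\<^sup>2 \<le> (norm y)\<^sup>2" unfolding py by (simp add: power2_norm_eq_inner)
    hence "norm (p - x0) \<le> norm y" by (rule power2_le_imp_le) simp
    hence "p \<in> U" using x by (simp add: U_def y_def dist_norm norm_minus_commute)
    hence "u *\<^sub>R x + (1 - u) *\<^sub>R p \<in> U" using U(2) x u by (intro convexD) auto
    moreover have "u *\<^sub>R x + (1 - u) *\<^sub>R p = A u x" by (simp add: A_def p_def algebra_simps)
    ultimately show ?thesis by simp
  qed
  define D where "D = (\<lambda>y. FD g (at y) n)"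
  have gD: "(g has_derivative FD g (at y)) (at y)" if "y \<in> U" for y
    using ck_on_has_derivative[OF g(1)[of "Suc 0"] that] .
  have Dck: "ck_on j U D" for j using g(1)[of "Suc j"] by (simp add: D_def)
  define h where "h = (\<lambda>x. integral (cbox 0 1) (\<lambda>u. 1 * D (A u x)))"
  show ?thesis
  proof (rule that[of h])
    show "ck_on k U h" for k unfolding h_def A_def
      by (rule ck_on_segment_integral[OF U]) (use AU Dck in \<open>auto simp: A_def\<close>)
    have "A u x0 = x0" for u using n(2) by (simp add: A_def)
    thus "h x0 = FD g (at x0) n" by (simp add: h_def D_def)
    fix x assume x: "x \<in> U"
    have "((\<lambda>u. (x \<bullet> n) * D (A u x)) has_integral (g (A 1 x) - g (A 0 x))) {0..1}"
    proof (rule fundamental_theorem_of_calculus)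
      fix u :: real assume u: "u \<in> {0..1}"
      have y: "A u x \<in> U" using AU x u by simp
      have "((\<lambda>u. A u x) has_derivative (\<lambda>h. h *\<^sub>R ((x \<bullet> n) *\<^sub>R n))) (at u within {0..1})"
        unfolding A_def by (auto intro!: derivative_eq_intros simp: algebra_simps)
      from has_derivative_compose[OF this gD[OF y]]
      have "((\<lambda>u. g (A u x)) has_derivative (\<lambda>h. FD g (at (A u x)) (h *\<^sub>R ((x \<bullet> n) *\<^sub>R n)))) (at u within {0..1})" .
      thus "((\<lambda>u. g (A u x)) has_vector_derivative (x \<bullet> n) * D (A u x)) (at u within {0..1})"
        using linear_scale[OF has_derivative_linear[OF gD[OF y]]] by (simp add: has_vector_derivative_def D_def mult.assoc)
    qed simp
    moreover have "A 1 x = x" "g (A 0 x) = 0" using g(2)[of "A 0 x"] AU[OF x, of 0] by (simp_all add: A_def inner_diff_left nn)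
    ultimately have "((\<lambda>u. (x \<bullet> n) * D (A u x)) has_integral g x) {0..1}" by simp
    from integral_unique[OF this] have "integral {0..1} (\<lambda>u. (x \<bullet> n) * D (A u x)) = g x" .
    thus "g x = (x \<bullet> n) * h x" by (simp add: h_def)
  qed
qed

text \<open>The reflection exchanging \<open>b\<close> and \<^const>\<open>conormal\<close>; on a product type we do not know which
  basis vector \<^const>\<open>conormal\<close> is.\<close>

definition swap :: "'e::euclidean_space \<Rightarrow> 'e \<Rightarrow> 'e" where
  "swap b v = v + ((v \<bullet> b) - (v \<bullet> conormal)) *\<^sub>R (conormal - b)"

lemma swap:
  fixes b v :: "'e::euclidean_space"
  assumes b: "b \<in> Basis"
  shows "swap b (swap b v) = v" "swap b v \<bullet> conormal = v \<bullet> b" "bounded_linear (swap b)"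
proof -
  have i: "(conormal::'e) \<bullet> conormal = 1" "b \<bullet> b = 1" "b \<noteq> conormal ==> conormal \<bullet> b = 0" "b \<noteq> conormal ==> b \<bullet> conormal = 0"
    using b by (auto simp: inner_Basis conormal_Basis)
  show 1: "swap b v \<bullet> conormal = v \<bullet> b"
    using i by (cases "b = conormal") (simp_all add: swap_def inner_add_left inner_diff_left)
  have 2: "swap b v \<bullet> b = v \<bullet> conormal"
    using i by (cases "b = conormal") (simp_all add: swap_def inner_add_left inner_diff_left)
  have "swap b (swap b v) = swap b v + ((v \<bullet> conormal) - (v \<bullet> b)) *\<^sub>R (conormal - b)" by (simp add: swap_def[of b "swap b v"] 1 2)
  also have "\<dots> = v" by (simp add: swap_def algebra_simps)
  finally show "swap b (swap b v) = v" .
  show "bounded_linear (swap b)" unfolding swap_def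
    by (intro bounded_linear_add bounded_linear_ident bounded_linear_compose[OF bounded_linear_scaleR_left]
        bounded_linear_sub bounded_linear_inner_left)
qed

lemma chart_inv_prod_chart:
  assumes "is_chart W c" "y \<in> fst c"
  shows "chart_inv (prod_chart c) (snd c y, z) = (y, z)"
proof -
  have "inj_on (snd c) (fst c)" using chart_simps(1)[OF assms(1)] by (metis inj_onI)
  hence "inj_on (snd (prod_chart c)) (fst (prod_chart c))" by (auto simp: prod_chart_def inj_on_def)
  from inv_into_f_f[OF this, of "(y, z)"] assms(2) show ?thesis
    by (simp add: chart_inv_def prod_chart_def)
qed

lemma prod_chart_simps [simp]:
  "fst (prod_chart c) = fst c \<times> UNIV" "snd (prod_chart c) p = (snd c (fst p), snd p)"
  "chart_img (prod_chart c) = chart_img c \<times> UNIV"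
proof -
  show "fst (prod_chart c) = fst c \<times> UNIV" "snd (prod_chart c) p = (snd c (fst p), snd p)"
    by (simp_all add: prod_chart_def case_prod_unfold)
  show "chart_img (prod_chart c) = chart_img c \<times> UNIV"
    by (simp add: prod_chart_def chart_img_def image_paired_Times)
qed

text \<open>\<open>is_chart\<close> fixes the inverse as an \<open>inv_into\<close>; an explicitly
  known inverse agrees with it on the image.\<close>

lemma homeomorphism_chart_inv:
  assumes "homeomorphism (fst d) (chart_img d) (snd d) g"
  shows "homeomorphism (fst d) (chart_img d) (snd d) (chart_inv d)"
proof -
  have inj: "inj_on (snd d) (fst d)"
    by (rule inj_on_inverseI[of _ g]) (use assms in \<open>simp add: homeomorphism_def\<close>)
  have eq: "chart_inv d x = g x" if "x \<in> chart_img d" for x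
  proof -
    have "g x \<in> fst d" "snd d (g x) = x" using assms that unfolding homeomorphism_def by blast+
    thus ?thesis unfolding chart_inv_def using inv_into_f_f[OF inj, of "g x"] by simp
  qed
  show ?thesis
    by (rule homeomorphism_cong[OF assms]) (use eq in auto)
qed

context hamiltonian_domain
begin

lemma tube_subset: "tube W H \<subseteq> W \<times> UNIV"
  by (auto simp: tube_def)

text \<open>A criterion for boundary points: if a diffeomorphism f between open sets carries the
  tube to the half space of a basis vector b, then f followed by \<open>swap b\<close> is a chart of
  the induced atlas. The inverse g is part of the data, so no inverse function theorem
  enters.\<close>

lemma tube_chart:
  fixes f g :: "'e \<times> complex \<Rightarrow> 'e \<times> complex"
  assumes c: "c \<in> A" and O': "open O'" and Q: "open Q" and b: "b \<in> Basis"
    and f: "smooth_on O' f" "\<And>q. q \<in> O' ==> f q \<in> Q" "\<And>q. q \<in> O' ==> g (f q) = q"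
    and g: "smooth_on Q g" "\<And>q. q \<in> Q ==> g q \<in> O'" "\<And>q. q \<in> Q ==> f (g q) = q"
    and tubeO: "\<And>x z. (x, z) \<in> O' ==> (x \<in> chart_img c \<and> (chart_inv c x, z) \<in> tube W H) \<longleftrightarrow> f (x, z) \<bullet> b \<ge> 0"
    and p: "p \<in> tube W H" "fst p \<in> fst c" "(snd c (fst p), snd p) \<in> O'" "f (snd c (fst p), snd p) \<bullet> b = 0"
  shows "p \<in> mfd_boundary TA"
proof -
  let ?tb = "tube W H"
  let ?j = "\<lambda>p. (snd c (fst p), snd p)"
  note ch = chart_simps[OF charts[OF c]]
  define d where "d = ({p \<in> ?tb. fst p \<in> fst c \<and> ?j p \<in> O'}, \<lambda>p. swap b (f (?j p)))"
  define inv where "inv = (\<lambda>v. (chart_inv c (fst (g (swap b v))), snd (g (swap b v))))"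
  define img where "img = {v \<in> half_space. swap b v \<in> Q}"
  have dm: "p \<in> fst d \<longleftrightarrow> p \<in> ?tb \<and> fst p \<in> fst c \<and> ?j p \<in> O'" for p by (simp add: d_def)
  have sd: "snd d p = swap b (f (?j p))" for p by (simp add: d_def)
  have ds: "snd d p \<in> img" "inv (snd d p) = p" if pd: "p \<in> fst d" for p
  proof -
    have k: "?j p \<in> O'" "p \<in> ?tb" "fst p \<in> fst c" using pd dm by auto
    have "snd c (fst p) \<in> chart_img c \<and> (chart_inv c (snd c (fst p)), snd p) \<in> ?tb" using k ch(1,4) by simp
    hence "f (?j p) \<bullet> b \<ge> 0" using tubeO[OF k(1)] by blast
    thus "snd d p \<in> img" unfolding img_def sd using f(2)[OF k(1)] swap[OF b] by (simp add: half_space_def)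
    show "inv (snd d p) = p" unfolding inv_def sd using swap(1)[OF b] f(3)[OF k(1)] ch(1)[OF k(3)] by simp
  qed
  have iv: "inv v \<in> fst d" "snd d (inv v) = v" "?j (inv v) = g (swap b v)" "fst (g (swap b v)) \<in> chart_img c" if v: "v \<in> img" for v
  proof -
    have u: "swap b v \<in> Q" "v \<bullet> conormal \<ge> 0" using v by (auto simp: img_def half_space_def)
    have q: "g (swap b v) \<in> O'" by (rule g(2)[OF u(1)])
    have "f (g (swap b v)) \<bullet> b \<ge> 0"
      using g(3)[OF u(1)] swap(2)[OF b, of "swap b v"] swap(1)[OF b] u(2) by simp
    hence m: "fst (g (swap b v)) \<in> chart_img c" "inv v \<in> ?tb"
      using tubeO[of "fst (g (swap b v))" "snd (g (swap b v))"] q by (auto simp: inv_def)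
    show "fst (g (swap b v)) \<in> chart_img c" by (rule m(1))
    show k: "?j (inv v) = g (swap b v)" using ch(2)[OF m(1)] by (simp add: inv_def)
    show "inv v \<in> fst d" unfolding dm k using q m ch(3)[OF m(1)] by (simp add: inv_def)
    show "snd d (inv v) = v" unfolding sd k using g(3)[OF u(1)] swap(1)[OF b] by simp
  qed
  have di: "chart_img d = img"
    unfolding chart_img_def using ds(1) iv(1,2) by (auto simp: image_iff) metis
  have swc: "continuous_on S (swap b)" for S by (rule linear_continuous_on[OF swap(3)[OF b]])
  have "open (swap b -` Q)" using continuous_open_vimage[OF Q] swc[of UNIV] by (simp add: continuous_on_open_vimage Q)
  hence img_open: "openin (top_of_set half_space) img"
    unfolding openin_open by (intro exI[of _ "swap b -` Q"]) (auto simp: img_def)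
  have jc: "continuous_on (fst c \<times> UNIV) ?j"
    by (intro continuous_on_Pair continuous_on_snd continuous_on_id continuous_on_compose2[OF ch(6) continuous_on_fst[OF continuous_on_id]]) auto
  have fd_open: "openin (top_of_set ?tb) (fst d)"
  proof -
    obtain V where V: "open V" "fst c = W \<inter> V" using ch(8) unfolding openin_open by blast
    obtain V' where V': "open V'" "(fst c \<times> UNIV) \<inter> ?j -` O' = (fst c \<times> UNIV) \<inter> V'"
      using continuous_openin_preimage_gen[OF jc O'] unfolding openin_open by blast
    have "fst d = ?tb \<inter> ((V \<times> UNIV) \<inter> V')"
    proof (intro set_eqI iffI)
      fix p assume "p \<in> fst d"
      hence m: "p \<in> ?tb" "p \<in> (fst c \<times> UNIV) \<inter> ?j -` O'" by (auto simp: dm mem_Times_iff)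
      have "p \<in> (fst c \<times> UNIV) \<inter> V'" using m(2) unfolding V'(2) .
      thus "p \<in> ?tb \<inter> ((V \<times> UNIV) \<inter> V')" using m(1) V(2) by (auto simp: mem_Times_iff)
    next
      fix p assume p: "p \<in> ?tb \<inter> ((V \<times> UNIV) \<inter> V')"
      hence "p \<in> (fst c \<times> UNIV) \<inter> V'" using tube_subset V(2) by (auto simp: mem_Times_iff)
      hence "p \<in> (fst c \<times> UNIV) \<inter> ?j -` O'" unfolding V'(2) .
      thus "p \<in> fst d" unfolding dm using p by auto
    qed
    thus ?thesis using V(1) V'(1) by (auto simp: openin_open intro!: exI[of _ "(V \<times> UNIV) \<inter> V'"] open_Int open_Times)
  qed
  have "homeomorphism (fst d) (chart_img d) (snd d) inv"
    unfolding homeomorphism_def di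
  proof (intro conjI ballI)
    have "continuous_on (fst d) ?j" by (rule continuous_on_subset[OF jc]) (auto simp: dm mem_Times_iff)
    hence "continuous_on (fst d) (\<lambda>p. f (?j p))"
      by (rule continuous_on_compose2[OF smooth_on_continuous_on[OF f(1)]]) (auto simp: dm)
    hence "continuous_on (fst d) (\<lambda>p. swap b (f (?j p)))" by (rule continuous_on_compose2[OF swc]) auto
    thus "continuous_on (fst d) (snd d)" by (simp add: d_def)
    have "continuous_on img (\<lambda>v. g (swap b v))"
      by (rule continuous_on_compose2[OF smooth_on_continuous_on[OF g(1)] swc]) (auto simp: img_def)
    thus "continuous_on img inv" unfolding inv_def
      by (intro continuous_on_Pair continuous_on_snd continuous_on_compose2[OF ch(7) continuous_on_fst]) (use iv(4) in auto)
    show "snd d ` fst d = img" using di by (simp add: chart_img_def)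
    show "inv ` img = fst d" using iv(1) ds by (auto simp: image_iff) metis
  qed (use ds iv in auto)
  hence hom: "homeomorphism (fst d) (chart_img d) (snd d) (chart_inv d)" by (rule homeomorphism_chart_inv)
  hence isd: "is_chart ?tb d" unfolding is_chart_def using fd_open img_open di by simp
  note cd = chart_simps[OF isd]
  have sw: "smooth_on S (swap b)" for S by (rule smooth_on_linear[OF swap(3)[OF b]])
  \<comment> \<open>Compatibility with every product chart: coordinate changes of W act on the first
    component only, and f, g and \<open>swap\<close> are smooth.\<close>
  have "smooth_on (transition_dom d pc') (transition d pc') \<and> smooth_on (transition_dom pc' d) (transition pc' d)"
    if pc': "pc' \<in> prod_chart ` A" for pc'
  proof -
    obtain c' where c': "c' \<in> A" "pc' = prod_chart c'" using pc' by blast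
    note ch' = chart_simps[OF charts[OF c'(1)]]
    have lift: "smooth_on (transition_dom a a' \<times> (UNIV :: complex set)) (\<lambda>q. (transition a a' (fst q), snd q))"
      if "a \<in> A" "a' \<in> A" for a a'
      by (intro smooth_on_Pair smooth_on_compose[OF smooth_on_linear[OF bounded_linear_fst] smooth_transition[OF that]] smooth_on_linear bounded_linear_snd) auto
    have tr: "transition a a' (snd a y) = snd a' y" if "a \<in> A" "y \<in> fst a" for a a' y
      using chart_simps(1)[OF charts[OF that(1)] that(2)] by (simp add: transition_def)
    have 1: "smooth_on (transition_dom d pc') (transition d pc')"
    proof -
      let ?T = "transition_dom d pc'"
      have T: "\<exists>p. p \<in> fst d \<and> fst p \<in> fst c' \<and> v = snd d p" if "v \<in> ?T" for v
        using that by (auto simp: transition_dom_def c'(2))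
      have s1: "smooth_on ?T (\<lambda>v. g (swap b v))"
      proof (rule smooth_on_compose[OF sw g(1)])
        fix v assume "v \<in> ?T"
        then obtain p where "p \<in> fst d" "v = snd d p" using T by blast
        thus "swap b v \<in> Q" using ds(1)[of p] by (simp add: img_def)
      qed
      have k: "g (swap b (snd d p)) = ?j p" if "p \<in> fst d" for p
        using iv(3)[OF ds(1)[OF that]] ds(2)[OF that] by simp
      have "smooth_on ?T (\<lambda>v. (transition c c' (fst (g (swap b v))), snd (g (swap b v))))"
      proof (rule smooth_on_compose[OF s1 lift[OF c c'(1)]])
        fix v assume "v \<in> ?T"
        then obtain p where "p \<in> fst d" "fst p \<in> fst c'" "v = snd d p" using T by blast
        thus "g (swap b v) \<in> transition_dom c c' \<times> UNIV" using k[of p] dm by (auto simp: transition_dom_def)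
      qed
      thus ?thesis
      proof (rule smooth_on_cong)
        fix v assume "v \<in> ?T"
        then obtain p where p: "p \<in> fst d" "fst p \<in> fst c'" "v = snd d p" using T by blast
        thus "(transition c c' (fst (g (swap b v))), snd (g (swap b v))) = transition d pc' v"
          using k[OF p(1)] cd(1)[OF p(1)] tr[OF c, of "fst p" c'] dm[of p] by (simp add: transition_def[of d] c'(2))
      qed
    qed
    have 2: "smooth_on (transition_dom pc' d) (transition pc' d)"
    proof -
      let ?T = "transition_dom pc' d"
      have T: "\<exists>p. p \<in> fst d \<and> fst p \<in> fst c' \<and> v = (snd c' (fst p), snd p)" if "v \<in> ?T" for v
        using that by (auto simp: transition_dom_def c'(2))
      have s1: "smooth_on ?T (\<lambda>q. (transition c' c (fst q), snd q))"
        by (rule smooth_on_subset[OF lift[OF c'(1) c]]) (use T dm in \<open>force simp: transition_dom_def\<close>)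
      have s2: "smooth_on ?T (\<lambda>q. f (transition c' c (fst q), snd q))"
        by (rule smooth_on_compose[OF s1 f(1)]) (use T tr[OF c'(1), of _ c] dm in fastforce)
      have "smooth_on ?T (\<lambda>q. swap b (f (transition c' c (fst q), snd q)))"
        by (rule smooth_on_linear_compose[OF swap(3)[OF b] s2])
      thus ?thesis
      proof (rule smooth_on_cong)
        fix v assume "v \<in> ?T"
        then obtain p where p: "p \<in> fst d" "fst p \<in> fst c'" "v = (snd c' (fst p), snd p)" using T by blast
        have "chart_inv pc' v = p" unfolding p(3) c'(2) using chart_inv_prod_chart[OF charts[OF c'(1)] p(2), of "snd p"] by simp
        thus "swap b (f (transition c' c (fst v), snd v)) = transition pc' d v"
          using tr[OF c'(1) p(2), of c] by (simp add: transition_def[of pc'] sd p(3))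
      qed
    qed
    show ?thesis using 1 2 by simp
  qed
  hence dA: "d \<in> TA" unfolding tube_atlas_def induced_atlas_def using isd by blast
  have "p \<in> fst d" using p dm by simp
  moreover have "snd d p \<bullet> conormal = 0" unfolding sd swap(2)[OF b] by (rule p(4))
  ultimately show ?thesis using dA unfolding mfd_boundary_def by blast
qed

end

text \<open>By invariance of domain the image is open, so it contains a point slightly below
  \<open>f x\<close> in the conormal direction, and that point still lies in the half space.\<close>

lemma open_image_interior:
  fixes f :: "'f::euclidean_space \<Rightarrow> 'f"
  assumes U: "open U" and f: "continuous_on U f" "inj_on f U" "f ` U \<subseteq> half_space" and x: "x \<in> U"
  shows "f x \<bullet> conormal > 0"
proof -
  have "open (f ` U)" by (rule invariance_of_domain[OF f(1) U f(2)])
  then obtain e where e: "e > 0" "ball (f x) e \<subseteq> f ` U" using x open_contains_ball by blast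
  have n: "(conormal :: 'f) \<bullet> conormal = 1" "norm (conormal :: 'f) = 1" by (simp_all add: inner_Basis conormal_Basis norm_Basis)
  have "f x - (e/2) *\<^sub>R conormal \<in> ball (f x) e" using e by (simp add: dist_norm n)
  hence "f x - (e/2) *\<^sub>R conormal \<in> half_space" using e f(3) by blast
  thus ?thesis using e by (simp add: half_space_def inner_diff_left n)
qed

lemma inner_Complex_i: "(x, Complex a s) \<bullet> (0, \<i>) = s"
  by (simp add: inner_complex_def)

lemma i_Basis: "(0, \<i>) \<in> (Basis :: ('e::euclidean_space \<times> complex) set)"
  by (simp add: Basis_prod_def Basis_complex_def)

lemma smooth_on_Complex:
  assumes "smooth_on S f" "smooth_on S g"
  shows "smooth_on S (\<lambda>x. Complex (f x) (g x))"
proof -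
  have "smooth_on S (\<lambda>x. complex_of_real (f x) + \<i> * complex_of_real (g x))"
    by (intro smooth_on_add smooth_on_linear_compose[OF bounded_linear_of_real assms(1)]
        smooth_on_linear_compose[OF bounded_linear_compose[OF bounded_linear_mult_right bounded_linear_of_real] assms(2)])
  thus ?thesis by (simp add: Complex_eq)
qed

lemma polar_exists: obtains t where "z = polar (cmod z) t"
proof (rule that[of "Arg z / (2 * pi)"])
  show "z = polar (cmod z) (Arg z / (2 * pi))"
    using rcis_cmod_Arg[of z] by (simp add: rcis_def)
qed

context hamiltonian_domain
begin

lemma interior_nhd:
  assumes y: "y \<in> W" "y \<notin> bd"
  obtains c U where "c \<in> A" "y \<in> fst c" "open U" "snd c y \<in> U" "U \<subseteq> chart_img c"
proof -
  obtain c where c: "c \<in> A" "y \<in> fst c" using chart_exists[OF y(1)] .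
  note ch = chart_simps[OF charts[OF c(1)]]
  let ?x = "snd c y"
  have x: "?x \<in> chart_img c" using ch(4) c by blast
  have "?x \<bullet> conormal \<noteq> 0" using y(2) c by (auto simp: mfd_boundary_def)
  moreover have "?x \<bullet> conormal \<ge> 0" using ch(10) x by (auto simp: half_space_def)
  ultimately have xp: "?x \<bullet> conormal > 0" by simp
  obtain O1 where O1: "open O1" "chart_img c = half_space \<inter> O1" using ch(9) unfolding openin_open by blast
  show ?thesis
  proof (rule that[OF c, of "O1 \<inter> {y. y \<bullet> conormal > 0}"])
    show "open (O1 \<inter> {y. y \<bullet> conormal > 0})" using O1(1) open_halfspace_component_gt by (rule open_Int)
    have "?x \<in> O1" using O1(2) x by blast
    thus "?x \<in> O1 \<inter> {y. y \<bullet> conormal > 0}" using xp by simp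
    show "O1 \<inter> {y. y \<bullet> conormal > 0} \<subseteq> chart_img c" unfolding O1(2) by (auto simp: half_space_def)
  qed
qed

text \<open>Away from \<open>z = 0\<close>: the coordinates \<open>(x, t, H - \<pi> \<bar>z\<bar>\<^sup>2)\<close>, with explicit inverse.\<close>

lemma polar_chart:
  assumes y: "y \<in> W" "y \<notin> bd" and z0: "z0 \<noteq> 0" "z0 = polar (cmod z0) t0"
  obtains c O' \<Omega> and f g :: "'e \<times> complex \<Rightarrow> 'e \<times> complex" where "c \<in> A" "y \<in> fst c" "open O'" "open \<Omega>"
    "smooth_on O' f" "\<forall>q\<in>O'. f q \<in> \<Omega> \<and> g (f q) = q \<and> fst q \<in> chart_img c"
    "smooth_on \<Omega> g" "\<forall>q\<in>\<Omega>. g q \<in> O' \<and> f (g q) = q"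
    "\<forall>x z. (x, z) \<in> O' \<longrightarrow> ((chart_inv c x, z) \<in> tube W H \<longleftrightarrow> 0 \<le> f (x, z) \<bullet> (0, \<i>))"
    "(snd c y, z0) \<in> O'" "f (snd c y, z0) \<bullet> (0, \<i>) = H t0 y - pi * (cmod z0)\<^sup>2"
proof -
  obtain c U where c: "c \<in> A" "y \<in> fst c" and U: "open U" "snd c y \<in> U" "U \<subseteq> chart_img c" using interior_nhd[OF y] .
  note ch = chart_simps[OF charts[OF c(1)]]
  define G where "G = (\<lambda>t x. H t (chart_inv c x))"
  have Gs: "smooth_on (UNIV \<times> U) (\<lambda>(t, x). G t x)"
    unfolding G_def by (rule smooth_on_subset[OF smooth_H[OF c(1)]]) (use U(3) in auto)
  \<comment> \<open>Rotating \<open>z0\<close> onto the positive real axis makes the principal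
    argument smooth on the half plane \<open>Z\<close>, and makes \<open>tt\<close> the branch of
    the angle with value \<open>t0\<close> at \<open>z0\<close>.\<close>
  define rot where "rot = (\<lambda>z. z * cis (- (2 * pi * t0)))"
  define tt where "tt = (\<lambda>z. t0 + Arg (rot z) / (2 * pi))"
  define Z where "Z = {z. Re (rot z) > 0}"
  define O' where "O' = U \<times> Z"
  \<comment> \<open>The complex coordinate has the angle as real part and the defect H - \<pi> |z|^2
    as imaginary part. The half plane \<open>Z\<close> corresponds to angles within 1/4 of
    \<open>t0\<close>, and z \<noteq> 0 to a defect smaller than H.\<close>
  define \<Omega> where "\<Omega> = {q \<in> U \<times> {v. \<bar>Re v - t0\<bar> < 1/4}. Im (snd q) < G (Re (snd q)) (fst q)}"
  define f where "f = (\<lambda>q. (fst q, Complex (tt (snd q)) (G (tt (snd q)) (fst q) - pi * (snd q \<bullet> snd q))))"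
  define g where "g = (\<lambda>q. (fst q, complex_of_real (sqrt ((G (Re (snd q)) (fst q) - Im (snd q)) * (1 / pi))) * cis ((2 * pi) * Re (snd q))))"
  have Znz: "rot z \<noteq> 0" "\<bar>Arg (rot z)\<bar> < pi / 2" "rot z \<notin> \<real>\<^sub>\<le>\<^sub>0" if "z \<in> Z" for z
  proof -
    show nz: "rot z \<noteq> 0" using that by (auto simp: Z_def)
    show "\<bar>Arg (rot z)\<bar> < pi / 2" using Re_Ln_pos_lt[OF nz] that Arg_eq_Im_Ln[OF nz] by (simp add: Z_def)
    show "rot z \<notin> \<real>\<^sub>\<le>\<^sub>0" using that by (auto simp: Z_def complex_nonpos_Reals_iff)
  qed
  have cmrot: "cmod (rot z) = cmod z" for z by (simp add: rot_def norm_mult)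
  have ttz: "z = polar (cmod z) (tt z)" for z
  proof -
    have "z = rot z * cis (2 * pi * t0)" by (simp add: rot_def mult.assoc cis_mult)
    also have "rot z = complex_of_real (cmod z) * cis (Arg (rot z))" using rcis_cmod_Arg[of "rot z"] by (simp add: rcis_def cmrot)
    also have "\<dots> * cis (2 * pi * t0) = polar (cmod z) (tt z)"
      by (simp add: mult.assoc cis_mult tt_def distrib_left add.commute)
    finally show ?thesis .
  qed
  have rots: "smooth_on S rot" for S unfolding rot_def by (intro smooth_on_linear bounded_linear_mult_left)
  have rotc: "continuous_on S rot" for S unfolding rot_def by (intro continuous_intros)
  have oZ: "open Z" unfolding Z_def by (intro open_Collect_less continuous_intros rotc)
  hence oO: "open O'" unfolding O'_def by (rule open_Times[OF U(1)])
  have tts: "smooth_on O' (\<lambda>q. tt (snd q))"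
  proof -
    have "smooth_on O' (\<lambda>q. Ln (rot (snd q)))"
      by (rule smooth_on_Ln[OF smooth_on_compose[OF smooth_on_linear[OF bounded_linear_snd] rots[of UNIV]]])
        (use Znz(3) in \<open>auto simp: O'_def\<close>)
    hence "smooth_on O' (\<lambda>q. t0 + (1 / (2 * pi)) * Im (Ln (rot (snd q))))"
      by (intro smooth_on_add smooth_on_const smooth_on_linear_compose[OF bounded_linear_compose[OF bounded_linear_mult_right bounded_linear_Im]])
    thus ?thesis
    proof (rule smooth_on_cong)
      fix q assume "q \<in> O'"
      hence "rot (snd q) \<noteq> 0" using Znz(1) by (auto simp: O'_def)
      from Arg_eq_Im_Ln[OF this] show "t0 + (1 / (2 * pi)) * Im (Ln (rot (snd q))) = tt (snd q)" by (simp add: tt_def)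
    qed
  qed
  have Gtt: "smooth_on O' (\<lambda>q. G (tt (snd q)) (fst q))"
    using smooth_on_compose[OF smooth_on_Pair[OF tts smooth_on_linear[OF bounded_linear_fst]] Gs] by (auto simp: O'_def)
  have fs: "smooth_on O' f" unfolding f_def
    by (intro smooth_on_Pair smooth_on_Complex smooth_on_diff tts Gtt smooth_on_linear[OF bounded_linear_fst]
        smooth_on_linear_compose[OF bounded_linear_mult_right] smooth_on_bilinear[OF bounded_bilinear_inner] smooth_on_linear[OF bounded_linear_snd])
  have GR: "smooth_on \<Omega> (\<lambda>q. G (Re (snd q)) (fst q))"
    using smooth_on_compose[OF smooth_on_Pair[OF smooth_on_linear[OF bounded_linear_compose[OF bounded_linear_Re bounded_linear_snd]] smooth_on_linear[OF bounded_linear_fst]] Gs, of \<Omega>]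
    by (auto simp: \<Omega>_def)
  have gs: "smooth_on \<Omega> g" unfolding g_def
  proof (rule smooth_on_Pair[OF smooth_on_linear[OF bounded_linear_fst]])
    have s1: "smooth_on \<Omega> (\<lambda>q. (G (Re (snd q)) (fst q) - Im (snd q)) * (1 / pi))"
      by (intro smooth_on_linear_compose[OF bounded_linear_mult_left] smooth_on_diff GR smooth_on_linear bounded_linear_compose[OF bounded_linear_Im bounded_linear_snd])
    have s1p: "0 < (G (Re (snd q)) (fst q) - Im (snd q)) * (1 / pi)" if "q \<in> \<Omega>" for q using that by (simp add: \<Omega>_def)
    have s2: "smooth_on \<Omega> (\<lambda>q. (2 * pi) * Re (snd q))"
      by (intro smooth_on_linear bounded_linear_compose[OF bounded_linear_mult_right] bounded_linear_compose[OF bounded_linear_Re bounded_linear_snd])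
    show "smooth_on \<Omega> (\<lambda>q. complex_of_real (sqrt ((G (Re (snd q)) (fst q) - Im (snd q)) * (1 / pi))) * cis ((2 * pi) * Re (snd q)))"
      by (rule smooth_on_bilinear[OF bounded_bilinear_mult smooth_on_linear_compose[OF bounded_linear_of_real smooth_on_sqrt[OF s1 s1p]] smooth_on_cis[OF s2]])
  qed
  have o\<Omega>: "open \<Omega>"
  proof -
    let ?V = "U \<times> {v. \<bar>Re v - t0\<bar> < 1/4}"
    have oV: "open ?V" by (intro open_Times U(1) open_Collect_less continuous_intros)
    have "smooth_on ?V (\<lambda>q. G (Re (snd q)) (fst q))"
      using smooth_on_compose[OF smooth_on_Pair[OF smooth_on_linear[OF bounded_linear_compose[OF bounded_linear_Re bounded_linear_snd]] smooth_on_linear[OF bounded_linear_fst]] Gs, of ?V]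
      by auto
    hence "continuous_on ?V (\<lambda>q. Im (snd q) - G (Re (snd q)) (fst q))"
      by (intro continuous_on_diff smooth_on_continuous_on continuous_intros)
    hence "open (?V \<inter> (\<lambda>q. Im (snd q) - G (Re (snd q)) (fst q)) -` {..<0})" using oV by (intro continuous_open_preimage) auto
    moreover have "?V \<inter> (\<lambda>q. Im (snd q) - G (Re (snd q)) (fst q)) -` {..<0} = \<Omega>" unfolding \<Omega>_def by auto
    ultimately show ?thesis by simp
  qed
  have f\<Omega>: "f q \<in> \<Omega> \<and> g (f q) = q \<and> fst q \<in> chart_img c" if q: "q \<in> O'" for q
  proof (intro conjI)
    have z: "snd q \<in> Z" "fst q \<in> U" using q by (auto simp: O'_def)
    have "cmod (snd q) > 0" using Znz(1)[OF z(1)] by (auto simp: rot_def)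
    hence pos: "pi * (snd q \<bullet> snd q) > 0" by (simp add: power2_norm_eq_inner[symmetric])
    have "\<bar>tt (snd q) - t0\<bar> = \<bar>Arg (rot (snd q))\<bar> / (2 * pi)" by (simp add: tt_def abs_divide)
    also have "\<dots> < (pi / 2) / (2 * pi)" using Znz(2)[OF z(1)] by (intro divide_strict_right_mono) auto
    finally have "\<bar>tt (snd q) - t0\<bar> < 1/4" by simp
    thus "f q \<in> \<Omega>" using z pos by (simp add: f_def \<Omega>_def)
    have "sqrt (pi * (snd q \<bullet> snd q) * (1 / pi)) = cmod (snd q)" by (simp add: norm_eq_sqrt_inner)
    thus "g (f q) = q" using ttz[of "snd q"] by (simp add: g_def f_def prod_eq_iff)
    show "fst q \<in> chart_img c" using z U by blast
  qed
  have g\<Omega>: "g q \<in> O' \<and> f (g q) = q" if q: "q \<in> \<Omega>" for q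
  proof
    define s where "s = sqrt ((G (Re (snd q)) (fst q) - Im (snd q)) * (1 / pi))"
    have s: "s > 0" "pi * s\<^sup>2 = G (Re (snd q)) (fst q) - Im (snd q)" using q by (auto simp: s_def \<Omega>_def)
    have u: "fst q \<in> U" "\<bar>Re (snd q) - t0\<bar> < 1/4" using q by (auto simp: \<Omega>_def)
    have x: "g q = (fst q, complex_of_real s * cis (2 * pi * Re (snd q)))" by (simp add: g_def s_def)
    define a where "a = 2 * pi * (Re (snd q) - t0)"
    have "\<bar>a\<bar> = 2 * pi * \<bar>Re (snd q) - t0\<bar>" by (simp add: a_def abs_mult)
    also have "\<dots> < 2 * pi * (1/4)" using u(2) by (intro mult_strict_left_mono) auto
    finally have a: "\<bar>a\<bar> < pi / 2" by simp
    have r: "rot (snd (g q)) = complex_of_real s * cis a"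
      by (simp add: rot_def x mult.assoc cis_mult a_def right_diff_distrib)
    have "cos a > 0" using a by (intro cos_gt_zero_pi) auto
    hence "Re (rot (snd (g q))) > 0" using s by (simp add: r)
    thus "g q \<in> O'" using u by (simp add: O'_def Z_def x)
    have "Arg (rot (snd (g q))) = a" by (rule Arg_unique[of s]) (use s a in \<open>auto simp: r cis_conv_exp\<close>)
    hence "tt (snd (g q)) = Re (snd q)" by (simp add: tt_def a_def)
    moreover have "snd (g q) \<bullet> snd (g q) = s\<^sup>2" using s(1) by (simp add: x power2_norm_eq_inner[symmetric] norm_mult)
    ultimately show "f (g q) = q" using s(2) by (simp add: f_def x prod_eq_iff complex_eq_iff)
  qed
  have rot0: "rot z0 = complex_of_real (cmod z0)"
    unfolding rot_def by (subst z0(2)) (simp add: mult.assoc cis_mult)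
  have tt0: "tt z0 = t0" by (simp add: tt_def rot0)
  have m0: "(snd c y, z0) \<in> O'" using U z0(1) by (simp add: O'_def Z_def rot0)
  have w1: "\<forall>q\<in>O'. f q \<in> \<Omega> \<and> g (f q) = q \<and> fst q \<in> chart_img c" using f\<Omega> by (rule ballI)
  have w2: "\<forall>q\<in>\<Omega>. g q \<in> O' \<and> f (g q) = q" using g\<Omega> by (rule ballI)
  have w3: "\<forall>x z. (x, z) \<in> O' \<longrightarrow> ((chart_inv c x, z) \<in> tube W H) = (0 \<le> f (x, z) \<bullet> (0, \<i>))"
  proof (intro allI impI)
    fix x z assume "(x, z) \<in> O'"
    hence "chart_inv c x \<in> W" using ch(3,5) U by (auto simp: O'_def)
    from tube_iff(1)[OF this ttz[of z]] have "((chart_inv c x, z) \<in> tube W H) = (pi * (z \<bullet> z) \<le> H (tt z) (chart_inv c x))"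
      by (simp add: power2_norm_eq_inner)
    thus "((chart_inv c x, z) \<in> tube W H) = (0 \<le> f (x, z) \<bullet> (0, \<i>))"
      by (simp add: f_def inner_Complex_i G_def)
  qed
  have w4: "f (snd c y, z0) \<bullet> (0, \<i>) = H t0 y - pi * (cmod z0)\<^sup>2"
    using ch(1)[OF c(2)] by (simp add: f_def inner_Complex_i tt0 G_def power2_norm_eq_inner)
  show ?thesis by (rule that[OF c oO o\<Omega> fs w1 gs w2 w3 m0 w4])
qed

text \<open>Tangential derivatives of H vanish. If the normal one did too, then dH and X would be 0,
  and \<tau> = H = 0 at a boundary point.\<close>

lemma dH_boundary:
  assumes c: "c \<in> A" "p \<in> fst c" and p: "snd c p \<bullet> conormal = 0"
  shows "dH t c p conormal \<noteq> 0"
proof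
  assume z: "dH t c p conormal = 0"
  note ch = chart_simps[OF charts[OF c(1)]]
  have "dH t c p v = 0" if "v \<bullet> conormal = 0" for v
  proof (rule derivative_zero_along_boundary[OF dH_derivative[OF c] ch(9) ch(4)[OF c(2)] p _ that])
    fix y assume y: "y \<in> chart_img c" "y \<bullet> conormal = 0"
    hence "chart_inv c y \<in> bd" unfolding mfd_boundary_def using c(1) ch(2,3) by force
    thus "(H t \<circ> chart_inv c) y = 0" by (simp add: H_boundary)
  qed
  hence *: "dH t c p v = (v \<bullet> conormal) * dH t c p conormal" for v
    by (rule linear_vanishing_on_hyperplane[OF linear_dH[OF c]])
  hence "dH t c p v = 0" for v using *[of v] z by simp
  hence X0: "X t c p = 0" using linear_0[OF bilinear_ext_deriv(2)[OF c]] by (intro X_eqI[OF c]) simp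
  have pb: "p \<in> bd" using c p by (auto simp: mfd_boundary_def)
  hence "p \<in> W" using boundary_subset by blast
  from tau_pos[OF this, of t] show False
    using tau_eq[OF c, of t] linear_0[OF linear_lam[OF c]] X0 H_boundary[OF pb] by simp
qed

text \<open>Near the boundary \<open>H\<close> is \<open>x \<bullet> conormal\<close> times a positive smooth function, by Hadamard's lemma.\<close>

lemma boundary_collar:
  assumes y: "y \<in> bd"
  obtains c U h where "c \<in> A" "y \<in> fst c" "snd c y \<bullet> conormal = 0" "open U" "snd c y \<in> U" "smooth_on U h"
    "\<forall>x\<in>U. h x > 0" "U \<inter> half_space \<subseteq> chart_img c"
    "\<forall>x\<in>U \<inter> half_space. \<forall>t. H t (chart_inv c x) = (x \<bullet> conormal) * h x"
proof -
  obtain c where c: "c \<in> A" "y \<in> fst c" and y0: "snd c y \<bullet> conormal = 0" using y by (auto simp: mfd_boundary_def)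
  note ch = chart_simps[OF charts[OF c(1)]]
  let ?n = "conormal :: 'e" and ?x = "snd c y"
  have n: "norm ?n = 1" "?n \<bullet> ?n = 1" by (simp_all add: inner_Basis conormal_Basis norm_Basis)
  obtain N where N: "openin (top_of_set W) N" "bd \<subseteq> N" "\<forall>w\<in>N. \<forall>s t. H s w = H t w" using autonomous by blast
  have x: "?x \<in> chart_img c" using ch(4) c by blast
  obtain O1 where O1: "open O1" "chart_img c = half_space \<inter> O1" using ch(9) unfolding openin_open by blast
  \<comment> \<open>The second chart is only a carrier for N: its transition domain marks the
    coordinates at which H is autonomous.\<close>
  obtain O2 where O2: "open O2" "transition_dom c (N, snd c) = chart_img c \<inter> O2"
    using openin_transition_dom[OF charts[OF c(1)], of "(N, snd c)"] N(1) by auto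
  have xO2: "?x \<in> O2" using O2(2) c y N by (auto simp: transition_dom_def)
  have inN: "chart_inv c z \<in> N" if "z \<in> chart_img c \<inter> O2" for z
  proof -
    have "z \<in> transition_dom c (N, snd c)" using that O2 by simp
    thus ?thesis using ch(1) by (auto simp: transition_dom_def)
  qed
  have Gs: "smooth_on (chart_img c) (H 0 \<circ> chart_inv c)"
    using smooth_on_compose[OF smooth_on_Pair[OF smooth_on_const[of _ 0] smooth_on_ident] smooth_H[OF c(1)], of "chart_img c"] by (simp add: o_def)
  obtain V g where V: "open V" "?x \<in> V" and g: "\<forall>k. ck_on k V g" "\<forall>y\<in>chart_img c \<inter> V. g y = (H 0 \<circ> chart_inv c) y"
    and dg: "\<forall>y\<in>chart_img c \<inter> V. FD (H 0 \<circ> chart_inv c) (at y within chart_img c) = FD g (at y)"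
    by (rule smooth_on_extension[OF fat_chart_img[OF c(1)] Gs x])
  have "open (V \<inter> O1 \<inter> O2)" "?x \<in> V \<inter> O1 \<inter> O2" using V O1 O2 x xO2 by auto
  then obtain r where r: "r > 0" "ball ?x r \<subseteq> V \<inter> O1 \<inter> O2" using open_contains_ball by blast
  have gck: "ck_on j (ball ?x r) g" for j
    by (rule ck_on_subset[of _ V]) (use g r V in auto)
  have inch: "z \<in> chart_img c \<and> z \<in> V \<and> z \<in> O2" if "z \<in> ball ?x r" "z \<in> half_space" for z using that r O1(2) by blast
  have gb: "g z = 0" if z: "z \<in> ball ?x r" "z \<bullet> ?n = 0" for z
  proof -
    have zc: "z \<in> chart_img c" "z \<in> V" using inch z by (auto simp: half_space_def)
    have "chart_inv c z \<in> bd" unfolding mfd_boundary_def using c(1) ch(2,3) zc z(2) by force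
    thus ?thesis using g(2) zc by (simp add: H_boundary)
  qed
  obtain h where h: "\<And>k. ck_on k (ball ?x r) h" "\<And>z. z \<in> ball ?x r ==> g z = (z \<bullet> ?n) * h z" "h ?x = FD g (at ?x) ?n"
    using hadamard_division[OF r(1) n(1) y0 gck gb] by blast
  have "h ?x = dH 0 c y ?n" unfolding h(3) dH_def using dg x V by simp
  hence hx: "h ?x \<noteq> 0" using dH_boundary[OF c y0] by simp
  have hs: "smooth_on (ball ?x r) h" by (rule smooth_on_ckI[OF open_ball h(1)])
  have hc: "continuous_on (ball ?x r) h" by (rule smooth_on_continuous_on[OF hs])
  have "open (ball ?x r \<inter> (\<lambda>z. h z * h ?x) -` {0<..})" by (intro continuous_open_preimage continuous_intros hc) auto
  moreover have "?x \<in> ball ?x r \<inter> (\<lambda>z. h z * h ?x) -` {0<..}" using r hx by (simp add: zero_less_mult_iff) linarith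
  ultimately obtain e where e: "e > 0" "ball ?x e \<subseteq> ball ?x r \<inter> (\<lambda>z. h z * h ?x) -` {0<..}" using open_contains_ball by blast
  have HH: "H t (chart_inv c z) = (z \<bullet> ?n) * h z" if z: "z \<in> ball ?x r" "z \<in> half_space" for z t
  proof -
    have "H t (chart_inv c z) = H 0 (chart_inv c z)" using N(3) inN[of z] inch[OF z] by blast
    also have "\<dots> = g z" using g(2) inch[OF z] by simp
    finally show ?thesis using h(2)[OF z(1)] by simp
  qed
  \<comment> \<open>\<open>dH_boundary\<close> gives h \<noteq> 0 at the centre but not its sign; H
    \<ge> 0 at a point slightly inside decides it.\<close>
  let ?p = "?x + (e/2) *\<^sub>R ?n"
  have pb: "?p \<in> ball ?x e" using e n by (simp add: dist_norm)
  have pn: "?p \<bullet> ?n = e / 2" using n y0 by (simp add: inner_add_left)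
  have ph: "?p \<in> half_space" using pn e by (simp add: half_space_def)
  have pr: "?p \<in> ball ?x r" using pb e by blast
  have "chart_inv c ?p \<in> W" using inch[OF pr ph] ch(3,5) by blast
  hence "0 \<le> (e / 2) * h ?p" using H_pos_iff(1)[of "chart_inv c ?p" 0] HH[OF pr ph, of 0] pn by simp
  hence "h ?p \<ge> 0" using e by (simp add: zero_le_mult_iff)
  moreover have "h ?p * h ?x > 0" using e pb by blast
  ultimately have hxp: "h ?x > 0" by (simp add: zero_less_mult_iff)
  show ?thesis
  proof (rule that[OF c y0 open_ball[of ?x e]])
    show "?x \<in> ball ?x e" using e by simp
    show "smooth_on (ball ?x e) h" by (rule smooth_on_subset[OF hs]) (use e in blast)
    show "\<forall>x\<in>ball ?x e. h x > 0"
    proof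
      fix z assume "z \<in> ball ?x e"
      hence "h z * h ?x > 0" using e by blast
      thus "h z > 0" using hxp by (simp add: zero_less_mult_iff)
    qed
    show "ball ?x e \<inter> half_space \<subseteq> chart_img c" using inch e by blast
    show "\<forall>x\<in>ball ?x e \<inter> half_space. \<forall>t. H t (chart_inv c x) = (x \<bullet> ?n) * h x" using HH e by blast
  qed
qed

text \<open>In a collar the tube is \<pi> |z|^2 \<le> (x \<bullet> n) h x. Rescaling z by sqrt
  (\<pi> / h) to v makes this |v|^2 \<le> x \<bullet> n, and the map x - |v|^2 n straightens it to a
  half space; \<open>e1\<close> recovers x. This chart works at z = 0, where polar coordinates
  fail.\<close>

lemma binding_in_tube_boundary:
  assumes y: "y \<in> bd"
  shows "(y, 0) \<in> mfd_boundary TA"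
proof -
  obtain c U h where c: "c \<in> A" "y \<in> fst c" and y0: "snd c y \<bullet> conormal = 0" and U: "open U" "snd c y \<in> U" and h: "smooth_on U h"
    "\<forall>x\<in>U. h x > 0" and Uc: "U \<inter> half_space \<subseteq> chart_img c"
    and HH: "\<forall>x\<in>U \<inter> half_space. \<forall>t. H t (chart_inv c x) = (x \<bullet> conormal) * h x"
    by (rule boundary_collar[OF y])
  note ch = chart_simps[OF charts[OF c(1)]]
  let ?n = "conormal :: 'e"
  have n: "norm ?n = 1" "?n \<bullet> ?n = 1" by (simp_all add: inner_Basis conormal_Basis norm_Basis)
  define O' where "O' = U \<times> (UNIV :: complex set)"
  define e1 where "e1 = (\<lambda>q :: 'e \<times> complex. fst q + (snd q \<bullet> snd q) *\<^sub>R ?n)"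
  define \<Omega> where "\<Omega> = e1 -` U"
  define v where "v = (\<lambda>q. sqrt (inverse (h (fst q)) * pi) *\<^sub>R snd q :: complex)"
  define \<psi> where "\<psi> = (\<lambda>q. (fst q - (v q \<bullet> v q) *\<^sub>R ?n, v q))"
  define g where "g = (\<lambda>q. (e1 q, sqrt (h (e1 q) * (1 / pi)) *\<^sub>R snd q))"
  have zz: "smooth_on S (\<lambda>q. snd q \<bullet> snd q)" for S :: "('e \<times> complex) set"
    by (intro smooth_on_bilinear[OF bounded_bilinear_inner] smooth_on_linear bounded_linear_snd)
  have e1s: "smooth_on S e1" for S
    unfolding e1_def by (intro smooth_on_add smooth_on_linear bounded_linear_fst smooth_on_linear_compose[OF bounded_linear_scaleR_left zz])
  have o\<Omega>: "open \<Omega>" unfolding \<Omega>_def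
    using continuous_open_preimage[OF smooth_on_continuous_on[OF e1s] open_UNIV U(1)] by simp
  have hO: "smooth_on O' (\<lambda>q. h (fst q))"
    by (rule smooth_on_compose[OF smooth_on_linear[OF bounded_linear_fst] h(1)]) (auto simp: O'_def)
  have hO2: "smooth_on O' (\<lambda>q. inverse (h (fst q)) * pi)"
    by (rule smooth_on_linear_compose[OF bounded_linear_mult_left smooth_on_inverse[OF hO]]) (use h in \<open>fastforce simp: O'_def\<close>)
  have hO3: "smooth_on O' (\<lambda>q. sqrt (inverse (h (fst q)) * pi))"
    by (rule smooth_on_sqrt[OF hO2]) (use h in \<open>auto simp: O'_def\<close>)
  have vs: "smooth_on O' v" unfolding v_def
    by (rule smooth_on_bilinear[OF bounded_bilinear_scaleR hO3 smooth_on_linear[OF bounded_linear_snd]])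
  have vv: "smooth_on O' (\<lambda>q. v q \<bullet> v q)"
    by (rule smooth_on_bilinear[OF bounded_bilinear_inner vs vs])
  have \<psi>s: "smooth_on O' \<psi>" unfolding \<psi>_def
    by (rule smooth_on_Pair[OF smooth_on_diff[OF smooth_on_linear[OF bounded_linear_fst] smooth_on_linear_compose[OF bounded_linear_scaleR_left vv]] vs])
  have he: "smooth_on \<Omega> (\<lambda>q. h (e1 q) * (1 / pi))"
    by (rule smooth_on_linear_compose[OF bounded_linear_mult_left smooth_on_compose[OF e1s h(1)]]) (auto simp: \<Omega>_def)
  have he2: "smooth_on \<Omega> (\<lambda>q. sqrt (h (e1 q) * (1 / pi)))"
    by (rule smooth_on_sqrt[OF he]) (use h in \<open>auto simp: \<Omega>_def\<close>)
  have gs: "smooth_on \<Omega> g" unfolding g_def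
    by (rule smooth_on_Pair[OF e1s smooth_on_bilinear[OF bounded_bilinear_scaleR he2 smooth_on_linear[OF bounded_linear_snd]]])
  have e1\<psi>: "e1 (\<psi> q) = fst q" for q by (simp add: e1_def \<psi>_def)
  have v2: "v q \<bullet> v q = pi * (cmod (snd q))\<^sup>2 / h (fst q)" if "h (fst q) > 0" for q
    using that by (simp add: v_def power2_norm_eq_inner[symmetric] power_mult_distrib divide_inverse mult_ac)
  have one: "sqrt (a * (1 / pi)) * sqrt (inverse a * pi) = 1" if "a > 0" for a
    using that by (simp add: real_sqrt_mult[symmetric])
  have b: "(?n, 0) \<in> (Basis :: ('e \<times> complex) set)" by (simp add: Basis_prod_def conormal_Basis)
  show ?thesis
  proof (rule tube_chart[OF c(1) _ o\<Omega> b \<psi>s _ _ gs])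
    show "open O'" unfolding O'_def using U(1) by (intro open_Times) auto
    show "\<psi> q \<in> \<Omega>" if "q \<in> O'" for q using that by (auto simp: \<Omega>_def e1\<psi> O'_def)
    show "g (\<psi> q) = q" if "q \<in> O'" for q
    proof -
      have "h (fst q) > 0" using that h by (auto simp: O'_def)
      from one[OF this] show ?thesis by (simp add: g_def e1\<psi>) (simp add: \<psi>_def v_def)
    qed
    show "g q \<in> O'" if "q \<in> \<Omega>" for q using that by (simp add: \<Omega>_def O'_def g_def)
    show "\<psi> (g q) = q" if "q \<in> \<Omega>" for q
    proof -
      have "h (e1 q) > 0" using that h by (auto simp: \<Omega>_def)
      from one[OF this] have "v (g q) = snd q" by (simp add: g_def v_def mult.commute)
      thus ?thesis by (simp add: \<psi>_def prod_eq_iff) (simp add: g_def e1_def)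
    qed
    fix x z assume "(x, z) \<in> O'"
    hence xU: "x \<in> U" and hp: "h x > 0" using h by (auto simp: O'_def)
    have ps: "\<psi> (x, z) \<bullet> (?n, 0) = x \<bullet> ?n - pi * (cmod z)\<^sup>2 / h x" using hp by (simp add: \<psi>_def v2 inner_diff_left n)
    obtain t where t: "z = polar (cmod z) t" by (rule polar_exists)
    have "(x \<in> chart_img c \<and> (chart_inv c x, z) \<in> tube W H) \<longleftrightarrow> (x \<in> half_space \<and> pi * (cmod z)\<^sup>2 \<le> (x \<bullet> ?n) * h x)"
    proof (cases "x \<in> half_space")
      case True
      hence "x \<in> chart_img c" using Uc xU by blast
      moreover from this have "chart_inv c x \<in> W" using ch(3,5) by blast
      ultimately show ?thesis using tube_iff(1)[OF _ t] HH True xU by simp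
    next
      case False thus ?thesis using ch(10) by blast
    qed
    also have "\<dots> \<longleftrightarrow> pi * (cmod z)\<^sup>2 / h x \<le> x \<bullet> ?n"
    proof -
      have "0 \<le> x \<bullet> ?n" if "pi * (cmod z)\<^sup>2 / h x \<le> x \<bullet> ?n"
        using order_trans[OF _ that] hp by simp
      thus ?thesis using hp by (auto simp: half_space_def divide_le_eq)
    qed
    finally show "(x \<in> chart_img c \<and> (chart_inv c x, z) \<in> tube W H) \<longleftrightarrow> \<psi> (x, z) \<bullet> (?n, 0) \<ge> 0" unfolding ps by simp
  next
    have "y \<in> W" using y boundary_subset by blast
    from tube_iff(1)[OF this, of 0] show "(y, 0) \<in> tube W H" using H_boundary[OF y] by simp
    show "fst (y, 0) \<in> fst c" using c by simp
    show "(snd c (fst (y, 0)), snd (y, 0)) \<in> O'" using U by (simp add: O'_def)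
    show "\<psi> (snd c (fst (y, 0)), snd (y, 0)) \<bullet> (?n, 0) = 0" using y0 by (simp add: \<psi>_def v_def)
  qed
qed

end

text \<open>Parametrizing a part of S injectively by an open set and applying the chart gives an
  injective continuous map between spaces of equal dimension, so \<open>open_image_interior\<close>
  applies.\<close>

lemma chart_interior_point:
  fixes d :: "('a::topological_space, 'f::euclidean_space) chart" and j :: "'f \<Rightarrow> 'a"
  assumes d: "is_chart S d" "j u0 \<in> fst d" and U: "open U" "u0 \<in> U"
    and j: "continuous_on U j" "inj_on j U" "\<And>u. u \<in> U ==> j u \<in> S"
  shows "snd d (j u0) \<bullet> conormal > 0"
proof -
  note ch = chart_simps[OF d(1)]
  obtain V where V: "open V" "fst d = S \<inter> V" using ch(8) unfolding openin_open by blast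
  let ?U = "U \<inter> j -` V"
  have oU: "open ?U" by (rule continuous_open_preimage[OF j(1) U(1) V(1)])
  have jd: "j ` ?U \<subseteq> fst d" using j(3) V(2) by blast
  have "(snd d \<circ> j) u0 \<bullet> conormal > 0"
  proof (rule open_image_interior[where f="snd d \<circ> j", OF oU])
    show "continuous_on ?U (snd d \<circ> j)"
      by (rule continuous_on_compose[OF continuous_on_subset[OF j(1) Int_lower1] continuous_on_subset[OF ch(6) jd]])
    have "inj_on (snd d) (fst d)" by (rule inj_on_inverseI[of _ "chart_inv d"]) (rule ch(1))
    thus "inj_on (snd d \<circ> j) ?U"
      by (intro comp_inj_on inj_on_subset[OF j(2) Int_lower1]) (rule inj_on_subset[OF _ jd])
    show "(snd d \<circ> j) ` ?U \<subseteq> half_space" using jd ch(4,10) by (auto simp: image_subset_iff)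
    show "u0 \<in> ?U" using U(2) d(2) V(2) by blast
  qed
  thus ?thesis by simp
qed

text \<open>If p were interior for d, the inverse of d would parametrize a part of S around p by an
  open set, and p would be interior for d0 as well. Needed because \<open>mfd_boundary\<close> asks
  for only one chart.\<close>

lemma chart_boundary_invariant:
  fixes d0 d :: "('a::topological_space, 'f::euclidean_space) chart"
  assumes d0: "is_chart S d0" "p \<in> fst d0" "snd d0 p \<bullet> conormal = 0" and d: "is_chart S d" "p \<in> fst d"
  shows "snd d p \<bullet> conormal = 0"
proof (rule ccontr)
  note ch = chart_simps[OF d(1)]
  assume "snd d p \<bullet> conormal \<noteq> 0"
  moreover have "snd d p \<bullet> conormal \<ge> 0" using ch(4,10) d(2) by (auto simp: half_space_def)
  ultimately have pos: "snd d p \<bullet> conormal > 0" by simp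
  obtain O1 where O1: "open O1" "chart_img d = half_space \<inter> O1" using ch(9) unfolding openin_open by blast
  let ?U = "O1 \<inter> {y. y \<bullet> conormal > 0}"
  have oU: "open ?U" using O1(1) open_halfspace_component_gt by (rule open_Int)
  have Ui: "?U \<subseteq> chart_img d" unfolding O1(2) by (auto simp: half_space_def)
  have pU: "snd d p \<in> ?U" using pos O1(2) ch(4)[OF d(2)] by blast
  have "snd d0 (chart_inv d (snd d p)) \<bullet> conormal > 0"
  proof (rule chart_interior_point[OF d0(1) _ oU pU])
    show "chart_inv d (snd d p) \<in> fst d0" using ch(1)[OF d(2)] d0(2) by simp
    show "continuous_on ?U (chart_inv d)" by (rule continuous_on_subset[OF ch(7) Ui])
    show "inj_on (chart_inv d) ?U" by (rule inj_on_inverseI[of _ "snd d"]) (use ch(2) Ui in blast)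
    show "chart_inv d u \<in> S" if "u \<in> ?U" for u using that Ui ch(3,5) by blast
  qed
  thus False using ch(1)[OF d(2)] d0(3) by simp
qed

context hamiltonian_domain
begin

lemma tube_atlas_chart: "d \<in> TA ==> is_chart (tube W H) d"
  by (simp add: tube_atlas_def induced_atlas_def)

lemma tube_interior_chart:
  assumes d: "d \<in> TA" "(y, z) \<in> fst d" and c: "c \<in> A" "y \<in> fst c"
    and U: "open U" "(snd c y, z) \<in> U" "\<And>x v. (x, v) \<in> U ==> x \<in> chart_img c \<and> (chart_inv c x, v) \<in> tube W H"
  shows "snd d (y, z) \<bullet> conormal > 0"
proof -
  note ch = chart_simps[OF charts[OF c(1)]]
  let ?j = "\<lambda>q. (chart_inv c (fst q), snd q)"
  have "snd d (?j (snd c y, z)) \<bullet> conormal > 0"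
  proof (rule chart_interior_point[OF tube_atlas_chart[OF d(1)] _ U(1,2)])
    show "?j (snd c y, z) \<in> fst d" using ch(1)[OF c(2)] d(2) by simp
    show "continuous_on U ?j"
      by (intro continuous_on_Pair continuous_on_compose2[OF ch(7)] continuous_intros) (use U(3) in auto)
    show "inj_on ?j U"
      by (rule inj_on_inverseI[of _ "\<lambda>q. (snd c (fst q), snd q)"]) (use U(3) ch(2) in auto)
    show "?j u \<in> tube W H" if "u \<in> U" for u using U(3)[of "fst u" "snd u"] that by simp
  qed
  thus ?thesis using ch(1)[OF c(2)] by simp
qed

text \<open>Points of M are boundary points by the polar chart, or by the collar chart when z = 0.
  Points of the tube outside M satisfy the inequality strictly; an open set of product coordinates
  around them stays in the tube, so every chart sees them as interior.\<close>

lemma tube_boundary: "mfd_boundary TA = M"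
proof (intro equalityI subsetI)
  fix p assume "p \<in> M"
  moreover obtain y z where p: "p = (y, z)" by (cases p)
  ultimately have pM: "(y, z) \<in> M" by simp
  hence y: "y \<in> W" using fst_P unfolding M_def by (auto simp: P_def)
  obtain t where t: "z = polar (cmod z) t" by (rule polar_exists)
  have eq: "pi * (cmod z)\<^sup>2 = H t y" using tube_iff(2)[OF y t] pM by simp
  have pt: "(y, z) \<in> tube W H" using tube_iff(1)[OF y t] eq by simp
  show "p \<in> mfd_boundary TA"
  proof (cases "z = 0")
    case True
    hence "y \<in> bd" using H_pos_iff(2)[OF y, of t] eq by simp
    thus ?thesis using binding_in_tube_boundary True p by simp
  next
    case False
    hence yb: "y \<notin> bd" using H_pos_iff(2)[OF y, of t] eq by auto
    obtain c O' Q and g j :: "'e \<times> complex \<Rightarrow> 'e \<times> complex" where c: "c \<in> A" "y \<in> fst c" and o: "open O'" "open Q"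
      and g: "smooth_on O' g" "\<forall>q\<in>O'. g q \<in> Q \<and> j (g q) = q \<and> fst q \<in> chart_img c"
      and j: "smooth_on Q j" "\<forall>q\<in>Q. j q \<in> O' \<and> g (j q) = q"
      and tO: "\<forall>x z. (x, z) \<in> O' \<longrightarrow> ((chart_inv c x, z) \<in> tube W H \<longleftrightarrow> 0 \<le> g (x, z) \<bullet> (0, \<i>))"
      and yO: "(snd c y, z) \<in> O'" "g (snd c y, z) \<bullet> (0, \<i>) = H t y - pi * (cmod z)\<^sup>2"
      by (rule polar_chart[OF y yb False t])
    show ?thesis unfolding p
    proof (rule tube_chart[OF c(1) o i_Basis g(1) _ _ j(1)])
      show "g q \<in> Q" "j (g q) = q" if "q \<in> O'" for q using g(2) that by blast+
      show "j q \<in> O'" "g (j q) = q" if "q \<in> Q" for q using j(2) that by blast+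
      show "(x \<in> chart_img c \<and> (chart_inv c x, z) \<in> tube W H) \<longleftrightarrow> 0 \<le> g (x, z) \<bullet> (0, \<i>)" if "(x, z) \<in> O'" for x z
        using tO g(2) that by fastforce
      show "(y, z) \<in> tube W H" by fact
      show "fst (y, z) \<in> fst c" "(snd c (fst (y, z)), snd (y, z)) \<in> O'" using c yO by simp_all
      show "g (snd c (fst (y, z)), snd (y, z)) \<bullet> (0, \<i>) = 0" using yO eq by simp
    qed
  qed
next
  fix p assume "p \<in> mfd_boundary TA"
  moreover obtain y z where p: "p = (y, z)" by (cases p)
  ultimately obtain d where d: "d \<in> TA" "(y, z) \<in> fst d" "snd d (y, z) \<bullet> conormal = 0" unfolding mfd_boundary_def by auto
  have pt: "(y, z) \<in> tube W H" using chart_simps(5)[OF tube_atlas_chart[OF d(1)]] d(2) by blast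
  hence y: "y \<in> W" using tube_subset by blast
  obtain t where t: "z = polar (cmod z) t" by (rule polar_exists)
  show "p \<in> M"
  proof (rule ccontr)
    assume "p \<notin> M"
    hence lt: "pi * (cmod z)\<^sup>2 < H t y" using tube_iff[OF y t] pt p by simp
    moreover have "0 \<le> pi * (cmod z)\<^sup>2" by simp
    ultimately have yb: "y \<notin> bd" using H_pos_iff(2)[OF y, of t] by force
    have "snd d (y, z) \<bullet> conormal > 0"
    proof (cases "z = 0")
      case False
      obtain c O' Q and g j :: "'e \<times> complex \<Rightarrow> 'e \<times> complex" where c: "c \<in> A" "y \<in> fst c" and o: "open O'" "open Q"
        and g: "smooth_on O' g" "\<forall>q\<in>O'. g q \<in> Q \<and> j (g q) = q \<and> fst q \<in> chart_img c"
        and j: "smooth_on Q j" "\<forall>q\<in>Q. j q \<in> O' \<and> g (j q) = q"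
        and tO: "\<forall>x z. (x, z) \<in> O' \<longrightarrow> ((chart_inv c x, z) \<in> tube W H \<longleftrightarrow> 0 \<le> g (x, z) \<bullet> (0, \<i>))"
        and yO: "(snd c y, z) \<in> O'" "g (snd c y, z) \<bullet> (0, \<i>) = H t y - pi * (cmod z)\<^sup>2"
        by (rule polar_chart[OF y yb False t])
      show ?thesis
      proof (rule tube_interior_chart[OF d(1,2) c])
        show "open (O' \<inter> g -` {v. v \<bullet> (0, \<i>) > 0})"
          by (rule continuous_open_preimage[OF smooth_on_continuous_on[OF g(1)] o(1)]) (intro open_Collect_less continuous_intros)
        show "(snd c y, z) \<in> O' \<inter> g -` {v. v \<bullet> (0, \<i>) > 0}" using yO lt by simp
        fix x h assume "(x, h) \<in> O' \<inter> g -` {v. v \<bullet> (0, \<i>) > 0}"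
        hence "(x, h) \<in> O'" "g (x, h) \<bullet> (0, \<i>) > 0" by auto
        thus "x \<in> chart_img c \<and> (chart_inv c x, h) \<in> tube W H" using tO g(2) by fastforce
      qed
    next
      \<comment> \<open>At z = 0 over the interior of W there is no angle to work with. The positive
        minimum over t of H at y persists, up to a factor 1/2, near y for all t at once, so a thin
        product neighbourhood lies in the tube.\<close>
      case True
      obtain c U where c: "c \<in> A" "y \<in> fst c" and U: "open U" "snd c y \<in> U" "U \<subseteq> chart_img c" using interior_nhd[OF y yb] .
      note ch = chart_simps[OF charts[OF c(1)]]
      have "continuous_on {0..1::real} (\<lambda>t. H t y)"
        by (rule continuous_on_pair[OF continuous_H]) (use y in \<open>auto intro: continuous_intros\<close>)
      then obtain t0 where t0: "t0 \<in> {0..1::real}" "\<forall>t\<in>{0..1}. H t0 y \<le> H t y"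
        using continuous_attains_inf[of "{0..1::real}" "\<lambda>t. H t y"] by auto
      have m: "H t0 y > 0" using H_pos_iff[OF y, of t0] yb by fastforce
      let ?m = "H t0 y / 2"
      have "continuous_on ({0..1::real} \<times> W \<times> W) (\<lambda>q. \<bar>H (fst q) (fst (snd q)) - H (fst q) (snd (snd q))\<bar>)"
        by (intro continuous_intros continuous_on_pair[OF continuous_H]) auto
      hence cg: "continuous_on ({0..1::real} \<times> W \<times> W) (\<lambda>(k, a, b). \<bar>H k a - H k b\<bar>)" by (simp add: case_prod_unfold)
      obtain V where V: "open V" "y \<in> V" "\<And>k a b. k \<in> {0..1::real} ==> a \<in> V \<inter> W ==> b \<in> V \<inter> W ==> \<bar>H k a - H k b\<bar> < ?m"
        by (rule diagonal_tube[OF compact_Icc cg _ y, of ?m]) (use m in auto)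
      have Hw: "H s w > ?m" if w: "w \<in> V \<inter> W" for s w
      proof -
        have f: "frac s \<in> {0..1}" by (simp add: frac_lt_1 less_imp_le)
        have "\<bar>H (frac s) y - H (frac s) w\<bar> < ?m" using V(2) y by (intro V(3)[OF f _ w]) simp
        moreover have "H t0 y \<le> H (frac s) y" using t0(2) f by blast
        ultimately have "H (frac s) w > ?m" by linarith
        moreover have "H (frac s + of_int \<lfloor>s\<rfloor>) w = H (frac s) w" using w by (intro H_int) simp
        ultimately show ?thesis by (simp add: frac_def)
      qed
      have oV: "open (U \<inter> chart_inv c -` V)"
        by (rule continuous_open_preimage[OF continuous_on_subset[OF ch(7) U(3)] U(1) V(1)])
      show ?thesis
      proof (rule tube_interior_chart[OF d(1,2) c])
        show "open ((U \<inter> chart_inv c -` V) \<times> {h. pi * (cmod h)\<^sup>2 < ?m})"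
          by (intro open_Times oV open_Collect_less continuous_intros)
        show "(snd c y, z) \<in> (U \<inter> chart_inv c -` V) \<times> {h. pi * (cmod h)\<^sup>2 < ?m}" using U(2) ch(1)[OF c(2)] V(2) True m by simp
        fix x h assume q: "(x, h) \<in> (U \<inter> chart_inv c -` V) \<times> {h. pi * (cmod h)\<^sup>2 < ?m}"
        hence xc: "x \<in> chart_img c" using U(3) by blast
        hence xW: "chart_inv c x \<in> W" using ch(3,5) by blast
        obtain s where s: "h = polar (cmod h) s" by (rule polar_exists)
        have "pi * (cmod h)\<^sup>2 < ?m" "chart_inv c x \<in> V \<inter> W" using q xW by auto
        with Hw[of "chart_inv c x" s] have "pi * (cmod h)\<^sup>2 \<le> H s (chart_inv c x)" by linarith
        thus "x \<in> chart_img c \<and> (chart_inv c x, h) \<in> tube W H" using tube_iff(1)[OF xW s] xc by simp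
      qed
    qed
    thus False using d(3) by simp
  qed
qed

lemma tube_boundary_chart:
  assumes d: "d \<in> TA" "p \<in> fst d" and p: "p \<in> M"
  shows "snd d p \<bullet> conormal = 0"
proof -
  obtain d0 where "d0 \<in> TA" "p \<in> fst d0" "snd d0 p \<bullet> conormal = 0" using p unfolding tube_boundary[symmetric] mfd_boundary_def by blast
  from chart_boundary_invariant[OF tube_atlas_chart[OF this(1)] this(2,3) tube_atlas_chart[OF d(1)] d(2)] show ?thesis .
qed

end

section \<open>The Reeb vector field\<close>

text \<open>\<open>tube_form\<close> in product coordinates, with a free chart \<open>c\<close> in
  place of the chosen \<open>chart_at\<close>.\<close>

definition alpha :: "('a, 'e::euclidean_space) one_form \<Rightarrow> ('a, 'e) chart \<Rightarrow> 'a \<times> complex \<Rightarrow> 'e \<times> complex \<Rightarrow> real" where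
  "alpha lam c p u = lam c (fst p) (fst u) + (Re (snd p) * Im (snd u) - Im (snd p) * Re (snd u)) / 2"

context hamiltonian_domain
begin

abbreviation E :: "('a \<times> complex, 'e \<times> complex) chart \<Rightarrow> ('a, 'e) chart \<Rightarrow> 'a \<times> complex \<Rightarrow> 'e \<times> complex \<Rightarrow> 'e \<times> complex" where
  "E d c p \<equiv> dtransition d (prod_chart c) p"

lemma tube_region:
  assumes d: "d \<in> TA" and N: "openin (top_of_set W) N"
  obtains O' where "open O'" "snd d ` {p \<in> fst d. fst p \<in> N} = chart_img d \<inter> O'"
proof -
  obtain V where V: "open V" "N = W \<inter> V" using N unfolding openin_open by blast
  have eq: "{p \<in> tube W H. fst p \<in> N} = tube W H \<inter> V \<times> UNIV" using tube_subset V(2) by auto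
  have o: "openin (top_of_set (tube W H)) (fst ({p \<in> tube W H. fst p \<in> N}, snd d))"
    unfolding fst_conv eq by (intro openin_open_Int open_Times V(1) open_UNIV)
  obtain O' where O': "open O'" "transition_dom d ({p \<in> tube W H. fst p \<in> N}, snd d) = chart_img d \<inter> O'"
    by (rule openin_transition_dom[OF tube_atlas_chart[OF d] o])
  have "{p \<in> fst d. fst p \<in> N} = fst d \<inter> {p \<in> tube W H. fst p \<in> N}"
    using chart_simps(5)[OF tube_atlas_chart[OF d]] by blast
  thus ?thesis using that[OF O'(1)] O'(2) by (simp add: transition_dom_def)
qed

lemma tube_transition_dom:
  assumes d: "d \<in> TA" and c: "c \<in> A"
  obtains O' where "open O'" "transition_dom d (prod_chart c) = chart_img d \<inter> O'"
proof -
  have "{p \<in> fst d. fst p \<in> fst c} = fst d \<inter> fst (prod_chart c)" by auto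
  thus ?thesis using tube_region[OF d chart_simps(8)[OF charts[OF c]]] that by (auto simp: transition_dom_def)
qed

lemma fat_tube_chart: "d \<in> TA ==> fat (chart_img d)"
  using tube_atlas_chart chart_simps(9) by (intro fat_openin_half_space) blast

lemma fat_transition_dom:
  assumes d: "d \<in> TA" and c: "c \<in> A"
  shows "fat (transition_dom d (prod_chart c))"
  using tube_transition_dom[OF d c] fat_Int_open[OF fat_tube_chart[OF d]] by metis

lemma smooth_tube_transition:
  assumes d: "d \<in> TA" and c: "c \<in> A"
  shows "smooth_on (transition_dom d (prod_chart c)) (transition d (prod_chart c))"
    "smooth_on (transition_dom (prod_chart c) d) (transition (prod_chart c) d)"
  using d c by (auto simp: tube_atlas_def induced_atlas_def)

lemma tube_transition_eq:
  assumes d: "d \<in> TA" "q \<in> fst d"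
  shows "transition d (prod_chart c) (snd d q) = (snd c (fst q), snd q)"
  using chart_simps(1)[OF tube_atlas_chart[OF d(1)] d(2)] by (simp add: transition_def)

lemma tube_transition_inv_eq:
  assumes c: "c \<in> A" "fst q \<in> fst c"
  shows "transition (prod_chart c) d (snd c (fst q), snd q) = snd d q"
  using chart_inv_prod_chart[OF charts[OF c(1)] c(2), of "snd q"] by (simp add: transition_def)

lemma in_tube_transition_dom: "p \<in> fst d ==> fst p \<in> fst c ==> snd d p \<in> transition_dom d (prod_chart c)"
  by (auto simp: transition_dom_def mem_Times_iff)

lemma E_derivative:
  assumes d: "d \<in> TA" "p \<in> fst d" and c: "c \<in> A" "fst p \<in> fst c"
  shows "(transition d (prod_chart c) has_derivative E d c p) (at (snd d p) within transition_dom d (prod_chart c))"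
  unfolding dtransition_def
  by (rule smooth_on_has_derivative[OF fat_transition_dom[OF d(1) c(1)] smooth_tube_transition(1)[OF d(1) c(1)] in_tube_transition_dom[OF d(2) c(2)]])

lemma linear_E:
  assumes d: "d \<in> TA" "p \<in> fst d" and c: "c \<in> A" "fst p \<in> fst c"
  shows "linear (E d c p)"
  using has_derivative_linear[OF E_derivative[OF assms]] .

text \<open>In product coordinates the domain of the transition is cut out by the tube and need not
  be \<open>fat\<close>, so the inverse derivative G is taken from a smooth extension of the
  transition. The chain rule gives a left inverse of E, which is two-sided by finite
  dimension.\<close>

lemma E_inverse:
  assumes d: "d \<in> TA" "p \<in> fst d" and c: "c \<in> A" "fst p \<in> fst c"
  obtains G where "(transition (prod_chart c) d has_derivative G) (at (snd c (fst p), snd p) within transition_dom (prod_chart c) d)"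
    "linear G" "\<forall>v. G (E d c p v) = v" "\<forall>v. E d c p (G v) = v"
proof -
  let ?pc = "prod_chart c" and ?x = "snd d p" and ?k = "(snd c (fst p), snd p)"
  let ?T = "transition_dom d ?pc" and ?T' = "transition_dom ?pc d"
  have e: "transition d ?pc (snd d q) = (snd c (fst q), snd q)" "transition ?pc d (snd c (fst q), snd q) = snd d q" if "q \<in> fst d" "fst q \<in> fst c" for q
    by (rule tube_transition_eq[OF d(1) that(1)], rule tube_transition_inv_eq[OF c(1) that(2)])
  have k: "?k \<in> ?T'" unfolding transition_dom_def
    by (rule image_eqI[of _ _ p]) (use d c in \<open>auto simp: mem_Times_iff\<close>)
  obtain U g where U: "open U" "?k \<in> U" "\<And>j. ck_on j U g" "\<And>y. y \<in> ?T' \<inter> U ==> g y = transition ?pc d y"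
    using smooth_onE[OF smooth_tube_transition(2)[OF d(1) c(1)] k] by metis
  have "g differentiable (at ?k)" using U(2) U(3)[of "Suc 0"] by simp
  then obtain G where G: "(g has_derivative G) (at ?k)" unfolding differentiable_def by blast
  have tG: "(transition ?pc d has_derivative G) (at ?k within ?T')"
    by (rule has_derivative_local[OF has_derivative_at_withinI[OF G] U(1,2) k]) (use U(4) in simp)
  have D: "(transition d ?pc has_derivative E d c p) (at ?x within ?T)" by (rule E_derivative[OF assms])
  have "(transition ?pc d has_derivative G) (at (transition d ?pc ?x) within transition d ?pc ` ?T)"
    unfolding e(1)[OF d(2) c(2)]
  proof (rule has_derivative_subset[OF tG], rule image_subsetI)
    fix x assume "x \<in> ?T"
    then obtain q where q: "q \<in> fst d" "fst q \<in> fst c" "x = snd d q" by (auto simp: transition_dom_def mem_Times_iff)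
    show "transition d ?pc x \<in> ?T'" unfolding q(3) e(1)[OF q(1,2)] transition_dom_def
      by (rule image_eqI[of _ _ q]) (use q in \<open>auto simp: mem_Times_iff\<close>)
  qed
  from has_derivative_in_compose[OF D this]
  have D1: "((\<lambda>x. transition ?pc d (transition d ?pc x)) has_derivative (\<lambda>v. G (E d c p v))) (at ?x within ?T)" .
  have x: "?x \<in> ?T" by (rule in_tube_transition_dom[OF d(2) c(2)])
  have D2: "((\<lambda>x. transition ?pc d (transition d ?pc x)) has_derivative (\<lambda>v. v)) (at ?x within ?T)"
  proof (rule has_derivative_transform[OF x _ has_derivative_ident])
    fix x assume "x \<in> ?T"
    then obtain q where q: "q \<in> fst d" "fst q \<in> fst c" "x = snd d q" by (auto simp: transition_dom_def mem_Times_iff)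
    thus "transition ?pc d (transition d ?pc x) = x" using e by simp
  qed
  have GE: "G (E d c p v) = v" for v
    using fat_derivative_unique[OF fat_transition_dom[OF d(1) c(1)] x D1 D2] by (rule fun_cong)
  have lE: "linear (E d c p)" by (rule linear_E[OF assms])
  have "inj (E d c p)" using GE by (rule inj_on_inverseI)
  hence "surj (E d c p)" by (rule linear_injective_imp_surjective[OF lE]) (rule refl)
  hence "E d c p (G v) = v" for v using GE by (metis surjD)
  thus ?thesis using that[OF tG has_derivative_linear[OF tG]] GE by blast
qed

lemma E_change:
  assumes d: "d \<in> TA" "p \<in> fst d" and c: "c \<in> A" "fst p \<in> fst c" and c': "c' \<in> A" "fst p \<in> fst c'"
  shows "E d c' p v = (dtransition c c' (fst p) (fst (E d c p v)), snd (E d c p v))"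
proof -
  let ?x = "snd d p" and ?T = "transition_dom d (prod_chart c)" and ?T' = "transition_dom d (prod_chart c')"
  obtain O1 where O1: "open O1" "?T = chart_img d \<inter> O1" by (rule tube_transition_dom[OF d(1) c(1)])
  obtain O2 where O2: "open O2" "?T' = chart_img d \<inter> O2" by (rule tube_transition_dom[OF d(1) c'(1)])
  let ?S = "chart_img d \<inter> (O1 \<inter> O2)"
  have S: "?S \<subseteq> ?T" "?S \<subseteq> ?T'" using O1 O2 by auto
  have x: "?x \<in> ?S" using in_tube_transition_dom[OF d(2)] c(2) c'(2) O1(2) O2(2) by blast
  have fS: "fat ?S" by (intro fat_Int_open fat_tube_chart d(1) open_Int O1 O2)
  have Sq: "\<exists>q. q \<in> fst d \<and> fst q \<in> fst c \<and> fst q \<in> fst c' \<and> y = snd d q" if y: "y \<in> ?S" for y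
  proof -
    note ch = chart_simps[OF tube_atlas_chart[OF d(1)]]
    obtain q where q: "q \<in> fst d" "fst q \<in> fst c" "y = snd d q" using S(1) y by (auto simp: transition_dom_def mem_Times_iff)
    obtain q' where q': "q' \<in> fst d" "fst q' \<in> fst c'" "y = snd d q'" using S(2) y by (auto simp: transition_dom_def mem_Times_iff)
    have "q = q'" using ch(1)[OF q(1)] ch(1)[OF q'(1)] q(3) q'(3) by simp
    thus ?thesis using q q' by blast
  qed
  have D: "(transition d (prod_chart c) has_derivative E d c p) (at ?x within ?S)"
    by (rule has_derivative_subset[OF E_derivative[OF d c] S(1)])
  have D': "(transition d (prod_chart c') has_derivative E d c' p) (at ?x within ?S)"
    by (rule has_derivative_subset[OF E_derivative[OF d c'] S(2)])
  have D1: "((\<lambda>y. fst (transition d (prod_chart c) y)) has_derivative (\<lambda>v. fst (E d c p v))) (at ?x within ?S)"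
    using D by (rule has_derivative_fst)
  have "(transition c c' has_derivative dtransition c c' (fst p)) (at (snd c (fst p)) within transition_dom c c')"
    using c c' by (intro dtransition_derivative) auto
  hence "(transition c c' has_derivative dtransition c c' (fst p)) (at (fst (transition d (prod_chart c) ?x)) within (\<lambda>y. fst (transition d (prod_chart c) y)) ` ?S)"
    unfolding tube_transition_eq[OF d] fst_conv
  proof (rule has_derivative_subset, intro image_subsetI)
    fix y assume "y \<in> ?S"
    then obtain q where q: "q \<in> fst d" "fst q \<in> fst c" "fst q \<in> fst c'" "y = snd d q" using Sq by blast
    thus "fst (transition d (prod_chart c) y) \<in> transition_dom c c'"
      unfolding q(4) tube_transition_eq[OF d(1) q(1)] fst_conv transition_dom_def using q by blast
  qed
  from has_derivative_in_compose[OF D1 this]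
  have D2: "((\<lambda>y. transition c c' (fst (transition d (prod_chart c) y))) has_derivative (\<lambda>v. dtransition c c' (fst p) (fst (E d c p v)))) (at ?x within ?S)" .
  have "((\<lambda>y. (transition c c' (fst (transition d (prod_chart c) y)), snd (transition d (prod_chart c) y))) has_derivative
      (\<lambda>v. (dtransition c c' (fst p) (fst (E d c p v)), snd (E d c p v)))) (at ?x within ?S)"
    by (rule has_derivative_Pair[OF D2 has_derivative_snd[OF D]])
  hence "(transition d (prod_chart c') has_derivative
      (\<lambda>v. (dtransition c c' (fst p) (fst (E d c p v)), snd (E d c p v)))) (at ?x within ?S)"
  proof (rule has_derivative_transform[OF x, rotated])
    fix y assume "y \<in> ?S"
    then obtain q where q: "q \<in> fst d" "fst q \<in> fst c" "fst q \<in> fst c'" "y = snd d q" using Sq by blast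
    show "transition d (prod_chart c') y = (transition c c' (fst (transition d (prod_chart c) y)), snd (transition d (prod_chart c) y))"
      unfolding q(4) tube_transition_eq[OF d(1) q(1)] using chart_simps(1)[OF charts[OF c(1)] q(2)] by (simp add: transition_def)
  qed
  from fat_derivative_unique[OF fS x D' this] show ?thesis by (rule fun_cong)
qed

lemma tube_form_eq:
  assumes d: "d \<in> TA" "p \<in> fst d" and c: "c \<in> A" "fst p \<in> fst c"
  shows "tube_form A lam d p v = alpha lam c p (E d c p v)"
proof -
  have "p \<in> tube W H" using chart_simps(5)[OF tube_atlas_chart[OF d(1)]] d(2) by blast
  hence "fst p \<in> W" using tube_subset by auto
  hence c': "chart_at A (fst p) \<in> A" "fst p \<in> fst (chart_at A (fst p))" using chart_at_in by auto
  have "lam c (fst p) (fst (E d c p v)) = lam (chart_at A (fst p)) (fst p) (dtransition c (chart_at A (fst p)) (fst p) (fst (E d c p v)))"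
    by (rule lam_change[OF c(1) c'(1)]) (use c c' in simp)
  thus ?thesis unfolding tube_form_def Let_def alpha_def E_change[OF d c c'] by simp
qed

lemma alpha_linear:
  assumes "c \<in> A" "fst p \<in> fst c"
  shows "linear (alpha lam c p)"
proof -
  note l = linear_lam[OF assms]
  show ?thesis unfolding alpha_def
    by (rule linearI) (simp_all add: linear_add[OF l] linear_scale[OF l] algebra_simps add_divide_distrib diff_divide_distrib)
qed

lemma smooth_alpha:
  assumes c: "c \<in> A"
  shows "smooth_on (chart_img c \<times> UNIV) (\<lambda>q. alpha lam c (chart_inv c (fst q), snd q) v)"
proof -
  have "smooth_on (chart_img c \<times> (UNIV :: complex set)) (\<lambda>q. lam c (chart_inv c (fst q)) (fst v))"
    by (rule smooth_on_compose[OF smooth_on_linear[OF bounded_linear_fst] smooth_lam[OF c]]) auto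
  moreover have "bounded_linear (\<lambda>q :: 'e \<times> complex. (Re (snd q) * Im (snd v) - Im (snd q) * Re (snd v)) / 2)"
    by (intro bounded_linear_intros bounded_linear_compose[OF bounded_linear_Re bounded_linear_snd] bounded_linear_compose[OF bounded_linear_Im bounded_linear_snd]
        bounded_linear_sub bounded_linear_compose[OF bounded_linear_divide] bounded_linear_compose[OF bounded_linear_mult_left])
  ultimately show ?thesis unfolding alpha_def by (simp add: smooth_on_add smooth_on_linear)
qed

text \<open>The exterior derivative of \<open>alpha\<close>, that is d\<lambda> + dx \<and> dy in
  product coordinates; antisymmetrizing cancels the factor 1/2 of the form.\<close>

definition omega :: "('a, 'e) chart \<Rightarrow> 'a \<Rightarrow> 'e \<times> complex \<Rightarrow> 'e \<times> complex \<Rightarrow> real" where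
  "omega c y u v = ext_deriv lam c y (fst u) (fst v) + (Re (snd u) * Im (snd v) - Im (snd u) * Re (snd v))"

lemma alpha_derivative:
  assumes c: "c \<in> A" "y \<in> fst c"
  shows "FD (\<lambda>q. alpha lam c (chart_inv c (fst q), snd q) v) (at (snd c y, z) within chart_img c \<times> UNIV) u =
    FD (\<lambda>x. lam c (chart_inv c x) (fst v)) (at (snd c y) within chart_img c) (fst u)
      + (Re (snd u) * Im (snd v) - Im (snd u) * Re (snd v)) / 2"
proof -
  note ch = chart_simps[OF charts[OF c(1)]]
  have x: "snd c y \<in> chart_img c" using ch(4) c(2) by blast
  let ?L = "FD (\<lambda>x. lam c (chart_inv c x) (fst v)) (at (snd c y) within chart_img c)"
  let ?S = "chart_img c \<times> (UNIV :: complex set)"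
  have "((\<lambda>x. lam c (chart_inv c x) (fst v)) has_derivative ?L) (at (snd c y) within chart_img c)"
    by (rule smooth_on_has_derivative[OF fat_chart_img[OF c(1)] smooth_lam[OF c(1)] x])
  hence "((\<lambda>x. lam c (chart_inv c x) (fst v)) has_derivative ?L) (at (fst (snd c y, z)) within fst ` ?S)" by simp
  from has_derivative_in_compose[OF has_derivative_fst[OF has_derivative_ident] this]
  have D1: "((\<lambda>q. lam c (chart_inv c (fst q)) (fst v)) has_derivative (\<lambda>u. ?L (fst u))) (at (snd c y, z) within ?S)" .
  have bl: "bounded_linear (\<lambda>q :: 'e \<times> complex. (Re (snd q) * Im (snd v) - Im (snd q) * Re (snd v)) / 2)"
    by (intro bounded_linear_intros bounded_linear_compose[OF bounded_linear_Re bounded_linear_snd] bounded_linear_compose[OF bounded_linear_Im bounded_linear_snd]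
        bounded_linear_sub bounded_linear_compose[OF bounded_linear_divide] bounded_linear_compose[OF bounded_linear_mult_left])
  have "((\<lambda>q. alpha lam c (chart_inv c (fst q), snd q) v) has_derivative (\<lambda>u. ?L (fst u) + (Re (snd u) * Im (snd v) - Im (snd u) * Re (snd v)) / 2)) (at (snd c y, z) within ?S)"
    unfolding alpha_def fst_conv snd_conv by (rule has_derivative_add[OF D1 bounded_linear_imp_has_derivative[OF bl]])
  from fat_frechet_derivative[OF fat_Times[OF fat_chart_img[OF c(1)] fat_UNIV] _ this] x show ?thesis by simp
qed

lemma ext_deriv_tube_form:
  assumes d: "d \<in> TA" "p \<in> fst d" and c: "c \<in> A" "fst p \<in> fst c"
  shows "ext_deriv (tube_form A lam) d p u v = omega c (fst p) (E d c p u) (E d c p v)"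
proof -
  note ch = chart_simps[OF charts[OF c(1)]]
  note chd = chart_simps[OF tube_atlas_chart[OF d(1)]]
  let ?x = "snd d p" and ?T = "transition_dom d (prod_chart c)" and ?S = "chart_img c \<times> (UNIV :: complex set)"
  let ?e = "transition d (prod_chart c)" and ?b = "\<lambda>x v. tube_form A lam d (chart_inv d x) v"
  let ?a = "\<lambda>q v. alpha lam c (chart_inv c (fst q), snd q) v"
  obtain O1 where O1: "open O1" "?T = chart_img d \<inter> O1" by (rule tube_transition_dom[OF d(1) c(1)])
  have x: "?x \<in> ?T" by (rule in_tube_transition_dom[OF d(2) c(2)])
  hence at: "at ?x within ?T = at ?x within chart_img d" using O1 by (simp add: at_within_Int_nhd)
  have Tq: "\<exists>q. q \<in> fst d \<and> fst q \<in> fst c \<and> y = snd d q" if "y \<in> ?T" for y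
    using that by (auto simp: transition_dom_def mem_Times_iff)
  have "FD (\<lambda>x. ?b x v) (at ?x within ?T) u - FD (\<lambda>x. ?b x u) (at ?x within ?T) v =
      FD (\<lambda>q. ?a q (E d c p v)) (at (?e ?x) within ?S) (E d c p u) - FD (\<lambda>q. ?a q (E d c p u)) (at (?e ?x) within ?S) (E d c p v)"
  proof (rule exterior_derivative_pullback[OF fat_transition_dom[OF d(1) c(1)] fat_Times[OF fat_chart_img[OF c(1)] fat_UNIV] smooth_tube_transition(1)[OF d(1) c(1)] _ smooth_alpha[OF c(1)] _ _ x])
    show "?e y \<in> ?S" if y: "y \<in> ?T" for y
    proof -
      obtain q where q: "q \<in> fst d" "fst q \<in> fst c" "y = snd d q" using Tq[OF y] by blast
      show ?thesis unfolding q(3) tube_transition_eq[OF d(1) q(1)] using ch(4)[OF q(2)] by simp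
    qed
    show "linear (?a q)" if "q \<in> ?S" for q using that ch(3) by (intro alpha_linear c(1)) auto
    show "?b y v = ?a (?e y) (FD ?e (at y within ?T) v)" if y: "y \<in> ?T" for y v
    proof -
      obtain q where q: "q \<in> fst d" "fst q \<in> fst c" "y = snd d q" using Tq[OF y] by blast
      show ?thesis unfolding q(3) chd(1)[OF q(1)] tube_form_eq[OF d(1) q(1) c(1) q(2)] tube_transition_eq[OF d(1) q(1)] fst_conv snd_conv ch(1)[OF q(2)] dtransition_def
        by simp
    qed
    show "E d c p = FD ?e (at ?x within ?T)" by (simp add: dtransition_def)
  qed
  thus ?thesis unfolding ext_deriv_def omega_def tube_transition_eq[OF d] at alpha_derivative[OF c] by (simp add: field_simps)
qed

text \<open>The \<open>z\<close>-component of the velocity of \<open>u \<mapsto> P u (fl u w)\<close>. On the boundary of \<open>W\<close> the quotient is \<open>0\<close> by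
  convention, but there \<open>z = 0\<close> anyway.\<close>

definition zeta :: "real \<Rightarrow> ('a, 'e) chart \<Rightarrow> 'a \<Rightarrow> complex" where
  "zeta t c y = (complex_of_real (DG c (t, snd c y) (1, 0) / (2 * H t y)) + 2 * pi * \<i>) * snd (P t y)"

lemma DG_split:
  assumes c: "c \<in> A" "y \<in> fst c"
  shows "DG c (t, snd c y) (s, v) = s * DG c (t, snd c y) (1, 0) + dH t c y v"
proof -
  have "snd c y \<in> chart_img c" using chart_simps(4)[OF charts[OF c(1)]] c(2) by blast
  hence l: "linear (DG c (t, snd c y))" using has_derivative_linear[OF DG_derivative[OF c(1)]] by blast
  have "DG c (t, snd c y) (s, v) = DG c (t, snd c y) (s *\<^sub>R (1, 0) + (0, v))" by simp
  also have "\<dots> = s * DG c (t, snd c y) (1, 0) + DG c (t, snd c y) (0, v)"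
    unfolding linear_add[OF l] linear_scale[OF l] by simp
  finally show ?thesis by (simp add: dH_eq[OF c])
qed

text \<open>On the boundary of the tube the function H_(h z) (y) - \<pi> |z|^2 is 0, so its
  derivative kills boundary vectors. The angle function h is left open: a branch of the angle where
  z \<noteq> 0, and a constant near z = 0, where H does not depend on t.\<close>

lemma boundary_defining_function:
  assumes d: "d \<in> TA" "(y, z) \<in> fst d" and c: "c \<in> A" "y \<in> fst c" and yM: "(y, z) \<in> M"
    and h: "(h has_derivative h') (at z)" "h z = t" and N: "openin (top_of_set W) N" "y \<in> N"
    and hM: "\<And>w \<zeta>. w \<in> N ==> (w, \<zeta>) \<in> M ==> H (h \<zeta>) w = pi * (\<zeta> \<bullet> \<zeta>)" and v: "v \<bullet> conormal = 0"
  shows "DG c (t, snd c y) (h' (snd (E d c (y, z) v)), fst (E d c (y, z) v)) = 2 * pi * (z \<bullet> snd (E d c (y, z) v))"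
proof -
  note ch = chart_simps[OF charts[OF c(1)]]
  note chd = chart_simps[OF tube_atlas_chart[OF d(1)]]
  let ?x = "snd d (y, z)" and ?e = "transition d (prod_chart c)" and ?E = "E d c (y, z)"
  define S where "S = snd d ` {p \<in> fst d. fst p \<in> fst c \<inter> N}"
  obtain O' where O': "open O'" "S = chart_img d \<inter> O'"
    unfolding S_def by (rule tube_region[OF d(1) openin_Int[OF ch(8) N(1)]])
  have oS: "openin (top_of_set half_space) S" unfolding O'(2) using chd(9) O'(1) by (rule openin_Int_open)
  have x: "?x \<in> S" unfolding S_def using d(2) c(2) N(2) by (intro imageI) simp
  have Sq: "\<exists>q. q \<in> fst d \<and> fst q \<in> fst c \<and> fst q \<in> N \<and> u = snd d q" if "u \<in> S" for u using that unfolding S_def by blast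
  have ST: "S \<subseteq> transition_dom d (prod_chart c)" unfolding S_def transition_dom_def by (auto simp: mem_Times_iff)
  have fc: "fst (y, z) \<in> fst c" using c(2) by simp
  have e: "(?e has_derivative ?E) (at ?x within S)"
    by (rule has_derivative_subset[OF E_derivative[OF d c(1) fc] ST])
  have ex: "?e ?x = (snd c y, z)" using tube_transition_eq[OF d, of c] by simp
  have e2: "((\<lambda>x. snd (?e x)) has_derivative (\<lambda>v. snd (?E v))) (at ?x within S)" by (rule has_derivative_snd[OF e])
  have "(h has_derivative h') (at (snd (?e ?x)) within (\<lambda>x. snd (?e x)) ` S)"
    unfolding ex snd_conv by (rule has_derivative_at_withinI[OF h(1)])
  from has_derivative_Pair[OF has_derivative_in_compose[OF e2 this] has_derivative_fst[OF e]]
  have D1: "((\<lambda>x. (h (snd (?e x)), fst (?e x))) has_derivative (\<lambda>v. (h' (snd (?E v)), fst (?E v)))) (at ?x within S)" .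
  have "((\<lambda>(t, x). H t (chart_inv c x)) has_derivative DG c (t, snd c y)) (at (t, snd c y) within UNIV \<times> chart_img c)"
    by (rule DG_derivative[OF c(1) ch(4)[OF c(2)]])
  hence "((\<lambda>(t, x). H t (chart_inv c x)) has_derivative DG c (t, snd c y)) (at (h (snd (?e ?x)), fst (?e ?x)) within (\<lambda>x. (h (snd (?e x)), fst (?e x))) ` S)"
    unfolding ex snd_conv fst_conv h(2)
  proof (rule has_derivative_subset, intro image_subsetI)
    fix u assume "u \<in> S"
    then obtain q where q: "q \<in> fst d" "fst q \<in> fst c" "u = snd d q" using Sq by blast
    show "(h (snd (?e u)), fst (?e u)) \<in> UNIV \<times> chart_img c"
      unfolding q(3) tube_transition_eq[OF d(1) q(1)] using ch(4)[OF q(2)] by simp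
  qed
  from has_derivative_in_compose[OF D1 this]
  have D2: "((\<lambda>x. H (h (snd (?e x))) (chart_inv c (fst (?e x)))) has_derivative (\<lambda>v. DG c (t, snd c y) (h' (snd (?E v)), fst (?E v)))) (at ?x within S)"
    by simp
  have D3: "((\<lambda>x. H (h (snd (?e x))) (chart_inv c (fst (?e x))) - pi * (snd (?e x) \<bullet> snd (?e x))) has_derivative
      (\<lambda>v. DG c (t, snd c y) (h' (snd (?E v)), fst (?E v)) - pi * (snd (?e ?x) \<bullet> snd (?E v) + snd (?E v) \<bullet> snd (?e ?x)))) (at ?x within S)"
    by (rule has_derivative_diff[OF D2 has_derivative_mult_right[OF has_derivative_inner[OF e2 e2]]])
  have "DG c (t, snd c y) (h' (snd (?E v)), fst (?E v)) - pi * (snd (?e ?x) \<bullet> snd (?E v) + snd (?E v) \<bullet> snd (?e ?x)) = 0"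
  proof (rule derivative_zero_along_boundary[OF D3 oS x tube_boundary_chart[OF d yM] _ v])
    fix u assume u: "u \<in> S" "u \<bullet> conormal = 0"
    then obtain q where q: "q \<in> fst d" "fst q \<in> fst c" "fst q \<in> N" "u = snd d q" using Sq by blast
    have "q \<in> M" unfolding tube_boundary[symmetric] mfd_boundary_def using q(1,4) u(2) d(1) by blast
    hence "H (h (snd q)) (fst q) = pi * (snd q \<bullet> snd q)" using hM[of "fst q" "snd q"] q(3) by simp
    thus "H (h (snd (?e u))) (chart_inv c (fst (?e u))) - pi * (snd (?e u) \<bullet> snd (?e u)) = 0"
      unfolding q(4) tube_transition_eq[OF d(1) q(1)] fst_conv snd_conv ch(1)[OF q(2)] by simp
  qed
  thus ?thesis unfolding ex snd_conv by (simp add: inner_commute)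
qed

text \<open>The branch comes from rotating z to the positive real axis. Its derivative is claimed
  only at z, while the polar identity is claimed for every \<zeta>, including 0 and the cut, since
  the principal logarithm yields some argument of every nonzero number.\<close>

lemma angle_function:
  assumes z: "z \<noteq> 0" "z = polar (cmod z) t"
  obtains v where "(v has_derivative (\<lambda>h. Im (h / z) / (2 * pi))) (at z)" "v z = t"
    "\<forall>\<zeta>. \<zeta> = polar (cmod \<zeta>) (v \<zeta>)"
proof -
  define k where "k = cis (- (2 * pi * t))"
  define v where "v = (\<lambda>\<zeta>. t + 1 / (2 * pi) * Im (Ln (\<zeta> * k)))"
  have kk: "cis (2 * pi * t) * k = 1" unfolding k_def cis_mult by simp
  have zk: "z * k = complex_of_real (cmod z)" by (subst z(2), subst mult.assoc, subst kk) simp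
  hence nz: "z * k \<notin> \<real>\<^sub>\<le>\<^sub>0" using z(1) by simp
  have "((\<lambda>\<zeta>. Ln (\<zeta> * k)) has_field_derivative inverse (z * k) * k) (at z)"
    using nz by (auto intro!: derivative_eq_intros)
  moreover have "inverse (z * k) * k = inverse z"
  proof -
    have "k \<noteq> 0" using kk by auto
    thus ?thesis by (simp add: field_simps)
  qed
  ultimately have "((\<lambda>\<zeta>. Ln (\<zeta> * k)) has_field_derivative inverse z) (at z)" by (simp only:)
  hence "((\<lambda>\<zeta>. Ln (\<zeta> * k)) has_derivative (\<lambda>h. inverse z * h)) (at z)" unfolding has_field_derivative_def .
  hence "((\<lambda>\<zeta>. Im (Ln (\<zeta> * k))) has_derivative (\<lambda>h. Im (inverse z * h))) (at z)" by (rule has_derivative_Im)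
  hence D: "((\<lambda>\<zeta>. 1 / (2 * pi) * Im (Ln (\<zeta> * k))) has_derivative (\<lambda>h. 1 / (2 * pi) * Im (inverse z * h))) (at z)"
    by (rule has_derivative_mult_right)
  have "((\<lambda>\<zeta>. t + 1 / (2 * pi) * Im (Ln (\<zeta> * k))) has_derivative (\<lambda>h. 0 + 1 / (2 * pi) * Im (inverse z * h))) (at z)"
    by (rule has_derivative_add[OF has_derivative_const D])
  hence 1: "(v has_derivative (\<lambda>h. Im (h / z) / (2 * pi))) (at z)" unfolding v_def
  proof (rule has_derivative_eq_rhs, intro ext)
    fix h :: complex
    have "h / z = inverse z * h" by (simp add: field_class.field_divide_inverse mult.commute[of h])
    thus "0 + 1 / (2 * pi) * Im (inverse z * h) = Im (h / z) / (2 * pi)" by (simp del: mult_1_left)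
  qed
  have 2: "v z = t" using z(1) by (simp add: v_def zk)
  have 3: "\<zeta> = polar (cmod \<zeta>) (v \<zeta>)" for \<zeta>
  proof (cases "\<zeta> = 0")
    case False
    hence "Im (Ln (\<zeta> * k)) = Arg (\<zeta> * k)" by (simp add: Arg_eq_Im_Ln k_def)
    hence "\<zeta> * k = complex_of_real (cmod \<zeta>) * cis (Im (Ln (\<zeta> * k)))"
      using rcis_cmod_Arg[of "\<zeta> * k"] by (simp add: rcis_def norm_mult k_def)
    hence "\<zeta> * k * cis (2 * pi * t) = complex_of_real (cmod \<zeta>) * cis (Im (Ln (\<zeta> * k))) * cis (2 * pi * t)" by (rule arg_cong)
    moreover have "\<zeta> * k * cis (2 * pi * t) = \<zeta>" by (subst mult.assoc, subst mult.commute[of k], subst kk) simp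
    moreover have "complex_of_real (cmod \<zeta>) * cis (Im (Ln (\<zeta> * k))) * cis (2 * pi * t) = polar (cmod \<zeta>) (v \<zeta>)"
      by (subst mult.assoc, subst cis_mult) (simp add: v_def distrib_left add.commute)
    ultimately show ?thesis by metis
  qed simp
  show ?thesis using that[OF 1 2] 3 by blast
qed

text \<open>Written out, \<omega> ((X, \<open>zeta\<close>), v) is dH on the first component of v
  plus a term in the second, and it equals the derivative along v of the defining function of the
  boundary. The cases z = 0 and z \<noteq> 0 differ in the angle function used.\<close>

lemma omega_zero_on_boundary:
  assumes d: "d \<in> TA" "P t y \<in> fst d" and c: "c \<in> A" "y \<in> fst c" and v: "v \<bullet> conormal = 0"
  shows "omega c y (X t c y, zeta t c y) (E d c (P t y) v) = 0"
proof -
  have y: "y \<in> W" using chart_simps(5)[OF charts[OF c(1)]] c(2) by blast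
  define z where "z = snd (P t y)"
  have Pz: "P t y = (y, z)" by (simp add: z_def prod_eq_iff)
  have dz: "(y, z) \<in> fst d" "(y, z) \<in> M" using d(2) P_in_M[OF y, of t] unfolding Pz by simp_all
  let ?v = "E d c (y, z) v"
  have om: "omega c y (X t c y, zeta t c y) ?v = dH t c y (fst ?v) + (Re (zeta t c y) * Im (snd ?v) - Im (zeta t c y) * Re (snd ?v))"
    by (simp add: omega_def X_eq[OF c])
  have "dH t c y (fst ?v) + (Re (zeta t c y) * Im (snd ?v) - Im (zeta t c y) * Re (snd ?v)) = 0"
  proof (cases "z = 0")
    case True
    hence "H t y = 0" using norm_snd_P[OF y, of t] by (simp add: z_def[symmetric])
    hence yb: "y \<in> bd" using H_pos_iff(2)[OF y] by simp
    obtain N where N: "openin (top_of_set W) N" "bd \<subseteq> N" "\<forall>w\<in>N. \<forall>s t. H s w = H t w" using autonomous by blast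
    have "DG c (t, snd c y) (0, fst ?v) = 2 * pi * (z \<bullet> snd ?v)"
    proof (rule boundary_defining_function[OF d(1) dz(1) c dz(2) has_derivative_const refl N(1) _ _ v])
      show "y \<in> N" using yb N by blast
      fix w \<zeta> assume w: "w \<in> N" "(w, \<zeta>) \<in> M"
      hence wW: "w \<in> W" using N(1) openin_imp_subset by blast
      obtain s where s: "\<zeta> = polar (cmod \<zeta>) s" by (rule polar_exists)
      have "pi * (cmod \<zeta>)\<^sup>2 = H s w" using tube_iff(2)[OF wW s] w(2) by simp
      thus "H t w = pi * (\<zeta> \<bullet> \<zeta>)" using N(3) w(1) by (simp add: power2_norm_eq_inner)
    qed
    thus ?thesis using True by (simp add: DG_split[OF c, of t 0] zeta_def z_def[symmetric])
  next
    case False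
    have zp: "z = polar (cmod z) t" unfolding z_def by (rule snd_P_polar[OF y])
    obtain u where u: "(u has_derivative (\<lambda>h. Im (h / z) / (2 * pi))) (at z)" "u z = t"
      "\<forall>\<zeta>. \<zeta> = polar (cmod \<zeta>) (u \<zeta>)" by (rule angle_function[OF False zp])
    have *: "DG c (t, snd c y) (Im (snd ?v / z) / (2 * pi), fst ?v) = 2 * pi * (z \<bullet> snd ?v)"
    proof (rule boundary_defining_function[OF d(1) dz(1) c dz(2) u(1,2) openin_subtopology_self y _ v])
      fix w \<zeta> assume w: "w \<in> W" "(w, \<zeta>) \<in> M"
      have "pi * (cmod \<zeta>)\<^sup>2 = H (u \<zeta>) w" using tube_iff(2)[OF w(1) u(3)[rule_format, of \<zeta>]] w(2) by simp
      thus "H (u \<zeta>) w = pi * (\<zeta> \<bullet> \<zeta>)" by (simp add: power2_norm_eq_inner)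
    qed
    let ?D = "DG c (t, snd c y) (1, 0)"
    have Hz: "H t y = pi * (cmod z)\<^sup>2" using norm_snd_P[OF y, of t] by (simp add: z_def)
    have nz: "(cmod z)\<^sup>2 > 0" using False by simp
    have im: "Im (snd ?v / z) = (Re z * Im (snd ?v) - Im z * Re (snd ?v)) / (cmod z)\<^sup>2"
      by (simp add: Im_divide cmod_power2 mult.commute)
    have "Re (zeta t c y) * Im (snd ?v) - Im (zeta t c y) * Re (snd ?v) =
        ?D / (2 * H t y) * (Re z * Im (snd ?v) - Im z * Re (snd ?v)) - 2 * pi * (Re z * Re (snd ?v) + Im z * Im (snd ?v))"
      unfolding zeta_def z_def[symmetric] by (simp add: algebra_simps)
    also have "?D / (2 * H t y) * (Re z * Im (snd ?v) - Im z * Re (snd ?v)) = Im (snd ?v / z) / (2 * pi) * ?D"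
      unfolding im Hz using nz by (simp add: field_simps)
    finally show ?thesis using * unfolding DG_split[OF c, of t "Im (snd ?v / z) / (2 * pi)"] by (simp add: inner_complex_def)
  qed
  thus ?thesis unfolding Pz om .
qed

text \<open>The radial part of \<open>zeta\<close> is invisible to the angular form, and the
  rotation 2 \<pi> i z contributes \<pi> |z|^2 = H; with \<lambda> (X) this is \<tau>.\<close>

lemma alpha_V:
  assumes c: "c \<in> A" "y \<in> fst c"
  shows "alpha lam c (P t y) (X t c y, zeta t c y) = \<tau> t y"
proof -
  have y: "y \<in> W" using chart_simps(5)[OF charts[OF c(1)]] c(2) by blast
  define z where "z = snd (P t y)"
  have "Re z * Im (zeta t c y) - Im z * Re (zeta t c y) = 2 * (pi * (cmod z)\<^sup>2)"
    unfolding zeta_def z_def[symmetric] cmod_power2 by (simp add: algebra_simps power2_eq_square)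
  also have "\<dots> = 2 * H t y" using norm_snd_P[OF y, of t] by (simp add: z_def)
  finally show ?thesis unfolding alpha_def tau_eq[OF c] z_def by simp
qed

lemma omega_V_V: "c \<in> A ==> y \<in> fst c ==> omega c y (X t c y, zeta t c y) (X t c y, zeta t c y) = 0"
  by (simp add: omega_def X_eq dH_X)

lemma linear_omega:
  assumes c: "c \<in> A" "y \<in> fst c"
  shows "linear (omega c y u)" "linear (\<lambda>u. omega c y u v)"
  unfolding omega_def
  by (rule linearI; simp add: linear_add[OF bilinear_ext_deriv(1)[OF c]] linear_scale[OF bilinear_ext_deriv(1)[OF c]]
      linear_add[OF bilinear_ext_deriv(2)[OF c]] linear_scale[OF bilinear_ext_deriv(2)[OF c]] algebra_simps)+

lemma omega_nondegenerate:
  assumes c: "c \<in> A" "y \<in> fst c" and z: "\<And>v. omega c y u v = 0"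
  shows "u = 0"
proof -
  have "ext_deriv lam c y (fst u) v = 0" for v using z[of "(v, 0)"] by (simp add: omega_def)
  hence 1: "fst u = 0" using nondegenerate[OF c, of "fst u"] by blast
  have 0: "ext_deriv lam c y (fst u) 0 = 0" by (rule linear_0[OF bilinear_ext_deriv(1)[OF c]])
  have "Re (snd u) = 0" "Im (snd u) = 0" using z[of "(0, \<i>)"] z[of "(0, 1)"] 0 by (simp_all add: omega_def)
  thus ?thesis using 1 by (simp add: prod_eq_iff complex_eq_iff)
qed

text \<open>The functional \<omega> ((X, \<open>zeta\<close>), _) vanishes on boundary vectors, so
  it is k times the conormal component, with k \<noteq> 0 by nondegeneracy. It vanishes on (X,
  \<open>zeta\<close>) itself, which is therefore tangent to the boundary. Any candidate for the
  Reeb vector also gives a multiple of the conormal component, hence is a multiple of (X,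
  \<open>zeta\<close>), and the normalization of the form fixes the factor 1/\<tau>.\<close>

lemma reeb_vf_eq:
  assumes d: "d \<in> TA" "P t y \<in> fst d" and c: "c \<in> A" "y \<in> fst c"
  shows "E d c (P t y) (reeb_vf (tube_form A lam) d (P t y)) = (1 / \<tau> t y) *\<^sub>R (X t c y, zeta t c y)"
proof -
  have y: "y \<in> W" using chart_simps(5)[OF charts[OF c(1)]] c(2) by blast
  let ?p = "P t y" and ?V = "(X t c y, zeta t c y)" and ?n = "conormal :: 'e \<times> complex"
  let ?T = "\<tau> t y"
  have T: "?T > 0" by (rule tau_pos[OF y])
  have fc: "fst ?p \<in> fst c" using c(2) by simp
  note form = tube_form_eq[OF d c(1) fc] and ext = ext_deriv_tube_form[OF d c(1) fc]
  note lE = linear_E[OF d c(1) fc] and la = alpha_linear[OF c(1) fc] and lo = linear_omega[OF c]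
  obtain G where G: "linear G" "\<forall>v. G (E d c ?p v) = v" "\<forall>v. E d c ?p (G v) = v"
    by (rule E_inverse[OF d c(1) fc])
  define k where "k = omega c y ?V (E d c ?p ?n)"
  have hyper: "omega c y u (E d c ?p v) = (v \<bullet> ?n) * omega c y u (E d c ?p ?n)" if "\<And>v. v \<bullet> ?n = 0 ==> omega c y u (E d c ?p v) = 0" for u v
    by (rule linear_vanishing_on_hyperplane[OF linear_compose[OF lE lo(1), unfolded o_def] that])
  have V: "omega c y ?V (E d c ?p v) = (v \<bullet> ?n) * k" for v
    unfolding k_def by (rule hyper[OF omega_zero_on_boundary[OF d c]])
  have k0: "k \<noteq> 0"
  proof
    assume "k = 0"
    hence "omega c y ?V v = 0" for v using V[of "G v"] G(3) by simp
    hence "?V = 0" by (rule omega_nondegenerate[OF c])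
    hence "alpha lam c ?p ?V = 0" using linear_0[OF la] by simp
    thus False using alpha_V[OF c, of t] T by simp
  qed
  define r where "r = G ((1 / ?T) *\<^sub>R ?V)"
  have Er: "E d c ?p r = (1 / ?T) *\<^sub>R ?V" using G(3) by (simp add: r_def)
  have rn: "r \<bullet> ?n = 0"
  proof -
    have "(r \<bullet> ?n) * k = omega c y ?V ((1 / ?T) *\<^sub>R ?V)" using V[of r] Er by simp
    also have "\<dots> = 0" unfolding linear_scale[OF lo(1)] omega_V_V[OF c] by simp
    finally show ?thesis using k0 by simp
  qed
  have "reeb_vf (tube_form A lam) d ?p = r" unfolding reeb_vf_def
  proof (rule the_equality, intro conjI allI impI)
    show "r \<bullet> ?n = 0" by (rule rn)
    show "tube_form A lam d ?p r = 1" unfolding form Er linear_scale[OF la] alpha_V[OF c] using T by simp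
    show "ext_deriv (tube_form A lam) d ?p r v = 0" if "v \<bullet> ?n = 0" for v
      unfolding ext Er linear_scale[OF lo(2)] fst_P omega_zero_on_boundary[OF d c that] by simp
    fix r' assume r': "r' \<bullet> ?n = 0 \<and> tube_form A lam d ?p r' = 1 \<and> (\<forall>v. v \<bullet> ?n = 0 \<longrightarrow> ext_deriv (tube_form A lam) d ?p r' v = 0)"
    define u where "u = E d c ?p r'"
    have au: "alpha lam c ?p u = 1" using r' unfolding form u_def by simp
    have "omega c y u (E d c ?p v) = 0" if "v \<bullet> ?n = 0" for v
    proof -
      have "ext_deriv (tube_form A lam) d ?p r' v = 0" using r' that by blast
      thus ?thesis unfolding ext fst_P u_def .
    qed
    note hu = hyper[OF this]
    define b where "b = omega c y u (E d c ?p ?n) / k"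
    have "omega c y (u - b *\<^sub>R ?V) v = 0" for v
    proof -
      have "omega c y u v = (G v \<bullet> ?n) * (b * k)" using hu[of "G v"] G(3) k0 by (simp add: b_def)
      moreover have "omega c y ?V v = (G v \<bullet> ?n) * k" using V[of "G v"] G(3) by simp
      ultimately show ?thesis unfolding linear_diff[OF lo(2)] linear_scale[OF lo(2)] by simp
    qed
    hence "u - b *\<^sub>R ?V = 0" by (rule omega_nondegenerate[OF c])
    hence u: "u = b *\<^sub>R ?V" by simp
    have "b * ?T = 1" using au unfolding u linear_scale[OF la] alpha_V[OF c] by simp
    hence "b = 1 / ?T" using T by (simp add: field_simps)
    hence "G u = r" using u by (simp add: r_def)
    thus "r' = r" using G(2) by (simp add: u_def)
  qed
  thus ?thesis using Er by simp
qed

end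

section \<open>Reeb orbits\<close>

text \<open>The preimage of a closed set is the projection of a compact part of the graph. This
  suits functions on M that are known only through a parametrization that is not injective.\<close>

lemma compact_graph_continuous:
  fixes f :: "'y::t2_space \<Rightarrow> 'z::t2_space"
  assumes "compact ((\<lambda>y. (y, f y)) ` Y)"
  shows "continuous_on Y f"
  unfolding continuous_on_closed_invariant
proof (intro allI impI)
  fix B :: "'z set" assume "closed B"
  let ?G = "(\<lambda>y. (y, f y)) ` Y"
  have "compact (fst ` (?G \<inter> UNIV \<times> B))"
    by (intro compact_continuous_image continuous_intros compact_Int_closed assms closed_Times closed_UNIV \<open>closed B\<close>)
  hence "closed (fst ` (?G \<inter> UNIV \<times> B))" by (rule compact_imp_closed)
  moreover have "fst ` (?G \<inter> UNIV \<times> B) \<inter> Y = f -` B \<inter> Y" by force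
  ultimately show "\<exists>A. closed A \<and> A \<inter> Y = f -` B \<inter> Y" by blast
qed

lemma inverse_derivative_within:
  fixes f U :: "real \<Rightarrow> real"
  assumes f: "(f has_field_derivative f') (at (U s) within J)" "f' \<noteq> 0"
    and U: "\<And>x. x \<in> I ==> U x \<in> J \<and> f (U x) = x" "continuous_on I U" and s: "s \<in> I"
  shows "(U has_field_derivative inverse f') (at s within I)"
proof -
  have "(U \<longlongrightarrow> U s) (at s within I)" using U(2) s by (simp add: continuous_on_def)
  moreover have "\<forall>\<^sub>F x in at s within I. U x \<in> J \<and> U x \<noteq> U s"
    unfolding eventually_at_filter using U(1) s by (intro always_eventually) metis
  ultimately have L: "filterlim U (at (U s) within J) (at s within I)" by (simp add: filterlim_at)
  have "((\<lambda>y. (f y - f (U s)) / (y - U s)) \<longlongrightarrow> f') (at (U s) within J)" using f(1) by (simp add: has_field_derivative_iff)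
  from tendsto_inverse[OF filterlim_compose[OF this L] f(2)]
  have "((\<lambda>x. inverse ((f (U x) - f (U s)) / (U x - U s))) \<longlongrightarrow> inverse f') (at s within I)" .
  hence "((\<lambda>x. (U x - U s) / (x - s)) \<longlongrightarrow> inverse f') (at s within I)"
  proof (rule Lim_transform_eventually)
    show "\<forall>\<^sub>F x in at s within I. inverse ((f (U x) - f (U s)) / (U x - U s)) = (U x - U s) / (x - s)"
      unfolding eventually_at_filter using U(1) s by (intro always_eventually) (simp add: inverse_eq_divide)
  qed
  thus ?thesis by (simp add: has_field_derivative_iff)
qed

text \<open>Rescaling to the fixed interval [0,1] turns the variable endpoint into a parameter of an
  integrand that is jointly continuous.\<close>

lemma continuous_on_indefinite_integral:
  fixes g :: "real \<Rightarrow> 'b::topological_space \<Rightarrow> real"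
  assumes g: "continuous_on ({0..C} \<times> B) (\<lambda>(v, b). g v b)"
  shows "continuous_on ({0..C} \<times> B) (\<lambda>(u, b). integral {0..u} (\<lambda>v. g v b))"
proof -
  have gb: "continuous_on {0..C} (\<lambda>v. g v b)" if "b \<in> B" for b
    by (rule continuous_on_pair[OF g]) (use that in \<open>auto intro: continuous_intros\<close>)
  have "continuous_on (({0..C} \<times> B) \<times> cbox 0 1) (\<lambda>z. fst (fst z) * g (snd z * fst (fst z)) (snd (fst z)))"
  proof (intro continuous_on_mult continuous_on_pair[OF g] continuous_intros)
    fix z assume z: "z \<in> ({0..C} \<times> B) \<times> cbox (0::real) 1"
    hence "snd z * fst (fst z) \<le> 1 * C" by (intro mult_mono) auto
    thus "snd z * fst (fst z) \<in> {0..C}" "snd (fst z) \<in> B" using z by auto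
  qed
  hence "continuous_on (({0..C} \<times> B) \<times> cbox 0 1) (\<lambda>(x, v). fst x * g (v * fst x) (snd x))" by (simp add: case_prod_unfold)
  hence "continuous_on ({0..C} \<times> B) (\<lambda>x. integral (cbox 0 1) (\<lambda>v. fst x * g (v * fst x) (snd x)))"
    by (rule integral_continuous_on_param)
  thus ?thesis
  proof (rule continuous_on_eq)
    fix x assume x: "x \<in> {0..C} \<times> B"
    define u where "u = fst x" define b where "b = snd x"
    have u: "0 \<le> u" "u \<le> C" "b \<in> B" using x by (auto simp: u_def b_def)
    let ?S = "\<lambda>u. integral {0..u} (\<lambda>v. g v b)"
    have S: "(?S has_real_derivative g w b) (at w within {0..C})" if "w \<in> {0..C}" for w
      by (rule integral_has_real_derivative[OF gb[OF u(3)] that])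
    have "((\<lambda>v. u * g (v * u) b) has_integral (?S (1 * u) - ?S (0 * u))) {0..1}"
    proof (rule fundamental_theorem_of_calculus)
      fix v :: real assume v: "v \<in> {0..1}"
      have img: "(\<lambda>v. v * u) ` {0..1} \<subseteq> {0..C}"
      proof (rule image_subsetI)
        fix v :: real assume "v \<in> {0..1}"
        hence v: "0 \<le> v" "v \<le> 1" by auto
        have "v * u \<le> 1 * C" using u v by (intro mult_mono) auto
        moreover have "0 \<le> v * u" using u v by simp
        ultimately show "v * u \<in> {0..C}" by simp
      qed
      have vu: "v * u \<in> {0..C}" using img v by blast
      have "(?S has_real_derivative g (v * u) b) (at (v * u) within (\<lambda>v. v * u) ` {0..1})"
        by (rule has_field_derivative_subset[OF S[OF vu] img])
      moreover have "((\<lambda>v. v * u) has_real_derivative u) (at v within {0..1})" by (auto intro!: derivative_eq_intros)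
      ultimately have "(?S \<circ> (\<lambda>v. v * u) has_real_derivative g (v * u) b * u) (at v within {0..1})" by (rule DERIV_image_chain)
      thus "((\<lambda>v. ?S (v * u)) has_vector_derivative u * g (v * u) b) (at v within {0..1})"
        by (simp add: o_def has_real_derivative_iff_has_vector_derivative mult.commute)
    qed simp
    hence "integral {0..1} (\<lambda>v. u * g (v * u) b) = ?S u" by (intro integral_unique) simp
    thus "integral (cbox 0 1) (\<lambda>v. fst x * g (v * fst x) (snd x)) = (case x of (u, b) \<Rightarrow> integral {0..u} (\<lambda>v. g v b))"
      by (simp add: case_prod_unfold u_def b_def)
  qed
qed

context hamiltonian_domain
begin

section \<open>Reeb time along Hamiltonian orbits\<close>

definition tmin :: real where "tmin = (INF (t, w)\<in>UNIV \<times> W. \<tau> t w)"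
definition tmax :: real where "tmax = (SUP (t, w)\<in>UNIV \<times> W. \<tau> t w)"

lemma tau_range: "tmin > 0" "w \<in> W ==> tmin \<le> \<tau> t w" "w \<in> W ==> \<tau> t w \<le> tmax"
  using tau_bounds unfolding tmin_def tmax_def by auto

text \<open>The Reeb time that corresponds to the Hamiltonian time \<open>u\<close> along the orbit of \<open>w\<close>; \<open>U w\<close> is its inverse.\<close>

definition sg :: "real \<Rightarrow> 'a \<Rightarrow> real" where
  "sg u w = integral {0..u} (\<lambda>v. \<tau> v (fl v w))"

lemma continuous_tau_fl: "continuous_on ({0..C} \<times> W) (\<lambda>(v, w). \<tau> v (fl v w))"
proof (cases "0 \<le> C")
  case True
  have "continuous_on ({0..C} \<times> W) (\<lambda>z. \<tau> (fst z) (fl (fst z) (snd z)))"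
    by (rule continuous_on_pair[OF continuous_tau continuous_on_fst[OF continuous_on_id]])
      (use fl_exists(1)[OF True] fl_in in \<open>auto simp: case_prod_unfold\<close>)
  thus ?thesis by (simp add: case_prod_unfold)
qed simp

lemma continuous_tau_fl_orbit: "w \<in> W ==> continuous_on {0..C} (\<lambda>v. \<tau> v (fl v w))"
  by (rule continuous_on_pair[OF continuous_tau_fl]) (auto intro: continuous_intros)

lemma continuous_sg: "continuous_on ({0..C} \<times> W) (\<lambda>(u, w). sg u w)"
  unfolding sg_def by (rule continuous_on_indefinite_integral[OF continuous_tau_fl])

lemma sg_derivative: "w \<in> W ==> u \<in> {0..C} ==> ((\<lambda>u. sg u w) has_real_derivative \<tau> u (fl u w)) (at u within {0..C})"
  unfolding sg_def by (rule integral_has_real_derivative[OF continuous_tau_fl_orbit])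

lemma sg_0: "sg 0 w = 0"
  by (simp add: sg_def)

lemma tau_fl_integrable: "w \<in> W ==> 0 \<le> u ==> (\<lambda>v. \<tau> v (fl v w)) integrable_on {u..u'}"
  by (rule integrable_continuous_real[OF continuous_on_subset[OF continuous_tau_fl_orbit[of w u']]]) auto

lemma sg_diff:
  assumes w: "w \<in> W" and u: "0 \<le> u" "u \<le> u'"
  shows "sg u' w - sg u w = integral {u..u'} (\<lambda>v. \<tau> v (fl v w))"
  using Henstock_Kurzweil_Integration.integral_combine[OF u(1,2) tau_fl_integrable[OF w order_refl]] by (simp add: sg_def)

lemma sg_mono:
  assumes w: "w \<in> W" and u: "0 \<le> u" "u \<le> u'"
  shows "tmin * (u' - u) \<le> sg u' w - sg u w"
proof -
  have "integral {u..u'} (\<lambda>v. tmin) \<le> integral {u..u'} (\<lambda>v. \<tau> v (fl v w))"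
    by (rule integral_le[OF _ tau_fl_integrable[OF w u(1)]]) (use tau_range(2) fl_in w u in auto)
  thus ?thesis using sg_diff[OF assms] u by (simp add: mult.commute)
qed

text \<open>The cocycle identity: after one unit of time both \<tau> and the flow repeat, with the
  starting point replaced by \<open>fl 1 w\<close>.\<close>

lemma sg_shift:
  assumes w: "w \<in> W" and u: "0 \<le> u"
  shows "sg (u + 1) w = sg u (fl 1 w) + sg 1 w"
proof -
  have "sg (u + 1) w - sg 1 w = integral {1..u + 1} (\<lambda>v. \<tau> v (fl v w))"
    by (rule sg_diff[OF w]) (use u in auto)
  also have "\<dots> = integral {0 + 1..u + 1} (\<lambda>v. \<tau> v (fl v w))" by simp
  also have "\<dots> = integral {0..u} ((\<lambda>v. \<tau> v (fl v w)) \<circ> (\<lambda>v. v + 1))"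
    by (rule integral_shift[symmetric], rule continuous_on_subset[OF continuous_tau_fl_orbit[OF w, of "u + 1"]]) auto
  also have "\<dots> = sg u (fl 1 w)" unfolding sg_def
    by (rule integral_cong) (use fl_shift w tau_periodic fl_in in \<open>auto simp: o_def\<close>)
  finally show ?thesis by simp
qed

lemma sg_surj:
  assumes w: "w \<in> W" and s: "0 \<le> s"
  shows "\<exists>u\<ge>0. sg u w = s"
proof -
  have "s \<le> sg (s / tmin) w" using sg_mono[OF w order_refl, of "s / tmin"] s tau_range(1) by (simp add: sg_0)
  moreover have "continuous_on {0..s / tmin} (\<lambda>u. sg u w)"
    by (rule continuous_on_pair[OF continuous_sg]) (use w in \<open>auto intro: continuous_intros\<close>)
  ultimately show ?thesis using IVT'[of "\<lambda>u. sg u w" 0 s "s / tmin"] s tau_range(1) by (auto simp: sg_0)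
qed

lemma sg_less:
  assumes w: "w \<in> W" and u: "0 \<le> u" "u < u'"
  shows "sg u w < sg u' w"
proof -
  have "0 < tmin * (u' - u)" using u tau_range(1) by (intro mult_pos_pos) auto
  thus ?thesis using sg_mono[OF w u(1), of u'] u by linarith
qed

lemma sg_nonneg:
  assumes w: "w \<in> W" and u: "0 \<le> u"
  shows "0 \<le> sg u w"
  using sg_less[OF w order_refl, of u] u by (cases "u = 0") (auto simp: sg_0)

definition U :: "'a \<Rightarrow> real \<Rightarrow> real" where
  "U w s = (SOME u. 0 \<le> u \<and> sg u w = s)"

lemma U: "w \<in> W ==> 0 \<le> s ==> 0 \<le> U w s \<and> sg (U w s) w = s"
  unfolding U_def by (rule someI_ex) (use sg_surj in blast)

lemma U_eqI: "w \<in> W ==> 0 \<le> u ==> sg u w = s ==> U w s = u"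
proof -
  assume w: "w \<in> W" and u: "0 \<le> u" "sg u w = s"
  have "0 \<le> s" using sg_nonneg[OF w u(1)] u(2) by simp
  from U[OF w this] show "U w s = u"
    using sg_less[OF w, of u "U w s"] sg_less[OF w, of "U w s" u] u by (metis less_irrefl not_less_iff_gr_or_eq)
qed

lemma U_sg: "w \<in> W ==> 0 \<le> u ==> U w (sg u w) = u"
  by (rule U_eqI) auto

lemma U_mono:
  assumes w: "w \<in> W" and s: "0 \<le> s" "s \<le> s'"
  shows "U w s \<le> U w s'" "tmin * (U w s' - U w s) \<le> s' - s"
proof -
  note 1 = U[OF w s(1)] and 2 = U[OF w order_trans[OF s]]
  show le: "U w s \<le> U w s'" using sg_less[OF w, of "U w s'" "U w s"] 1 2 s by linarith
  show "tmin * (U w s' - U w s) \<le> s' - s" using sg_mono[OF w _ le] 1 2 by simp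
qed

text \<open>As \<open>sg\<close> grows at rate at least \<open>tmin\<close>, its inverse is
  Lipschitz with constant 1 / \<open>tmin\<close>.\<close>

lemma continuous_U: assumes w: "w \<in> W" shows "continuous_on {0..} (U w)"
proof -
  have le: "\<bar>U w s - U w s'\<bar> \<le> (1 / tmin) * \<bar>s - s'\<bar>" if "0 \<le> s" "0 \<le> s'" for s s'
  proof (cases "s \<le> s'")
    case True thus ?thesis using U_mono[OF w that(1) True] tau_range(1) by (simp add: field_simps)
  next
    case False thus ?thesis using U_mono[OF w that(2), of s] tau_range(1) by (simp add: field_simps)
  qed
  have "(1 / tmin)-lipschitz_on {0..} (U w)"
    by (rule lipschitz_onI) (use le tau_range(1) in \<open>auto simp: dist_real_def\<close>)
  thus ?thesis by (rule lipschitz_on_continuous_on)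
qed

lemma U_derivative:
  assumes w: "w \<in> W" and s: "s \<in> I" and I: "I \<subseteq> {0..S}"
  shows "(U w has_real_derivative 1 / \<tau> (U w s) (fl (U w s) w)) (at s within I)"
proof -
  have I0: "x \<in> I ==> 0 \<le> x \<and> x \<le> S" for x using I by auto
  have "(U w has_real_derivative inverse (\<tau> (U w s) (fl (U w s) w))) (at s within I)"
  proof (rule inverse_derivative_within[OF _ _ _ _ s])
    show "((\<lambda>u. sg u w) has_real_derivative \<tau> (U w s) (fl (U w s) w)) (at (U w s) within {0..U w S})"
      by (rule sg_derivative[OF w]) (use U[OF w, of s] U_mono(1)[OF w, of s S] I0[OF s] in auto)
    show "\<tau> (U w s) (fl (U w s) w) \<noteq> 0" using tau_pos[OF fl_in[OF _ w], of "U w s" "U w s"] U[OF w, of s] I0[OF s] by auto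
    show "U w x \<in> {0..U w S} \<and> sg (U w x) w = x" if "x \<in> I" for x
      using U[OF w, of x] U_mono(1)[OF w, of x S] I0[OF that] by auto
    show "continuous_on I (U w)" by (rule continuous_on_subset[OF continuous_U[OF w]]) (use I0 in auto)
  qed
  thus ?thesis by (simp add: inverse_eq_divide)
qed

end

lemma eventually_openin_curve:
  assumes "continuous_on I g" "g ` I \<subseteq> S" "openin (top_of_set S) N" "s \<in> I" "g s \<in> N"
  shows "eventually (\<lambda>u. g u \<in> N) (at s within I)"
proof -
  obtain V where V: "open V" "N = S \<inter> V" using assms(3) unfolding openin_open by blast
  have "(g \<longlongrightarrow> g s) (at s within I)" using assms(1,4) by (simp add: continuous_on_def)
  hence "eventually (\<lambda>u. g u \<in> V) (at s within I)" using V assms(5) by (intro topological_tendstoD) auto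
  thus ?thesis unfolding eventually_at_filter by eventually_elim (use assms(2) V(2) in auto)
qed

lemma cis_vector_derivative:
  assumes "(f has_real_derivative f') (at s within I)"
  shows "((\<lambda>s. cis (f s)) has_vector_derivative f' *\<^sub>R (\<i> * cis (f s))) (at s within I)"
proof -
  have "((\<lambda>s. cis (f s)) has_derivative (\<lambda>h. (f' * h) *\<^sub>R (\<i> * cis (f s)))) (at s within I)"
    by (rule has_derivative_cis) (use assms in \<open>simp add: has_field_derivative_def\<close>)
  thus ?thesis by (simp add: has_vector_derivative_def mult.commute[of f'])
qed

context hamiltonian_domain
begin

section \<open>Reeb orbits over Hamiltonian orbits\<close>

lemma M_subset_tube: "M \<subseteq> tube W H"
proof
  fix p assume "p \<in> M"
  then obtain d where "d \<in> TA" "p \<in> fst d" unfolding tube_boundary[symmetric] mfd_boundary_def by blast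
  thus "p \<in> tube W H" using chart_simps(5)[OF tube_atlas_chart] by blast
qed

lemma M_E:
  assumes "p \<in> M"
  obtains t where "fst p \<in> W" "p = P t (fst p)"
  using assms unfolding M_def by fastforce

text \<open>Only the explicit dependence on time changes H along a Hamiltonian orbit, because dH (X)
  = 0.\<close>

lemma H_along_orbit_derivative:
  assumes w: "w \<in> W" and c: "c \<in> A" "fl u w \<in> fst c" and u: "u \<in> {0..C}"
  shows "((\<lambda>u. H u (fl u w)) has_real_derivative DG c (u, snd c (fl u w)) (1, 0)) (at u within {0..C})"
proof -
  note ch = chart_simps[OF charts[OF c(1)]]
  let ?I = "{0..C}"
  have C: "0 \<le> C" using u by simp
  have cf: "continuous_on ?I (\<lambda>u. fl u w)" "(\<lambda>u. fl u w) ` ?I \<subseteq> W" using fl_exists(3)[OF C w] by (auto simp: curve_on_def)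
  have ev: "eventually (\<lambda>u. fl u w \<in> fst c) (at u within ?I)" by (rule eventually_openin_curve[OF cf ch(8) u c(2)])
  have x: "((\<lambda>u. snd c (fl u w)) has_vector_derivative X u c (fl u w)) (at u within ?I)"
    using curve_onD[OF fl_exists(3)[OF C w] u c] by (simp add: o_def)
  obtain O' where O': "open O'" "u \<in> O'" "\<And>s. s \<in> O' ==> s \<noteq> u ==> s \<in> ?I ==> fl s w \<in> fst c"
    using ev unfolding eventually_at_topological by blast
  have mem: "fl s w \<in> fst c" if "s \<in> ?I \<inter> O'" for s using O'(3)[of s] that c(2) by (cases "s = u") auto
  have at: "at u within ?I \<inter> O' = at u within ?I" by (rule at_within_Int_nhd[OF O'(1,2)])
  have "((\<lambda>u. (u, snd c (fl u w))) has_derivative (\<lambda>h. (h, h *\<^sub>R X u c (fl u w)))) (at u within ?I \<inter> O')"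
    unfolding at using x by (intro has_derivative_Pair has_derivative_ident) (simp add: has_vector_derivative_def)
  moreover have "((\<lambda>(t, x). H t (chart_inv c x)) has_derivative DG c (u, snd c (fl u w))) (at (u, snd c (fl u w)) within (\<lambda>u. (u, snd c (fl u w))) ` (?I \<inter> O'))"
    by (rule has_derivative_subset[OF DG_derivative[OF c(1) ch(4)[OF c(2)]]]) (use mem ch(4) in auto)
  ultimately have "((\<lambda>s. (\<lambda>(t, x). H t (chart_inv c x)) (s, snd c (fl s w))) has_derivative (\<lambda>h. DG c (u, snd c (fl u w)) (h, h *\<^sub>R X u c (fl u w)))) (at u within ?I \<inter> O')"
    by (rule has_derivative_in_compose)
  moreover have "DG c (u, snd c (fl u w)) (h, h *\<^sub>R X u c (fl u w)) = DG c (u, snd c (fl u w)) (1, 0) * h" for h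
    unfolding DG_split[OF c, of u h] linear_scale[OF linear_dH[OF c]] dH_X[OF c] by simp
  ultimately have "((\<lambda>s. H s (chart_inv c (snd c (fl s w)))) has_derivative (\<lambda>h. DG c (u, snd c (fl u w)) (1, 0) * h)) (at u within ?I \<inter> O')"
    by simp
  hence "((\<lambda>s. H s (fl s w)) has_derivative (\<lambda>h. DG c (u, snd c (fl u w)) (1, 0) * h)) (at u within ?I \<inter> O')"
    by (rule has_derivative_transform[rotated 2]) (use mem ch(1) u O'(2) in auto)
  thus ?thesis unfolding at has_field_derivative_def .
qed

lemma zeta_boundary: "y \<in> bd ==> zeta t c y = 0 \<and> P t y = (y, 0)"
  by (simp add: zeta_def P_def H_boundary)

text \<open>An orbit that meets the boundary of W stays there, so its lift has z = 0 throughout and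
  the square root of H is never differentiated at 0. Elsewhere H > 0, and the square root and the
  rotation account for the two terms of \<open>zeta\<close>.\<close>

lemma P_orbit_derivative:
  assumes w: "w \<in> W" and c: "c \<in> A" "fl u w \<in> fst c" and u: "u \<in> {0..C}"
  shows "((\<lambda>u. snd (P u (fl u w))) has_vector_derivative zeta u c (fl u w)) (at u within {0..C})"
proof (cases "fl u w \<in> bd")
  case True
  have "snd (P s (fl s w)) = 0" if "s \<in> {0..C}" for s
    using zeta_boundary[OF fl_boundary[OF w _ _ True, of s]] that u by auto
  thus ?thesis using zeta_boundary[OF True] u
    by (intro has_vector_derivative_transform[OF u _ has_vector_derivative_const[of 0], THEN has_vector_derivative_eq_rhs]) auto
next
  case False
  let ?h = "\<lambda>u. H u (fl u w)" and ?D = "DG c (u, snd c (fl u w)) (1, 0)"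
  have flW: "fl u w \<in> W" using fl_in w u by auto
  have hp: "?h u > 0" using H_pos_iff[OF flW, of u] False by simp
  have d1: "((\<lambda>u. ?h u / pi) has_real_derivative ?D / pi) (at u within {0..C})"
    by (rule DERIV_cdivide[OF H_along_orbit_derivative[OF assms]])
  have hp': "0 < ?h u / pi" using hp by simp
  have "sqrt (?h u / pi) * sqrt (?h u / pi) = ?h u / pi" "sqrt (?h u / pi) > 0" using hp by simp_all
  hence sq: "inverse (sqrt (?h u / pi)) / 2 * (?D / pi) = ?D / (2 * ?h u) * sqrt (?h u / pi)"
    using hp by (simp add: divide_simps) (simp add: mult_ac)
  have s: "((\<lambda>u. sqrt (?h u / pi)) has_real_derivative ?D / (2 * ?h u) * sqrt (?h u / pi)) (at u within {0..C})"
    using DERIV_chain2[OF DERIV_real_sqrt[OF hp'] d1] unfolding sq .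
  have "((\<lambda>u. 2 * pi * u) has_real_derivative 2 * pi) (at u within {0..C})" by (auto intro!: derivative_eq_intros)
  from has_vector_derivative_scaleR[OF s cis_vector_derivative[OF this]]
  have "((\<lambda>u. sqrt (?h u / pi) *\<^sub>R cis (2 * pi * u)) has_vector_derivative
    (sqrt (?h u / pi) *\<^sub>R ((2 * pi) *\<^sub>R (\<i> * cis (2 * pi * u))) + (?D / (2 * ?h u) * sqrt (?h u / pi)) *\<^sub>R cis (2 * pi * u))) (at u within {0..C})" .
  moreover have "sqrt (?h u / pi) *\<^sub>R ((2 * pi) *\<^sub>R (\<i> * cis (2 * pi * u))) + (?D / (2 * ?h u) * sqrt (?h u / pi)) *\<^sub>R cis (2 * pi * u) = zeta u c (fl u w)"
    unfolding zeta_def P_def snd_conv scaleR_conv_of_real by (simp add: algebra_simps)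
  ultimately show ?thesis unfolding P_def snd_conv scaleR_conv_of_real by simp
qed

text \<open>The Reeb orbit over the Hamiltonian orbit of w, starting at angle 0 and parametrized by
  Reeb time.\<close>

definition R :: "'a \<Rightarrow> real \<Rightarrow> 'a \<times> complex" where
  "R w s = P (U w s) (fl (U w s) w)"

lemma R_sg: "w \<in> W ==> 0 \<le> u ==> R w (sg u w) = P u (fl u w)"
  by (simp add: R_def U_sg)

lemma R_in_M: "w \<in> W ==> 0 \<le> s ==> R w s \<in> M"
  unfolding R_def using U fl_in by (intro P_in_M) blast

text \<open>In product coordinates the velocity with respect to Hamiltonian time is (X,
  \<open>zeta\<close>), and the inverse of \<open>sg\<close> contributes 1/\<tau>. By
  \<open>reeb_vf_eq\<close> this is the Reeb vector, carried back to the tube chart by the inverse G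
  of \<open>E\<close>.\<close>

lemma R_curve:
  assumes w: "w \<in> W" and s0: "0 \<le> s0"
  shows "curve_on M TA RV 0 S (\<lambda>s. R w (s0 + s))"
  unfolding curve_on_def
proof (intro conjI ballI impI)
  let ?I = "{0..S}"
  have pos: "0 \<le> s0 + s" if "s \<in> ?I" for s using that s0 by simp
  let ?C = "U w (s0 + S)"
  have UI: "U w (s0 + s) \<in> {0..?C}" if "s \<in> ?I" for s
    using U[OF w pos[OF that]] U_mono(1)[OF w pos[OF that], of "s0 + S"] that by auto
  show img: "(\<lambda>s. R w (s0 + s)) ` ?I \<subseteq> M" using R_in_M[OF w pos] by blast
  have cU: "continuous_on ?I (\<lambda>s. U w (s0 + s))"
  proof (rule continuous_on_compose2[OF continuous_U[OF w]])
    show "continuous_on ?I (\<lambda>s. s0 + s)" by (intro continuous_intros)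
    show "(\<lambda>s. s0 + s) ` ?I \<subseteq> {0..}" using s0 by auto
  qed
  have cfl: "continuous_on ?I (\<lambda>s. fl (U w (s0 + s)) w)"
  proof (cases "0 \<le> S")
    case True
    hence C: "0 \<le> ?C" using UI[of 0] by auto
    show ?thesis by (rule continuous_on_pair[OF fl_exists(1)[OF C] cU continuous_on_const]) (use UI w in auto)
  qed simp
  show cR: "continuous_on ?I (\<lambda>s. R w (s0 + s))"
    unfolding R_def by (rule continuous_on_pair[OF continuous_P cU cfl]) (use UI fl_in w in auto)
  fix s d assume s: "s \<in> ?I" and d: "d \<in> TA" "R w (s0 + s) \<in> fst d"
  let ?u = "U w (s0 + s)"
  let ?y = "fl ?u w" and ?g = "\<lambda>s. R w (s0 + s)"
  have u: "?u \<in> {0..?C}" by (rule UI[OF s])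
  have yW: "?y \<in> W" using fl_in w u by auto
  obtain c where c: "c \<in> A" "?y \<in> fst c" using chart_exists[OF yW] .
  note ch = chart_simps[OF charts[OF c(1)]]
  have dP: "P ?u ?y \<in> fst d" using d(2) by (simp add: R_def)
  have fc: "fst (P ?u ?y) \<in> fst c" using c(2) by simp
  obtain G where G: "(transition (prod_chart c) d has_derivative G) (at (snd c (fst (P ?u ?y)), snd (P ?u ?y)) within transition_dom (prod_chart c) d)"
    "linear G" "\<forall>v. G (E d c (P ?u ?y) v) = v" "\<forall>v. E d c (P ?u ?y) (G v) = v"
    by (rule E_inverse[OF d(1) dP c(1) fc])
  have C0: "0 \<le> ?C" using u by auto
  have "((\<lambda>u. snd c (fl u w)) has_vector_derivative X ?u c ?y) (at ?u within {0..?C})"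
    using curve_onD[OF fl_exists(3)[OF C0 w] u c] by (simp add: o_def)
  hence k: "((\<lambda>u. (snd c (fl u w), snd (P u (fl u w)))) has_vector_derivative (X ?u c ?y, zeta ?u c ?y)) (at ?u within {0..?C})"
    by (rule has_vector_derivative_Pair[OF _ P_orbit_derivative[OF w c u]])
  have Ud: "(U w has_real_derivative 1 / \<tau> ?u ?y) (at (s0 + s) within (\<lambda>s. s0 + s) ` ?I)"
    by (rule U_derivative[OF w, of _ _ "s0 + S"]) (use s s0 in auto)
  have "((\<lambda>s. s0 + s) has_real_derivative 1) (at s within ?I)" by (auto intro!: derivative_eq_intros)
  from DERIV_image_chain[OF Ud this]
  have "((\<lambda>s. U w (s0 + s)) has_vector_derivative 1 / \<tau> ?u ?y) (at s within ?I)"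
    by (simp add: o_def has_real_derivative_iff_has_vector_derivative)
  moreover have "((\<lambda>u. (snd c (fl u w), snd (P u (fl u w)))) has_vector_derivative (X ?u c ?y, zeta ?u c ?y)) (at ?u within (\<lambda>s. U w (s0 + s)) ` ?I)"
    by (rule has_vector_derivative_within_subset[OF k]) (use UI in blast)
  ultimately have "((\<lambda>u. (snd c (fl u w), snd (P u (fl u w)))) \<circ> (\<lambda>s. U w (s0 + s)) has_vector_derivative
      (1 / \<tau> ?u ?y) *\<^sub>R (X ?u c ?y, zeta ?u c ?y)) (at s within ?I)"
    by (rule vector_diff_chain_within)
  moreover have "(\<lambda>u. (snd c (fl u w), snd (P u (fl u w)))) \<circ> (\<lambda>s. U w (s0 + s)) = snd (prod_chart c) \<circ> ?g"
    by (auto simp: R_def)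
  ultimately have v: "((snd (prod_chart c) \<circ> ?g) has_vector_derivative (1 / \<tau> ?u ?y) *\<^sub>R (X ?u c ?y, zeta ?u c ?y)) (at s within ?I)" by simp
  have "((snd d \<circ> ?g) has_vector_derivative G ((1 / \<tau> ?u ?y) *\<^sub>R (X ?u c ?y, zeta ?u c ?y))) (at s within ?I)"
  proof (rule chart_change_derivative[OF _ v _ _ s])
    show "(transition (prod_chart c) d has_derivative G) (at (snd (prod_chart c) (R w (s0 + s))) within transition_dom (prod_chart c) d)"
      using G(1) by (simp add: R_def)
    show "R w (s0 + s) \<in> fst (prod_chart c) \<inter> fst d" using d(2) c(2) by (simp add: R_def mem_Times_iff)
    have 1: "eventually (\<lambda>s. fl (U w (s0 + s)) w \<in> fst c) (at s within ?I)"
      by (rule eventually_openin_curve[OF cfl _ ch(8) s c(2)]) (use UI fl_in w in auto)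
    have 2: "eventually (\<lambda>s. R w (s0 + s) \<in> fst d) (at s within ?I)"
      by (rule eventually_openin_curve[OF cR _ chart_simps(8)[OF tube_atlas_chart[OF d(1)]] s d(2)]) (use img M_subset_tube in blast)
    show "eventually (\<lambda>s. R w (s0 + s) \<in> fst (prod_chart c) \<inter> fst d) (at s within ?I)"
      using 1 2 by eventually_elim (simp add: R_def mem_Times_iff)
    show "chart_inv (prod_chart c) (snd (prod_chart c) p) = p" if "p \<in> fst (prod_chart c)" for p
      using chart_inv_prod_chart[OF charts[OF c(1)], of "fst p" "snd p"] that by auto
  qed
  moreover have "G ((1 / \<tau> ?u ?y) *\<^sub>R (X ?u c ?y, zeta ?u c ?y)) = reeb_vf (tube_form A lam) d (R w (s0 + s))"
    unfolding reeb_vf_eq[OF d(1) dP c, symmetric] R_def by (rule G(3)[rule_format])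
  ultimately show "((snd d \<circ> ?g) has_vector_derivative reeb_vf (tube_form A lam) d (R w (s0 + s))) (at s within ?I)" by simp
qed

text \<open>\<tau> as a function on M; any angle that represents the point gives the same
  value.\<close>

definition tM :: "'a \<times> complex \<Rightarrow> real" where
  "tM p = \<tau> (SOME t. P t (fst p) = p) (fst p)"

lemma tM_P: assumes "w \<in> W" shows "tM (P t w) = \<tau> t w"
proof -
  have "P (SOME s. P s (fst (P t w)) = P t w) (fst (P t w)) = P t w" by (rule someI[of _ t]) simp
  hence eq: "P (SOME s. P s w = P t w) w = P t w" by simp
  thus ?thesis unfolding tM_def using P_eq_same_X(2)[OF assms eq] by simp
qed

lemma tM_range:
  assumes "p \<in> M" shows "0 < tM p" "tmin \<le> tM p" "tM p \<le> tmax"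
proof -
  obtain t where t: "fst p \<in> W" "p = P t (fst p)" by (rule M_E[OF assms])
  have "tM p = \<tau> t (fst p)" using tM_P[OF t(1), of t] t(2) by simp
  thus "0 < tM p" "tmin \<le> tM p" "tM p \<le> tmax" using tau_range[OF ] t(1) tau_pos by auto
qed

lemma continuous_tM: "continuous_on M tM"
proof (rule compact_graph_continuous)
  have "(\<lambda>y. (y, tM y)) ` M = (\<lambda>z. (P (fst z) (snd z), \<tau> (fst z) (snd z))) ` ({0..1} \<times> W)"
    unfolding M_def by (auto simp: image_image tM_P case_prod_unfold intro!: image_cong)
  moreover have "compact \<dots>"
  proof (rule compact_continuous_image[OF _ compact_Times[OF compact_Icc compact_W]])
    show "continuous_on ({0..1} \<times> W) (\<lambda>z. (P (fst z) (snd z), \<tau> (fst z) (snd z)))"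
      using continuous_on_subset[OF continuous_P, of "{0..1} \<times> W"] continuous_on_subset[OF continuous_tau, of "{0..1} \<times> W"]
      by (intro continuous_on_Pair) (auto simp: case_prod_unfold)
  qed
  ultimately show "compact ((\<lambda>y. (y, tM y)) ` M)" by simp
qed

text \<open>Uniqueness is drawn from the flow on W instead of from Lipschitz estimates for the Reeb
  field. Integrating 1/\<tau> along g gives a candidate T for the Hamiltonian time. It turns out
  that g s = P (T s) (y s), so the projection y moves with velocity X_T / \<tau> and equals
  \<open>fl (T s) w\<close>. Finally \<open>sg (T s) w - s\<close> is constant, which identifies T
  with \<open>U\<close>.\<close>

lemma reeb_curve_unique:
  assumes g: "curve_on M TA RV 0 S g" "g 0 = P t (fl t w)" and t: "0 \<le> t" and w: "w \<in> W" and s: "s \<in> {0..S}"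
  shows "g s = R w (sg t w + s)"
proof -
  let ?I = "{0..S}"
  have S: "0 \<le> S" "0 \<in> ?I" using s by auto
  have gM: "g s \<in> M" if "s \<in> ?I" for s using g(1) that by (auto simp: curve_on_def)
  have gc: "continuous_on ?I g" using g(1) by (simp add: curve_on_def)
  define y where "y = (\<lambda>s. fst (g s))"
  define z where "z = (\<lambda>s. snd (g s))"
  have yW: "y s \<in> W" if "s \<in> ?I" for s using gM[OF that] M_E unfolding y_def by metis
  have yc: "continuous_on ?I y" unfolding y_def by (intro continuous_on_fst gc)
  define \<rho> where "\<rho> = (\<lambda>s. 1 / tM (g s))"
  have rep: "\<exists>r. g s = P r (y s)" if "s \<in> ?I" for s using gM[OF that] M_E unfolding y_def by metis
  have tMc: "continuous_on ?I (\<lambda>s. tM (g s))"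
    by (rule continuous_on_compose2[OF continuous_tM gc]) (use gM in blast)
  have tp: "tM (g s) > 0" if "s \<in> ?I" for s by (rule tM_range(1)[OF gM[OF that]])
  have \<rho>c: "continuous_on ?I \<rho>" unfolding \<rho>_def
    by (intro continuous_on_divide continuous_on_const tMc) (use tp in force)
  define T where "T = (\<lambda>s. t + integral {0..s} \<rho>)"
  have T': "(T has_real_derivative \<rho> s) (at s within ?I)" if "s \<in> ?I" for s
  proof -
    from integral_has_real_derivative[OF \<rho>c that] have "((\<lambda>s. t + integral {0..s} \<rho>) has_real_derivative 0 + \<rho> s) (at s within ?I)"
      by (rule DERIV_add[OF DERIV_const])
    thus ?thesis by (simp add: T_def)
  qed
  have Tc: "continuous_on ?I T" by (rule DERIV_continuous_on[OF T'])
  have T0: "T 0 = t" by (simp add: T_def)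
  have Tt: "T s \<ge> t" if s: "s \<in> ?I" for s
  proof -
    have "0 \<le> integral {0..s} \<rho>"
      by (rule integral_nonneg[OF integrable_continuous_real[OF continuous_on_subset[OF \<rho>c]]])
        (use s tp in \<open>auto simp: \<rho>_def intro!: less_imp_le\<close>)
    thus ?thesis by (simp add: T_def)
  qed
  have vel: "((\<lambda>s. (snd c (y s), z s)) has_vector_derivative \<rho> s *\<^sub>R (X r c (y s), zeta r c (y s))) (at s within ?I)"
    if s: "s \<in> ?I" and c: "c \<in> A" "y s \<in> fst c" and r: "g s = P r (y s)" for s c r
  proof -
    obtain d where d: "d \<in> TA" "g s \<in> fst d" using gM[OF s] unfolding tube_boundary[symmetric] mfd_boundary_def by blast
    note chd = chart_simps[OF tube_atlas_chart[OF d(1)]]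
    have dP: "P r (y s) \<in> fst d" and fc: "fst (P r (y s)) \<in> fst c" using d(2) r c by simp_all
    have v: "((snd d \<circ> g) has_vector_derivative reeb_vf (tube_form A lam) d (P r (y s))) (at s within ?I)"
      using curve_onD[OF g(1) s d] r by simp
    have "((snd (prod_chart c) \<circ> g) has_vector_derivative E d c (P r (y s)) (reeb_vf (tube_form A lam) d (P r (y s)))) (at s within ?I)"
    proof (rule chart_change_derivative[OF _ v _ _ s])
      show "(transition d (prod_chart c) has_derivative E d c (P r (y s))) (at (snd d (g s)) within transition_dom d (prod_chart c))"
        unfolding r by (rule E_derivative[OF d(1) dP c(1) fc])
      show "g s \<in> fst d \<inter> fst (prod_chart c)" using d(2) c(2) by (simp add: mem_Times_iff y_def)
      have 1: "eventually (\<lambda>s. y s \<in> fst c) (at s within ?I)"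
        by (rule eventually_openin_curve[OF yc _ chart_simps(8)[OF charts[OF c(1)]] s c(2)]) (use yW in blast)
      have 2: "eventually (\<lambda>s. g s \<in> fst d) (at s within ?I)"
        by (rule eventually_openin_curve[OF gc _ chd(8) s d(2)]) (use gM M_subset_tube in blast)
      show "eventually (\<lambda>s. g s \<in> fst d \<inter> fst (prod_chart c)) (at s within ?I)"
        using 1 2 by eventually_elim (simp add: mem_Times_iff y_def)
    qed (rule chd(1))
    moreover have "snd (prod_chart c) \<circ> g = (\<lambda>s. (snd c (y s), z s))" by (auto simp: y_def z_def)
    moreover have "\<rho> s = 1 / \<tau> r (y s)" using tM_P[OF yW[OF s], of r] by (simp add: \<rho>_def r)
    ultimately show ?thesis unfolding reeb_vf_eq[OF d(1) dP c] by simp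
  qed
  have vely: "((snd c \<circ> y) has_vector_derivative \<rho> s *\<^sub>R X r c (y s)) (at s within ?I)"
    if "s \<in> ?I" "c \<in> A" "y s \<in> fst c" "g s = P r (y s)" for s c r
  proof -
    have "((\<lambda>s. fst (snd c (y s), z s)) has_derivative (\<lambda>h. fst (h *\<^sub>R (\<rho> s *\<^sub>R (X r c (y s), zeta r c (y s)))))) (at s within ?I)"
      by (rule has_derivative_fst[OF vel[OF that, unfolded has_vector_derivative_def]])
    thus ?thesis by (simp add: has_vector_derivative_def o_def)
  qed
  have velz: "(z has_vector_derivative \<rho> s *\<^sub>R zeta r c (y s)) (at s within ?I)"
    if "s \<in> ?I" "c \<in> A" "y s \<in> fst c" "g s = P r (y s)" for s c r
  proof -
    have "((\<lambda>s. snd (snd c (y s), z s)) has_derivative (\<lambda>h. snd (h *\<^sub>R (\<rho> s *\<^sub>R (X r c (y s), zeta r c (y s)))))) (at s within ?I)"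
      by (rule has_derivative_snd[OF vel[OF that, unfolded has_vector_derivative_def]])
    thus ?thesis by (simp add: has_vector_derivative_def)
  qed
  have gP: "g s = P (T s) (y s)" if s: "s \<in> ?I" for s
  proof (cases "\<exists>s0\<in>?I. y s0 \<in> bd")
    case True
    \<comment> \<open>A projection that meets the boundary of W stays in it; then z = 0 and every
      angle, in particular \<open>T s\<close>, represents g s.\<close>
    then obtain s0 where s0: "s0 \<in> ?I" "y s0 \<in> bd" by blast
    have "y s \<in> bd"
    proof (rule boundary_invariant[OF yc yW _ s0 s])
      show "\<exists>\<rho> T. ((snd c \<circ> y) has_vector_derivative \<rho> *\<^sub>R X T c (y s)) (at s within ?I)" if "s \<in> ?I" "c \<in> A" "y s \<in> fst c" for s c
        using rep[OF that(1)] vely[OF that] by blast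
    qed
    thus ?thesis using rep[OF s] zeta_boundary by metis
  next
    case False
    \<comment> \<open>z turned back by the expected angle. Its derivative is a real multiple of q,
      because the rotation term of \<open>zeta\<close> cancels; so q keeps its direction, which at s
      = 0 is that of the positive real axis.\<close>
    define q where "q = (\<lambda>s. z s * cis (- (2 * pi * T s)))"
    have znz: "z s \<noteq> 0" if s: "s \<in> ?I" for s
    proof -
      obtain r where r: "g s = P r (y s)" using rep[OF s] by blast
      have "H r (y s) \<noteq> 0" using False s H_pos_iff(2)[OF yW[OF s]] by blast
      thus ?thesis using norm_snd_P[OF yW[OF s], of r] unfolding r[symmetric] z_def by auto
    qed
    have q': "\<exists>b. (q has_vector_derivative b *\<^sub>R q s) (at s within ?I)" if s: "s \<in> ?I" for s
    proof -
      obtain r where r: "g s = P r (y s)" using rep[OF s] by blast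
      obtain c where c: "c \<in> A" "y s \<in> fst c" using chart_exists[OF yW[OF s]] .
      define a where "a = DG c (r, snd c (y s)) (1, 0) / (2 * H r (y s))"
      have ze: "zeta r c (y s) = (complex_of_real a + 2 * pi * \<i>) * z s" unfolding zeta_def a_def z_def r[symmetric] ..
      have "((\<lambda>s. - (2 * pi * T s)) has_real_derivative - (2 * pi * \<rho> s)) (at s within ?I)"
        by (rule DERIV_minus[OF DERIV_cmult[OF T'[OF s]]])
      from has_vector_derivative_mult[OF velz[OF s c r] cis_vector_derivative[OF this]]
      have "(q has_vector_derivative z s * (- (2 * pi * \<rho> s)) *\<^sub>R (\<i> * cis (- (2 * pi * T s))) + \<rho> s *\<^sub>R zeta r c (y s) * cis (- (2 * pi * T s))) (at s within ?I)"
        unfolding q_def .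
      moreover have "z s * (- (2 * pi * \<rho> s)) *\<^sub>R (\<i> * cis (- (2 * pi * T s))) + \<rho> s *\<^sub>R zeta r c (y s) * cis (- (2 * pi * T s)) = (\<rho> s * a) *\<^sub>R q s"
        unfolding ze q_def scaleR_conv_of_real by (simp add: algebra_simps)
      ultimately show ?thesis by auto
    qed
    have qn: "cmod (q s) = cmod (z s)" for s by (simp add: q_def norm_mult)
    define n where "n = (\<lambda>s. sqrt (q s \<bullet> q s))"
    have n: "n s = cmod (z s)" for s by (simp add: n_def norm_eq_sqrt_inner[symmetric] qn)
    have "((\<lambda>s. inverse (n s) *\<^sub>R q s) has_vector_derivative 0) (at s within ?I)" if s: "s \<in> ?I" for s
    proof -
      obtain b where b: "(q has_vector_derivative b *\<^sub>R q s) (at s within ?I)" using q'[OF s] by blast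
      have np: "n s > 0" "n s \<noteq> 0" using znz[OF s] by (simp_all add: n)
      hence qq: "q s \<bullet> q s > 0" by (simp add: n_def)
      have "((\<lambda>s. q s \<bullet> q s) has_derivative (\<lambda>h. q s \<bullet> (h *\<^sub>R (b *\<^sub>R q s)) + (h *\<^sub>R (b *\<^sub>R q s)) \<bullet> q s)) (at s within ?I)"
        using has_derivative_inner[OF b[unfolded has_vector_derivative_def] b[unfolded has_vector_derivative_def]] .
      moreover have "(\<lambda>h. q s \<bullet> (h *\<^sub>R (b *\<^sub>R q s)) + (h *\<^sub>R (b *\<^sub>R q s)) \<bullet> q s) = (*) (2 * b * (q s \<bullet> q s))" by (auto simp: algebra_simps)
      ultimately have "((\<lambda>s. q s \<bullet> q s) has_real_derivative 2 * b * (q s \<bullet> q s)) (at s within ?I)" by (simp add: has_field_derivative_def)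
      from DERIV_chain2[OF DERIV_real_sqrt[OF qq] this]
      have "(n has_real_derivative inverse (n s) / 2 * (2 * b * (q s \<bullet> q s))) (at s within ?I)" unfolding n_def .
      moreover have "q s \<bullet> q s = n s * n s" using qq by (simp add: n_def)
      hence "inverse (n s) / 2 * (2 * b * (q s \<bullet> q s)) = b * n s" using np by simp
      ultimately have "(n has_real_derivative b * n s) (at s within ?I)" by (simp only:)
      from has_vector_derivative_scaleR[OF DERIV_inverse'[OF this np(2)] b]
      have "((\<lambda>s. inverse (n s) *\<^sub>R q s) has_vector_derivative inverse (n s) *\<^sub>R (b *\<^sub>R q s) + (- (inverse (n s) * (b * n s) * inverse (n s))) *\<^sub>R q s) (at s within ?I)" .
      moreover have "inverse (n s) *\<^sub>R (b *\<^sub>R q s) + (- (inverse (n s) * (b * n s) * inverse (n s))) *\<^sub>R q s = 0"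
        using np by (simp add: scaleR_left.minus mult.commute)
      ultimately show ?thesis by (simp only:)
    qed
    then obtain k where k: "\<And>s. s \<in> ?I ==> inverse (n s) *\<^sub>R q s = k"
      by (rule has_vector_derivative_zero_constant[of ?I, rotated]) auto
    have z0: "z 0 = polar (cmod (z 0)) t"
      using snd_P_polar[OF fl_in[OF t w], of t] by (simp add: z_def g(2))
    have "q 0 = complex_of_real (n 0)" unfolding q_def T0 n by (subst z0) (simp add: mult.assoc[of "complex_of_real (cmod (z 0))"] cis_mult)
    hence "inverse (n 0) *\<^sub>R q 0 = 1" using znz[OF S(2)] by (simp add: scaleR_conv_of_real n)
    hence "inverse (n s) *\<^sub>R q s = 1" using k[OF s] k[OF S(2)] by simp
    hence qs: "q s = complex_of_real (cmod (z s))" using znz[OF s] by (simp add: scaleR_conv_of_real n field_simps)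
    have "z s = q s * cis (2 * pi * T s)" by (simp add: q_def mult.assoc cis_mult)
    hence zp: "z s = polar (cmod (z s)) (T s)" unfolding qs .
    have yz: "g s = (y s, z s)" by (simp add: y_def z_def)
    have "pi * (cmod (z s))\<^sup>2 = H (T s) (y s)" using tube_iff(2)[OF yW[OF s] zp] gM[OF s] yz by simp
    hence "H (T s) (y s) / pi = (cmod (z s))\<^sup>2" by (simp add: field_simps)
    hence "P (T s) (y s) = (y s, complex_of_real (cmod (z s)) * cis (2 * pi * T s))" by (simp add: P_def)
    thus ?thesis using zp yz by simp
  qed
  \<comment> \<open>Clamping extends the speed and the time, known only on [0,S], to continuous
    functions on the line, as \<open>reparametrized\<close> demands.\<close>
  define cl where "cl = (\<lambda>s. max 0 (min S s))"
  have clI: "cl s \<in> ?I" for s using S by (simp add: cl_def)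
  have cls: "cl s = s" if "s \<in> ?I" for s using that by (simp add: cl_def)
  have clc: "continuous_on UNIV cl" unfolding cl_def by (intro continuous_intros)
  interpret r: flow_domain W A "\<lambda>s c p. \<rho> (cl s) *\<^sub>R X (T (cl s)) c p"
    by (rule fd.reparametrized) (rule continuous_on_compose2[OF \<rho>c clc] continuous_on_compose2[OF Tc clc]; use clI in blast)+
  have c1: "curve_on W A (\<lambda>s c p. \<rho> (cl s) *\<^sub>R X (T (cl s)) c p) 0 S y"
    unfolding curve_on_def
  proof (intro conjI ballI impI yc)
    show "y ` ?I \<subseteq> W" using yW by blast
    show "((snd c \<circ> y) has_vector_derivative \<rho> (cl s) *\<^sub>R X (T (cl s)) c (y s)) (at s within ?I)" if "s \<in> ?I" "c \<in> A" "y s \<in> fst c" for s c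
      using vely[OF that gP[OF that(1)]] cls[OF that(1)] by simp
  qed
  obtain C where C: "\<And>s. s \<in> ?I ==> T s \<in> {0..C}"
  proof -
    obtain s1 where "s1 \<in> ?I" "\<forall>s\<in>?I. T s \<le> T s1" using continuous_attains_sup[OF compact_Icc _ Tc] S by blast
    thus ?thesis using that[of "T s1"] Tt t by force
  qed
  have C0: "0 \<le> C" using C[OF S(2)] by simp
  note flc = fl_exists(3)[OF C0 w]
  have c2: "curve_on W A (\<lambda>s c p. \<rho> (cl s) *\<^sub>R X (T (cl s)) c p) 0 S (\<lambda>s. fl (T s) w)"
    unfolding curve_on_def
  proof (intro conjI ballI impI)
    show "(\<lambda>s. fl (T s) w) ` ?I \<subseteq> W" using C fl_in[OF _ w] by auto
    show "continuous_on ?I (\<lambda>s. fl (T s) w)"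
      by (rule continuous_on_pair[OF fl_exists(1)[OF C0] Tc continuous_on_const]) (use C w in auto)
    fix s c assume s: "s \<in> ?I" and c: "c \<in> A" "fl (T s) w \<in> fst c"
    have "((snd c \<circ> (\<lambda>u. fl u w)) has_vector_derivative X (T s) c (fl (T s) w)) (at (T s) within T ` ?I)"
      by (rule has_vector_derivative_within_subset[OF curve_onD[OF flc C[OF s] c]]) (use C in blast)
    from vector_diff_chain_within[OF T'[OF s, unfolded has_real_derivative_iff_has_vector_derivative] this]
    show "((snd c \<circ> (\<lambda>s. fl (T s) w)) has_vector_derivative \<rho> (cl s) *\<^sub>R X (T (cl s)) c (fl (T s) w)) (at s within ?I)"
      unfolding cls[OF s] by (simp add: o_def)
  qed
  have yT: "y s = fl (T s) w" if "s \<in> ?I" for s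
    by (rule r.curve_unique[OF c1 c2 S(2) _ that]) (simp add: y_def g(2) T0)
  have "((\<lambda>s. sg (T s) w - s) has_field_derivative 0) (at s within ?I)" if s: "s \<in> ?I" for s
  proof -
    have "((\<lambda>u. sg u w) has_real_derivative \<tau> (T s) (fl (T s) w)) (at (T s) within T ` ?I)"
      by (rule has_field_derivative_subset[OF sg_derivative[OF w C[OF s]]]) (use C in blast)
    from DERIV_image_chain[OF this T'[OF s]]
    have "((\<lambda>s. sg (T s) w) has_real_derivative \<tau> (T s) (fl (T s) w) * \<rho> s) (at s within ?I)" by (simp add: o_def)
    moreover have "\<rho> s = 1 / \<tau> (T s) (fl (T s) w)"
      using tM_P[OF yW[OF s], of "T s"] unfolding gP[OF s, symmetric] by (simp add: \<rho>_def yT[OF s])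
    moreover have "\<tau> (T s) (fl (T s) w) \<noteq> 0" using tau_pos[OF yW[OF s], of "T s"] by (simp add: yT[OF s])
    ultimately have "((\<lambda>s. sg (T s) w) has_real_derivative 1) (at s within ?I)" by simp
    from DERIV_diff[OF this DERIV_ident] show ?thesis by simp
  qed
  then obtain k where k: "\<And>s. s \<in> ?I ==> sg (T s) w - s = k"
    using has_field_derivative_zero_constant[of ?I "\<lambda>s. sg (T s) w - s"] by auto
  have "sg (T s) w = sg t w + s" using k[OF s] k[OF S(2)] T0 by simp
  hence "U w (sg t w + s) = T s" using U_eqI[OF w, of "T s"] C[OF s] by simp
  thus ?thesis unfolding R_def using gP[OF s] yT[OF s] by simp
qed

text \<open>The Reeb flow on M through a chosen representation of the point; that the choice does
  not matter is itself a consequence of the uniqueness of Reeb curves.\<close>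

definition Phi :: "real \<Rightarrow> 'a \<times> complex \<Rightarrow> 'a \<times> complex" where
  "Phi a x = (let (t, w) = SOME (t, w). 0 \<le> t \<and> w \<in> W \<and> x = P t (fl t w) in R w (sg t w + a))"

lemma M_rep:
  assumes "x \<in> M" obtains t w where "t \<in> {0..1}" "w \<in> W" "x = P t (fl t w)"
proof -
  obtain t y where t: "t \<in> {0..1}" "y \<in> W" "x = P t y" using assms by (auto simp: M_def)
  obtain w where "w \<in> W" "fl t w = y" using fl_surj[of t y] t by auto
  thus ?thesis using that t by blast
qed

lemma Phi_eq:
  assumes t: "0 \<le> t" and w: "w \<in> W" and a: "0 \<le> a"
  shows "Phi a (P t (fl t w)) = R w (sg t w + a)"
proof -
  let ?Q = "\<lambda>q. 0 \<le> fst q \<and> snd q \<in> W \<and> P t (fl t w) = P (fst q) (fl (fst q) (snd q))"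
  define q where "q = (SOME q. ?Q q)"
  have q: "?Q q" unfolding q_def by (rule someI[of ?Q "(t, w)"]) (use t w in simp)
  have s: "0 \<le> sg (fst q) (snd q)" using q by (intro sg_nonneg) auto
  have "R (snd q) (sg (fst q) (snd q) + a) = R w (sg t w + a)"
    by (rule reeb_curve_unique[OF R_curve[OF _ s, where S = a] _ t w]) (use q a R_sg in auto)
  thus ?thesis by (simp add: Phi_def q_def case_prod_unfold Let_def)
qed

lemma Phi_R:
  assumes w: "w \<in> W" and s: "0 \<le> s" "0 \<le> a"
  shows "Phi a (R w s) = R w (s + a)"
  using Phi_eq[OF _ w s(2), of "U w s"] U[OF w s(1)] by (simp add: R_def)

lemma Phi_M: "x \<in> M ==> 0 \<le> a ==> Phi a x \<in> M"
  using Phi_eq R_in_M sg_nonneg by (elim M_rep) simp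

lemma Phi_add:
  assumes x: "x \<in> M" and a: "0 \<le> a" "0 \<le> b"
  shows "Phi (a + b) x = Phi a (Phi b x)"
proof -
  obtain t w where t: "t \<in> {0..1}" "w \<in> W" "x = P t (fl t w)" using M_rep[OF x] .
  have "0 \<le> sg t w" using t by (intro sg_nonneg) auto
  thus ?thesis using t a Phi_eq[of t w] Phi_R[of w "sg t w + b" a] by (simp add: add_ac)
qed

text \<open>As \<open>Phi\<close> is defined by a choice, its continuity is read off from its graph.
  Triples of two times t, u and an orbit, with Reeb times differing by a given a, form a compact
  set, and the graph is a continuous image of it.\<close>

lemma continuous_Phi: "continuous_on ({0..2} \<times> M) (\<lambda>(a, x). Phi a x)"
proof (rule compact_graph_continuous)
  \<comment> \<open>Reeb time at most 2 takes Hamiltonian time at most 2 / \<open>tmin\<close>,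
    counted from a start t \<le> 1.\<close>
  define C where "C = 1 + 2 / tmin"
  have C: "0 \<le> C" "1 \<le> C" using tau_range(1) by (auto simp: C_def)
  define S where "S = {0..2::real} \<times> {0..1::real} \<times> W \<times> {0..C}"
  define h where "h = (\<lambda>q::real \<times> real \<times> 'a \<times> real. sg (snd (snd (snd q))) (fst (snd (snd q))) - sg (fst (snd q)) (fst (snd (snd q))) - fst q)"
  define \<pi> where "\<pi> = (\<lambda>q::real \<times> real \<times> 'a \<times> real. ((fst q, P (fst (snd q)) (fl (fst (snd q)) (fst (snd (snd q))))), P (snd (snd (snd q))) (fl (snd (snd (snd q))) (fst (snd (snd q))))))"
  have cS: "compact S" unfolding S_def by (intro compact_Times compact_Icc compact_W)
  have hc: "continuous_on S h" unfolding h_def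
    by (intro continuous_on_diff continuous_on_pair[OF continuous_sg[of C]] continuous_intros) (use C in \<open>auto simp: S_def\<close>)
  have cf: "continuous_on S (\<lambda>q. fl (fst (snd q)) (fst (snd (snd q))))"
    by (intro continuous_on_pair[OF fl_exists(1)[OF C(1)]] continuous_intros) (use C in \<open>auto simp: S_def\<close>)
  have cf': "continuous_on S (\<lambda>q. fl (snd (snd (snd q))) (fst (snd (snd q))))"
    by (intro continuous_on_pair[OF fl_exists(1)[OF C(1)]] continuous_intros) (use C in \<open>auto simp: S_def\<close>)
  have c1: "continuous_on S (\<lambda>q. P (fst (snd q)) (fl (fst (snd q)) (fst (snd (snd q)))))"
    by (rule continuous_on_pair[OF continuous_P _ cf]) (auto simp: S_def fl_in intro!: continuous_intros)
  have c2: "continuous_on S (\<lambda>q. P (snd (snd (snd q))) (fl (snd (snd (snd q))) (fst (snd (snd q)))))"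
    by (rule continuous_on_pair[OF continuous_P _ cf']) (auto simp: S_def fl_in intro!: continuous_intros)
  have \<pi>c: "continuous_on S \<pi>" unfolding \<pi>_def by (intro continuous_on_Pair c1 c2 continuous_intros)
  have "closed (S \<inter> h -` {0})" by (rule continuous_closed_preimage[OF hc compact_imp_closed[OF cS]]) simp
  hence "compact (S \<inter> (S \<inter> h -` {0}))" by (rule compact_Int_closed[OF cS])
  hence K: "compact (\<pi> ` (S \<inter> h -` {0}))"
    by (intro compact_continuous_image continuous_on_subset[OF \<pi>c]) (auto simp: Int_assoc[symmetric])
  have "(\<lambda>y. (y, case y of (a, x) \<Rightarrow> Phi a x)) ` ({0..2} \<times> M) = \<pi> ` (S \<inter> h -` {0})"
  proof (intro equalityI subsetI)
    fix g assume "g \<in> (\<lambda>y. (y, case y of (a, x) \<Rightarrow> Phi a x)) ` ({0..2} \<times> M)"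
    then obtain a x where a: "a \<in> {0..2}" "x \<in> M" "g = ((a, x), Phi a x)" by auto
    obtain t w where t: "t \<in> {0..1}" "w \<in> W" "x = P t (fl t w)" using M_rep[OF a(2)] .
    have t0: "0 \<le> t" "0 \<le> sg t w" using t sg_nonneg by auto
    define u where "u = U w (sg t w + a)"
    have u: "0 \<le> u" "sg u w = sg t w + a" using U[OF t(2), of "sg t w + a"] t0 a by (auto simp: u_def)
    have "tmin * (u - t) \<le> a" using U_mono(2)[OF t(2) t0(2), of "sg t w + a"] a U_sg[OF t(2) t0(1)] by (simp add: u_def)
    hence "u - t \<le> a / tmin" using tau_range(1) by (simp add: pos_le_divide_eq mult.commute)
    also have "\<dots> \<le> 2 / tmin" using a tau_range(1) by (intro divide_right_mono) auto
    finally have "u \<le> C" using t by (simp add: C_def)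
    hence "(a, t, w, u) \<in> S \<inter> h -` {0}" using a t u by (simp add: S_def h_def)
    moreover have "g = \<pi> (a, t, w, u)" using a t t0 by (simp add: \<pi>_def Phi_eq R_def u_def)
    ultimately show "g \<in> \<pi> ` (S \<inter> h -` {0})" by blast
  next
    fix g assume "g \<in> \<pi> ` (S \<inter> h -` {0})"
    then obtain a t w u where q: "(a, t, w, u) \<in> S" "h (a, t, w, u) = 0" "g = \<pi> (a, t, w, u)" by auto
    hence a: "a \<in> {0..2}" "t \<in> {0..1}" "w \<in> W" "0 \<le> u" by (auto simp: S_def)
    have "U w (sg t w + a) = u" using q(2) a by (intro U_eqI) (auto simp: h_def)
    hence "g = ((a, P t (fl t w)), Phi a (P t (fl t w)))" using a q(3) by (simp add: \<pi>_def Phi_eq R_def)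
    moreover have "P t (fl t w) \<in> M" using a by (intro P_in_M fl_in) auto
    ultimately show "g \<in> (\<lambda>y. (y, case y of (a, x) \<Rightarrow> Phi a x)) ` ({0..2} \<times> M)" using a(1) by auto
  qed
  thus "compact ((\<lambda>y. (y, case y of (a, x) \<Rightarrow> Phi a x)) ` ({0..2} \<times> M))" using K by simp
qed

lemma reeb_time_one:
  assumes x: "x \<in> M"
  shows "RT x = Phi 1 x"
proof -
  obtain t w where t: "t \<in> {0..1}" "w \<in> W" "x = P t (fl t w)" using M_rep[OF x] .
  have t0: "0 \<le> t" "0 \<le> sg t w" using t sg_nonneg by auto
  show ?thesis unfolding boundary_reeb_time_one_def time_one_map_def tube_boundary integral_curve_iff
  proof (rule the_equality)
    show "\<exists>g. curve_on M TA RV 0 1 g \<and> g 0 = x \<and> g 1 = Phi 1 x"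
      by (rule exI[of _ "\<lambda>s. R w (sg t w + s)"]) (use R_curve[OF t(2) t0(2)] t t0 R_sg Phi_eq in simp)
    show "q = Phi 1 x" if ex: "\<exists>g. curve_on M TA RV 0 1 g \<and> g 0 = x \<and> g 1 = q" for q
    proof -
      obtain g where g: "curve_on M TA RV 0 1 g" "g 0 = x" "g 1 = q" using ex by blast
      have "g 1 = R w (sg t w + 1)" by (rule reeb_curve_unique[OF g(1) _ t0(1) t(2)]) (use g(2) t(3) in auto)
      thus ?thesis using g(3) t t0 Phi_eq by simp
    qed
  qed
qed

text \<open>The Hamiltonian time that passes while the Reeb flow runs for time \<open>a\<close>.\<close>

definition eM :: "real \<Rightarrow> 'a \<times> complex \<Rightarrow> real" where
  "eM a x = integral {0..a} (\<lambda>v. 1 / tM (Phi v x))"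

lemma continuous_inverse_tM_R:
  assumes w: "w \<in> W" and s: "0 \<le> s"
  shows "continuous_on {0..C} (\<lambda>v. 1 / tM (R w (s + v)))"
proof -
  have "continuous_on {0..C} (\<lambda>v. R w (s + v))" using R_curve[OF w s, of C] by (simp add: curve_on_def)
  hence "continuous_on {0..C} (\<lambda>v. tM (R w (s + v)))"
    by (rule continuous_on_compose2[OF continuous_tM]) (use R_in_M w s in auto)
  moreover have "tM (R w (s + v)) \<noteq> 0" if "v \<in> {0..C}" for v
    using tM_range(1)[OF R_in_M[OF w, of "s + v"]] s that by auto
  ultimately show ?thesis by (intro continuous_on_divide continuous_on_const) auto
qed

lemma continuous_inverse_tM_Phi:
  assumes "x \<in> M" shows "continuous_on {0..C} (\<lambda>v. 1 / tM (Phi v x))"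
proof -
  obtain t w where t: "t \<in> {0..1}" "w \<in> W" "x = P t (fl t w)" using M_rep[OF assms] .
  have t0: "0 \<le> t" "0 \<le> sg t w" using t sg_nonneg by auto
  show ?thesis by (rule continuous_on_eq[OF continuous_inverse_tM_R[OF t(2) t0(2)]]) (use t t0 Phi_eq in simp)
qed

text \<open>Along a Reeb orbit 1/\<tau> is the derivative of the inverse \<open>U\<close> of
  \<open>sg\<close>, so the integral telescopes.\<close>

lemma eM_eq:
  assumes t: "0 \<le> t" and w: "w \<in> W" and a: "0 \<le> a"
  shows "eM a (P t (fl t w)) = U w (sg t w + a) - t"
proof -
  have s: "0 \<le> sg t w" by (rule sg_nonneg[OF w t])
  have "((\<lambda>v. 1 / tM (R w (sg t w + v))) has_integral (U w (sg t w + a) - U w (sg t w + 0))) {0..a}"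
  proof (rule fundamental_theorem_of_calculus[OF a])
    fix v assume v: "v \<in> {0..a}"
    let ?u = "U w (sg t w + v)"
    have u: "0 \<le> ?u" using U[OF w, of "sg t w + v"] s v by auto
    have "(U w has_real_derivative 1 / \<tau> ?u (fl ?u w)) (at (sg t w + v) within (\<lambda>v. sg t w + v) ` {0..a})"
      by (rule U_derivative[OF w, of _ _ "sg t w + a"]) (use s v in auto)
    moreover have "((\<lambda>v. sg t w + v) has_real_derivative 1) (at v within {0..a})" by (auto intro!: derivative_eq_intros)
    ultimately have "(U w \<circ> (\<lambda>v. sg t w + v) has_real_derivative 1 / \<tau> ?u (fl ?u w) * 1) (at v within {0..a})" by (rule DERIV_image_chain)
    moreover have "tM (R w (sg t w + v)) = \<tau> ?u (fl ?u w)" unfolding R_def by (rule tM_P[OF fl_in[OF u w]])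
    ultimately show "((\<lambda>v. U w (sg t w + v)) has_vector_derivative 1 / tM (R w (sg t w + v))) (at v within {0..a})"
      by (simp add: o_def has_real_derivative_iff_has_vector_derivative)
  qed
  hence "integral {0..a} (\<lambda>v. 1 / tM (R w (sg t w + v))) = U w (sg t w + a) - t"
    using U_sg[OF w t] by (intro integral_unique) simp
  moreover have "integral {0..a} (\<lambda>v. 1 / tM (Phi v (P t (fl t w)))) = integral {0..a} (\<lambda>v. 1 / tM (R w (sg t w + v)))"
    by (rule integral_cong) (use Phi_eq[OF t w] in simp)
  ultimately show ?thesis by (simp add: eM_def)
qed

lemma continuous_eM: "continuous_on ({0..2} \<times> M) (\<lambda>(a, x). eM a x)"
  unfolding eM_def
proof (rule continuous_on_indefinite_integral)
  have "continuous_on ({0..2} \<times> M) (\<lambda>z. tM (case z of (a, x) \<Rightarrow> Phi a x))"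
    by (rule continuous_on_compose2[OF continuous_tM continuous_Phi]) (use Phi_M in auto)
  moreover have "tM (case z of (a, x) \<Rightarrow> Phi a x) \<noteq> 0" if "z \<in> {0..2} \<times> M" for z
    using tM_range(1)[OF Phi_M[of "snd z" "fst z"]] that by (auto simp: case_prod_unfold)
  ultimately have "continuous_on ({0..2} \<times> M) (\<lambda>z. 1 / tM (case z of (a, x) \<Rightarrow> Phi a x))"
    by (intro continuous_on_divide continuous_on_const) auto
  thus "continuous_on ({0..2} \<times> M) (\<lambda>(v, x). 1 / tM (Phi v x))" by (simp add: case_prod_unfold)
qed

lemma tmax_pos: "tmax > 0"
proof -
  obtain w where "w \<in> W" using W_nonempty by blast
  thus ?thesis using tau_range(2,3)[of w 0] tau_range(1) by linarith
qed

section \<open>The two applications of the entropy estimate\<close>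

lemma reeb_iterate:
  assumes w: "w \<in> W" and s: "0 \<le> s"
  shows "(RT ^^ k) (R w s) = R w (s + real k)"
proof (induction k)
  case (Suc k)
  have "RT (R w (s + real k)) = R w (s + real k + 1)"
    using reeb_time_one[OF R_in_M[OF w, of "s + real k"]] Phi_R[OF w, of "s + real k" 1] s by simp
  thus ?case using Suc by (simp add: add_ac)
qed simp

lemma ham_iterate:
  assumes w: "w \<in> W"
  shows "(ham_time_one W A lam H ^^ k) w = fl (real k) w"
proof -
  have "fl (real k) w = (fl 1 ^^ k) w \<and> (ham_time_one W A lam H ^^ k) w = (fl 1 ^^ k) w \<and> (fl 1 ^^ k) w \<in> W" using w
  proof (induction k arbitrary: w)
    case (Suc k)
    have 1: "fl 1 w \<in> W" "ham_time_one W A lam H w = fl 1 w" using fl_in ham_time_one_eq Suc.prems by auto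
    have "fl (real (Suc k)) w = fl (real k) (fl 1 w)" using fl_shift[of "real k" w] Suc.prems by (simp add: add.commute)
    thus ?case using Suc.IH[OF 1(1)] 1(2) by (simp del: funpow.simps add: funpow_Suc_right)
  qed (simp add: fl_0)
  thus ?thesis by simp
qed

text \<open>The base is the Hamiltonian time-one map with time change \<open>sg\<close>, of rate at
  least \<open>tmin\<close>. Every point of M lies over some orbit at a Hamiltonian phase t in
  [0,1], and its Reeb iterates sit where \<open>sg\<close> has grown by integers. A full turn of the
  angle is absorbed by \<open>P_int\<close>.\<close>

lemma entropy_lower_bound: "ereal tmin * top_entropy M RT \<le> top_entropy W (ham_time_one W A lam H)"
proof (rule entropy_time_change[OF compact_M compact_W W_nonempty, of _ "\<lambda>a w. P a (fl a w)" sg])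
  show "ham_time_one W A lam H b \<in> W" if "b \<in> W" for b using that fl_in ham_time_one_eq by simp
  have "continuous_on ({0..2} \<times> W) (\<lambda>z. P (fst z) (case z of (a, w) \<Rightarrow> fl a w))"
    by (rule continuous_on_pair[OF continuous_P continuous_on_fst[OF continuous_on_id] fl_exists(1)]) (auto simp: fl_in)
  thus "continuous_on ({0..2} \<times> W) (\<lambda>(a, w). P a (fl a w))" by (simp add: case_prod_unfold)
  show "P a (fl a b) \<in> M" if "0 \<le> a" "b \<in> W" for a b using that fl_in P_in_M by blast
  show "P (a + 1) (fl (a + 1) b) = P a (fl a (ham_time_one W A lam H b))" if "0 \<le> a" "b \<in> W" for a b
    using that P_int[OF fl_in[OF that(1) fl_in[OF _ that(2), of 1]], of a 1] by (simp add: fl_shift ham_time_one_eq)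
  show "continuous_on ({0..2} \<times> W) (\<lambda>(a, w). sg a w)" by (rule continuous_sg)
  show "sg (a + 1) b = sg a (ham_time_one W A lam H b) + sg 1 b" if "0 \<le> a" "b \<in> W" for a b
    using that by (simp add: sg_shift ham_time_one_eq)
  show "sg 0 b = 0" for b by (rule sg_0)
  show "tmin * (a' - a) \<le> sg a' b - sg a b" if "0 \<le> a" "a \<le> a'" "b \<in> W" for a a' b using sg_mono that by blast
  show "0 < tmin" by (rule tau_range(1))
  fix q assume "q \<in> M"
  then obtain t w where t: "t \<in> {0..1}" "w \<in> W" "q = P t (fl t w)" by (rule M_rep)
  have t0: "0 \<le> t" "0 \<le> sg t w" using t sg_nonneg by auto
  show "\<exists>b\<in>W. \<exists>r\<in>{0..1}. \<forall>k::nat. \<exists>a\<ge>r. sg a b = sg r b + real k \<and> (RT ^^ k) q = P a (fl a b)"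
  proof (intro bexI[OF _ t(2)] bexI[OF _ t(1)] allI)
    fix k :: nat
    have "t \<le> U w (sg t w + real k)" using U_mono(1)[OF t(2) t0(2), of "sg t w + real k"] U_sg[OF t(2) t0(1)] by simp
    moreover have "sg (U w (sg t w + real k)) w = sg t w + real k" using U[OF t(2), of "sg t w + real k"] t0 by simp
    moreover have "(RT ^^ k) q = R w (sg t w + real k)"
      using reeb_iterate[OF t(2) t0(2), of k] t(3) R_sg[OF t(2) t0(1)] by simp
    ultimately show "\<exists>a\<ge>t. sg a w = sg t w + real k \<and> (RT ^^ k) q = P a (fl a w)"
      unfolding R_def by blast
  qed
qed

text \<open>The base is the Reeb time-one map with the elapsed Hamiltonian time \<open>eM\<close> as
  time change, of rate at least 1 / \<open>tmax\<close>. A point q of W is lifted to angle 0; its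
  k-th Hamiltonian image lies under the lifted orbit at Reeb time \<open>sg k q\<close>.\<close>

lemma entropy_upper_bound: "ereal (1 / tmax) * top_entropy W (ham_time_one W A lam H) \<le> top_entropy M RT"
proof (rule entropy_time_change[OF compact_W compact_M, of _ "\<lambda>a x. fst (Phi a x)" eM])
  show "M \<noteq> {}" using W_nonempty P_in_M by blast
  show "RT x \<in> M" if "x \<in> M" for x using that reeb_time_one Phi_M by simp
  show "continuous_on ({0..2} \<times> M) (\<lambda>(a, x). fst (Phi a x))"
    using continuous_on_fst[OF continuous_Phi] by (simp add: case_prod_unfold)
  show "fst (Phi a x) \<in> W" if "0 \<le> a" "x \<in> M" for a x using Phi_M[OF that(2,1)] M_E by metis
  show "fst (Phi (a + 1) x) = fst (Phi a (RT x))" if "0 \<le> a" "x \<in> M" for a x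
    using Phi_add[OF that(2,1), of 1] reeb_time_one[OF that(2)] by simp
  show "continuous_on ({0..2} \<times> M) (\<lambda>(a, x). eM a x)" by (rule continuous_eM)
  show "eM 0 x = 0" for x by (simp add: eM_def)
  show "eM (a + 1) x = eM a (RT x) + eM 1 x" if a: "0 \<le> a" and x: "x \<in> M" for a x
  proof -
    obtain t w where t: "t \<in> {0..1}" "w \<in> W" "x = P t (fl t w)" using M_rep[OF x] .
    have t0: "0 \<le> t" "0 \<le> sg t w" using t sg_nonneg by auto
    let ?u = "U w (sg t w + 1)"
    have u: "0 \<le> ?u" "sg ?u w = sg t w + 1" using U[OF t(2), of "sg t w + 1"] t0 by auto
    have "RT x = P ?u (fl ?u w)" using reeb_time_one[OF x] t t0 by (simp add: Phi_eq R_def)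
    thus ?thesis using eM_eq[OF t0(1) t(2), of "a + 1"] eM_eq[OF t0(1) t(2), of 1] eM_eq[OF u(1) t(2), of a] a u(2) t(3)
      by (simp add: add_ac)
  qed
  show "1 / tmax * (a' - a) \<le> eM a' x - eM a x" if a: "0 \<le> a" "a \<le> a'" and x: "x \<in> M" for a a' x
  proof -
    note int = integrable_continuous_real[OF continuous_on_subset[OF continuous_inverse_tM_Phi[OF x, of a']]]
    have "integral {0..a} (\<lambda>v. 1 / tM (Phi v x)) + integral {a..a'} (\<lambda>v. 1 / tM (Phi v x)) = integral {0..a'} (\<lambda>v. 1 / tM (Phi v x))"
      by (rule Henstock_Kurzweil_Integration.integral_combine[OF a int]) simp
    moreover have "integral {a..a'} (\<lambda>v. 1 / tmax) \<le> integral {a..a'} (\<lambda>v. 1 / tM (Phi v x))"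
    proof (rule integral_le[OF _ int])
      show "1 / tmax \<le> 1 / tM (Phi v x)" if "v \<in> {a..a'}" for v
        using tM_range[OF Phi_M[OF x, of v]] that a by (intro divide_left_mono) (auto intro!: mult_pos_pos tmax_pos)
    qed (use a in auto)
    ultimately show ?thesis using a by (simp add: eM_def)
  qed
  show "0 < 1 / tmax" using tmax_pos by simp
  fix q assume q: "q \<in> W"
  show "\<exists>x\<in>M. \<exists>r\<in>{0..1}. \<forall>k::nat. \<exists>a\<ge>r. eM a x = eM r x + real k \<and> (ham_time_one W A lam H ^^ k) q = fst (Phi a x)"
  proof (intro bexI[of _ "P 0 (fl 0 q)"] bexI[of _ 0] allI)
    fix k :: nat
    have s: "0 \<le> sg (real k) q" by (rule sg_nonneg[OF q]) simp
    have "eM (sg (real k) q) (P 0 (fl 0 q)) = real k" using eM_eq[OF order_refl q s] U_sg[OF q, of "real k"] by (simp add: sg_0)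
    moreover have "fst (Phi (sg (real k) q) (P 0 (fl 0 q))) = fl (real k) q"
      using Phi_eq[OF order_refl q s] R_sg[OF q, of "real k"] by (simp add: sg_0)
    moreover have "eM 0 (P 0 (fl 0 q)) = 0" by (simp add: eM_def)
    ultimately show "\<exists>a\<ge>0. eM a (P 0 (fl 0 q)) = eM 0 (P 0 (fl 0 q)) + real k \<and> (ham_time_one W A lam H ^^ k) q = fst (Phi a (P 0 (fl 0 q)))"
      using s ham_iterate[OF q, of k] by (intro exI[of _ "sg (real k) q"]) simp
  qed (use q P_in_M fl_0 in auto)
qed

end

theorem theorem4:
  fixes W :: "'a::t2_space set"
    and A :: "('a, 'e::euclidean_space) chart set"
    and lam :: "('a, 'e) one_form"
    and H :: "real \<Rightarrow> 'a \<Rightarrow> real"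
  assumes "liouville_domain W A lam"
    and "H \<in> admissible_hamiltonians W A lam"
  shows "ereal (INF (t, w)\<in>UNIV \<times> W. tau A lam H t w) *
           top_entropy (mfd_boundary (tube_atlas W A H))
             (boundary_reeb_time_one (tube_atlas W A H) (tube_form A lam))
         \<le> top_entropy W (ham_time_one W A lam H) \<and>
         top_entropy W (ham_time_one W A lam H)
         \<le> ereal (SUP (t, w)\<in>UNIV \<times> W. tau A lam H t w) *
           top_entropy (mfd_boundary (tube_atlas W A H))
             (boundary_reeb_time_one (tube_atlas W A H) (tube_form A lam))"
proof -
  interpret hamiltonian_domain W A lam H by unfold_locales (fact assms)+
  \<comment> \<open>The upper estimate carries the factor 1 / \<open>tmax\<close> on the Hamiltonian
    side; multiplying by the positive real \<open>tmax\<close> clears it in the extended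
    reals.\<close>
  have "ereal tmax * (ereal (1 / tmax) * top_entropy W (ham_time_one W A lam H))
      \<le> ereal tmax * top_entropy M RT"
    by (rule ereal_mult_left_mono[OF entropy_upper_bound]) (use tmax_pos in simp)
  moreover have "ereal tmax * (ereal (1 / tmax) * top_entropy W (ham_time_one W A lam H)) = top_entropy W (ham_time_one W A lam H)"
    unfolding mult.assoc[symmetric] using tmax_pos by simp
  ultimately show ?thesis unfolding tmin_def[symmetric] tmax_def[symmetric] tube_boundary using entropy_lower_bound by simp
qed

end
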